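(* Let $\pi'$ be the cuspidal automorphic representation of $\mathrm{PGL}_2(\mathbb{A})$ generated by the newform $\eta(z)^2\eta(2z)^2\eta(3z)^2\eta(6z)^2$ of weight $4$ and level $\Gamma_0(6)$. Let $E$ be an imaginary quadratic field such that $-\Delta_E$ is a prime number and $\Delta_E\equiv 13,\,17$ or $21 \pmod{24}$. Then $L(\tfrac12,\pi'\otimes\eta_E)\neq 0$.
   Context: $\eta$ is the Dedekind eta function; $\mathbb{A}$ is the adèle ring of $\mathbb{Q}$; the space $S_4^{\mathrm{new}}(\Gamma_0(6))$ is one-dimensional. $\Delta_E$ is the fundamental discriminant of $E$, $\eta_E$ the quadratic idèle class character attached to $E/\mathbb{Q}$, and $L(s,\pi'\otimes\eta_E)$ is normalized with center $s=\tfrac12$. *)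

theory Defs
  imports "HOL-Complex_Analysis.Complex_Analysis"
          "HOL-Computational_Algebra.Polynomial" "HOL-Computational_Algebra.Squarefree"
          "HOL-Number_Theory.Quadratic_Reciprocity"
begin

definition eta_prod_trunc :: "nat \<Rightarrow> int poly" where
  "eta_prod_trunc N = (\<Prod>m\<in>{1..N}.
      (1 - Polynomial.monom 1 m)^2 * (1 - Polynomial.monom 1 (2*m))^2 * (1 - Polynomial.monom 1 (3*m))^2 * (1 - Polynomial.monom 1 (6*m))^2)"

(* n-th Fourier coefficient a(n) of f = eta(z)^2 eta(2z)^2 eta(3z)^2 eta(6z)^2 = sum_{n>=1} a(n) q^n.
   The coefficient of q^(n-1) in the product is determined by the factors with m <= n. *)
definition eta_coeff :: "nat \<Rightarrow> int" where
  "eta_coeff n = (if n = 0 then 0 else Polynomial.coeff (eta_prod_trunc n) (n - 1))"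

definition kronecker_prime :: "int \<Rightarrow> nat \<Rightarrow> int" where
  "kronecker_prime d p =
     (if p = 2 then (if even d then 0 else if d mod 8 \<in> {1, 7} then 1 else -1)
      else Legendre d (int p))"

(* Kronecker symbol (d / n) for n a natural number; (d/0) = 0 (we only use |d| > 1) *)
definition kronecker :: "int \<Rightarrow> nat \<Rightarrow> int" where
  "kronecker d n = (if n = 0 then 0 else
      (\<Prod>p\<in>prime_factors n. kronecker_prime d p ^ multiplicity p n))"

definition fundamental_discriminant :: "int \<Rightarrow> bool" where
  "fundamental_discriminant D \<longleftrightarrow> D \<noteq> 1 \<and>
     ((D mod 4 = 1 \<and> squarefree D) \<or>
      (D mod 4 = 0 \<and> (D div 4) mod 4 \<in> {2, 3} \<and> squarefree (D div 4)))"

end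

theory Submission
  imports Defs "HOL-Number_Theory.Number_Theory" "HOL-Computational_Algebra.Computational_Algebra"
begin

text \<open>
  Write \<open>p = -D\<close>, \<open>\<chi> = (\<cdot>/p)\<close> and let \<open>f\<close> be the newform. Up to a nonzero factor \<open>L(2)\<close> is
  the sum over \<open>j\<close> mod \<open>p\<close> of \<open>\<chi>(2j)\<close> times the integral of \<open>f(2j/p + iy) y\<close> over \<open>y > 0\<close>.
  The imaginary part of the period of \<open>f\<close> against a real binary quadratic form
  \<open>(A, B, C)\<close> is equivariant, up to a multiple of one root, under the group generated by the
  reflections in the sides of the quadrilateral \<open>Re z = 0\<close>, \<open>|z|\<^sup>2 = 1/6\<close>, \<open>|z - 1/2|\<^sup>2 = 1/12\<close>,
  \<open>Re z = 1/2\<close>. The same cocycle is produced by counting the images of the second side (the walls)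
  that lie above \<open>z\<close>. The difference is therefore equivariant and vanishes at every cusp, which makes
  the period from \<open>r\<close> to \<open>\<infinity>\<close> a positive constant times a finite sum over the walls above \<open>r\<close>.

  Summing against \<open>\<chi>\<close> turns \<open>L(2)\<close> into a nonzero multiple of the integer
  \<open>\<Sum> m \<chi>(m) R(p\<^sup>2 - 6m\<^sup>2)\<close> over \<open>6m\<^sup>2 < p\<^sup>2\<close>, where \<open>R(n) = \<Sum> \<chi>(d)\<close> over \<open>d | n\<close>. It is nonzero by parity:
  for \<open>p = 3\<close> only \<open>m = 1\<close> and \<open>m = -1\<close> contribute, for \<open>p \<equiv> 11\<close> it is controlled modulo 8 by involutions on representations
  \<open>x\<^sup>2 + 2yz\<close>, and for \<open>p \<equiv> 7\<close> the sum twisted by \<open>(-1)^m\<close> vanishes (it belongs to the form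
  \<open>h(z) + 9 h(3z)\<close> with \<open>h(z) = \<eta>(z)^4 \<eta>(2z)^4\<close>, and \<open>\<chi>(3) = -1\<close>), which leaves the even terms, whose parity
  is that of the number of representations \<open>p = x\<^sup>2 + 6y\<^sup>2\<close>.
\<close>

section \<open>Parity of sets with involutions\<close>

text \<open>The cusps are \<open>2j/p\<close>, with even numerators, because the second form only
  has period 2: it changes sign under \<open>z + 1\<close>. For a wall \<open>(a, b, c)\<close> over
  \<open>2j/p\<close> the integer \<open>m = 2aj + bp\<close> has the parity of \<open>b\<close>, so
  the sign of a wall becomes \<open>(-1)^m\<close>. Both forms run through one locale with a sign
  \<open>eps\<close> that enters only at the side \<open>Re z = 1/2\<close>. Imaginary parts are
  taken because a reflection is antiholomorphic: conjugation makes the transformed period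
  holomorphic, and the reflection law holds up to a complex constant, whose imaginary part is found
  at a point of the mirror. The constant in front of the wall sum is positive since the real part of
  the form is positive on \<open>Re z = 0\<close> and, for \<open>eps = 1\<close>, at most 0 on
  \<open>Re z = 1/2\<close>; for \<open>eps = -1\<close> the second contribution is 0 by symmetry.
  The twisted sum over cusps decays exponentially at both ends of the \<open>y\<close>-axis, so a
  Mellin transform gives the entire continuation without a functional equation. For \<open>p\<close>
  congruent to 7 the vanishing alternating sum replaces a count over odd \<open>m\<close>: it makes
  the odd part equal to the even part.\<close>

lemma even_card_involution:
  assumes "finite S" "\<And>x. x \<in> S \<Longrightarrow> f x \<in> S" "\<And>x. x \<in> S \<Longrightarrow> f (f x) = x" "\<And>x. x \<in> S \<Longrightarrow> f x \<noteq> x"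
  shows "even (card S)"
  using assms
proof (induction "card S" arbitrary: S rule: less_induct)
  case less
  show ?case
  proof (cases "S = {}")
    case False
    then obtain x where x: "x \<in> S" by auto
    let ?T = "S - {x, f x}"
    have sub: "{x, f x} \<subseteq> S" using x less.prems by auto
    have c2: "card {x, f x} = 2" using less.prems(4)[OF x] by auto
    have cT: "card ?T = card S - 2" using sub c2 less.prems(1) by (simp add: card_Diff_subset)
    have cS: "card S \<ge> 2" using card_mono[OF less.prems(1) sub] c2 by simp
    have "even (card ?T)"
    proof (rule less.hyps)
      show "card ?T < card S" using cT cS by simp
      show "finite ?T" using less.prems by simp
      fix y assume y: "y \<in> ?T"
      then show "f (f y) = y" "f y \<noteq> y" using less.prems by auto
      have "f y \<noteq> x" using y less.prems by auto
      moreover have "f y \<noteq> f x" using y less.prems x by (metis Diff_iff insert_iff)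
      ultimately show "f y \<in> ?T" using y less.prems by auto
    qed
    then show ?thesis using cT cS by simp
  qed auto
qed

lemma card_involution_fixpoints:
  assumes "finite S" "\<And>x. x \<in> S \<Longrightarrow> f x \<in> S" "\<And>x. x \<in> S \<Longrightarrow> f (f x) = x"
  shows "even (card S) \<longleftrightarrow> even (card {x \<in> S. f x = x})"
proof -
  let ?F = "{x \<in> S. f x = x}"
  have "even (card (S - ?F))"
    by (rule even_card_involution[of _ f]) (use assms in auto)
  moreover have "card S = card ?F + card (S - ?F)"
    using assms(1) by (metis (no_types, lifting) card_Diff_subset card_mono finite_subset le_add_diff_inverse mem_Collect_eq subsetI)
  ultimately show ?thesis by simp
qed

lemma odd_if_mod_8: "n mod 8 = 3 \<Longrightarrow> odd (n::int)"
  using mod_mod_cancel[of 2 8 n] by (auto simp: even_iff_mod_2_eq_zero)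

lemma mod_24: "n mod 24 = r \<Longrightarrow> n mod 3 = r mod 3 \<and> n mod 8 = r mod 8 \<and> n mod 2 = r mod 2" for n r :: int
  by (drule sym) (simp add: mod_mod_cancel)

text \<open>A Zagier-type piecewise linear involution preserving \<open>x^2 + 2yz\<close>. The first
  and the last piece are exchanged, each of the three middle pieces is mapped to itself; for
  \<open>n mod 8 = 3\<close> only the second can contain fixed points.\<close>

definition jackson :: "int \<times> int \<times> int \<Rightarrow> int \<times> int \<times> int" where
  "jackson = (\<lambda>(x, y, z).
     if 2 * y < x then (x - 2*y, z + 2*x - 2*y, y)
     else if 2 * y < 2 * x + z then (2*y - x, y, 2*x - 2*y + z)
     else if 2 * y < 3 * x + 2 * z then (3*x - 2*y + 2*z, 2*x - y + 2*z, -2*x + 2*y - z)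
     else if y < 2 * x + 2 * z then (-3*x + 2*y - 2*z, -2*x + 2*y - z, 2*x - y + 2*z)
     else (x + 2*z, z, -2*x + y - 2*z))"

lemma square_mod_8: "(x::int)\<^sup>2 mod 8 = (if odd x then 1 else if x mod 4 = 0 then 0 else 4)"
proof -
  define r where "r = x mod 8"
  have "r \<in> {0..<8}" unfolding r_def by simp
  moreover have "{0..<8} = {0,1,2,3,4,5,6,7::int}" by auto
  ultimately have r: "r \<in> {0,1,2,3,4,5,6,7}" by simp
  have e: "x\<^sup>2 mod 8 = r\<^sup>2 mod 8" unfolding r_def by (simp add: power_mod)
  have o: "odd x \<longleftrightarrow> odd r" unfolding r_def by (simp add: dvd_mod_iff)
  have f: "x mod 4 = r mod 4" unfolding r_def by (simp add: mod_mod_cancel)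
  show ?thesis unfolding e o f using r by (elim insertE emptyE; simp)
qed

lemma finite_bounded_triples:
  "finite {(x::int, y::int, z::int). 0 < x \<and> 0 < y \<and> 0 < z \<and> x\<^sup>2 + 2*y*z = n}"
proof (rule finite_subset)
  show "{(x::int, y::int, z::int). 0 < x \<and> 0 < y \<and> 0 < z \<and> x\<^sup>2 + 2*y*z = n} \<subseteq> {0..n} \<times> {0..n} \<times> {0..n}"
  proof
    fix t assume "t \<in> {(x::int, y::int, z::int). 0 < x \<and> 0 < y \<and> 0 < z \<and> x\<^sup>2 + 2*y*z = n}"
    then obtain x y z :: int where h: "0 < x" "0 < y" "0 < z" and t: "t = (x, y, z)" "x\<^sup>2 + 2*y*z = n" by blast
    have "x \<le> x\<^sup>2" using h(1) by (simp add: self_le_power)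
    moreover have "y \<le> y * z" "z \<le> y * z" using h by (simp_all add: mult_le_cancel_left1 mult_le_cancel_right1)
    moreover have "0 < y * z" using h by auto
    moreover have "2 * y * z = 2 * (y * z)" by simp
    ultimately have "x \<le> x\<^sup>2 + 2*y*z" "y \<le> x\<^sup>2 + 2*y*z" "z \<le> x\<^sup>2 + 2*y*z" 
      using h by linarith+
    then show "t \<in> {0..n} \<times> {0..n} \<times> {0..n}" using h t by auto
  qed
qed auto

text \<open>The congruence excludes \<open>k^2\<close>, \<open>u^2 - 2z^2\<close> and
  \<open>u^2 + z^2\<close> as values of \<open>n\<close>. On the boundary between two of the five
  pieces either \<open>x\<close> would be even (first and third condition) or \<open>n\<close> a
  square (second and fourth). A fixed point in the third or fourth piece would write
  \<open>n\<close> as \<open>u^2 + z^2\<close> or \<open>u^2 - 2z^2\<close>.\<close>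

lemma jackson_involution:
  fixes n :: int
  assumes n: "n mod 8 = 3"
  defines "S \<equiv> {(x::int, y::int, z::int). 0 < x \<and> 0 < y \<and> 0 < z \<and> x\<^sup>2 + 2*y*z = n}"
  assumes t: "t \<in> S"
  shows "jackson t \<in> S" "jackson (jackson t) = t" "jackson t = t \<Longrightarrow> fst t = fst (snd t)"
proof -
  obtain x y z where txyz: "t = (x, y, z)" by (cases t)
  have h: "0 < x" "0 < y" "0 < z" and e: "x\<^sup>2 + 2*y*z = n" using t txyz by (auto simp: S_def)
  have nsq: "k\<^sup>2 \<noteq> n" for k :: int
    using n square_mod_8[of k] by (auto split: if_splits)
  have sq: "u\<^sup>2 mod 8 = 0 \<or> u\<^sup>2 mod 8 = 1 \<or> u\<^sup>2 mod 8 = 4" for u :: int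
    using square_mod_8[of u] by (auto split: if_splits)
  have m1: "(U - 2 * V) mod 8 \<noteq> 3" if "U mod 8 = 0 \<or> U mod 8 = 1 \<or> U mod 8 = 4" "V mod 8 = 0 \<or> V mod 8 = 1 \<or> V mod 8 = 4" for U V :: int
  proof -
    have e: "(U - 2 * V) mod 8 = (U mod 8 - (2 * (V mod 8)) mod 8) mod 8" by (simp add: mod_diff_eq mod_mult_right_eq)
    show ?thesis unfolding e using that by auto
  qed
  have m2: "(U + V) mod 8 \<noteq> 3" if "U mod 8 = 0 \<or> U mod 8 = 1 \<or> U mod 8 = 4" "V mod 8 = 0 \<or> V mod 8 = 1 \<or> V mod 8 = 4" for U V :: int
  proof -
    have e: "(U + V) mod 8 = (U mod 8 + V mod 8) mod 8" by (simp add: mod_add_eq)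
    show ?thesis unfolding e using that by auto
  qed
  have nsq': "u\<^sup>2 - 2 * z\<^sup>2 \<noteq> n" for u z :: int
    using m1[OF sq[of u] sq[of z]] n by auto
  have nsq'': "u\<^sup>2 + z\<^sup>2 \<noteq> n" for u z :: int
    using m2[OF sq[of u] sq[of z]] n by auto
  have oddx: "odd x" 
  proof
    assume "even x"
    then have "even n" using e by auto
    then show False using odd_if_mod_8[OF n] by simp
  qed
  have b1: "2 * y \<noteq> x" using oddx by auto
  have b2: "2 * y \<noteq> 2 * x + z"
  proof
    assume "2 * y = 2 * x + z"
    then have "z = 2*y - 2*x" by simp
    then have "x\<^sup>2 + 2 * y * (2*y - 2*x) = n" using e by simp
    then have "(x - 2*y)\<^sup>2 = n" by (simp add: power2_eq_square algebra_simps)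
    then show False using nsq by blast
  qed
  have "odd (3 * x + 2 * z)" using oddx by simp
  then have b3: "2 * y \<noteq> 3 * x + 2 * z" by (metis dvd_triv_left)
  have b4: "y \<noteq> 2 * x + 2 * z"
  proof
    assume "y = 2 * x + 2 * z"
    then have "x\<^sup>2 + 2 * (2 * x + 2 * z) * z = n" using e by simp
    then have "(x + 2*z)\<^sup>2 = n" by (simp add: power2_eq_square algebra_simps)
    then show False using nsq by blast
  qed
  have "jackson t \<in> S \<and> jackson (jackson t) = t \<and> (jackson t = t \<longrightarrow> fst t = fst (snd t))"
  proof -
    consider "2 * y < x" | "2 * y > x" "2 * y < 2 * x + z" | "2 * y > 2 * x + z" "2 * y < 3 * x + 2 * z"
      | "2 * y > 3 * x + 2 * z" "y < 2 * x + 2 * z" | "y > 2 * x + 2 * z" using b1 b2 b3 b4 by linarith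
    then show ?thesis
    proof cases
      case 1
      then have j: "jackson t = (x - 2*y, z + 2*x - 2*y, y)" using txyz by (simp add: jackson_def)
      have "jackson t \<in> S" unfolding j S_def using h e 1 by (auto simp: power2_eq_square algebra_simps)
      moreover have "jackson (jackson t) = t" unfolding j using txyz h 1 by (auto simp: jackson_def)
      moreover have "fst t = fst (snd t)" if "jackson t = t"
      proof -
        have "x - 2 * y = x" using that j txyz by simp
        then show ?thesis using h txyz by simp
      qed
      ultimately show ?thesis by blast
    next
      case 2
      then have j: "jackson t = (2*y - x, y, 2*x - 2*y + z)" using txyz by (simp add: jackson_def)
      have "jackson t \<in> S" unfolding j S_def using h e 2 by (auto simp: power2_eq_square algebra_simps)
      moreover have "jackson (jackson t) = t" unfolding j using txyz h 2 by (auto simp: jackson_def)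
      moreover have "fst t = fst (snd t)" if "jackson t = t"
      proof -
        have "2 * y - x = x" using that j txyz by simp
        then show ?thesis using h txyz by simp
      qed
      ultimately show ?thesis by blast
    next
      case 3
      then have j: "jackson t = (3*x - 2*y + 2*z, 2*x - y + 2*z, -2*x + 2*y - z)" using txyz h by (simp add: jackson_def)
      have "jackson t \<in> S" unfolding j S_def using h e 3 by (auto simp: power2_eq_square algebra_simps)
      moreover have "jackson (jackson t) = t" unfolding j using txyz h 3 by (auto simp: jackson_def)
      moreover have "jackson t \<noteq> t"
      proof
        assume "jackson t = t"
        then have "y = x + z" using j txyz by auto
        then have "(x + z)\<^sup>2 + z\<^sup>2 = n" using e by (simp add: power2_eq_square algebra_simps)
        then show False using nsq'' by blast
      qed
      ultimately show ?thesis by blast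
    next
      case 4
      then have j: "jackson t = (-3*x + 2*y - 2*z, -2*x + 2*y - z, 2*x - y + 2*z)" using txyz h by (simp add: jackson_def)
      have "jackson t \<in> S" unfolding j S_def using h e 4 by (auto simp: power2_eq_square algebra_simps)
      moreover have "jackson (jackson t) = t" unfolding j using txyz h 4 by (auto simp: jackson_def)
      moreover have "jackson t \<noteq> t"
      proof
        assume "jackson t = t"
        then have "y = 2 * x + z" using j txyz by auto
        then have "(x + 2 * z)\<^sup>2 - 2 * z\<^sup>2 = n" using e by (simp add: power2_eq_square algebra_simps)
        then show False using nsq' by blast
      qed
      ultimately show ?thesis by blast
    next
      case 5
      then have j: "jackson t = (x + 2*z, z, -2*x + y - 2*z)" using txyz h by (simp add: jackson_def)
      have "jackson t \<in> S" unfolding j S_def using h e 5 by (auto simp: power2_eq_square algebra_simps)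
      moreover have "jackson (jackson t) = t" unfolding j using txyz h 5 by (auto simp: jackson_def)
      moreover have "fst t = fst (snd t)" if "jackson t = t"
      proof -
        have "x + 2 * z = x" using that j txyz by simp
        then show ?thesis using h txyz by simp
      qed
      ultimately show ?thesis by blast
    qed
  qed
  then show "jackson t \<in> S" "jackson (jackson t) = t" "jackson t = t \<Longrightarrow> fst t = fst (snd t)" by auto
qed

text \<open>Two involutions on the positive solutions of \<open>x^2 + 2yz = n\<close>: swapping
  \<open>y\<close> and \<open>z\<close> fixes the solutions of \<open>x^2 + 2y^2 = n\<close>, while
  \<open>jackson\<close> fixes the triples \<open>(d, d, k)\<close> with
  \<open>n = d (d + 2k)\<close>, one for each divisor \<open>d\<close> below the square root of
  \<open>n\<close>.\<close>

lemma jackson_parity: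
  fixes n :: int
  assumes n: "n mod 8 = 3"
  shows "even (card {(x::int, y::int). 0 < x \<and> 0 < y \<and> x\<^sup>2 + 2*y\<^sup>2 = n}) \<longleftrightarrow>
         even (card {d::int. 0 < d \<and> d dvd n \<and> d * d < n})"
proof -
  define S where "S = {(x::int, y::int, z::int). 0 < x \<and> 0 < y \<and> 0 < z \<and> x\<^sup>2 + 2*y*z = n}"
  have fin: "finite S" unfolding S_def by (rule finite_bounded_triples)
  have "even (card S) \<longleftrightarrow> even (card {t \<in> S. (\<lambda>(x,y,z). (x,z,y)) t = t})"
    by (rule card_involution_fixpoints[OF fin]) (auto simp: S_def algebra_simps)
  also have "card {t \<in> S. (\<lambda>(x,y,z). (x,z,y)) t = t} = card {(x::int, y::int). 0 < x \<and> 0 < y \<and> x\<^sup>2 + 2*y\<^sup>2 = n}"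
    by (rule bij_betw_same_card[of "\<lambda>(x,y,z). (x,y)"], rule bij_betwI[where g = "\<lambda>(x,y). (x,y,y)"])
       (auto simp: S_def power2_eq_square)
  finally have 1: "even (card S) \<longleftrightarrow> even (card {(x::int, y::int). 0 < x \<and> 0 < y \<and> x\<^sup>2 + 2*y\<^sup>2 = n})" .
  have "even (card S) \<longleftrightarrow> even (card {t \<in> S. jackson t = t})"
    using card_involution_fixpoints[OF fin, of jackson] jackson_involution[OF n] unfolding S_def by blast
  also have "card {t \<in> S. jackson t = t} = card {d::int. 0 < d \<and> d dvd n \<and> d * d < n}"
  proof (rule bij_betw_same_card[of fst], rule bij_betwI[where g = "\<lambda>d. (d, d, (n div d - d) div 2)"])
    have fx: "fst t = fst (snd t)" if "t \<in> {t \<in> S. jackson t = t}" for t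
      using that jackson_involution(3)[OF n, of t] unfolding S_def by blast
    show "fst \<in> {t \<in> S. jackson t = t} \<rightarrow> {d. 0 < d \<and> d dvd n \<and> d * d < n}"
    proof
      fix t assume t: "t \<in> {t \<in> S. jackson t = t}"
      obtain x y z where txyz: "t = (x, y, z)" by (cases t)
      then have h: "0 < x" "0 < z" "x\<^sup>2 + 2*x*z = n" using t fx[OF t] by (auto simp: S_def)
      then have "n = x * (x + 2 * z)" by (simp add: power2_eq_square algebra_simps)
      then show "fst t \<in> {d. 0 < d \<and> d dvd n \<and> d * d < n}" using h txyz by auto
    qed
    \<comment> \<open>\<open>n\<close> is odd, hence so are \<open>d\<close> and its cofactor, and
      their difference can be halved.\<close>
    have aux: "\<exists>k. n = d * (d + 2 * k) \<and> 0 < k \<and> (n div d - d) div 2 = k" if d: "0 < d" "d dvd n" "d * d < n" for d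
    proof -
      obtain e where e: "n = d * e" using d by blast
      have "odd n" using odd_if_mod_8[OF n] .
      then have "odd d" "odd e" using e by auto
      then have "even (e - d)" by simp
      then obtain k where "e - d = 2 * k" by (elim dvdE)
      then have k: "e = d + 2 * k" by simp
      have "d < e" using d e by simp
      then show ?thesis using e k d by (intro exI[of _ k]) auto
    qed
    show "(\<lambda>d. (d, d, (n div d - d) div 2)) \<in> {d. 0 < d \<and> d dvd n \<and> d * d < n} \<rightarrow> {t \<in> S. jackson t = t}"
    proof
      fix d assume "d \<in> {d. 0 < d \<and> d dvd n \<and> d * d < n}"
      then obtain k where k: "n = d * (d + 2 * k)" "0 < k" "(n div d - d) div 2 = k" "0 < d" using aux by blast
      show "(d, d, (n div d - d) div 2) \<in> {t \<in> S. jackson t = t}"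
        unfolding k(3) using k by (auto simp: S_def jackson_def power2_eq_square algebra_simps)
    qed
    fix t assume t: "t \<in> {t \<in> S. jackson t = t}"
    obtain x y z where txyz: "t = (x, y, z)" by (cases t)
    then have h: "0 < x" "0 < z" "x\<^sup>2 + 2*x*z = n" "x = y" using t fx[OF t] by (auto simp: S_def)
    then have "n = x * (x + 2 * z)" by (simp add: power2_eq_square algebra_simps)
    then show "(fst t, fst t, (n div fst t - fst t) div 2) = t" using h txyz by auto
  qed auto
  finally show ?thesis using 1 by simp
qed

text \<open>Multiplication by a primitive cube root of unity in the Eisenstein integers.\<close>
definition eis :: "int \<times> int \<Rightarrow> int \<times> int" where
  "eis = (\<lambda>(y, m). if even ((y + m) div 2) then ((y + 3 * m) div 2, \<bar>y - m\<bar> div 2)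
                   else (\<bar>3 * m - y\<bar> div 2, (y + m) div 2))"

text \<open>With \<open>y\<close> and \<open>m\<close> odd, \<open>y + m sqrt(-3)\<close> is twice
  an Eisenstein integer. Since \<open>(y + m)/2\<close> and \<open>(y - m)/2\<close> differ by the
  odd \<open>m\<close>, exactly one of its products with the two nontrivial cube roots of unity has
  odd coordinates again; \<open>eis\<close> selects that one, up to signs.\<close>

lemma eis_involution:
  fixes N :: int
  assumes "0 < y" "0 < m" "odd y" "odd m" "y\<^sup>2 + 3 * m\<^sup>2 = N" "eis (y, m) = (y', m')"
  shows "0 < y'" "0 < m'" "odd y'" "odd m'" "y'\<^sup>2 + 3 * m'\<^sup>2 = N" "eis (y', m') = (y, m)"
    "(y', m') = (y, m) \<longleftrightarrow> y = m \<or> y = 3 * m"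
proof -
  have "even (y + m)" using assms(3,4) by simp
  then obtain s where "y + m = 2 * s" by (elim dvdE)
  then have s: "y = 2 * s - m" by simp
  have "0 < y' \<and> 0 < m' \<and> odd y' \<and> odd m' \<and> y'\<^sup>2 + 3 * m'\<^sup>2 = N \<and> eis (y', m') = (y, m) \<and> ((y', m') = (y, m) \<longleftrightarrow> y = m \<or> y = 3 * m)"
  proof (cases "even s")
    case True
    then have j: "y' = s + m" "m' = \<bar>s - m\<bar>" using assms(6) s by (auto simp: eis_def)
    have ne: "s \<noteq> m" using True assms by auto
    have p: "0 < y'" "0 < m'" using j assms s ne by auto
    have o: "odd y'" "odd m'" using j True assms by auto
    have q: "y'\<^sup>2 + 3 * m'\<^sup>2 = N" unfolding j power2_abs using assms(5) s by (simp add: power2_eq_square algebra_simps)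
    have "eis (y', m') = (y, m)"
    proof (cases "s > m")
      case t: True
      then have "y' = s + m" "m' = s - m" using j by auto
      then have "(y' + m') div 2 = s" "(y' + 3 * m') div 2 = 2 * s - m" "\<bar>y' - m'\<bar> div 2 = m" using assms by auto
      then show ?thesis using True s by (simp add: eis_def)
    next
      case f: False
      then have "y' = s + m" "m' = m - s" using j by auto
      then have "(y' + m') div 2 = m" "\<bar>3 * m' - y'\<bar> div 2 = \<bar>m - 2 * s\<bar>" by auto
      then show ?thesis using True s assms by (simp add: eis_def)
    qed
    moreover have "((y', m') = (y, m)) \<longleftrightarrow> y = m \<or> y = 3 * m" using j s True assms by auto
    ultimately show ?thesis using p o q by auto
  next
    case False
    then have j: "y' = \<bar>2 * m - s\<bar>" "m' = s" using assms(6) s by (auto simp: eis_def)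
    have p: "0 < y'" "0 < m'" using j assms s False by auto
    have o: "odd y'" "odd m'" using j False assms by auto
    have q: "y'\<^sup>2 + 3 * m'\<^sup>2 = N" unfolding j power2_abs using assms(5) s by (simp add: power2_eq_square algebra_simps)
    have "eis (y', m') = (y, m)"
    proof (cases "s < 2 * m")
      case t: True
      then have "y' = 2 * m - s" "m' = s" using j by auto
      then have "(y' + m') div 2 = m" "\<bar>3 * m' - y'\<bar> div 2 = y" using s assms(1) by auto
      then show ?thesis using assms(4) by (simp add: eis_def)
    next
      case f: False
      then have "y' = s - 2 * m" "m' = s" using j by auto
      then have "(y' + m') div 2 = s - m" "(y' + 3 * m') div 2 = 2 * s - m" "\<bar>y' - m'\<bar> div 2 = m" using assms(2) by auto
      then show ?thesis using False assms(4) s by (simp add: eis_def)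
    qed
    moreover have "((y', m') = (y, m)) \<longleftrightarrow> y = m \<or> y = 3 * m" using j s False assms by auto
    ultimately show ?thesis using p o q by auto
  qed
  then show "0 < y'" "0 < m'" "odd y'" "odd m'" "y'\<^sup>2 + 3 * m'\<^sup>2 = N" "eis (y', m') = (y, m)"
    "(y', m') = (y, m) \<longleftrightarrow> y = m \<or> y = 3 * m" by auto
qed

section \<open>Representations by binary quadratic forms\<close>

lemma coprime_mult_square:
  fixes s t m :: int
  assumes "0 < s" "0 < t" "0 < m" "coprime s t" "s * t = m\<^sup>2"
  shows "\<exists>i j. 0 < i \<and> 0 < j \<and> s = i\<^sup>2 \<and> t = j\<^sup>2 \<and> i * j = m"
proof -
  obtain a b c where n: "s = int a" "t = int b" "m = int c" using assms(1-3) by (metis int_nat_eq less_imp_le)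
  have cop: "coprime a b" using assms(4) n by simp
  have e: "a * b = c^2" using assms(5) n by (metis of_nat_eq_iff of_nat_mult of_nat_power)
  have "is_nth_power 2 (a * b)" unfolding e by simp
  then have "is_nth_power 2 a" "is_nth_power 2 b"
    using is_nth_power_mult_coprime_natD[OF cop, of 2] assms n by auto
  then obtain i j where ij: "a = i^2" "b = j^2" by (auto elim!: is_nth_powerE)
  have "(i * j)^2 = c^2" using ij e by (simp add: power_mult_distrib)
  then have "i * j = c" by (simp add: power2_eq_iff_nonneg)
  moreover have "0 < i" "0 < j" using ij assms n by (auto intro!: Nat.gr0I)
  ultimately show ?thesis using n ij by (intro exI[of _ "int i"] exI[of _ "int j"]) auto
qed

lemma coprime_mult_two_square:
  fixes s t m :: int
  assumes "0 < s" "0 < t" "0 < m" "coprime s t" "s * t = 2 * m\<^sup>2"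
  shows "\<exists>i j. 0 < i \<and> 0 < j \<and> i * j = m \<and> (s = i\<^sup>2 \<and> t = 2 * j\<^sup>2 \<or> s = 2 * j\<^sup>2 \<and> t = i\<^sup>2)"
proof -
  have "even (s * t)" using assms by simp
  then consider "even s" | "even t" by auto
  then show ?thesis
  proof cases
    case 1
    then obtain u where u: "s = 2 * u" by blast
    have "\<exists>i j. 0 < i \<and> 0 < j \<and> u = i\<^sup>2 \<and> t = j\<^sup>2 \<and> i * j = m"
      by (rule coprime_mult_square) (use assms u in auto)
    then obtain i j where "0 < i" "0 < j" "u = i\<^sup>2" "t = j\<^sup>2" "i * j = m" by blast
    then show ?thesis using u by (intro exI[of _ j] exI[of _ i]) (auto simp: mult.commute)
  next
    case 2
    then obtain u where u: "t = 2 * u" by blast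
    have "\<exists>i j. 0 < i \<and> 0 < j \<and> s = i\<^sup>2 \<and> u = j\<^sup>2 \<and> i * j = m"
      by (rule coprime_mult_square) (use assms u in auto)
    then show ?thesis using u by blast
  qed
qed

text \<open>The coprime factors share out the primes 2 and 3 of \<open>6 m^2\<close>; up to order
  this leaves \<open>i^2, 6 j^2\<close> or \<open>2 i^2, 3 j^2\<close>, and only their sum is
  kept.\<close>

lemma coprime_mult_six_square:
  fixes s t m :: int
  assumes "0 < s" "0 < t" "0 < m" "coprime s t" "s * t = 6 * m\<^sup>2"
  shows "\<exists>i j. 0 < i \<and> 0 < j \<and> i * j = m \<and> (s + t = i\<^sup>2 + 6 * j\<^sup>2 \<or> s + t = 2 * i\<^sup>2 + 3 * j\<^sup>2)"
proof -
  have aux: "\<exists>i j. 0 < i \<and> 0 < j \<and> i * j = m \<and> (s + t = i\<^sup>2 + 6 * j\<^sup>2 \<or> s + t = 2 * i\<^sup>2 + 3 * j\<^sup>2)"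
    if h: "0 < s" "0 < t" "coprime s t" "s * t = 6 * m\<^sup>2" "3 dvd s" for s t :: int
  proof -
    obtain u where u: "s = 3 * u" using h(5) by blast
    have "3 * (u * t) = 3 * (2 * m\<^sup>2)" using h(4) u by simp
    then have "u * t = 2 * m\<^sup>2" by (simp only: mult_cancel_left) simp
    then have "\<exists>i j. 0 < i \<and> 0 < j \<and> i * j = m \<and> (u = i\<^sup>2 \<and> t = 2 * j\<^sup>2 \<or> u = 2 * j\<^sup>2 \<and> t = i\<^sup>2)"
      using coprime_mult_two_square[of u t m] h assms(3) u by auto
    then obtain i j where ij: "0 < i" "0 < j" "i * j = m" "u = i\<^sup>2 \<and> t = 2 * j\<^sup>2 \<or> u = 2 * j\<^sup>2 \<and> t = i\<^sup>2" by blast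
    from ij(4) show ?thesis
    proof
      assume "u = i\<^sup>2 \<and> t = 2 * j\<^sup>2"
      then show ?thesis using u ij by (intro exI[of _ j] exI[of _ i]) (auto simp: mult.commute)
    next
      assume "u = 2 * j\<^sup>2 \<and> t = i\<^sup>2"
      then show ?thesis using u ij by (intro exI[of _ i] exI[of _ j]) auto
    qed
  qed
  have "3 dvd s * t" using assms by simp
  then have "3 dvd s \<or> 3 dvd t" using prime_dvd_mult_iff[of "3::int" s t] by simp
  then show ?thesis
    using aux[of s t] aux[of t s] assms by (auto simp: coprime_commute mult.commute add.commute)
qed

lemma square_mod_3: "(x::int)\<^sup>2 mod 3 = (if 3 dvd x then 0 else 1)"
proof -
  define r where "r = x mod 3"
  have "r \<in> {0..<3}" unfolding r_def by simp
  moreover have "{0..<3} = {0,1,2::int}" by auto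
  ultimately have r: "r \<in> {0,1,2}" by simp
  have e: "x\<^sup>2 mod 3 = r\<^sup>2 mod 3" unfolding r_def by (simp add: power_mod)
  have o: "3 dvd x \<longleftrightarrow> 3 dvd r" unfolding r_def by (simp add: dvd_mod_iff)
  show ?thesis unfolding e o using r by (elim insertE emptyE; simp)
qed

text \<open>The forms \<open>x^2 + 6y^2\<close> and \<open>2x^2 + 3y^2\<close> are the two classes
  of discriminant -24; residues modulo 3 separate them.\<close>

lemma x2_6y2_mod_3: "((x::int)\<^sup>2 + 6 * y\<^sup>2) mod 3 \<noteq> 2" "(2 * x\<^sup>2 + 3 * y\<^sup>2) mod 3 \<noteq> 1"
proof -
  have "(x\<^sup>2 + 6 * y\<^sup>2) mod 3 = (x\<^sup>2 + 3 * (2 * y\<^sup>2)) mod 3" by simp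
  also have "\<dots> = x\<^sup>2 mod 3" by (rule mod_mult_self2)
  finally show "(x\<^sup>2 + 6 * y\<^sup>2) mod 3 \<noteq> 2" unfolding square_mod_3 by (cases "3 dvd x") simp_all
  have "(2 * x\<^sup>2 + 3 * y\<^sup>2) mod 3 = (2 * x\<^sup>2) mod 3" by (rule mod_mult_self2)
  also have "\<dots> = (2 * (x\<^sup>2 mod 3)) mod 3" by (rule mod_mult_right_eq[symmetric])
  finally show "(2 * x\<^sup>2 + 3 * y\<^sup>2) mod 3 \<noteq> 1" unfolding square_mod_3 by (cases "3 dvd x") simp_all
qed

lemma mod_8_combination: "(a * x\<^sup>2 + b * y\<^sup>2) mod 8 = (a * (x\<^sup>2 mod 8) + b * (y\<^sup>2 mod 8)) mod (8::int)"
  by (intro mod_add_cong) (simp_all only: mod_mult_right_eq)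

text \<open>Modulo 3 rules out the first form. The second is 5 modulo 8 for odd \<open>i\<close> and
  \<open>j\<close>, whereas \<open>p\<close> is 3 modulo 8. Oddness matters: 11 is
  \<open>2 * 2^2 + 3 * 1^2\<close>.\<close>

lemma not_represented_11_mod_24:
  fixes p :: int
  assumes p: "p mod 24 = 11" and ij: "odd i" "odd j"
  shows "p \<noteq> i\<^sup>2 + 6 * j\<^sup>2" "p \<noteq> 2 * i\<^sup>2 + 3 * j\<^sup>2"
proof -
  show "p \<noteq> i\<^sup>2 + 6 * j\<^sup>2" using mod_24[OF p] x2_6y2_mod_3(1)[of i j] by auto
  have "i\<^sup>2 mod 8 = 1" "j\<^sup>2 mod 8 = 1" unfolding square_mod_8 using ij by simp_all
  then have "(2 * i\<^sup>2 + 3 * j\<^sup>2) mod 8 = 5" using mod_8_combination[of 2 i 3 j] by simp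
  then show "p \<noteq> 2 * i\<^sup>2 + 3 * j\<^sup>2" using mod_24[OF p] by auto
qed

text \<open>The halves of \<open>p - x\<close> and \<open>p + x\<close> have sum \<open>p\<close>,
  so a common factor divides the prime \<open>p\<close>; both are positive and smaller than
  \<open>p\<close>.\<close>

lemma coprime_halves:
  fixes p x :: int
  assumes "prime p" "odd p" "odd x" "0 < x" "x < p"
  obtains s t where "0 < s" "0 < t" "coprime s t" "s + t = p" "t - s = x" "4 * (s * t) = p\<^sup>2 - x\<^sup>2"
proof -
  have "even (p - x)" using assms by simp
  then obtain s where s: "p - x = 2 * s" by blast
  let ?t = "p - s"
  have pos: "0 < s" "0 < ?t" using s assms by auto
  have "coprime s p"
    using assms(1) pos by (metis coprime_commute prime_imp_coprime zdvd_not_zless diff_gt_0_iff_gt)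
  moreover have "gcd s p = gcd s ?t" by (metis gcd.commute gcd_diff1)
  ultimately have "coprime s ?t" by (simp add: coprime_iff_gcd_eq_1)
  moreover have x: "x = p - 2 * s" using s by simp
  have "4 * (s * ?t) = p\<^sup>2 - x\<^sup>2" unfolding x by (simp add: power2_eq_square algebra_simps)
  ultimately show ?thesis using that[of s ?t] pos x by simp
qed

text \<open>Thue's argument: the \<open>(r + 1)^2 > p\<close> pairs \<open>(u, v)\<close> cannot
  have distinct residues \<open>u - s v\<close>, and the difference of two colliding pairs satisfies
  \<open>x^2 + 6 y^2 = k p\<close> with \<open>0 < k < 7\<close>. It remains to remove
  \<open>k\<close>.\<close>

lemma represented_by_x2_6y2:
  fixes p :: int
  assumes p: "prime p" "p mod 24 = 7" and s: "[s\<^sup>2 = -6] (mod p)"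
  shows "\<exists>i j. 0 < i \<and> 0 < j \<and> p = i\<^sup>2 + 6 * j\<^sup>2"
proof -
  have p0: "p > 0" using p by (simp add: prime_gt_0_int)
  define r where "r = \<lfloor>sqrt (real_of_int p)\<rfloor>"
  have r0: "r \<ge> 0" unfolding r_def using p0 by simp
  have "real_of_int r \<le> sqrt p" "sqrt p < real_of_int r + 1" unfolding r_def by linarith+
  then have "(real_of_int r)\<^sup>2 \<le> p" "p < (real_of_int r + 1)\<^sup>2"
    using r0 p0 by (metis of_int_0_le_iff order_less_imp_le power_mono real_sqrt_pow2 of_int_0_less_iff,
       metis of_int_0_le_iff order_less_imp_le power_strict_mono real_sqrt_pow2 of_int_0_less_iff real_sqrt_ge_zero zero_less_numeral)
  then have r1: "r\<^sup>2 \<le> p" "p < (r+1)\<^sup>2" 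
    by (metis of_int_le_iff of_int_power, metis of_int_less_iff of_int_power of_int_add of_int_1)
  have nsq: "k\<^sup>2 \<noteq> p" for k :: int
    using p(1) prime_power_iff[of k 2] by auto
  have r2: "r\<^sup>2 < p" using r1 nsq[of r] by simp
  define f where "f = (\<lambda>(u::int, v::int). (u - s * v) mod p)"
  have "\<not> inj_on f ({0..r} \<times> {0..r})"
  proof
    assume "inj_on f ({0..r} \<times> {0..r})"
    moreover have "f ` ({0..r} \<times> {0..r}) \<subseteq> {0..<p}" unfolding f_def using p0 by auto
    ultimately have "card ({0..r} \<times> {0..r}) \<le> card {0..<p}" by (metis card_inj_on_le finite_atLeastLessThan_int)
    then have "nat (r+1) * nat (r+1) \<le> nat p" by (simp add: card_cartesian_product)
    then have "(r+1)\<^sup>2 \<le> p" using r0 p0 by (simp add: power2_eq_square flip: nat_mult_distrib)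
    then show False using r1 by simp
  qed
  then obtain u v u' v' where uv: "u \<in> {0..r}" "v \<in> {0..r}" "u' \<in> {0..r}" "v' \<in> {0..r}" "(u, v) \<noteq> (u', v')"
    "(u - s * v) mod p = (u' - s * v') mod p"
    unfolding inj_on_def f_def by auto
  define x y where "x = u - u'" "y = v - v'"
  have xy0: "x \<noteq> 0 \<or> y \<noteq> 0" using uv x_y_def by auto
  have "\<bar>x\<bar> \<le> r" "\<bar>y\<bar> \<le> r" using uv x_y_def by auto
  then have "x\<^sup>2 \<le> r\<^sup>2" "y\<^sup>2 \<le> r\<^sup>2" using r0 by (metis abs_ge_zero power2_abs power_mono)+
  then have lt: "x\<^sup>2 + 6 * y\<^sup>2 < 7 * p" using r2 by linarith
  have "p dvd (u - s * v) - (u' - s * v')" using uv(6) by (simp add: mod_eq_dvd_iff)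
  then have "p dvd x - s * y" by (simp add: x_y_def algebra_simps)
  then have "p dvd (x - s * y) * (x + s * y) + (s\<^sup>2 - (-6)) * y\<^sup>2" 
    using s by (simp add: cong_iff_dvd_diff)
  also have "(x - s * y) * (x + s * y) + (s\<^sup>2 - (-6)) * y\<^sup>2 = x\<^sup>2 + 6 * y\<^sup>2" by (simp add: power2_eq_square algebra_simps)
  finally obtain k where k: "x\<^sup>2 + 6 * y\<^sup>2 = p * k" by blast
  have "0 < x\<^sup>2 + 6 * y\<^sup>2" 
  proof -
    have "0 < x\<^sup>2 \<or> 0 < y\<^sup>2" "0 \<le> x\<^sup>2" "0 \<le> y\<^sup>2" using xy0 by auto
    then show ?thesis by linarith
  qed
  then have pk: "p * 0 < p * k" "p * k < p * 7" using k lt by linarith+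
  have k17: "0 < k" "k < 7" using pk(1) mult_less_cancel_left_pos[OF p0] pk(2) by blast+
  have m3: "x\<^sup>2 mod 3 = k mod 3"
  proof -
    have "x\<^sup>2 mod 3 = (x\<^sup>2 + 3 * (2 * y\<^sup>2)) mod 3" by (simp only: mod_mult_self2)
    also have "\<dots> = (x\<^sup>2 + 6 * y\<^sup>2) mod 3" by simp
    also have "\<dots> = ((p mod 3) * k) mod 3" unfolding k by (simp add: mod_mult_left_eq)
    also have "p mod 3 = 1" using mod_24[OF p(2)] by simp
    finally show ?thesis by simp
  qed
  have p3: "p mod 3 = 1" using mod_24[OF p(2)] by simp
  have "\<exists>i j. p = i\<^sup>2 + 6 * j\<^sup>2"
  proof -
    \<comment> \<open>Squares modulo 3 exclude 2 and 5. For \<open>k = 3\<close> one would get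
      \<open>p = 3w^2 + 2y^2\<close>, impossible as \<open>p\<close> is 1 modulo 3. For
      \<open>k = 4\<close> both variables are even, and for \<open>k = 6\<close> the variable
      \<open>x\<close> is divisible by 6 and the roles of the variables swap.\<close>
    have "k \<in> {1,2,3,4,5,6}" using k17 by auto
    moreover have "k mod 3 \<noteq> 2" using m3 square_mod_3[of x] by (cases "3 dvd x") simp_all
    ultimately have "k = 1 \<or> k = 3 \<or> k = 4 \<or> k = 6" by auto
    then consider "k = 1" | "k = 3" | "k = 4" | "k = 6" by blast
    then show ?thesis
    proof cases
      case 1
      then show ?thesis using k by (metis mult.right_neutral)
    next
      case 2
      then have "3 dvd x" using m3 square_mod_3[of x] by (auto split: if_splits)
      then obtain w where "x = 3 * w" by blast
      then have "3 * w\<^sup>2 + 2 * y\<^sup>2 = p" using k 2 by (simp add: power2_eq_square)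
      then have False using p3 x2_6y2_mod_3(2)[of y w] by (simp add: add.commute)
      then show ?thesis ..
    next
      case 3
      have "x\<^sup>2 = 2 * (2 * p - 3 * y\<^sup>2)" using k 3 by simp
      then have "even (x\<^sup>2)" by simp
      then have "even x" by simp
      then obtain w where w: "x = 2 * w" by blast
      then have "3 * y\<^sup>2 = 2 * (p - w\<^sup>2)" using k 3 by (simp add: power2_eq_square)
      then have "even (3 * y\<^sup>2)" by simp
      then have "even y" by simp
      then obtain z where z: "y = 2 * z" by blast
      show ?thesis using k 3 w z by (intro exI[of _ w] exI[of _ z]) (simp add: power2_eq_square)
    next
      case 4
      then have "3 dvd x" using m3 square_mod_3[of x] by (auto split: if_splits)
      moreover have "x\<^sup>2 = 2 * (3 * p - 3 * y\<^sup>2)" using k 4 by simp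
      then have "even (x\<^sup>2)" by simp
      then have "even x" by simp
      moreover have "coprime (3::int) 2" by simp
      ultimately have "3 * 2 dvd x" by (metis divides_mult)
      then have "6 dvd x" by simp
      then obtain w where w: "x = 6 * w" by blast
      show ?thesis using k 4 w by (intro exI[of _ y] exI[of _ w]) (simp add: power2_eq_square)
    qed
  qed
  then obtain i j where ij: "p = i\<^sup>2 + 6 * j\<^sup>2" by blast
  have "i \<noteq> 0"
  proof
    assume "i = 0"
    then have "even p" using ij by simp
    then show False using mod_24[OF p(2)] by (simp add: even_iff_mod_2_eq_zero)
  qed
  moreover have "j \<noteq> 0" using ij nsq[of i] by auto
  ultimately show ?thesis using ij by (intro exI[of _ "\<bar>i\<bar>"] exI[of _ "\<bar>j\<bar>"]) auto
qed

text \<open>\<open>p\<close> divides \<open>(ad - bc)(ad + bc)\<close>, and \<open>p^2\<close> is a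
  square plus 6 times the square of either factor. A nonzero factor divisible by \<open>p\<close>
  would make this at least \<open>6 p^2\<close>, so \<open>ad = bc\<close>.\<close>

lemma x2_6y2_product_unique:
  fixes p :: int
  assumes p: "prime p" and a: "0 < a" "0 < b" "p = a\<^sup>2 + 6 * b\<^sup>2" and c: "0 < c" "0 < d" "p = c\<^sup>2 + 6 * d\<^sup>2"
  shows "a * b = c * d"
proof -
  have p0: "p > 0" using p by (simp add: prime_gt_0_int)
  have "(a * d - b * c) * (a * d + b * c) = a\<^sup>2 * d\<^sup>2 - b\<^sup>2 * c\<^sup>2" by (simp add: power2_eq_square algebra_simps)
  also have "\<dots> = (p - 6 * b\<^sup>2) * d\<^sup>2 - b\<^sup>2 * (p - 6 * d\<^sup>2)" using a c by simp
  also have "\<dots> = p * (d\<^sup>2 - b\<^sup>2)" by (simp add: algebra_simps)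
  finally have "p dvd (a * d - b * c) * (a * d + b * c)" by simp
  then consider "p dvd a * d - b * c" | "p dvd a * d + b * c" using p by (meson prime_dvd_mult_iff)
  then show ?thesis
  proof cases
    case 1
    have e: "p\<^sup>2 = (a*c + 6*b*d)\<^sup>2 + 6 * (a*d - b*c)\<^sup>2"
    proof -
      have "p\<^sup>2 = (a\<^sup>2 + 6 * b\<^sup>2) * (c\<^sup>2 + 6 * d\<^sup>2)" using a c by (simp add: power2_eq_square)
      then show ?thesis by (simp add: power2_eq_square algebra_simps)
    qed
    have z: "a * d - b * c = 0"
    proof (rule ccontr)
      assume "a * d - b * c \<noteq> 0"
      then have "p \<le> \<bar>a * d - b * c\<bar>" using 1 by (metis dvd_imp_le_int abs_of_pos p0)
      then have "p\<^sup>2 \<le> (a * d - b * c)\<^sup>2" using p0 by (metis abs_ge_zero less_imp_le power2_abs power_mono)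
      moreover have "0 < p\<^sup>2" using p0 by simp
      moreover have "0 \<le> (a*c + 6*b*d)\<^sup>2" by simp
      ultimately show False using e by linarith
    qed
    have "a\<^sup>2 * d\<^sup>2 = b\<^sup>2 * c\<^sup>2" using z by (metis power_mult_distrib eq_iff_diff_eq_0)
    then have "(p - 6 * b\<^sup>2) * d\<^sup>2 = b\<^sup>2 * (p - 6 * d\<^sup>2)" using a c by simp
    then have "p * (d\<^sup>2 - b\<^sup>2) = 0" by (simp add: algebra_simps)
    then have "b\<^sup>2 = d\<^sup>2" using p0 by simp
    then have "b = d" using a c by (simp add: power2_eq_iff)
    moreover have "a = c" using a c \<open>b = d\<close> by (simp add: power2_eq_iff)
    ultimately show ?thesis by simp
  next
    case 2
    have e: "p\<^sup>2 = (a*c - 6*b*d)\<^sup>2 + 6 * (a*d + b*c)\<^sup>2"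
    proof -
      have "p\<^sup>2 = (a\<^sup>2 + 6 * b\<^sup>2) * (c\<^sup>2 + 6 * d\<^sup>2)" using a c by (simp add: power2_eq_square)
      then show ?thesis by (simp add: power2_eq_square algebra_simps)
    qed
    have "0 < a * d + b * c" using a c by (simp add: add_pos_pos)
    then have "p \<le> a * d + b * c" using 2 by (simp add: zdvd_imp_le)
    then have "p\<^sup>2 \<le> (a * d + b * c)\<^sup>2" using p0 by (simp add: power_mono)
    moreover have "0 < p\<^sup>2" using p0 by simp
    moreover have "0 \<le> (a*c - 6*b*d)\<^sup>2" by simp
    ultimately show ?thesis using e by linarith
  qed
qed

section \<open>Character sums over walls\<close>

text \<open>The properties of the Legendre symbol for a prime \<open>p\<close> with
  \<open>p mod 4 = 3\<close> on which the counting rests. Oddness, \<open>chi (-1) = -1\<close>,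
  makes \<open>m * chi m\<close> even in \<open>m\<close>, so that the terms of \<open>m\<close> and
  \<open>-m\<close> add instead of cancelling.\<close>

locale odd_quadratic_character =
  fixes p :: int and chi :: "int \<Rightarrow> int"
  assumes p_prime: "prime p" and p_odd: "odd p"
    and chi_mult: "chi (a * b) = chi a * chi b"
    and chi_zero: "chi a = 0 \<longleftrightarrow> p dvd a"
    and chi_range: "chi a \<in> {-1, 0, 1}"
    and chi_cong: "[a = b] (mod p) \<Longrightarrow> chi a = chi b"
    and chi_neg: "chi (-1) = -1"
begin

lemma p_pos: "p > 0" using p_prime by (simp add: prime_gt_0_int)

lemma chi_odd: "\<not> p dvd a \<Longrightarrow> odd (chi a)"
  using chi_zero[of a] chi_range[of a] by auto

lemma chi_1: "chi 1 = 1"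
proof -
  have "chi 1 = chi 1 * chi 1" using chi_mult[of 1 1] by simp
  moreover have "chi 1 \<noteq> 0" using chi_zero[of 1] p_prime not_prime_unit by blast
  ultimately show ?thesis by simp
qed

lemma chi_minus: "chi (-a) = - chi a"
  using chi_mult[of "-1" a] chi_neg by simp

lemma chi_square: "\<not> p dvd a \<Longrightarrow> chi (a\<^sup>2) = 1"
  using chi_zero[of a] chi_range[of a] chi_mult[of a a] by (auto simp: power2_eq_square)

text \<open>For \<open>n > 0\<close> this is the number of ideals of norm \<open>n\<close> in the
  imaginary quadratic field whose character is \<open>chi\<close>.\<close>

definition divisor_sum :: "int \<Rightarrow> int" where
  "divisor_sum n = (\<Sum>d\<in>{d. 0 < d \<and> d dvd n}. chi d)"

abbreviation small_divisors :: "int \<Rightarrow> int set" where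
  "small_divisors n \<equiv> {d. 0 < d \<and> d dvd n \<and> d * d < n}"

text \<open>Pair \<open>d\<close> with \<open>n div d\<close>: since \<open>chi n = 1\<close>, both
  have the same character value. Only a square root of \<open>n\<close> stays unpaired, and it will
  decide the parity.\<close>

lemma divisor_sum_eq:
  assumes n: "0 < n" "chi n = 1"
  shows "divisor_sum n = 2 * (\<Sum>d\<in>small_divisors n. chi d) + (\<Sum>d\<in>{d. 0 < d \<and> d * d = n}. chi d)"
proof -
  let ?A = "small_divisors n" and ?B = "{d. 0 < d \<and> d dvd n \<and> n < d * d}" and ?C = "{d. 0 < d \<and> d * d = n}"
  have finD: "finite {d. 0 < d \<and> d dvd n}"
    by (rule finite_subset[of _ "{0..n}"]) (use n in \<open>auto simp: zdvd_imp_le\<close>)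
  have un: "{d. 0 < d \<and> d dvd n} = ?A \<union> (?B \<union> ?C)" by auto
  have fin: "finite ?A" "finite ?B" "finite ?C" by (rule finite_subset[OF _ finD], force)+
  have chi_div: "chi (n div d) = chi d" if "0 < d" "d dvd n" for d
  proof -
    have "chi (n div d) * chi d = 1" using that n chi_mult[of "n div d" d] by simp
    then show ?thesis using chi_range[of d] chi_range[of "n div d"] by auto
  qed
  have "(\<Sum>d\<in>?B. chi d) = (\<Sum>d\<in>?A. chi d)"
  proof (rule sum.reindex_bij_witness[of _ "\<lambda>d. n div d" "\<lambda>d. n div d"])
    fix d assume "d \<in> ?B"
    then obtain e where e: "n = d * e" "0 < d" "d * e < d * d" by auto
    then have "0 < e" "e < d" using n by (auto simp: zero_less_mult_iff)
    then show "n div (n div d) = d" "n div d \<in> ?A" using e by auto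
    show "chi (n div d) = chi d" by (rule chi_div) (use e in auto)
  next
    fix d assume "d \<in> ?A"
    then obtain e where e: "n = d * e" "0 < d" "d * d < d * e" by auto
    then have "0 < e" "d < e" using n by (auto simp: zero_less_mult_iff)
    then show "n div (n div d) = d" "n div d \<in> ?B" using e by auto
  qed
  moreover have "divisor_sum n = (\<Sum>d\<in>?A. chi d) + ((\<Sum>d\<in>?B. chi d) + (\<Sum>d\<in>?C. chi d))"
    unfolding divisor_sum_def un using fin
    by (subst sum.union_disjoint; (subst sum.union_disjoint)?) auto
  ultimately show ?thesis by simp
qed

lemma divisor_sum_nonsquare:
  assumes n: "0 < n" "chi n = 1" and "\<And>k. k\<^sup>2 \<noteq> n"
  shows "divisor_sum n = 2 * (\<Sum>d\<in>small_divisors n. chi d)"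
proof -
  have e: "{d. 0 < d \<and> d * d = n} = {}" using assms(3) by (auto simp: power2_eq_square)
  show ?thesis using divisor_sum_eq[OF n] unfolding e by simp
qed

lemma divisor_sum_parity:
  assumes n: "0 < n" "chi n = 1"
  shows "odd (divisor_sum n) \<longleftrightarrow> (\<exists>k. k\<^sup>2 = n)"
proof (cases "\<exists>k. k\<^sup>2 = n")
  case True
  then obtain k where k: "k\<^sup>2 = n" by blast
  then have k0: "k \<noteq> 0" using n by auto
  have "d = \<bar>k\<bar>" if "0 < d" "d * d = n" for d
    using that k by (metis abs_of_pos power2_eq_iff power2_eq_square abs_minus_cancel)
  moreover have "\<bar>k\<bar> * \<bar>k\<bar> = n" using k by (simp add: power2_eq_square)
  ultimately have "{d. 0 < d \<and> d * d = n} = {\<bar>k\<bar>}" using k0 by auto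
  moreover have "odd (chi \<bar>k\<bar>)"
  proof (rule chi_odd)
    show "\<not> p dvd \<bar>k\<bar>"
    proof
      assume "p dvd \<bar>k\<bar>"
      then have "p dvd n" using k by (simp add: power2_eq_square flip: k)
      then show False using n chi_zero[of n] by simp
    qed
  qed
  ultimately show ?thesis using divisor_sum_eq[OF n] True by simp
next
  case False
  then show ?thesis using divisor_sum_nonsquare[OF n] by auto
qed

lemma sum_small_divisors_parity:
  assumes "0 < n" "\<not> p dvd n"
  shows "even (\<Sum>d\<in>small_divisors n. chi d) \<longleftrightarrow> even (card (small_divisors n))"
proof -
  have fin: "finite (small_divisors n)"
    by (rule finite_subset[of _ "{0..n}"]) (use assms in \<open>auto simp: zdvd_imp_le\<close>)
  have "{d \<in> small_divisors n. odd (chi d)} = small_divisors n"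
    using chi_odd assms by (auto intro: dvd_trans)
  then show ?thesis using even_sum_iff[OF fin, of chi] by simp
qed

text \<open>\<open>\<epsilon> = 1\<close> belongs to \<open>eta_form\<close>,
  \<open>\<epsilon> = -1\<close> to \<open>eta_form24\<close>. The summand is even in
  \<open>m\<close>.\<close>

definition wall_sum :: "int \<Rightarrow> int" where
  "wall_sum \<epsilon> = (\<Sum>m | 6 * m\<^sup>2 < p\<^sup>2. \<epsilon> ^ nat \<bar>m\<bar> * m * chi m * divisor_sum (p\<^sup>2 - 6 * m\<^sup>2))"

abbreviation wall_term :: "int \<Rightarrow> int" where
  "wall_term m \<equiv> m * chi m * divisor_sum (p\<^sup>2 - 6 * m\<^sup>2)"

lemma finite_wall_range: "finite {m. 6 * m\<^sup>2 < p\<^sup>2}"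
proof (rule finite_subset)
  show "{m. 6 * m\<^sup>2 < p\<^sup>2} \<subseteq> {-p..p}"
  proof
    fix m assume "m \<in> {m. 6 * m\<^sup>2 < p\<^sup>2}"
    then have "6 * m\<^sup>2 < p\<^sup>2" by simp
    moreover have "0 \<le> m\<^sup>2" by simp
    ultimately have "m\<^sup>2 \<le> p\<^sup>2" by linarith
    then have "\<bar>m\<bar> \<le> \<bar>p\<bar>" by (simp add: abs_le_square_iff)
    then show "m \<in> {-p..p}" using p_pos by auto
  qed
qed auto

lemma wall_sum_pos:
  "wall_sum \<epsilon> = 2 * (\<Sum>m | 0 < m \<and> 6 * m\<^sup>2 < p\<^sup>2. \<epsilon> ^ nat m * wall_term m)"
proof -
  let ?f = "\<lambda>m. \<epsilon> ^ nat \<bar>m\<bar> * m * chi m * divisor_sum (p\<^sup>2 - 6 * m\<^sup>2)"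
  let ?P = "{m. 0 < m \<and> 6 * m\<^sup>2 < p\<^sup>2}" and ?N = "{m. m < 0 \<and> 6 * m\<^sup>2 < p\<^sup>2}"
  have un: "{m. 6 * m\<^sup>2 < p\<^sup>2} = ?P \<union> (?N \<union> {0})" using p_pos by auto
  have fin: "finite ?P" "finite ?N" by (rule finite_subset[OF _ finite_wall_range], force)+
  have "sum ?f ?N = sum ?f ?P"
    by (rule sum.reindex_bij_witness[of _ uminus uminus]) (auto simp: chi_minus)
  moreover have "wall_sum \<epsilon> = sum ?f ?P + (sum ?f ?N + 0)"
    unfolding wall_sum_def un using fin by (subst sum.union_disjoint; (subst sum.union_disjoint)?) auto
  moreover have "sum ?f ?P = (\<Sum>m\<in>?P. \<epsilon> ^ nat m * wall_term m)"
    by (rule sum.cong) (auto simp: mult.assoc)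
  ultimately show ?thesis by simp
qed

lemma wall_range_coprime:
  assumes "0 < m" "6 * m\<^sup>2 < p\<^sup>2"
  shows "\<not> p dvd m"
proof
  assume "p dvd m"
  then have "p \<le> m" using assms by (simp add: zdvd_imp_le)
  then have "p\<^sup>2 \<le> m\<^sup>2" using p_pos by (simp add: power_mono)
  moreover have "0 \<le> m\<^sup>2" by simp
  ultimately show False using assms by linarith
qed

text \<open>Modulo \<open>p\<close> the norm is \<open>-6 m^2\<close>; the condition on -6 is what
  makes the pairing of divisors available.\<close>

lemma chi_wall_norm:
  assumes "0 < m" "6 * m\<^sup>2 < p\<^sup>2" "chi (-6) = 1"
  shows "chi (p\<^sup>2 - 6 * m\<^sup>2) = 1"
proof -
  have "[p\<^sup>2 - 6 * m\<^sup>2 = -6 * m\<^sup>2] (mod p)" by (simp add: cong_iff_dvd_diff)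
  then have "chi (p\<^sup>2 - 6 * m\<^sup>2) = chi (-6) * chi (m\<^sup>2)" using chi_cong chi_mult by metis
  then show ?thesis using assms chi_square wall_range_coprime by simp
qed

text \<open>If the norm is a square \<open>w^2\<close>, then \<open>(p - w)(p + w) = 6 m^2\<close>;
  the halves of the two factors are coprime with product \<open>6 (m/2)^2\<close> and sum
  \<open>p\<close>.\<close>

lemma wall_norm_square_rep:
  assumes m: "0 < m" "even m" "6 * m\<^sup>2 < p\<^sup>2" and w: "w\<^sup>2 = p\<^sup>2 - 6 * m\<^sup>2"
  shows "\<exists>i j. 0 < i \<and> 0 < j \<and> m = 2 * (i * j) \<and> (p = i\<^sup>2 + 6 * j\<^sup>2 \<or> p = 2 * i\<^sup>2 + 3 * j\<^sup>2)"
proof -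
  have "odd (w\<^sup>2)" unfolding w using p_odd m by simp
  then have ow: "odd \<bar>w\<bar>" by simp
  then have "w \<noteq> 0" by auto
  then have w0: "0 < \<bar>w\<bar>" by simp
  have "0 < m\<^sup>2" using m by simp
  then have "\<bar>w\<bar>\<^sup>2 < p\<^sup>2" unfolding power2_abs w by linarith
  then have wp: "\<bar>w\<bar> < p" using p_pos by (metis less_imp_le power_less_imp_less_base)
  obtain s t where st: "0 < s" "0 < t" "coprime s t" "s + t = p" "4 * (s * t) = p\<^sup>2 - \<bar>w\<bar>\<^sup>2"
    using coprime_halves[OF p_prime p_odd ow w0 wp] by metis
  obtain k where k: "m = 2 * k" using m(2) by blast
  have "4 * (s * t) = 4 * (6 * k\<^sup>2)" using st(5) w k unfolding power2_abs by (simp add: power2_eq_square)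
  then have "s * t = 6 * k\<^sup>2" by simp
  then obtain i j where "0 < i" "0 < j" "i * j = k" "s + t = i\<^sup>2 + 6 * j\<^sup>2 \<or> s + t = 2 * i\<^sup>2 + 3 * j\<^sup>2"
    using coprime_mult_six_square[of s t k] st m k by auto
  then show ?thesis using k st(4) by (intro exI[of _ i] exI[of _ j]) auto
qed

end

section \<open>Nonvanishing of the wall sum by parity\<close>

lemma four_dvdI: "even T \<Longrightarrow> even (T div 2) \<Longrightarrow> 4 dvd (T::int)"
  by (auto elim!: evenE)

context odd_quadratic_character
begin

text \<open>Half of the term is \<open>(m/2) * chi m\<close> times the divisor sum. Here
  \<open>chi m\<close> is odd, and the divisor sum is odd exactly when the norm is a square.\<close>

lemma wall_term_even:
  assumes m: "0 < m" "6 * m\<^sup>2 < p\<^sup>2" "even m" "chi (-6) = 1"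
  shows "even (wall_term m div 2) \<longleftrightarrow> \<not> (odd (m div 2) \<and> (\<exists>w. w\<^sup>2 = p\<^sup>2 - 6 * m\<^sup>2))" "even (wall_term m)"
proof -
  obtain k where k: "m = 2 * k" using m(3) by blast
  have o: "odd (chi m)" using chi_odd wall_range_coprime m by blast
  have e: "wall_term m = 2 * (k * chi m * divisor_sum (p\<^sup>2 - 6 * m\<^sup>2))" using k by simp
  have h: "wall_term m div 2 = k * chi m * divisor_sum (p\<^sup>2 - 6 * m\<^sup>2)"
    unfolding e by (rule nonzero_mult_div_cancel_left) simp
  have d: "odd (divisor_sum (p\<^sup>2 - 6 * m\<^sup>2)) \<longleftrightarrow> (\<exists>w. w\<^sup>2 = p\<^sup>2 - 6 * m\<^sup>2)"
    using divisor_sum_parity chi_wall_norm m by simp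
  have "m div 2 = k" using k by simp
  then show "even (wall_term m div 2) \<longleftrightarrow> \<not> (odd (m div 2) \<and> (\<exists>w. w\<^sup>2 = p\<^sup>2 - 6 * m\<^sup>2))"
    unfolding h d[symmetric] using o by simp
  show "even (wall_term m)" unfolding e by simp
qed

lemma wall_norm_mod_8:
  fixes m :: int
  assumes "odd m"
  shows "(p\<^sup>2 - 6 * m\<^sup>2) mod 8 = 3"
proof -
  have "(p\<^sup>2 - 6 * m\<^sup>2) mod 8 = (p\<^sup>2 mod 8 - (6 * (m\<^sup>2 mod 8)) mod 8) mod 8"
    by (simp add: mod_diff_eq mod_mult_right_eq)
  then show ?thesis using assms p_odd by (simp add: square_mod_8)
qed

lemma not_square_3_mod_8: "(n::int) mod 8 = 3 \<Longrightarrow> k\<^sup>2 \<noteq> n"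
  using square_mod_8[of k] by (auto split: if_splits)

text \<open>The solutions for all odd \<open>m\<close> are collected in one set, because the
  involution that counts them acts on \<open>y\<close> and \<open>m\<close> together.\<close>

definition jackson_triples :: "(int \<times> int \<times> int) set" where
  "jackson_triples = {(x, y, m). 0 < x \<and> 0 < y \<and> 0 < m \<and> odd m \<and> x\<^sup>2 + 2 * y\<^sup>2 + 6 * m\<^sup>2 = p\<^sup>2}"

lemma finite_jackson_triples: "finite jackson_triples"
proof (rule finite_subset)
  show "jackson_triples \<subseteq> {0..p} \<times> {0..p} \<times> {0..p}"
  proof
    fix t assume "t \<in> jackson_triples"
    then obtain x y m where t: "t = (x, y, m)" and h: "0 < x" "0 < y" "0 < m" "x\<^sup>2 + 2 * y\<^sup>2 + 6 * m\<^sup>2 = p\<^sup>2"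
      by (auto simp: jackson_triples_def)
    have "0 \<le> x\<^sup>2" "0 \<le> y\<^sup>2" "0 \<le> m\<^sup>2" by auto
    then have "x\<^sup>2 \<le> p\<^sup>2" "y\<^sup>2 \<le> p\<^sup>2" "m\<^sup>2 \<le> p\<^sup>2" using h by linarith+
    then have "x \<le> p" "y \<le> p" "m \<le> p" using p_pos by (meson less_imp_le power2_le_imp_le)+
    then show "t \<in> {0..p} \<times> {0..p} \<times> {0..p}" using t h by auto
  qed
qed auto

lemma jackson_triples_odd:
  assumes "(x, y, m) \<in> jackson_triples"
  shows "odd x" "odd y"
proof -
  have h: "odd m" "x\<^sup>2 + 2 * y\<^sup>2 = p\<^sup>2 - 6 * m\<^sup>2" using assms by (auto simp: jackson_triples_def)
  have e: "(x\<^sup>2 + 2 * y\<^sup>2) mod 8 = 3" using h wall_norm_mod_8 by simp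
  have "odd (x\<^sup>2 + 2 * y\<^sup>2)" by (rule odd_if_mod_8[OF e])
  then show ox: "odd x" by simp
  show "odd y"
  proof
    assume "even y"
    then have "y\<^sup>2 mod 8 = 0 \<or> y\<^sup>2 mod 8 = 4" using square_mod_8[of y] by auto
    moreover have "x\<^sup>2 mod 8 = 1" using square_mod_8[of x] ox by simp
    ultimately show False using e mod_8_combination[of 1 x 2 y] by auto
  qed
qed

text \<open>Since \<open>2y^2 + 6m^2 = 2 (y^2 + 3m^2)\<close>, the map \<open>eis\<close> acts on
  \<open>(y, m)\<close>, with fixed points \<open>y = m\<close> or \<open>y = 3m\<close>. The case
  \<open>y = 3m\<close> would represent \<open>p\<close> by a form of discriminant -24 with odd
  variables. For \<open>y = m\<close> the equation \<open>x^2 + 8m^2 = p^2\<close> comes from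
  \<open>p = i^2 + 2j^2\<close>, and \<open>jackson_parity\<close> for \<open>n = p\<close> counts
  these: a prime has the single small divisor 1.\<close>

lemma odd_card_jackson_triples:
  assumes p24: "p mod 24 = 11"
  shows "odd (card jackson_triples)"
proof -
  let ?f = "\<lambda>(x::int, t::int \<times> int). (x, eis t)"
  have odd_xy: "odd x \<and> odd y" if "(x, y, m) \<in> jackson_triples" for x y m using jackson_triples_odd that by blast
  have inv: "?f t \<in> jackson_triples \<and> ?f (?f t) = t \<and> (?f t = t \<longleftrightarrow> fst (snd t) = snd (snd t) \<or> fst (snd t) = 3 * snd (snd t))"
    if t: "t \<in> jackson_triples" for t
  proof -
    obtain x y m where xym: "t = (x, y, m)" by (cases t)
    obtain y' m' where e: "eis (y, m) = (y', m')" by (cases "eis (y, m)")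
    have tj: "(x, y, m) \<in> jackson_triples" using t xym by simp
    have h: "0 < x" "0 < y" "0 < m" "odd m" "x\<^sup>2 + 2 * y\<^sup>2 + 6 * m\<^sup>2 = p\<^sup>2"
      using tj unfolding jackson_triples_def by simp_all
    have oy: "odd y" using odd_xy[OF tj] by simp
    note ei = eis_involution[OF h(2,3) oy h(4) refl e]
    have "x\<^sup>2 + 2 * y'\<^sup>2 + 6 * m'\<^sup>2 = p\<^sup>2" using ei(5) h(5) by linarith
    then have "(x, y', m') \<in> jackson_triples" using ei(2,1,4) h(1) by (auto simp: jackson_triples_def)
    then show ?thesis using ei(6,7) e xym by auto
  qed
  have "even (card jackson_triples) \<longleftrightarrow> even (card {t \<in> jackson_triples. ?f t = t})"
    by (rule card_involution_fixpoints[OF finite_jackson_triples]) (use inv in blast)+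
  also have "{t \<in> jackson_triples. ?f t = t} = {(x, y, m) \<in> jackson_triples. y = m \<or> y = 3 * m}"
    using inv by auto
  also have "\<dots> = (\<lambda>(i, j). (\<bar>i\<^sup>2 - 2 * j\<^sup>2\<bar>, i * j, i * j)) ` {(i, j). 0 < i \<and> 0 < j \<and> i\<^sup>2 + 2 * j\<^sup>2 = p}"
    (is "?L = ?g ` ?R")
  proof (intro equalityI subsetI)
    fix t assume "t \<in> ?L"
    then obtain x y m where t: "t = (x, y, m)" and tj: "(x, y, m) \<in> jackson_triples" and ym: "y = m \<or> y = 3 * m" by auto
    have h: "0 < x" "0 < m" "odd m" "x\<^sup>2 + 2 * y\<^sup>2 + 6 * m\<^sup>2 = p\<^sup>2" "odd x"
      using tj odd_xy[OF tj] unfolding jackson_triples_def by simp_all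
    have "0 < m\<^sup>2" "0 \<le> y\<^sup>2" using h by auto
    then have "x\<^sup>2 < p\<^sup>2" using h by linarith
    then have xp: "x < p" using p_pos by (meson less_imp_le power2_less_imp_less)
    obtain s u where su: "0 < s" "0 < u" "coprime s u" "s + u = p" "u - s = x" "4 * (s * u) = p\<^sup>2 - x\<^sup>2"
      using coprime_halves[OF p_prime p_odd h(5,1) xp] by metis
    show "t \<in> ?g ` ?R"
    proof (cases "y = m")
      case True
      then have "s * u = 2 * m\<^sup>2" using su h by simp
      then obtain i j where ij: "0 < i" "0 < j" "i * j = m" "s = i\<^sup>2 \<and> u = 2 * j\<^sup>2 \<or> s = 2 * j\<^sup>2 \<and> u = i\<^sup>2"
        using coprime_mult_two_square[of s u m] su h by auto
      then have "i\<^sup>2 + 2 * j\<^sup>2 = p" "\<bar>i\<^sup>2 - 2 * j\<^sup>2\<bar> = x" using su h by auto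
      then show ?thesis using ij t True by force
    next
      case False
      then have "y = 3 * m" using ym by simp
      then have "s * u = 6 * m\<^sup>2" using su h by (simp add: power_mult_distrib)
      then obtain i j where ij: "0 < i" "0 < j" "i * j = m" "p = i\<^sup>2 + 6 * j\<^sup>2 \<or> p = 2 * i\<^sup>2 + 3 * j\<^sup>2"
        using coprime_mult_six_square[of s u m] su h by auto
      have "odd i" "odd j" using h(3) ij(3) by auto
      then have False using not_represented_11_mod_24[OF p24] ij(4) by blast
      then show ?thesis ..
    qed
  next
    fix t assume "t \<in> ?g ` ?R"
    then obtain i j where t: "t = (\<bar>i\<^sup>2 - 2 * j\<^sup>2\<bar>, i * j, i * j)" and h: "0 < i" "0 < j" "i\<^sup>2 + 2 * j\<^sup>2 = p" by auto
    have oi: "odd i" using h(3) p_odd by (metis even_add even_mult_iff even_numeral even_power zero_less_numeral)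
    have p8: "p mod 8 = 3" using mod_24[OF p24] by auto
    have oj: "odd j"
    proof
      assume "even j"
      then have "j\<^sup>2 mod 8 = 0 \<or> j\<^sup>2 mod 8 = 4" using square_mod_8[of j] by auto
      moreover have "i\<^sup>2 mod 8 = 1" using square_mod_8[of i] oi by simp
      ultimately show False using p8 h(3) mod_8_combination[of 1 i 2 j] by auto
    qed
    have "i\<^sup>2 \<noteq> 2 * j\<^sup>2" using oi by (metis even_mult_iff even_numeral even_power zero_less_numeral)
    then have "0 < \<bar>i\<^sup>2 - 2 * j\<^sup>2\<bar>" by simp
    moreover have "\<bar>i\<^sup>2 - 2 * j\<^sup>2\<bar>\<^sup>2 + 2 * (i * j)\<^sup>2 + 6 * (i * j)\<^sup>2 = p\<^sup>2"
      unfolding power2_abs h(3)[symmetric] by (simp add: power2_eq_square algebra_simps)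
    ultimately show "t \<in> ?L" using t h oi oj by (auto simp: jackson_triples_def)
  qed
  also have "card (?g ` ?R) = card ?R"
  proof (rule card_image, rule inj_onI, clarify)
    fix i j i' j' :: int
    assume h: "0 < i" "0 < j" "p = i\<^sup>2 + 2 * j\<^sup>2" "0 < i'" "0 < j'" "i'\<^sup>2 + 2 * j'\<^sup>2 = i\<^sup>2 + 2 * j\<^sup>2"
      and e: "\<bar>i\<^sup>2 - 2 * j\<^sup>2\<bar> = \<bar>i'\<^sup>2 - 2 * j'\<^sup>2\<bar>"
    have "odd (i\<^sup>2)" using h(3) p_odd by simp
    then have "i\<^sup>2 \<noteq> 2 * j'\<^sup>2" by (metis even_mult_iff even_numeral)
    then have "i\<^sup>2 = i'\<^sup>2" using e h(6) by linarith
    then show "i = i' \<and> j = j'" using h by (auto simp: power2_eq_iff)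
  qed
  also have "even (card ?R) \<longleftrightarrow> even (card (small_divisors p))"
    by (rule jackson_parity) (use mod_24[OF p24] in auto)
  also have "small_divisors p = {1}"
  proof (intro equalityI subsetI)
    fix d assume "d \<in> small_divisors p"
    then have d: "0 < d" "d dvd p" "d * d < p" by auto
    then have "d = 1 \<or> d = p" using p_prime by (simp add: prime_int_iff)
    moreover have "p * p \<ge> p" using p_pos by (simp add: mult_le_cancel_left1)
    ultimately show "d \<in> {1}" using d by auto
  next
    fix d :: int assume "d \<in> {1}"
    then show "d \<in> small_divisors p" using p_prime prime_gt_1_int by auto
  qed
  finally show ?thesis by simp
qed

text \<open>Over positive \<open>m\<close>, the even terms add up to a multiple of 4 and the odd
  terms to 2 modulo 4.\<close>

lemma wall_sum_11:
  assumes p24: "p mod 24 = 11" and chi6: "chi (-6) = 1"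
  shows "wall_sum 1 \<noteq> 0"
proof -
  let ?M = "{m. 0 < m \<and> 6 * m\<^sup>2 < p\<^sup>2}"
  let ?E = "{m. 0 < m \<and> 6 * m\<^sup>2 < p\<^sup>2 \<and> even m}" and ?O = "{m. 0 < m \<and> 6 * m\<^sup>2 < p\<^sup>2 \<and> odd m}"
  have fin: "finite ?E" "finite ?O" by (rule finite_subset[OF _ finite_wall_range], force)+
  have un: "?M = ?E \<union> ?O" by auto
  have split: "sum wall_term ?M = sum wall_term ?E + sum wall_term ?O"
    unfolding un by (rule sum.union_disjoint[OF fin]) auto
  \<comment> \<open>An even term not divisible by 4 needs odd \<open>m/2\<close> and a square norm,
    which would represent \<open>p\<close> with odd \<open>i\<close> and \<open>j\<close>.\<close>
  have E4: "4 dvd sum wall_term ?E"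
  proof (rule dvd_sum)
    fix m assume m: "m \<in> ?E"
    have "\<not> (odd (m div 2) \<and> (\<exists>w. w\<^sup>2 = p\<^sup>2 - 6 * m\<^sup>2))"
    proof
      assume "odd (m div 2) \<and> (\<exists>w. w\<^sup>2 = p\<^sup>2 - 6 * m\<^sup>2)"
      then obtain w where o: "odd (m div 2)" and w: "w\<^sup>2 = p\<^sup>2 - 6 * m\<^sup>2" by blast
      obtain i j where ij: "m = 2 * (i * j)" "p = i\<^sup>2 + 6 * j\<^sup>2 \<or> p = 2 * i\<^sup>2 + 3 * j\<^sup>2"
        using wall_norm_square_rep[OF _ _ _ w] m by auto
      have "odd i" "odd j" using o ij by auto
      then show False using not_represented_11_mod_24[OF p24] ij(2) by blast
    qed
    then show "4 dvd wall_term m" using four_dvdI[of "wall_term m"] wall_term_even[of m] m chi6 by blast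
  qed
  \<comment> \<open>For odd \<open>m\<close> the norm is 3 modulo 8, hence not a square, and half of
    its divisor sum has the parity of the number of positive solutions of
    \<open>x^2 + 2y^2 = p^2 - 6m^2\<close>. Over all odd \<open>m\<close> these are the
    \<open>jackson_triples\<close>.\<close>
  have "\<exists>T. sum wall_term ?O = 2 * T \<and> odd T"
  proof -
    let ?h = "\<lambda>m. m * chi m * (\<Sum>d\<in>small_divisors (p\<^sup>2 - 6 * m\<^sup>2). chi d)"
    have t: "wall_term m = 2 * ?h m" if "m \<in> ?O" for m
    proof -
      have "divisor_sum (p\<^sup>2 - 6 * m\<^sup>2) = 2 * (\<Sum>d\<in>small_divisors (p\<^sup>2 - 6 * m\<^sup>2). chi d)"
        by (rule divisor_sum_nonsquare) (use that chi_wall_norm chi6 not_square_3_mod_8 wall_norm_mod_8 in auto)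
      then show ?thesis by simp
    qed
    let ?P = "\<lambda>m. {(x::int, y::int). 0 < x \<and> 0 < y \<and> x\<^sup>2 + 2 * y\<^sup>2 = p\<^sup>2 - 6 * m\<^sup>2}"
    have par: "odd (?h m) \<longleftrightarrow> odd (card (?P m))" if m: "m \<in> ?O" for m
    proof -
      have "\<not> p dvd m" "\<not> p dvd p\<^sup>2 - 6 * m\<^sup>2" 
        using wall_range_coprime[of m] chi_wall_norm[of m] chi6 m chi_zero[of "p\<^sup>2 - 6 * m\<^sup>2"] by auto
      then have "odd (?h m) \<longleftrightarrow> odd (card (small_divisors (p\<^sup>2 - 6 * m\<^sup>2)))"
        using m chi_odd[of m] sum_small_divisors_parity[of "p\<^sup>2 - 6 * m\<^sup>2"] by simp
      then show ?thesis using jackson_parity[OF wall_norm_mod_8] m by auto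
    qed
    have "odd (sum ?h ?O) \<longleftrightarrow> odd (card {m \<in> ?O. odd (?h m)})" using even_sum_iff[OF fin(2), of ?h] by blast
    also have "{m \<in> ?O. odd (?h m)} = {m \<in> ?O. odd (card (?P m))}" using par by blast
    also have "odd (card \<dots>) \<longleftrightarrow> odd (\<Sum>m\<in>?O. card (?P m))" using even_sum_iff[OF fin(2), of "\<lambda>m. card (?P m)"] by blast
    also have "(\<Sum>m\<in>?O. card (?P m)) = card (SIGMA m:?O. ?P m)"
    proof (rule card_SigmaI[symmetric, OF fin(2)], intro ballI)
      fix m assume m: "m \<in> ?O"
      have "(\<lambda>(x, y). (x, y, m)) ` ?P m \<subseteq> jackson_triples" using m by (auto simp: jackson_triples_def)
      then have "finite ((\<lambda>(x, y). (x, y, m)) ` ?P m)" using finite_jackson_triples finite_subset by blast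
      then show "finite (?P m)" by (rule finite_imageD) (auto simp: inj_on_def)
    qed
    also have "\<dots> = card jackson_triples"
    proof (rule bij_betw_same_card[of "\<lambda>(m, x, y). (x, y, m)"], rule bij_betwI[where g = "\<lambda>(x, y, m). (m, x, y)"])
      show "(\<lambda>(x, y, m). (m, x, y)) \<in> jackson_triples \<rightarrow> (SIGMA m:?O. ?P m)"
      proof
        fix t assume "t \<in> jackson_triples"
        then obtain x y m where t: "t = (x, y, m)" and h: "0 < x" "0 < y" "0 < m" "odd m" "x\<^sup>2 + 2 * y\<^sup>2 + 6 * m\<^sup>2 = p\<^sup>2"
          by (auto simp: jackson_triples_def)
        have "0 < x\<^sup>2" "0 < y\<^sup>2" using h by auto
        then have "6 * m\<^sup>2 < p\<^sup>2" "x\<^sup>2 + 2 * y\<^sup>2 = p\<^sup>2 - 6 * m\<^sup>2" using h by linarith+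
        then show "(\<lambda>(x, y, m). (m, x, y)) t \<in> (SIGMA m:?O. ?P m)" using t h by auto
      qed
    qed (auto simp: jackson_triples_def)
    finally have "odd (sum ?h ?O)" using odd_card_jackson_triples[OF p24] by simp
    moreover have "sum wall_term ?O = 2 * sum ?h ?O"
      using sum.cong[OF refl t] by (simp only: sum_distrib_left)
    ultimately show ?thesis by blast
  qed
  then obtain T where T: "sum wall_term ?O = 2 * T" "odd T" by blast
  have arith: "e + 2 * T \<noteq> 0" if "4 dvd e" for e :: int
  proof
    assume z: "e + 2 * T = 0"
    obtain k where "e = 4 * k" using \<open>4 dvd e\<close> by (elim dvdE)
    then have "T = 2 * (- k)" using z by simp
    then show False using T(2) by simp
  qed
  have "sum wall_term ?M \<noteq> 0" unfolding split T(1) by (rule arith[OF E4])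
  then show ?thesis unfolding wall_sum_pos by simp
qed

text \<open>By the vanishing of the alternating sum, \<open>wall_sum 1\<close> is 4 times the sum of
  the even terms. Half of that sum is odd, because precisely one even \<open>m\<close>, namely
  \<open>2ij\<close> for \<open>p = i^2 + 6j^2\<close>, has odd \<open>m/2\<close> and a square
  norm.\<close>

lemma wall_sum_7:
  assumes p24: "p mod 24 = 7" and chi6: "chi (-6) = 1" and s: "[s\<^sup>2 = -6] (mod p)" and z: "wall_sum (-1) = 0"
  shows "wall_sum 1 \<noteq> 0"
proof -
  let ?M = "{m. 0 < m \<and> 6 * m\<^sup>2 < p\<^sup>2}"
  let ?E = "{m. 0 < m \<and> 6 * m\<^sup>2 < p\<^sup>2 \<and> even m}" and ?O = "{m. 0 < m \<and> 6 * m\<^sup>2 < p\<^sup>2 \<and> odd m}"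
  have fin: "finite ?E" "finite ?O" by (rule finite_subset[OF _ finite_wall_range], force)+
  have un: "?M = ?E \<union> ?O" by auto
  have "sum wall_term ?M = sum wall_term ?E + sum wall_term ?O"
    unfolding un by (rule sum.union_disjoint[OF fin]) auto
  then have a: "wall_sum 1 = 2 * (sum wall_term ?E + sum wall_term ?O)" unfolding wall_sum_pos by simp
  have par: "even (nat m) \<longleftrightarrow> even m" if "0 < m" for m :: int using that by (metis int_nat_eq even_of_nat less_imp_le)
  have "(\<Sum>m\<in>?M. (-1) ^ nat m * wall_term m) = (\<Sum>m\<in>?E. (-1) ^ nat m * wall_term m) + (\<Sum>m\<in>?O. (-1) ^ nat m * wall_term m)"
    unfolding un by (rule sum.union_disjoint[OF fin]) auto
  also have "(\<Sum>m\<in>?E. (-1) ^ nat m * wall_term m) = sum wall_term ?E"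
    by (rule sum.cong) (auto simp: par)
  also have "(\<Sum>m\<in>?O. (-1) ^ nat m * wall_term m) = - sum wall_term ?O"
    unfolding sum_negf[symmetric] by (rule sum.cong) (auto simp: par)
  finally have b: "wall_sum (-1) = 2 * (sum wall_term ?E - sum wall_term ?O)" unfolding wall_sum_pos by simp
  obtain i j where ij: "0 < i" "0 < j" "p = i\<^sup>2 + 6 * j\<^sup>2" using represented_by_x2_6y2[OF p_prime p24 s] by blast
  let ?Q = "\<lambda>m. odd (m div 2) \<and> (\<exists>w. w\<^sup>2 = p\<^sup>2 - 6 * m\<^sup>2)"
  have p3: "p mod 3 = 1" "p mod 8 = 7" using mod_24[OF p24] by auto
  have "{m \<in> ?E. ?Q m} = {2 * (i * j)}"
  proof (intro equalityI subsetI)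
    fix m assume m: "m \<in> {m \<in> ?E. ?Q m}"
    then obtain w where w: "w\<^sup>2 = p\<^sup>2 - 6 * m\<^sup>2" by blast
    obtain a b where ab: "0 < a" "0 < b" "m = 2 * (a * b)" "p = a\<^sup>2 + 6 * b\<^sup>2 \<or> p = 2 * a\<^sup>2 + 3 * b\<^sup>2"
      using wall_norm_square_rep[OF _ _ _ w] m by auto
    have "p \<noteq> 2 * a\<^sup>2 + 3 * b\<^sup>2" using p3(1) x2_6y2_mod_3(2) by metis
    then have "p = a\<^sup>2 + 6 * b\<^sup>2" using ab by blast
    then have "a * b = i * j" using x2_6y2_product_unique[OF p_prime] ab ij by blast
    then show "m \<in> {2 * (i * j)}" using ab by simp
  next
    fix m assume "m \<in> {2 * (i * j)}"
    then have m: "m = 2 * (i * j)" by simp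
    have oi: "odd i" using ij(3) p_odd by (metis even_add even_mult_iff even_numeral even_power zero_less_numeral)
    have oj: "odd j"
    proof
      assume "even j"
      then have "j\<^sup>2 mod 8 = 0 \<or> j\<^sup>2 mod 8 = 4" using square_mod_8[of j] by auto
      moreover have "i\<^sup>2 mod 8 = 1" using square_mod_8[of i] oi by simp
      ultimately show False using p3(2) ij(3) mod_8_combination[of 1 i 6 j] by auto
    qed
    have e: "(i\<^sup>2 - 6 * j\<^sup>2)\<^sup>2 = p\<^sup>2 - 6 * m\<^sup>2"
      unfolding ij(3) m by (simp add: power2_eq_square algebra_simps)
    have "i\<^sup>2 - 6 * j\<^sup>2 \<noteq> 0" using oi by (metis eq_iff_diff_eq_0 even_mult_iff even_numeral even_power zero_less_numeral)
    then have "0 < (i\<^sup>2 - 6 * j\<^sup>2)\<^sup>2" by simp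
    then have "6 * m\<^sup>2 < p\<^sup>2" using e by linarith
    then show "m \<in> {m \<in> ?E. ?Q m}" using m e oi oj ij by auto
  qed
  then have c: "card {m \<in> ?E. ?Q m} = 1" by simp
  have "{m \<in> ?E. odd (wall_term m div 2)} = {m \<in> ?E. ?Q m}"
    using wall_term_even(1) chi6 by blast
  then have "odd (\<Sum>m\<in>?E. wall_term m div 2)" using even_sum_iff[OF fin(1), of "\<lambda>m. wall_term m div 2"] c by simp
  moreover have "sum wall_term ?E = 2 * (\<Sum>m\<in>?E. wall_term m div 2)"
  proof -
    have "wall_term m = 2 * (wall_term m div 2)" if "m \<in> ?E" for m
      by (rule dvd_mult_div_cancel[symmetric]) (use wall_term_even(2)[of m] chi6 that in blast)
    from sum.cong[OF refl this] show ?thesis by (simp only: sum_distrib_left)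
  qed
  ultimately have "sum wall_term ?E \<noteq> 0" by auto
  then show ?thesis using a b z by simp
qed

text \<open>Here \<open>chi (-6) = 0\<close>, so divisors cannot be paired, but the only positive
  \<open>m\<close> is 1, with norm 3 and \<open>chi 3 = 0\<close>.\<close>

lemma wall_sum_3:
  assumes "p = 3"
  shows "wall_sum 1 \<noteq> 0"
proof -
  have "{m. 0 < m \<and> 6 * m\<^sup>2 < p\<^sup>2} = {1}"
  proof (intro equalityI subsetI)
    fix m assume "m \<in> {m. 0 < m \<and> 6 * m\<^sup>2 < p\<^sup>2}"
    then have h: "0 < m" "6 * m\<^sup>2 < 9" using assms by auto
    have "\<not> 2 \<le> m"
    proof
      assume "2 \<le> m"
      then have "2\<^sup>2 \<le> m\<^sup>2" by (rule power_mono) simp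
      then show False using h by simp
    qed
    then show "m \<in> {1}" using h by simp
  qed (use assms in auto)
  moreover have "divisor_sum 3 = 1"
  proof -
    have "{d::int. 0 < d \<and> d dvd 3} = {1, 3}"
    proof (intro equalityI subsetI)
      fix d :: int assume "d \<in> {d. 0 < d \<and> d dvd 3}"
      then have "0 < d" "d dvd 3" by auto
      moreover have "prime (3::int)" by simp
      ultimately show "d \<in> {1, 3}" by (auto simp: prime_int_iff)
    qed auto
    then show ?thesis using chi_1 chi_zero[of 3] assms by (simp add: divisor_sum_def)
  qed
  ultimately show ?thesis unfolding wall_sum_pos using assms chi_1 by simp
qed

end

section \<open>Legendre and Kronecker symbols\<close>

lemma Legendre_cases: "Legendre a p \<in> {-1, 0, 1}"
  by (auto simp: Legendre_def)

lemma Legendre_eqI: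
  assumes p: "prime p" "2 < p" and c: "[Legendre a (int p) = x] (mod int p)" and x: "x \<in> {-1, 0, 1}"
  shows "Legendre a (int p) = x"
proof -
  have "int p dvd Legendre a (int p) - x" using c by (simp add: cong_iff_dvd_diff)
  moreover have "\<bar>Legendre a (int p) - x\<bar> < int p" using Legendre_cases[of a "int p"] x p(2) by auto
  ultimately show ?thesis using dvd_imp_le_int[of "Legendre a (int p) - x" "int p"] by force
qed

lemma Legendre_mult:
  assumes p: "prime p" "2 < p"
  shows "Legendre (a * b) (int p) = Legendre a (int p) * Legendre b (int p)"
proof (rule Legendre_eqI[OF p])
  have "[Legendre (a * b) (int p) = a ^ ((p - 1) div 2) * b ^ ((p - 1) div 2)] (mod int p)"
    using euler_criterion[OF p, of "a * b"] by (simp add: power_mult_distrib)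
  also have "[a ^ ((p - 1) div 2) * b ^ ((p - 1) div 2) = Legendre a (int p) * Legendre b (int p)] (mod int p)"
    by (intro cong_mult cong_sym[OF euler_criterion[OF p]])
  finally show "[Legendre (a * b) (int p) = Legendre a (int p) * Legendre b (int p)] (mod int p)" .
  show "Legendre a (int p) * Legendre b (int p) \<in> {- 1, 0, 1}"
    using Legendre_cases[of a "int p"] Legendre_cases[of b "int p"] by auto
qed

lemma Legendre_cong: "[a = b] (mod p) \<Longrightarrow> Legendre a p = Legendre b p"
  by (simp add: Legendre_def QuadRes_def cong_def)

lemma Legendre_minus_1:
  assumes p: "prime p" "2 < p"
  shows "Legendre (-1) (int p) = (-1) ^ ((p - 1) div 2)"
  by (rule Legendre_eqI[OF p euler_criterion[OF p]]) (auto simp: minus_one_power_iff)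

text \<open>Gauss's lemma: the sign counts the doubles \<open>2x\<close> with
  \<open>0 < x <= 2k + 1\<close> that exceed \<open>(p - 1)/2 = 2k + 1\<close>, which are those with
  \<open>x > k\<close>.\<close>

lemma Legendre_2:
  assumes p: "prime p" "p = 4 * k + 3"
  shows "Legendre 2 (int p) = (-1) ^ (k + 1)"
proof -
  have p2: "2 < p" using p by simp
  have n0: "[2 \<noteq> 0] (mod int p)"
    using p2 by (simp add: cong_0_iff zdvd_not_zless)
  interpret GAUSS p 2 by unfold_locales (use p p2 n0 in auto)
  have h: "(int p - 1) div 2 = 2 * int k + 1" using p(2) by simp
  have A: "A = {0<..2 * int k + 1}" unfolding A_def h ..
  have "C = (\<lambda>x. x * 2) ` A"
    unfolding C_def B_def image_image using A p(2) by (intro image_cong refl) auto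
  then have "E = (\<lambda>x. x * 2) ` {int k<..2 * int k + 1}"
    unfolding E_def h A by auto
  then have "card E = card {int k<..2 * int k + 1}"
    by (simp add: card_image inj_on_def)
  also have "\<dots> = k + 1" by simp
  finally show ?thesis using gauss_lemma by simp
qed

text \<open>As \<open>-p\<close> is 1 modulo 4, for odd \<open>q\<close> the sign of the reciprocity
  law cancels against the symbol of -1; \<open>q = 2\<close> is the supplementary law, and for
  \<open>q = p\<close> both sides vanish.\<close>

lemma kronecker_prime_eq_Legendre:
  fixes p q :: nat
  assumes p: "prime p" "p mod 4 = 3" and q: "prime q"
  shows "kronecker_prime (- int p) q = Legendre (int q) (int p)"
proof -
  define k where "k = p div 4"
  have pk: "p = 4 * k + 3" unfolding k_def using p(2) by (metis mult_div_mod_eq)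
  have p2: "2 < p" using pk by simp
  consider "q = 2" | "q = p" | "q \<noteq> 2" "q \<noteq> p" by blast
  then show ?thesis
  proof cases
    case 1
    have odd: "\<not> even (- int p)" using pk by simp
    have L: "Legendre 2 (int p) = (-1) ^ (k + 1)" by (rule Legendre_2[OF p(1) pk])
    show ?thesis
    proof (cases "even k")
      case True
      then obtain j where "k = 2 * j" by blast
      then have "- int p = 8 * (- int j - 1) + 5" using pk by simp
      then have "(- int p) mod 8 = 5" by (simp only: mod_mult_self4) simp
      then show ?thesis using 1 odd L True by (simp add: kronecker_prime_def)
    next
      case False
      then obtain j where "k = 2 * j + 1" by (elim oddE)
      then have "- int p = 8 * (- int j - 1) + 1" using pk by simp
      then have "(- int p) mod 8 = 1" by (simp only: mod_mult_self4) simp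
      then show ?thesis using 1 odd L False by (simp add: kronecker_prime_def)
    qed
  next
    case 2
    then show ?thesis using p2 by (simp add: kronecker_prime_def Legendre_def cong_0_iff)
  next
    case 3
    have q2: "2 < q" using 3 prime_ge_2_nat[OF q] by simp
    let ?e = "(-1::int) ^ ((q - 1) div 2)"
    have "Legendre (- int p) (int q) = Legendre (-1) (int q) * Legendre (int p) (int q)"
      using Legendre_mult[OF q q2, of "-1" "int p"] by simp
    also have "Legendre (-1) (int q) = ?e" by (rule Legendre_minus_1[OF q q2])
    finally have a: "Legendre (- int p) (int q) = ?e * Legendre (int p) (int q)" .
    have "Legendre (int p) (int q) * Legendre (int q) (int p) = (-1) ^ ((p - 1) div 2 * ((q - 1) div 2))"
      by (rule Quadratic_Reciprocity) (use p(1) p2 q q2 3 in auto)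
    also have "(p - 1) div 2 = 2 * k + 1" using pk by simp
    also have "(-1::int) ^ ((2 * k + 1) * ((q - 1) div 2)) = ?e"
    proof -
      have "(-1::int) ^ (2 * k + 1) = -1" by simp
      then show ?thesis by (simp only: power_mult)
    qed
    finally have b: "Legendre (int p) (int q) * Legendre (int q) (int p) = ?e" .
    have sq: "?e * ?e = 1" by (simp flip: power_add power2_eq_square add: power_mult[symmetric])
    have "Legendre (int p) (int q) * Legendre (int p) (int q) = 1"
      using b sq Legendre_cases[of "int p" "int q"] by auto
    then have "Legendre (int q) (int p) = ?e * Legendre (int p) (int q)"
      using b by (metis mult.assoc mult.commute mult.right_neutral)
    then show ?thesis using a 3 by (simp add: kronecker_prime_def)
  qed
qed

lemma Legendre_prod_power:
  assumes p: "prime p" "2 < p"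
  shows "finite A \<Longrightarrow> (\<Prod>q\<in>A. Legendre (int q) (int p) ^ e q) = Legendre (int (\<Prod>q\<in>A. q ^ e q)) (int p)"
proof (induction A rule: finite_induct)
  case empty
  have "Legendre 1 (int p) = 1"
    using p by (auto simp: Legendre_def QuadRes_def cong_0_iff zdvd1_eq intro!: exI[of _ 1])
  then show ?case by simp
next
  case (insert q A)
  have pw: "Legendre (a ^ n) (int p) = Legendre a (int p) ^ n" for a n
  proof (induction n)
    case 0
    have "Legendre 1 (int p) = 1"
      using p by (auto simp: Legendre_def QuadRes_def cong_0_iff zdvd1_eq intro!: exI[of _ 1])
    then show ?case by simp
  qed (simp add: Legendre_mult[OF p])
  have "int (\<Prod>q\<in>insert q A. q ^ e q) = int q ^ e q * int (\<Prod>q\<in>A. q ^ e q)" using insert by simp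
  then show ?case using insert by (simp only: prod.insert insert.IH Legendre_mult[OF p] pw simp_thms)
qed

lemma kronecker_eq_Legendre:
  assumes p: "prime p" "p mod 4 = 3"
  shows "kronecker (- int p) n = Legendre (int n) (int p)"
proof (cases "n = 0")
  case True
  then show ?thesis by (simp add: kronecker_def Legendre_def)
next
  case False
  have p2: "2 < p" using p(2) by (cases "p = 0 \<or> p = 1 \<or> p = 2") auto
  have "kronecker (- int p) n = (\<Prod>q\<in>prime_factors n. Legendre (int q) (int p) ^ multiplicity q n)"
  proof -
    have "kronecker_prime (- int p) q = Legendre (int q) (int p)" if "q \<in> prime_factors n" for q
      by (rule kronecker_prime_eq_Legendre[OF p]) (use that in \<open>simp add: in_prime_factors_imp_prime\<close>)
    then show ?thesis unfolding kronecker_def using False by simp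
  qed
  also have "\<dots> = Legendre (int (\<Prod>q\<in>prime_factors n. q ^ multiplicity q n)) (int p)"
    by (rule Legendre_prod_power[OF p(1) p2]) simp
  also have "(\<Prod>q\<in>prime_factors n. q ^ multiplicity q n) = n"
    using prime_factorization_nat[of n] False by simp
  finally show ?thesis .
qed

lemma odd_quadratic_character_Legendre:
  assumes p: "prime p" "p mod 4 = 3"
  shows "odd_quadratic_character (int p) (\<lambda>a. Legendre a (int p))"
proof
  have p2: "2 < p" using p(2) by (cases "p = 0 \<or> p = 1 \<or> p = 2") auto
  show "prime (int p)" using p by simp
  show "odd (int p)" using p2 p prime_odd_nat by auto
  fix a b :: int
  show "Legendre (a * b) (int p) = Legendre a (int p) * Legendre b (int p)" by (rule Legendre_mult[OF p(1) p2])
  show "(Legendre a (int p) = 0) = (int p dvd a)" by (simp add: Legendre_def cong_0_iff)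
  show "Legendre a (int p) \<in> {- 1, 0, 1}" by (rule Legendre_cases)
  show "Legendre a (int p) = Legendre b (int p)" if "[a = b] (mod int p)" using Legendre_cong that .
  have "p = 4 * (p div 4) + 3" using p(2) by (metis mult_div_mod_eq)
  then have "(p - 1) div 2 = 2 * (p div 4) + 1" by linarith
  then show "Legendre (- 1) (int p) = - 1" unfolding Legendre_minus_1[OF p(1) p2] by simp
qed

text \<open>The symbol of 3 modulo \<open>p\<close> is that of \<open>-p\<close> modulo 3, by the
  reciprocity law above at \<open>q = 3\<close>; the symbol of 2 comes from Gauss's lemma.\<close>

lemma Legendre_6_values:
  assumes p: "prime p"
  shows "p mod 24 = 11 \<Longrightarrow> Legendre (-6) (int p) = 1"
    and "p mod 24 = 7 \<Longrightarrow> Legendre (-6) (int p) = 1"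
    and "p mod 24 = 7 \<Longrightarrow> Legendre 3 (int p) = -1"
proof -
  have *: "Legendre 3 (int p) = (if p mod 24 = 11 then 1 else -1) \<and> Legendre (-6) (int p) = 1"
    if h: "p mod 24 = 11 \<or> p mod 24 = 7"
  proof -
    define j where "j = p div 24"
    have pj: "p = 24 * j + (if p mod 24 = 11 then 11 else 7)" 
    proof -
      have "p = 24 * j + p mod 24" unfolding j_def by simp
      moreover have "(if p mod 24 = 11 then 11 else 7) = p mod 24" using h by auto
      ultimately show ?thesis by simp
    qed
    have p4: "p mod 4 = 3" using h mod_mod_cancel[of 4 24 p] by auto
    have p2: "2 < p" using pj by (auto split: if_splits)
    have pr3: "prime (3::nat)" by simp
    have "Legendre 3 (int p) = Legendre (- int p) 3"
      using kronecker_prime_eq_Legendre[OF p p4 pr3] by (simp add: kronecker_prime_def)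
    also have "\<dots> = (if p mod 24 = 11 then 1 else -1)"
    proof -
      have "[Legendre (- int p) (int 3) = - int p] (mod int 3)" using euler_criterion[OF pr3, of "- int p"] by simp
      also have "[- int p = (if p mod 24 = 11 then 1 else -1)] (mod int 3)"
      proof (cases "p mod 24 = 11")
        case True
        then have e: "- int p = 3 * (- 8 * int j - 4) + 1" using pj by simp
        show ?thesis unfolding e using True by (simp add: cong_iff_dvd_diff)
      next
        case False
        then have e: "- int p = 3 * (- 8 * int j - 2) + (- 1)" using pj by simp
        show ?thesis unfolding e using False by (simp add: cong_iff_dvd_diff)
      qed
      finally have "Legendre (- int p) (int 3) = (if p mod 24 = 11 then 1 else -1)"
        using Legendre_eqI[OF pr3] by auto
      then show ?thesis by simp
    qed
    finally have 3: "Legendre 3 (int p) = (if p mod 24 = 11 then 1 else -1)" .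
    have "p = 4 * (if p mod 24 = 11 then 6 * j + 2 else 6 * j + 1) + 3" using pj by (auto split: if_splits)
    from Legendre_2[OF p this] have 2: "Legendre 2 (int p) = (if p mod 24 = 11 then -1 else 1)" by auto
    have "(p - 1) div 2 = (if p mod 24 = 11 then 2 * (6 * j + 2) + 1 else 2 * (6 * j + 1) + 1)"
      using pj by (auto split: if_splits)
    then have "Legendre (-1) (int p) = -1" unfolding Legendre_minus_1[OF p p2] by auto
    moreover have "Legendre (-6) (int p) = Legendre (-1) (int p) * (Legendre 2 (int p) * Legendre 3 (int p))"
      using Legendre_mult[OF p p2, of "-1" 6] Legendre_mult[OF p p2, of 2 3] by simp
    ultimately show ?thesis using 2 3 by auto
  qed
  show "p mod 24 = 11 \<Longrightarrow> Legendre (-6) (int p) = 1"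
    and "p mod 24 = 7 \<Longrightarrow> Legendre (-6) (int p) = 1"
    and "p mod 24 = 7 \<Longrightarrow> Legendre 3 (int p) = -1" using * by auto
qed

section \<open>Transformation of the eta function\<close>

text \<open>The sine product at the imaginary point \<open>ix\<close>, in logarithmic form.\<close>

lemma sinh_product:
  fixes x :: real
  assumes x: "x > 0"
  shows "(\<lambda>n. \<Sum>k<n. ln (1 + x\<^sup>2 / (real (Suc k))\<^sup>2)) \<longlonglongrightarrow> ln (sinh (pi * x) / (pi * x))"
proof -
  have "(\<lambda>n. of_real pi * (\<i> * x) * (\<Prod>k=1..n. 1 - (\<i> * x)^2 / of_nat k^2)) \<longlonglongrightarrow> sin (of_real pi * (\<i> * x))"
    by (rule sin_product_formula_complex)
  also have "sin (of_real pi * (\<i> * x)) = \<i> * of_real (sinh (pi * x))"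
  proof -
    have "of_real pi * (\<i> * complex_of_real x) = \<i> * complex_of_real (pi * x)" by simp
    moreover have "complex_of_real (sinh y) = (exp (of_real y) - exp (- of_real y)) / 2" for y
      by (simp add: sinh_field_def flip: exp_of_real of_real_minus)
    ultimately show ?thesis by (simp only: sin_i_times exp_minus)
  qed
  also have "(\<lambda>n. of_real pi * (\<i> * x) * (\<Prod>k=1..n. 1 - (\<i> * x)^2 / of_nat k^2)) =
      (\<lambda>n. \<i> * of_real (pi * x * (\<Prod>k=1..n. 1 + x^2 / real k^2)))"
    by (simp add: power_mult_distrib mult_ac)
  finally have "(\<lambda>n. \<i> * of_real (pi * x * (\<Prod>k=1..n. 1 + x^2 / real k^2))) \<longlonglongrightarrow> \<i> * complex_of_real (sinh (pi * x))" .
  then have "(\<lambda>n. Im (\<i> * of_real (pi * x * (\<Prod>k=1..n. 1 + x^2 / real k^2)))) \<longlonglongrightarrow> Im (\<i> * complex_of_real (sinh (pi * x)))"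
    by (rule tendsto_Im)
  then have "(\<lambda>n. pi * x * (\<Prod>k=1..n. 1 + x^2 / real k^2)) \<longlonglongrightarrow> sinh (pi * x)"
    by (simp only: Im_i_times Re_complex_of_real)
  then have "(\<lambda>n. pi * x * (\<Prod>k=1..n. 1 + x^2 / real k^2) / (pi * x)) \<longlonglongrightarrow> sinh (pi * x) / (pi * x)"
    by (intro tendsto_divide tendsto_const) (use x in auto)
  then have "(\<lambda>n. (\<Prod>k=1..n. 1 + x^2 / real k^2)) \<longlonglongrightarrow> sinh (pi * x) / (pi * x)" using x by simp
  then have "(\<lambda>n. ln (\<Prod>k=1..n. 1 + x^2 / real k^2)) \<longlonglongrightarrow> ln (sinh (pi * x) / (pi * x))"
    by (rule tendsto_ln) (use x in auto)
  also have "(\<lambda>n. ln (\<Prod>k=1..n. 1 + x^2 / real k^2)) = (\<lambda>n. \<Sum>k<n. ln (1 + x\<^sup>2 / (real (Suc k))\<^sup>2))"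
  proof
    fix n
    have "ln (\<Prod>k=1..n. 1 + x^2 / real k^2) = (\<Sum>k=1..n. ln (1 + x^2 / real k^2))"
    proof (rule ln_prod)
      show "finite {1..n}" by simp
      fix k assume "k \<in> {1..n}"
      have "0 < 1 + x\<^sup>2 / (real k)\<^sup>2" by (intro add_pos_nonneg) auto
      then show "1 + x\<^sup>2 / (real k)\<^sup>2 \<noteq> 0" by linarith
    qed
    also have "\<dots> = (\<Sum>k<n. ln (1 + x\<^sup>2 / (real (Suc k))\<^sup>2))"
      by (rule sum.reindex_bij_witness[of _ Suc "\<lambda>k. k - 1"]) auto
    finally show "ln (\<Prod>k=1..n. 1 + x^2 / real k^2) = (\<Sum>k<n. ln (1 + x\<^sup>2 / (real (Suc k))\<^sup>2))" .
  qed
  finally show ?thesis .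
qed

text \<open>The logarithmic derivative of the sinh product is the partial fraction series of
  \<open>coth\<close>. Half of it, with \<open>coth (pi x) = 1 + 2 / (exp (2 pi x) - 1)\<close>,
  gives this form, which isolates the Lambert term.\<close>

lemma coth_pfd:
  fixes x :: real
  assumes x: "x > 0"
  shows "(\<lambda>m. x / (x\<^sup>2 + (real (Suc m))\<^sup>2)) sums (pi / (exp (2 * pi * x) - 1) + pi / 2 - 1 / (2 * x))"
proof -
  define S where "S = {0<..<x + 1}"
  let ?f = "\<lambda>k y. ln (1 + y\<^sup>2 / (real (Suc k))\<^sup>2)"
  let ?f' = "\<lambda>k y. 2 * y / (y\<^sup>2 + (real (Suc k))\<^sup>2)"
  have der: "(?f k has_field_derivative ?f' k y) (at y within S)" if "y \<in> S" for k y
  proof -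
    define K where "K = (real (Suc k))\<^sup>2"
    have K: "0 < K" unfolding K_def by simp
    then have p: "0 < 1 + y\<^sup>2 / K" by (intro add_pos_nonneg) auto
    have "((\<lambda>y. 1 + y\<^sup>2 / K) has_field_derivative 2 * y / K) (at y within S)"
      using K by (auto intro!: derivative_eq_intros)
    then have d: "((\<lambda>y. ln (1 + y\<^sup>2 / K)) has_field_derivative 1 / (1 + y\<^sup>2 / K) * (2 * y / K)) (at y within S)"
      by (rule DERIV_chain2[of ln _ "\<lambda>y. 1 + y\<^sup>2 / K", OF DERIV_ln_divide[OF p]])
    have "1 + y\<^sup>2 / K = (y\<^sup>2 + K) / K" using K by (simp add: add_divide_distrib)
    then have e: "1 / (1 + y\<^sup>2 / K) * (2 * y / K) = 2 * y / (y\<^sup>2 + K)" using K by simp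
    show ?thesis using d unfolding e unfolding K_def .
  qed
  have unif: "uniformly_convergent_on S (\<lambda>n y. \<Sum>i<n. ?f' i y)"
  proof (rule Weierstrass_m_test')
    show "summable (\<lambda>k. 2 * (x + 1) * (1 / (real (Suc k))\<^sup>2))"
      using inverse_power_summable[of 2, where 'a = real] summable_Suc_iff[of "\<lambda>n. inverse (real n ^ 2)"] by (intro summable_mult) (simp add: inverse_eq_divide)
    fix n y assume "y \<in> S"
    then have y: "0 < y" "y \<le> x + 1" by (auto simp: S_def)
    have "2 * y / (y\<^sup>2 + (real (Suc n))\<^sup>2) \<le> 2 * (x + 1) / (real (Suc n))\<^sup>2"
      by (rule frac_le) (use y in auto)
    then show "norm (?f' n y) \<le> 2 * (x + 1) * (1 / (real (Suc n))\<^sup>2)" using y by simp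
  qed
  have fsums: "(\<lambda>k. ?f k y) sums ln (sinh (pi * y) / (pi * y))" if "0 < y" for y
    using sinh_product[OF that] by (simp add: sums_def)
  have "((\<lambda>y. \<Sum>k. ?f k y) has_field_derivative (\<Sum>k. ?f' k x)) (at x)"
    by (rule has_field_derivative_series'(2)[of S ?f ?f' x])
       (use der unif x fsums[OF x] in \<open>auto simp: S_def interior_open intro: sums_summable\<close>)
  moreover have "eventually (\<lambda>y. y \<in> {0<..}) (nhds x)" by (rule eventually_nhds_in_open) (use x in auto)
  then have "eventually (\<lambda>y. (\<Sum>k. ?f k y) = ln (sinh (pi * y) / (pi * y))) (nhds x)"
    by (rule eventually_mono) (use fsums sums_unique in force)
  ultimately have "((\<lambda>y. ln (sinh (pi * y) / (pi * y))) has_field_derivative (\<Sum>k. ?f' k x)) (at x)"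
    by (subst (asm) DERIV_cong_ev[OF refl _ refl]) auto
  moreover have "((\<lambda>y. ln (sinh (pi * y) / (pi * y))) has_field_derivative
     (pi * cosh (pi * x) * (pi * x) - sinh (pi * x) * pi) / (pi * x * (pi * x)) / (sinh (pi * x) / (pi * x))) (at x)"
    using x by (auto intro!: derivative_eq_intros simp: mult_ac)
  ultimately have e: "(\<Sum>k. ?f' k x) = (pi * cosh (pi * x) * (pi * x) - sinh (pi * x) * pi) / (pi * x * (pi * x)) / (sinh (pi * x) / (pi * x))"
    by (rule DERIV_unique)
  have sh: "sinh (pi * x) > 0" using x by simp
  have "(\<Sum>k. ?f' k x) = pi * cosh (pi * x) / sinh (pi * x) - 1 / x"
    unfolding e using sh x by (simp add: field_simps)
  also have "pi * cosh (pi * x) / sinh (pi * x) = 2 * pi / (exp (2 * pi * x) - 1) + pi"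
  proof -
    define u where "u = exp (pi * x)"
    have u: "u > 1" unfolding u_def using x by simp
    have eu: "exp (2 * pi * x) = u\<^sup>2" unfolding u_def by (simp add: power2_eq_square flip: exp_add)
    have "u\<^sup>2 > 1" using u by (simp add: one_less_power)
    have "cosh (pi * x) = (u + 1 / u) / 2" "sinh (pi * x) = (u - 1 / u) / 2"
      unfolding u_def cosh_def sinh_def by (simp_all add: exp_minus inverse_eq_divide)
    moreover have "(u + 1 / u) / 2 = (u\<^sup>2 + 1) / (2 * u)" "(u - 1 / u) / 2 = (u\<^sup>2 - 1) / (2 * u)"
      using u by (simp_all add: field_simps power2_eq_square)
    ultimately have "cosh (pi * x) = (u\<^sup>2 + 1) / (2 * u)" "sinh (pi * x) = (u\<^sup>2 - 1) / (2 * u)" by simp_all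
    then have "pi * cosh (pi * x) / sinh (pi * x) = pi * (u\<^sup>2 + 1) / (u\<^sup>2 - 1)"
      using u \<open>u\<^sup>2 > 1\<close> by simp
    also have "\<dots> = 2 * pi / (u\<^sup>2 - 1) + pi" using \<open>u\<^sup>2 > 1\<close> by (simp add: field_simps)
    finally show ?thesis unfolding eu .
  qed
  finally have s: "(\<Sum>k. ?f' k x) = 2 * pi / (exp (2 * pi * x) - 1) + pi - 1 / x" .
  have "(\<lambda>k. ?f' k x) sums (2 * pi / (exp (2 * pi * x) - 1) + pi - 1 / x)"
  proof -
    have "convergent (\<lambda>n. \<Sum>i<n. ?f' i x)"
      by (rule uniformly_convergent_imp_convergent[OF unif]) (use x in \<open>auto simp: S_def\<close>)
    then have "summable (\<lambda>k. ?f' k x)" by (simp add: summable_iff_convergent)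
    then show ?thesis using s by (simp add: sums_iff)
  qed
  then have "(\<lambda>k. ?f' k x / 2) sums ((2 * pi / (exp (2 * pi * x) - 1) + pi - 1 / x) / 2)" by (rule sums_divide)
  moreover have "(2 * pi / E + pi - 1 / x) / 2 = pi / E + pi / 2 - 1 / (2 * x)" "2 * x / E / 2 = x / E" for E
    by (simp_all add: add_divide_distrib diff_divide_distrib)
  ultimately show ?thesis by (simp only: )
qed

section \<open>Comparison of the partial fractions with the arctangent\<close>

lemma arctan_step:
  fixes c :: real
  assumes c: "c > 0" and ab: "0 \<le> a" "a < b"
  shows "(b - a) * (c / (c\<^sup>2 + b\<^sup>2)) \<le> arctan (b / c) - arctan (a / c)"
    and "arctan (b / c) - arctan (a / c) \<le> (b - a) * (c / (c\<^sup>2 + a\<^sup>2))"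
proof -
  have "\<exists>z>a. z < b \<and> arctan (b / c) - arctan (a / c) = (b - a) * (c / (c\<^sup>2 + z\<^sup>2))"
  proof (rule MVT2[OF ab(2)])
    fix x assume "a \<le> x" "x \<le> b"
    have "0 < c\<^sup>2 + x\<^sup>2" using c by (intro add_pos_nonneg) auto
    then have "c / (c\<^sup>2 + x\<^sup>2) = inverse (1 + (x / c)\<^sup>2) * (1 / c)" using c by (simp add: field_simps power2_eq_square)
    then show "((\<lambda>x. arctan (x / c)) has_real_derivative c / (c\<^sup>2 + x\<^sup>2)) (at x)"
      using c by (auto intro!: derivative_eq_intros simp: inverse_eq_divide)
  qed
  then obtain z where z: "a < z" "z < b" "arctan (b / c) - arctan (a / c) = (b - a) * (c / (c\<^sup>2 + z\<^sup>2))" by blast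
  have "z\<^sup>2 \<le> b\<^sup>2" "a\<^sup>2 \<le> z\<^sup>2" using z ab by (auto intro!: power_mono)
  moreover have "0 < c\<^sup>2 + a\<^sup>2" "0 < c\<^sup>2 + z\<^sup>2" using c by (auto intro!: add_pos_nonneg)
  ultimately have m: "c / (c\<^sup>2 + b\<^sup>2) \<le> c / (c\<^sup>2 + z\<^sup>2)" "c / (c\<^sup>2 + z\<^sup>2) \<le> c / (c\<^sup>2 + a\<^sup>2)"
    using c by (auto intro!: divide_left_mono mult_pos_pos add_pos_nonneg)
  have ba: "0 \<le> b - a" using ab by simp
  show "(b - a) * (c / (c\<^sup>2 + b\<^sup>2)) \<le> arctan (b / c) - arctan (a / c)"
    unfolding z(3) by (rule mult_left_mono[OF m(1) ba])
  show "arctan (b / c) - arctan (a / c) \<le> (b - a) * (c / (c\<^sup>2 + a\<^sup>2))"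
    unfolding z(3) by (rule mult_left_mono[OF m(2) ba])
qed

lemma arctan_riemann_sum:
  fixes c :: real
  assumes c: "c > 0"
  shows "(\<Sum>k<N. c / (c\<^sup>2 + (real (Suc k))\<^sup>2)) \<le> arctan (real N / c)"
    and "arctan (real N / c) - 1 / c \<le> (\<Sum>k<N. c / (c\<^sup>2 + (real (Suc k))\<^sup>2))"
proof -
  have tel: "(\<Sum>k<N. arctan (real (Suc k) / c) - arctan (real k / c)) = arctan (real N / c)"
    by (subst sum_lessThan_telescope) simp
  have "(\<Sum>k<N. c / (c\<^sup>2 + (real (Suc k))\<^sup>2)) \<le> (\<Sum>k<N. arctan (real (Suc k) / c) - arctan (real k / c))"
    by (rule sum_mono) (use arctan_step(1)[OF c, of "real k" "real (Suc k)" for k] in force)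
  then show "(\<Sum>k<N. c / (c\<^sup>2 + (real (Suc k))\<^sup>2)) \<le> arctan (real N / c)" unfolding tel .
  let ?g = "\<lambda>k. c / (c\<^sup>2 + (real k)\<^sup>2)"
  have "(\<Sum>k<N. arctan (real (Suc k) / c) - arctan (real k / c)) \<le> (\<Sum>k<N. ?g k)"
    by (rule sum_mono) (use arctan_step(2)[OF c, of "real k" "real (Suc k)" for k] in force)
  moreover have "(\<Sum>k<N. ?g k) = (\<Sum>k<N. ?g (Suc k)) + ?g 0 - ?g N"
  proof -
    have "(\<Sum>k<N. ?g (Suc k) - ?g k) = ?g N - ?g 0" by (rule sum_lessThan_telescope)
    then show ?thesis by (simp add: sum_subtractf)
  qed
  moreover have "?g 0 = 1 / c" using c by (simp add: power2_eq_square)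
  moreover have "0 \<le> ?g N" using c by simp
  ultimately show "arctan (real N / c) - 1 / c \<le> (\<Sum>k<N. c / (c\<^sup>2 + (real (Suc k))\<^sup>2))"
    unfolding tel by linarith
qed

text \<open>The summand is a decreasing derivative of \<open>arctan (x / c)\<close>, so the integral
  \<open>arctan (c / N)\<close> lies between the tail and the tail increased by the term at
  \<open>N\<close>.\<close>

lemma arctan_tail:
  fixes c :: real
  assumes c: "c > 0" and s: "(\<lambda>m. c / (c\<^sup>2 + (real (Suc m))\<^sup>2)) sums S" and N: "N > 0"
  defines "T \<equiv> S - (\<Sum>m<N. c / (c\<^sup>2 + (real (Suc m))\<^sup>2))"
  shows "\<bar>T - arctan (c / real N)\<bar> \<le> c / (real N)\<^sup>2"
proof -
  let ?g = "\<lambda>k. c / (c\<^sup>2 + (real k)\<^sup>2)"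
  have sT: "(\<lambda>m. ?g (Suc (m + N))) sums T"
    unfolding T_def using sums_split_initial_segment[OF s, of N] by simp
  let ?a = "\<lambda>m. arctan (real (m + N) / c)"
  have "(\<lambda>m. ?a (Suc m) - ?a m) sums (pi / 2 - ?a 0)"
  proof (rule telescope_sums)
    have "filterlim (\<lambda>m. real (m + N) / c) at_top sequentially" using c by real_asymp
    then show "?a \<longlonglongrightarrow> pi / 2" by (rule filterlim_compose[OF tendsto_arctan_at_top])
  qed
  moreover have "pi / 2 - ?a 0 = arctan (c / real N)"
    using arctan_inverse[of "c / real N"] c N by simp
  ultimately have sa: "(\<lambda>m. ?a (Suc m) - ?a m) sums arctan (c / real N)" by simp
  have "T \<le> arctan (c / real N)"
    by (rule sums_le[OF _ sT sa]) (use arctan_step(1)[OF c, of "real (m + N)" "real (Suc (m + N))" for m] in force)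
  moreover have "(\<lambda>m. ?g (Suc (m + N)) + (?g (m + N) - ?g (Suc (m + N)))) sums (T + (?g N - 0))"
  proof (rule sums_add[OF sT])
    have "(\<lambda>m. ?g (m + N)) \<longlonglongrightarrow> 0" using c by real_asymp
    then have "(\<lambda>m. ?g (m + N) - ?g (Suc m + N)) sums (?g (0 + N) - 0)" by (rule telescope_sums')
    then show "(\<lambda>m. ?g (m + N) - ?g (Suc (m + N))) sums (?g N - 0)" by simp
  qed
  then have "(\<lambda>m. ?g (m + N)) sums (T + ?g N)" by simp
  then have "arctan (c / real N) \<le> T + ?g N"
    by (rule sums_le[OF _ sa, rotated]) (use arctan_step(2)[OF c, of "real (m + N)" "real (Suc (m + N))" for m] in force)
  moreover have "?g N \<le> c / (real N)\<^sup>2"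
    by (rule divide_left_mono) (use c N in \<open>auto intro!: mult_pos_pos add_pos_pos\<close>)
  moreover have "0 \<le> c / (real N)\<^sup>2" using c by simp
  ultimately show ?thesis by linarith
qed

text \<open>Minus the logarithm of the Euler product at \<open>q = exp (-2 pi t)\<close>.\<close>

definition lambert :: "real \<Rightarrow> real" where
  "lambert t = (\<Sum>k. 1 / real (Suc k) * (1 / (exp (2 * pi * real (Suc k) * t) - 1)))"

lemma lambert_term_nonneg: "t > 0 \<Longrightarrow> 0 \<le> 1 / real (Suc k) * (1 / (exp (2 * pi * real (Suc k) * t) - 1))"
  by simp

text \<open>Expand each logarithm in powers of \<open>q^(n+1)\<close> and sum over \<open>n\<close>
  first; the double series has nonnegative terms, so its order can be exchanged.\<close>

lemma ln_sums_lambert: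
  assumes t: "t > 0"
  shows "summable (\<lambda>k. 1 / real (Suc k) * (1 / (exp (2 * pi * real (Suc k) * t) - 1)))"
    and "(\<lambda>n. ln (1 - exp (- 2 * pi * real (Suc n) * t))) sums (- lambert t)"
proof -
  define q where "q = exp (- 2 * pi * t)"
  have q: "0 < q" "q < 1" unfolding q_def using t by simp_all
  let ?f = "\<lambda>(k, n). q ^ (Suc n * Suc k) / real (Suc k)"
  let ?c = "\<lambda>k. 1 / real (Suc k) * (1 / (exp (2 * pi * real (Suc k) * t) - 1))"
  have qpow: "0 < q ^ Suc n" "q ^ Suc n < 1" for n
    using q power_Suc_less_one[of q n] by simp_all
  have row: "((\<lambda>k. ?f (k, n)) has_sum (- ln (1 - q ^ Suc n))) UNIV" for n
  proof -
    let ?x = "q ^ Suc n"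
    have "(\<lambda>k. - ((- (- ?x)) ^ k) / of_nat k) sums ln (1 + (- ?x))"
      by (rule ln_series') (use qpow[of n] in simp)
    then have "(\<lambda>k. - ((- (- ?x)) ^ Suc k) / of_nat (Suc k)) sums (ln (1 + (- ?x)) - 0)"
      by (subst sums_Suc_iff) simp
    then have "(\<lambda>k. - (- ((- (- ?x)) ^ Suc k) / of_nat (Suc k))) sums (- (ln (1 + (- ?x)) - 0))"
      by (rule sums_minus)
    moreover have "- (- ((- (- ?x)) ^ Suc k) / of_nat (Suc k)) = ?f (k, n)" for k
      by (simp only: power_mult minus_minus minus_divide_left case_prod_conv)
    ultimately have "(\<lambda>k. ?f (k, n)) sums (- (ln (1 + (- ?x)) - 0))" by (simp only: )
    moreover have "- (ln (1 + (- ?x)) - 0) = - ln (1 - ?x)" by simp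
    ultimately have "(\<lambda>k. ?f (k, n)) sums (- ln (1 - ?x))" by (simp only: )
    then show ?thesis by (rule sums_nonneg_imp_has_sum) (use q in auto)
  qed
  have col: "((\<lambda>n. ?f (k, n)) has_sum ?c k) UNIV" for k
  proof -
    let ?y = "q ^ Suc k"
    have "(\<lambda>n. ?y ^ n) sums (1 / (1 - ?y))" by (rule geometric_sums) (use qpow[of k] in simp)
    then have "(\<lambda>n. ?y / real (Suc k) * ?y ^ n) sums (?y / real (Suc k) * (1 / (1 - ?y)))" by (rule sums_mult)
    moreover have "?y / real (Suc k) * ?y ^ n = ?f (k, n)" for n
    proof -
      have "?y * ?y ^ n = ?y ^ Suc n" by (rule power_Suc[symmetric])
      also have "\<dots> = q ^ (Suc k * Suc n)" by (rule power_mult[symmetric])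
      finally have "?y * ?y ^ n = q ^ (Suc n * Suc k)" by (simp only: mult.commute)
      then show ?thesis by simp
    qed
    moreover have "?y / real (Suc k) * (1 / (1 - ?y)) = ?c k"
    proof -
      have "?y = exp (- (2 * pi * real (Suc k) * t))"
        unfolding q_def by (simp only: exp_of_nat_mult[symmetric]) (simp add: mult_ac)
      then have e: "exp (2 * pi * real (Suc k) * t) = 1 / ?y" by (simp add: exp_minus inverse_eq_divide)
      have "1 / ?y - 1 = (1 - ?y) / ?y" using qpow[of k] q by (simp add: diff_divide_distrib)
      then show ?thesis unfolding e using qpow[of k] q by simp
    qed
    ultimately have "(\<lambda>n. ?f (k, n)) sums ?c k" by (simp only: )
    then show ?thesis by (rule sums_nonneg_imp_has_sum) (use q in auto)
  qed
  have cnn: "0 \<le> ?c k" for k using lambert_term_nonneg[OF t] .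
  show sumc: "summable ?c"
  proof (rule summable_comparison_test')
    show "summable (\<lambda>k. q ^ k * (1 / (1 - q)))" by (intro summable_mult2 summable_geometric) (use q in simp)
    fix k :: nat assume "0 \<le> k"
    let ?y = "q ^ Suc k"
    have "?y = exp (- (2 * pi * real (Suc k) * t))"
      unfolding q_def by (simp only: exp_of_nat_mult[symmetric]) (simp add: mult_ac)
    then have e: "exp (2 * pi * real (Suc k) * t) = 1 / ?y" by (simp add: exp_minus inverse_eq_divide)
    have "1 / ?y - 1 = (1 - ?y) / ?y" using qpow[of k] q by (simp add: diff_divide_distrib)
    then have "?c k = 1 / real (Suc k) * (?y / (1 - ?y))" unfolding e by simp
    also have "\<dots> \<le> 1 * (?y / (1 - ?y))"
      by (rule mult_right_mono) (use qpow[of k] in auto)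
    also have "\<dots> \<le> q ^ k / (1 - q)"
    proof -
      have "q ^ k \<le> 1" using q by (simp add: power_le_one)
      then have "?y \<le> q" "?y \<le> q ^ k" using q by (simp_all add: mult_left_le mult_left_le_one_le)
      then have "?y / (1 - ?y) \<le> q ^ k / (1 - q)" by (intro frac_le) (use q qpow[of k] in auto)
      then show ?thesis by (simp only: mult_1)
    qed
    finally show "norm (?c k) \<le> q ^ k * (1 / (1 - q))" using cnn[of k] by simp
  qed
  have abs: "(\<lambda>x. norm (?f x)) summable_on (SIGMA k:UNIV. UNIV)"
  proof (rule iffD2[OF Infinite_Sum.abs_summable_on_Sigma_iff], intro conjI ballI)
    have nf: "norm (?f (k, n)) = ?f (k, n)" for k n using q by simp
    show "(\<lambda>n. norm (?f (k, n))) summable_on UNIV" for k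
      unfolding nf by (rule has_sum_imp_summable[OF col])
    have "infsum (\<lambda>n. norm (?f (k, n))) UNIV = ?c k" for k
      unfolding nf by (rule infsumI[OF col])
    moreover have "(\<lambda>k. norm (?c k)) summable_on UNIV"
      using summable_on_UNIV_nonneg_real_iff[of ?c] cnn sumc by (simp only: real_norm_def abs_of_nonneg)
    ultimately show "(\<lambda>k. norm (infsum (\<lambda>n. norm (?f (k, n))) UNIV)) summable_on UNIV" by (simp only: )
  qed
  then have "?f summable_on (UNIV \<times> UNIV)" by (rule abs_summable_summable)
  then obtain S where S: "(?f has_sum S) (UNIV \<times> UNIV)" by (auto simp: summable_on_def)
  have "(?c has_sum S) UNIV" by (rule has_sum_SigmaD[OF S col])
  then have lam: "lambert t = S" unfolding lambert_def by (rule sums_unique[OF has_sum_imp_sums, symmetric])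
  have "((\<lambda>(n, k). ?f (k, n)) has_sum S) (UNIV \<times> UNIV)" using S by (subst (asm) has_sum_swap)
  then have "((\<lambda>n. - ln (1 - q ^ Suc n)) has_sum S) UNIV"
    by (rule has_sum_SigmaD) (use row in simp)
  then have "(\<lambda>n. - (- ln (1 - q ^ Suc n))) sums (- S)" by (intro sums_minus has_sum_imp_sums)
  moreover have "q ^ Suc n = exp (- 2 * pi * real (Suc n) * t)" for n
    unfolding q_def by (simp only: exp_of_nat_mult[symmetric]) (simp add: mult_ac)
  ultimately show "(\<lambda>n. ln (1 - exp (- 2 * pi * real (Suc n) * t))) sums (- lambert t)"
    unfolding lam by (simp only: minus_minus)
qed

text \<open>Main term of the truncation error: the arctangent at \<open>(k+1) t / N\<close>
  approximates the tail of the \<open>coth\<close> series after \<open>N\<close> terms.\<close>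

definition arctan_sum :: "nat \<Rightarrow> real \<Rightarrow> real" where
  "arctan_sum N t = (\<Sum>k<N. arctan (real (Suc k) * t / real N) / real (Suc k))"

text \<open>The derivative in \<open>t\<close> is a pair of Riemann sums close to
  \<open>(arctan t + arctan (1/t)) / t = pi / (2t)\<close>, and the difference vanishes at
  \<open>t = 1\<close>. This is where the logarithm in the transformation law arises.\<close>

lemma arctan_sum_diff:
  assumes t: "t > 1" and N: "N > 0"
  shows "\<bar>arctan_sum N t - arctan_sum N (1 / t) - pi / 2 * ln t\<bar> \<le> (t - 1) * (2 / real N)"
proof -
  let ?e = "\<lambda>t. arctan_sum N t - arctan_sum N (1 / t) - pi / 2 * ln t"
  let ?d = "\<lambda>t. (\<Sum>k<N. real N / ((real N)\<^sup>2 + (real (Suc k) * t)\<^sup>2)) + (\<Sum>k<N. real N / ((real N * t)\<^sup>2 + (real (Suc k))\<^sup>2)) - pi / 2 * (1 / t)"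
  have der: "(?e has_real_derivative ?d x) (at x)" if "x > 0" for x
  proof -
    have t1: "((\<lambda>t. arctan (real (Suc k) * t / real N) / real (Suc k)) has_real_derivative real N / ((real N)\<^sup>2 + (real (Suc k) * x)\<^sup>2)) (at x)" for k
    proof -
      define K where "K = real (Suc k)"
      define M where "M = real N"
      have K: "K > 0" "M > 0" unfolding K_def M_def using N by auto
      have "((\<lambda>t. arctan (K * t / M) / K) has_real_derivative (inverse (1 + (K * x / M)\<^sup>2) * (K / M)) / K) (at x)"
        using K by (auto intro!: derivative_eq_intros)
      also have "(inverse (1 + (K * x / M)\<^sup>2) * (K / M)) / K = M / (M\<^sup>2 + (K * x)\<^sup>2)"
      proof -
        have "1 + (K * x / M)\<^sup>2 = (M\<^sup>2 + (K * x)\<^sup>2) / M\<^sup>2" using K by (simp add: power_divide add_divide_distrib)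
        then show ?thesis using K by (simp add: inverse_eq_divide power2_eq_square)
      qed
      finally show ?thesis unfolding K_def M_def .
    qed
    have t2: "((\<lambda>t. arctan (real (Suc k) * (1 / t) / real N) / real (Suc k)) has_real_derivative - (real N / ((real N * x)\<^sup>2 + (real (Suc k))\<^sup>2))) (at x)" for k
    proof -
      define K where "K = real (Suc k)"
      define M where "M = real N"
      have K: "K > 0" "M > 0" unfolding K_def M_def using N by auto
      have "((\<lambda>t. arctan (K * (1 / t) / M) / K) has_real_derivative (inverse (1 + (K * (1 / x) / M)\<^sup>2) * (K * (- (1 / x\<^sup>2)) / M)) / K) (at x)"
        using K that by (auto intro!: derivative_eq_intros simp: power2_eq_square)
      also have "(inverse (1 + (K * (1 / x) / M)\<^sup>2) * (K * (- (1 / x\<^sup>2)) / M)) / K = - (M / ((M * x)\<^sup>2 + K\<^sup>2))"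
      proof -
        have "1 + (K * (1 / x) / M)\<^sup>2 = ((M * x)\<^sup>2 + K\<^sup>2) / (M * x)\<^sup>2" using K that by (simp add: power_divide add_divide_distrib)
        then show ?thesis using K that by (simp add: inverse_eq_divide power2_eq_square)
      qed
      finally show ?thesis unfolding K_def M_def .
    qed
    have "(?e has_real_derivative (\<Sum>k<N. real N / ((real N)\<^sup>2 + (real (Suc k) * x)\<^sup>2)) - (\<Sum>k<N. - (real N / ((real N * x)\<^sup>2 + (real (Suc k))\<^sup>2))) - pi / 2 * (1 / x)) (at x)"
      unfolding arctan_sum_def
      by (intro DERIV_diff DERIV_sum t1 t2 DERIV_cmult DERIV_ln_divide that)
    then show ?thesis by (simp only: sum_negf diff_minus_eq_add)
  qed
  have bound: "\<bar>?d x\<bar> \<le> 2 / real N" if x: "x \<ge> 1" for x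
  proof -
    have N0: "real N > 0" using N by simp
    define a where "a = (\<Sum>k<N. real N / ((real N)\<^sup>2 + (real (Suc k) * x)\<^sup>2))"
    define b where "b = (\<Sum>k<N. real N / ((real N * x)\<^sup>2 + (real (Suc k))\<^sup>2))"
    \<comment> \<open>After multiplication by \<open>x\<close> both sums have the shape of
      \<open>arctan_riemann_sum\<close>, for \<open>c = N / x\<close> and for
      \<open>c = N x\<close>.\<close>
    have "x * a = (\<Sum>k<N. (real N / x) / ((real N / x)\<^sup>2 + (real (Suc k))\<^sup>2))"
      unfolding a_def sum_distrib_left
    proof (rule sum.cong[OF refl])
      fix k
      define K where "K = real (Suc k)"
      have "(real N / x)\<^sup>2 + K\<^sup>2 = ((real N)\<^sup>2 + (K * x)\<^sup>2) / x\<^sup>2" using x by (simp add: power_divide add_divide_distrib power_mult_distrib)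
      then have "x * (real N / ((real N)\<^sup>2 + (K * x)\<^sup>2)) = (real N / x) / ((real N / x)\<^sup>2 + K\<^sup>2)"
        using x by (simp add: power2_eq_square)
      then show "x * (real N / ((real N)\<^sup>2 + (real (Suc k) * x)\<^sup>2)) = (real N / x) / ((real N / x)\<^sup>2 + (real (Suc k))\<^sup>2)"
        unfolding K_def .
    qed
    then have A: "x * a \<le> arctan x" "arctan x - x / real N \<le> x * a"
      using arctan_riemann_sum[of "real N / x" N] N0 x by auto
    have "x * b = (\<Sum>k<N. (real N * x) / ((real N * x)\<^sup>2 + (real (Suc k))\<^sup>2))"
      unfolding b_def sum_distrib_left by (rule sum.cong[OF refl]) simp
    then have B: "x * b \<le> arctan (1 / x)" "arctan (1 / x) - 1 / (real N * x) \<le> x * b"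
      using arctan_riemann_sum[of "real N * x" N] N0 x by auto
    have at: "arctan x + arctan (1 / x) = pi / 2" using arctan_inverse[of x] x by (simp add: inverse_eq_divide)
    have "1 / (real N * x) \<le> 1 / real N" by (rule divide_left_mono) (use x N0 in auto)
    also have "\<dots> \<le> x / real N" by (rule divide_right_mono) (use x N0 in auto)
    finally have "1 / (real N * x) \<le> x / real N" .
    then have "\<bar>x * (a + b) - pi / 2\<bar> \<le> 2 * x / real N" using A B at by (simp add: distrib_left)
    moreover have "x * (a + b) - pi / 2 = x * (a + b - pi / 2 * (1 / x))" using x by (simp add: right_diff_distrib)
    ultimately have "x * \<bar>a + b - pi / 2 * (1 / x)\<bar> \<le> x * (2 / real N)" using x by (simp add: abs_mult mult.commute)
    then have "\<bar>a + b - pi / 2 * (1 / x)\<bar> \<le> 2 / real N" using x by (simp only: mult_le_cancel_left)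
    then show ?thesis unfolding a_def b_def .
  qed
  have "\<exists>z>1. z < t \<and> ?e t - ?e 1 = (t - 1) * ?d z"
    by (rule MVT2[OF t]) (use der in auto)
  then obtain z where z: "z > 1" "?e t - ?e 1 = (t - 1) * ?d z" by blast
  have "\<bar>?e t\<bar> = (t - 1) * \<bar>?d z\<bar>" using z(2) t by (simp add: abs_mult)
  also have "\<dots> \<le> (t - 1) * (2 / real N)" by (rule mult_left_mono[OF bound]) (use z t in auto)
  finally show ?thesis .
qed

definition coth_tail :: "nat \<Rightarrow> real \<Rightarrow> nat \<Rightarrow> real" where
  "coth_tail N t k = (pi / (exp (2 * pi * (real (Suc k) * t)) - 1) + pi / 2 - 1 / (2 * (real (Suc k) * t)))
     - (\<Sum>m<N. (real (Suc k) * t) / ((real (Suc k) * t)\<^sup>2 + (real (Suc m))\<^sup>2))"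

lemma coth_tail_bound:
  assumes "t > 0" "N > 0"
  shows "\<bar>coth_tail N t k - arctan (real (Suc k) * t / real N)\<bar> \<le> (real (Suc k) * t) / (real N)\<^sup>2"
  unfolding coth_tail_def
  by (rule arctan_tail[OF _ coth_pfd]) (use assms in auto)

lemma sum_coth_tail:
  assumes t: "t > 0" and N: "N > 0"
  shows "\<bar>(\<Sum>k<N. coth_tail N t k / real (Suc k)) - arctan_sum N t\<bar> \<le> t / real N"
proof -
  have "(\<Sum>k<N. coth_tail N t k / real (Suc k)) - arctan_sum N t =
     (\<Sum>k<N. (coth_tail N t k - arctan (real (Suc k) * t / real N)) / real (Suc k))"
    unfolding arctan_sum_def by (simp add: sum_subtractf diff_divide_distrib)
  also have "\<bar>\<dots>\<bar> \<le> (\<Sum>k<N. \<bar>(coth_tail N t k - arctan (real (Suc k) * t / real N)) / real (Suc k)\<bar>)" by (rule sum_abs)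
  also have "\<dots> \<le> (\<Sum>k<N. t / (real N)\<^sup>2)"
  proof (rule sum_mono)
    fix k
    have "\<bar>(coth_tail N t k - arctan (real (Suc k) * t / real N)) / real (Suc k)\<bar> =
        \<bar>coth_tail N t k - arctan (real (Suc k) * t / real N)\<bar> / real (Suc k)" by (simp only: abs_divide abs_of_nat)
    also have "\<dots> \<le> ((real (Suc k) * t) / (real N)\<^sup>2) / real (Suc k)"
      by (rule divide_right_mono[OF coth_tail_bound[OF t N]]) simp
    also have "\<dots> = t / (real N)\<^sup>2" by simp
    finally show "\<bar>(coth_tail N t k - arctan (real (Suc k) * t / real N)) / real (Suc k)\<bar> \<le> t / (real N)\<^sup>2" .
  qed
  also have "\<dots> = t / real N" using N by (simp add: power2_eq_square)
  finally show ?thesis .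
qed

text \<open>Solve the \<open>coth\<close> expansion for the Lambert term. Both indices are cut at
  the same \<open>N\<close>, so that the double sum is invariant under exchanging \<open>t\<close>
  and \<open>1/t\<close>.\<close>

lemma lambert_partial:
  assumes t: "t > 0"
  shows "(\<Sum>k<N. 1 / real (Suc k) * (1 / (exp (2 * pi * real (Suc k) * t) - 1))) =
    (1 / pi) * (\<Sum>k<N. coth_tail N t k / real (Suc k))
    + (1 / pi) * (\<Sum>k<N. \<Sum>m<N. t / ((real (Suc k) * t)\<^sup>2 + (real (Suc m))\<^sup>2))
    - (\<Sum>k<N. 1 / (2 * real (Suc k))) + (1 / (2 * pi * t)) * (\<Sum>k<N. 1 / (real (Suc k))\<^sup>2)"
proof -
  have "1 / real (Suc k) * (1 / (exp (2 * pi * real (Suc k) * t) - 1)) =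
    (1 / pi) * (coth_tail N t k / real (Suc k))
    + (1 / pi) * (\<Sum>m<N. t / ((real (Suc k) * t)\<^sup>2 + (real (Suc m))\<^sup>2))
    - 1 / (2 * real (Suc k)) + (1 / (2 * pi * t)) * (1 / (real (Suc k))\<^sup>2)" for k
  proof -
    define K where "K = real (Suc k)"
    have K: "K > 0" unfolding K_def by simp
    define e where "e = exp (2 * pi * (K * t)) - 1"
    have e: "e > 0" unfolding e_def using K t by simp
    define T where "T = coth_tail N t k"
    have s: "(\<Sum>m<N. (K * t) / ((K * t)\<^sup>2 + (real (Suc m))\<^sup>2)) = K * (\<Sum>m<N. t / ((K * t)\<^sup>2 + (real (Suc m))\<^sup>2))"
      unfolding sum_distrib_left by (rule sum.cong) auto
    define U where "U = (\<Sum>m<N. t / ((K * t)\<^sup>2 + (real (Suc m))\<^sup>2))"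
    have "T = (pi / e + pi / 2 - 1 / (2 * (K * t))) - K * U"
      unfolding T_def coth_tail_def K_def[symmetric] s U_def e_def ..
    then have "pi / e = T - pi / 2 + 1 / (2 * (K * t)) + K * U" by simp
    then have "1 / K * (1 / e) = (T - pi / 2 + 1 / (2 * (K * t)) + K * U) / (pi * K)"
      using K by (simp add: field_simps)
    also have "\<dots> = (1 / pi) * (T / K) + (1 / pi) * U - 1 / (2 * K) + (1 / (2 * pi * t)) * (1 / K\<^sup>2)"
      using K t by (simp add: field_simps power2_eq_square)
    finally show ?thesis unfolding T_def U_def e_def K_def by (simp only: mult.assoc)
  qed
  then show ?thesis by (simp only: sum.distrib sum_subtractf sum_distrib_left)
qed

text \<open>In the difference the double sum and the harmonic sum cancel, although neither has a
  limit as \<open>N\<close> grows. The sum of inverse squares supplies the term with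
  \<open>pi / 12\<close>, and \<open>arctan_sum_diff\<close> the logarithm.\<close>

lemma lambert_transform:
  assumes t: "t > 1"
  shows "lambert t - lambert (1 / t) = pi / 12 * (1 / t - t) + ln t / 2"
proof -
  have t0: "t > 0" "1 / t > 0" using t by auto
  let ?l = "\<lambda>N t. \<Sum>k<N. 1 / real (Suc k) * (1 / (exp (2 * pi * real (Suc k) * t) - 1))"
  let ?Z = "\<lambda>N. \<Sum>k<N. 1 / (real (Suc k))\<^sup>2"
  let ?R = "\<lambda>N t. \<Sum>k<N. coth_tail N t k / real (Suc k)"
  have lim: "(\<lambda>N. ?l N t - ?l N (1 / t)) \<longlonglongrightarrow> lambert t - lambert (1 / t)"
    unfolding lambert_def
    by (intro tendsto_diff summable_LIMSEQ ln_sums_lambert(1) t0)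
  have sym: "(\<Sum>k<N. \<Sum>m<N. t / ((real (Suc k) * t)\<^sup>2 + (real (Suc m))\<^sup>2)) =
     (\<Sum>k<N. \<Sum>m<N. (1 / t) / ((real (Suc k) * (1 / t))\<^sup>2 + (real (Suc m))\<^sup>2))" for N
  proof -
    have "t / ((K * t)\<^sup>2 + M\<^sup>2) = (1 / t) / ((M * (1 / t))\<^sup>2 + K\<^sup>2)" for K M :: real
    proof -
      have "(M * (1 / t))\<^sup>2 + K\<^sup>2 = ((K * t)\<^sup>2 + M\<^sup>2) / t\<^sup>2" using t by (simp add: power_divide power_mult_distrib add_divide_distrib)
      then show ?thesis using t by (simp add: power2_eq_square)
    qed
    then have "(\<Sum>k<N. \<Sum>m<N. t / ((real (Suc k) * t)\<^sup>2 + (real (Suc m))\<^sup>2)) =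
      (\<Sum>k<N. \<Sum>m<N. (1 / t) / ((real (Suc m) * (1 / t))\<^sup>2 + (real (Suc k))\<^sup>2))" by (simp only: )
    also have "\<dots> = (\<Sum>m<N. \<Sum>k<N. (1 / t) / ((real (Suc m) * (1 / t))\<^sup>2 + (real (Suc k))\<^sup>2))" by (rule sum.swap)
    finally show ?thesis .
  qed
  have diff: "?l N t - ?l N (1 / t) = (1 / pi) * (?R N t - ?R N (1 / t)) + (1 / (2 * pi)) * (1 / t - t) * ?Z N" for N
    unfolding lambert_partial[OF t0(1)] lambert_partial[OF t0(2)] sym[of N]
    using t by (simp add: field_simps)
  have Z: "?Z \<longlonglongrightarrow> pi\<^sup>2 / 6"
    using inverse_squares_sums by (simp add: sums_def add.commute)
  have "(\<lambda>N. (?R N t - ?R N (1 / t)) - pi / 2 * ln t) \<longlonglongrightarrow> 0"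
  proof (rule Lim_null_comparison)
    show "(\<lambda>N. (t + 1 / t + 2 * (t - 1)) / real N) \<longlonglongrightarrow> 0" by real_asymp
    show "\<forall>\<^sub>F N in sequentially. norm ((?R N t - ?R N (1 / t)) - pi / 2 * ln t) \<le> (t + 1 / t + 2 * (t - 1)) / real N"
    proof (rule eventually_mono[OF eventually_gt_at_top[of 0]])
      fix N :: nat assume N: "0 < N"
      have "(t + 1 / t + 2 * (t - 1)) / real N = t / real N + (1 / t) / real N + (t - 1) * (2 / real N)"
        by (simp add: add_divide_distrib diff_divide_distrib algebra_simps)
      then show "norm ((?R N t - ?R N (1 / t)) - pi / 2 * ln t) \<le> (t + 1 / t + 2 * (t - 1)) / real N"
        using sum_coth_tail[OF t0(1) N] sum_coth_tail[OF t0(2) N] arctan_sum_diff[OF t N]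
        unfolding real_norm_def by linarith
    qed
  qed
  then have R: "(\<lambda>N. ?R N t - ?R N (1 / t)) \<longlonglongrightarrow> pi / 2 * ln t" by (simp only: LIM_zero_iff)
  have "(\<lambda>N. ?l N t - ?l N (1 / t)) \<longlonglongrightarrow> (1 / pi) * (pi / 2 * ln t) + (1 / (2 * pi)) * (1 / t - t) * (pi\<^sup>2 / 6)"
    unfolding diff by (intro tendsto_add tendsto_mult tendsto_const R Z)
  then have "lambert t - lambert (1 / t) = (1 / pi) * (pi / 2 * ln t) + (1 / (2 * pi)) * (1 / t - t) * (pi\<^sup>2 / 6)"
    by (rule LIMSEQ_unique[OF lim])
  also have "\<dots> = pi / 12 * (1 / t - t) + ln t / 2" by (simp add: power2_eq_square)
  finally show ?thesis .
qed

section \<open>The Euler product and the square of the eta function\<close>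

definition euler_prod :: "complex \<Rightarrow> complex" where
  "euler_prod q = (\<Prod>n. 1 - q ^ Suc n)"

lemma euler_prod_abs_convergent:
  assumes "norm (q::complex) < 1"
  shows "abs_convergent_prod (\<lambda>n. 1 - q ^ Suc n)"
proof (rule iffD2[OF abs_convergent_prod_conv_summable])
  from assms have "summable (\<lambda>n. norm q * norm q ^ n)" by (intro summable_mult summable_geometric) simp
  then show "summable (\<lambda>n. norm (1 - q ^ Suc n - 1))" by (simp add: norm_mult norm_power)
qed

lemma euler_prod_LIMSEQ:
  assumes "norm q < 1"
  shows "(\<lambda>n. \<Prod>k<n. 1 - q ^ Suc k) \<longlonglongrightarrow> euler_prod q"
proof -
  have "convergent_prod (\<lambda>n. 1 - q ^ Suc n)"
    by (rule abs_convergent_prod_imp_convergent_prod[OF euler_prod_abs_convergent[OF assms]])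
  then have "(\<lambda>n. \<Prod>k\<le>n. 1 - q ^ Suc k) \<longlonglongrightarrow> euler_prod q"
    unfolding euler_prod_def by (rule convergent_prod_LIMSEQ)
  then show ?thesis by (simp only: LIMSEQ_lessThan_iff_atMost)
qed

lemma euler_factor_nonzero: "norm q < 1 \<Longrightarrow> 1 - q ^ Suc n \<noteq> (0::complex)"
proof
  assume q: "norm q < 1" and "1 - q ^ Suc n = 0"
  then have "norm (q ^ Suc n) = 1" by simp
  then have "norm q ^ Suc n = 1" by (simp only: norm_power)
  moreover have "norm q ^ Suc n \<le> norm q" using q by (simp add: mult_left_le power_le_one)
  ultimately show False using q by simp
qed

lemma euler_prod_nonzero: "norm q < 1 \<Longrightarrow> euler_prod q \<noteq> 0"
  unfolding euler_prod_def
  by (rule prodinf_nonzero) (use euler_prod_abs_convergent abs_convergent_prod_imp_convergent_prod euler_factor_nonzero in auto)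

lemma euler_prod_uniform_limit:
  assumes r: "r < 1"
  shows "uniform_limit (cball 0 r) (\<lambda>n q. \<Prod>k<n. 1 - q ^ Suc k) euler_prod sequentially"
proof -
  have "uniformly_convergent_on (cball 0 r) (\<lambda>N q::complex. \<Prod>n<N. 1 - q ^ Suc n)"
  proof (rule uniformly_convergent_on_prod')
    show "uniformly_convergent_on (cball 0 r) (\<lambda>N q::complex. \<Sum>n<N. norm (1 - q ^ Suc n - 1))"
    proof (rule Weierstrass_m_test')
      show "summable (\<lambda>n. (max r 0) ^ Suc n)"
        using r by (simp add: summable_mult)
      fix n and q :: complex assume "q \<in> cball 0 r"
      then have "norm q \<le> max r 0" by simp
      then have "norm q ^ Suc n \<le> (max r 0) ^ Suc n" by (rule power_mono) simp
      then show "norm (norm (1 - q ^ Suc n - 1)) \<le> (max r 0) ^ Suc n" by (simp add: norm_mult norm_power)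
    qed
  qed (auto intro!: continuous_intros)
  then obtain l where l: "uniform_limit (cball 0 r) (\<lambda>N q::complex. \<Prod>n<N. 1 - q ^ Suc n) l sequentially"
    by (auto simp: uniformly_convergent_on_def)
  have "l q = euler_prod q" if "q \<in> cball 0 r" for q
    by (rule LIMSEQ_unique[OF tendsto_uniform_limitI[OF l that] euler_prod_LIMSEQ]) (use that r in auto)
  then show ?thesis using l by (subst uniform_limit_cong'[of _ _ _ euler_prod l]) auto
qed

lemma euler_prod_holomorphic: "euler_prod holomorphic_on ball 0 1"
proof (rule holomorphic_uniform_sequence[of _ "\<lambda>n q. \<Prod>k<n. 1 - q ^ Suc k"])
  show "open (ball (0::complex) 1)" by simp
  show "(\<lambda>q::complex. \<Prod>k<n. 1 - q ^ Suc k) holomorphic_on ball 0 1" for n by (intro holomorphic_intros)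
  fix x :: complex assume x: "x \<in> ball 0 1"
  define d where "d = (1 - norm x) / 2"
  have d: "d > 0" using x by (simp add: d_def)
  have sub: "cball x d \<subseteq> cball 0 (norm x + d)" 
  proof
    fix y assume "y \<in> cball x d"
    then have "norm (y - x) \<le> d" by (simp add: dist_norm norm_minus_commute)
    then show "y \<in> cball 0 (norm x + d)" using norm_triangle_sub[of y x] by simp
  qed
  have nx: "norm x + d < 1" using x by (simp add: d_def field_simps)
  have "uniform_limit (cball x d) (\<lambda>n q. \<Prod>k<n. 1 - q ^ Suc k) euler_prod sequentially"
    by (rule uniform_limit_on_subset[OF euler_prod_uniform_limit[OF nx] sub])
  moreover have "cball x d \<subseteq> ball 0 1" using sub nx by auto
  ultimately show "\<exists>d>0. cball x d \<subseteq> ball 0 1 \<and> uniform_limit (cball x d) (\<lambda>n q. \<Prod>k<n. 1 - q ^ Suc k) euler_prod sequentially"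
    using d by blast
qed

lemma euler_prod_of_real:
  assumes "0 < x" "x < 1" and sm: "summable (\<lambda>n. ln (1 - x ^ Suc n))"
  shows "euler_prod (of_real x) = of_real (exp (\<Sum>n. ln (1 - x ^ Suc n)))"
proof -
  have pos: "0 < 1 - x ^ Suc n" for n using power_Suc_less_one[of x n] assms by simp
  have "(\<lambda>n. \<Sum>k<n. ln (1 - x ^ Suc k)) \<longlonglongrightarrow> (\<Sum>n. ln (1 - x ^ Suc n))" by (rule summable_LIMSEQ[OF sm])
  then have "(\<lambda>n. complex_of_real (exp (\<Sum>k<n. ln (1 - x ^ Suc k)))) \<longlonglongrightarrow> of_real (exp (\<Sum>n. ln (1 - x ^ Suc n)))"
    by (intro tendsto_of_real tendsto_exp)
  moreover have "complex_of_real (exp (\<Sum>k<n. ln (1 - x ^ Suc k))) = (\<Prod>k<n. 1 - of_real x ^ Suc k)" for n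
    using pos by (simp add: exp_sum exp_ln del: power_Suc)
  ultimately have "(\<lambda>n. \<Prod>k<n. 1 - complex_of_real x ^ Suc k) \<longlonglongrightarrow> of_real (exp (\<Sum>n. ln (1 - x ^ Suc n)))" by simp
  moreover have "(\<lambda>n. \<Prod>k<n. 1 - complex_of_real x ^ Suc k) \<longlonglongrightarrow> euler_prod (of_real x)"
    by (rule euler_prod_LIMSEQ) (use assms in simp)
  ultimately show ?thesis by (simp add: LIMSEQ_unique)
qed

text \<open>The square of the Dedekind eta function.\<close>
definition eta2 :: "complex \<Rightarrow> complex" where
  "eta2 z = exp (\<i> * pi * z / 6) * (euler_prod (exp (2 * \<i> * pi * z)))\<^sup>2"

lemma norm_exp_2pi: "norm (exp (2 * \<i> * pi * z)) = exp (- 2 * pi * Im z)"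
  by (simp add: norm_exp_eq_Re)

lemma norm_q_less_1: "Im z > 0 \<Longrightarrow> norm (exp (2 * \<i> * pi * z)) < 1"
  by (simp add: norm_exp_eq_Re)

lemma eta2_holomorphic: "eta2 holomorphic_on {z. Im z > 0}"
proof -
  have "euler_prod \<circ> (\<lambda>z. exp (2 * \<i> * pi * z)) holomorphic_on {z. Im z > 0}"
    by (rule holomorphic_on_compose_gen[OF _ euler_prod_holomorphic])
       (auto intro!: holomorphic_intros simp: norm_q_less_1)
  then show ?thesis unfolding eta2_def o_def by (intro holomorphic_intros) auto
qed

lemma eta2_imag_axis:
  assumes t: "t > 0"
  shows "eta2 (\<i> * of_real t) = of_real (exp (- pi * t / 6 - 2 * lambert t))"
proof -
  define x where "x = exp (- 2 * pi * t)"
  have x: "0 < x" "x < 1" unfolding x_def using t by simp_all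
  have q: "exp (2 * \<i> * pi * (\<i> * of_real t)) = complex_of_real x"
    unfolding x_def by (simp add: exp_of_real[symmetric] mult_ac)
  have pw: "x ^ Suc n = exp (- 2 * pi * real (Suc n) * t)" for n
    unfolding x_def by (simp only: exp_of_nat_mult[symmetric]) (simp add: mult_ac)
  have s: "(\<lambda>n. ln (1 - x ^ Suc n)) sums (- lambert t)"
    unfolding pw by (rule ln_sums_lambert(2)[OF t])
  have "euler_prod (of_real x) = of_real (exp (- lambert t))"
    using euler_prod_of_real[OF x sums_summable[OF s]] sums_unique[OF s] by simp
  moreover have "exp (\<i> * pi * (\<i> * of_real t) / 6) = complex_of_real (exp (- pi * t / 6))"
    by (simp add: exp_of_real[symmetric] mult_ac)
  ultimately have "eta2 (\<i> * of_real t) = of_real (exp (- pi * t / 6) * (exp (- lambert t))\<^sup>2)"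
    unfolding eta2_def q by simp
  also have "exp (- pi * t / 6) * (exp (- lambert t))\<^sup>2 = exp (- pi * t / 6 - 2 * lambert t)"
  proof -
    have "exp (- pi * t / 6) * (exp (- lambert t))\<^sup>2 = exp (- pi * t / 6 + 2 * (- lambert t))"
      by (simp only: exp_add exp_double)
    then show ?thesis by simp
  qed
  finally show ?thesis .
qed

text \<open>\<open>lambert_transform\<close> gives the identity on the imaginary axis above
  \<open>i\<close>, a set accumulating at \<open>2i\<close>; the identity theorem extends it. For
  the square of eta the factor \<open>-i z\<close> requires no branch of a root.\<close>

lemma eta2_S:
  assumes z: "Im z > 0"
  shows "eta2 (- 1 / z) = - \<i> * z * eta2 z"
proof -
  let ?H = "{z. Im z > 0}"
  have ImS: "Im (- 1 / w) > 0" if "Im w > 0" for w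
  proof -
    have "Im (- 1 / w) = Im w / (cmod w)\<^sup>2" by (simp add: Im_divide cmod_power2)
    moreover have "w \<noteq> 0" using that by auto
    ultimately show ?thesis using that by simp
  qed
  have "eta2 (- 1 / z) - (- \<i> * z * eta2 z) = 0"
  proof (rule analytic_continuation[where f = "\<lambda>z. eta2 (- 1 / z) - (- \<i> * z * eta2 z)" and S = ?H and U = "(\<lambda>t. \<i> * of_real t) ` {1<..}" and \<xi> = "2 * \<i>"])
    have "eta2 \<circ> (\<lambda>z. - 1 / z) holomorphic_on ?H"
      by (rule holomorphic_on_compose_gen[OF _ eta2_holomorphic]) (use ImS in \<open>auto intro!: holomorphic_intros\<close>)
    then show "(\<lambda>z. eta2 (- 1 / z) - (- \<i> * z * eta2 z)) holomorphic_on ?H"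
      unfolding o_def by (intro holomorphic_intros eta2_holomorphic)
    show "open ?H" by (rule open_halfspace_Im_gt)
    show "connected ?H" using convex_halfspace_Im_gt convex_connected by blast
    show "(\<lambda>t. \<i> * of_real t) ` {1<..} \<subseteq> ?H" by auto
    show "2 * \<i> \<in> ?H" by simp
    show "z \<in> ?H" using z by simp
    show "2 * \<i> islimpt (\<lambda>t. \<i> * of_real t) ` {1<..}"
      unfolding islimpt_sequential
    proof (intro exI[of _ "\<lambda>n. \<i> * of_real (2 + 1 / real (Suc n))"] conjI allI)
      have "(\<lambda>n. \<i> * of_real (2 + 1 / real (Suc n))) \<longlonglongrightarrow> \<i> * complex_of_real (2 + 0)"
        by (intro tendsto_intros LIMSEQ_Suc lim_1_over_n)
      then show "(\<lambda>n. \<i> * of_real (2 + 1 / real (Suc n))) \<longlonglongrightarrow> 2 * \<i>" by (simp add: mult.commute)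
      fix n
      have "\<i> * complex_of_real (2 + 1 / real (Suc n)) \<noteq> 2 * \<i>"
        by (auto simp: complex_eq_iff)
      then show "\<i> * complex_of_real (2 + 1 / real (Suc n)) \<in> (\<lambda>t. \<i> * of_real t) ` {1<..} - {2 * \<i>}"
      proof (intro DiffI imageI)
        have "0 \<le> 1 / real (Suc n)" by simp
        then have "1 < 2 + 1 / real (Suc n)" by linarith
        then show "2 + 1 / real (Suc n) \<in> {1<..}" by simp
      qed simp
    qed
    fix w assume "w \<in> (\<lambda>t. \<i> * complex_of_real t) ` {1<..}"
    then obtain t where t: "t > 1" and w: "w = \<i> * of_real t" by auto
    have "- 1 / w = \<i> * of_real (1 / t)" unfolding w using t by (simp add: field_simps)
    then have "eta2 (- 1 / w) = of_real (exp (- pi * (1 / t) / 6 - 2 * lambert (1 / t)))"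
      using eta2_imag_axis[of "1 / t"] t by simp
    also have "- pi * (1 / t) / 6 - 2 * lambert (1 / t) = ln t + (- pi * t / 6 - 2 * lambert t)"
    proof -
      have "- pi * r / 6 = - pi * t / 6 - 2 * (pi / 12 * (r - t))" for r :: real by (simp add: field_simps)
      from this[of "1 / t"] show ?thesis using lambert_transform[OF t] by linarith
    qed
    also have "exp \<dots> = t * exp (- pi * t / 6 - 2 * lambert t)" using t by (simp only: exp_add exp_ln)
    also have "complex_of_real \<dots> = - \<i> * w * eta2 w"
      unfolding w using eta2_imag_axis[of t] t by simp
    finally show "eta2 (- 1 / w) - (- \<i> * w * eta2 w) = 0" by simp
  qed
  then show ?thesis by (simp only: right_minus_eq)
qed

lemma eta2_T: "eta2 (z + 1) = exp (\<i> * pi / 6) * eta2 z"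
proof -
  have "exp (2 * \<i> * pi * (z + 1)) = exp (2 * \<i> * pi * z)"
    by (simp add: distrib_left exp_add mult.commute mult.left_commute)
  then show ?thesis unfolding eta2_def
    by (simp add: distrib_left add_divide_distrib exp_add mult_ac)
qed

text \<open>Splitting off the odd factors turns this into \<open>O(q) O(-q) = O(q\<^sup>2)\<close> for \<open>O(q) = euler_prod q / euler_prod (q\<^sup>2)\<close>.\<close>
lemma euler_prod_neg:
  assumes q: "norm q < 1"
  shows "euler_prod q * euler_prod (- q) * euler_prod (q ^ 4) = euler_prod (q\<^sup>2) ^ 3"
proof -
  define od where "od = (\<lambda>n q. \<Prod>k<n. 1 - (q::complex) ^ (2 * k + 1))"
  define p where "p = (\<lambda>n q. \<Prod>k<n. 1 - (q::complex) ^ Suc k)"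
  have p2: "p (2 * n) q = od n q * p n (q\<^sup>2)" for n q
  proof (induction n)
    case (Suc n)
    have "p (2 * Suc n) q = p (2 * n) q * (1 - q ^ (2 * n + 1)) * (1 - q ^ (2 * n + 2))" by (simp add: p_def)
    moreover have "q ^ (2 * n + 2) = (q\<^sup>2) ^ Suc n" by (simp add: power_mult[symmetric] power2_eq_square[symmetric] flip: power_add)
    ultimately show ?case using Suc.IH by (simp add: p_def od_def del: power_Suc)
  qed (simp_all add: p_def od_def)
  have oo: "od n q * od n (- q) = od n (q\<^sup>2)" for n q
    unfolding od_def prod.distrib[symmetric]
  proof (rule prod.cong[OF refl])
    fix k
    have "(- q) ^ (2 * k + 1) = - (q ^ (2 * k + 1))" by simp
    moreover have "(q\<^sup>2) ^ (2 * k + 1) = q ^ (2 * k + 1) * q ^ (2 * k + 1)"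
      by (simp only: power_mult[symmetric] power_add[symmetric]) (simp add: algebra_simps)
    ultimately show "(1 - q ^ (2 * k + 1)) * (1 - (- q) ^ (2 * k + 1)) = 1 - (q\<^sup>2) ^ (2 * k + 1)"
      by (simp add: algebra_simps)
  qed
  have eq: "p (2 * n) q * p (2 * n) (- q) * p n (q ^ 4) = p (2 * n) (q\<^sup>2) * p n (q\<^sup>2) * p n (q\<^sup>2)" for n
  proof -
    have "p (2 * n) (q\<^sup>2) = od n (q\<^sup>2) * p n (q ^ 4)" using p2[of n "q\<^sup>2"] by (simp flip: power_mult)
    then show ?thesis unfolding p2[of n q] p2[of n "- q"] using oo[of n q] by (simp add: mult_ac)
  qed
  have lim: "(\<lambda>n. p n x) \<longlonglongrightarrow> euler_prod x" "(\<lambda>n. p (2 * n) x) \<longlonglongrightarrow> euler_prod x" if "norm x < 1" for x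
  proof -
    show "(\<lambda>n. p n x) \<longlonglongrightarrow> euler_prod x" unfolding p_def by (rule euler_prod_LIMSEQ[OF that])
    then show "(\<lambda>n. p (2 * n) x) \<longlonglongrightarrow> euler_prod x"
      using LIMSEQ_subseq_LIMSEQ[of "\<lambda>n. p n x" _ "\<lambda>n. 2 * n"] by (simp add: strict_mono_def comp_def)
  qed
  have n: "norm (- q) < 1" "norm (q\<^sup>2) < 1" "norm (q ^ 4) < 1"
    using q by (simp_all add: norm_power power_less_one_iff abs_square_less_1)
  have "(\<lambda>n. p (2 * n) q * p (2 * n) (- q) * p n (q ^ 4)) \<longlonglongrightarrow> euler_prod q * euler_prod (- q) * euler_prod (q ^ 4)"
    by (intro tendsto_mult lim q n)
  moreover have "(\<lambda>n. p (2 * n) (q\<^sup>2) * p n (q\<^sup>2) * p n (q\<^sup>2)) \<longlonglongrightarrow> euler_prod (q\<^sup>2) * euler_prod (q\<^sup>2) * euler_prod (q\<^sup>2)"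
    by (intro tendsto_mult lim n)
  ultimately show ?thesis unfolding eq using LIMSEQ_unique by (fastforce simp: power3_eq_cube)
qed

text \<open>Adding 1/2 to \<open>z\<close> replaces \<open>q\<close> by \<open>-q\<close>, and
  \<open>euler_prod_neg\<close> expresses the Euler product there by those at \<open>q\<close>,
  \<open>q^2\<close> and \<open>q^4\<close>.\<close>

lemma eta2_half:
  assumes z: "Im z > 0"
  shows "eta2 (z + 1 / 2) = exp (\<i> * pi / 12) * eta2 (2 * z) ^ 3 / (eta2 z * eta2 (4 * z))"
proof -
  define q where "q = exp (2 * \<i> * pi * z)"
  have q: "norm q < 1" unfolding q_def by (rule norm_q_less_1[OF z])
  have q2: "exp (2 * \<i> * pi * (2 * z)) = q\<^sup>2" "exp (2 * \<i> * pi * (4 * z)) = q ^ 4"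
    unfolding q_def by (simp_all add: exp_of_nat_mult[symmetric] mult_ac)
  have qm: "exp (2 * \<i> * pi * (z + 1 / 2)) = - q"
  proof -
    have "2 * \<i> * pi * (z + 1 / 2) = 2 * \<i> * pi * z + \<i> * pi" by (simp add: distrib_left)
    then show ?thesis unfolding q_def by (simp only: exp_add exp_pi_i') simp
  qed
  define e where "e = exp (\<i> * pi * z / 6)"
  have e: "exp (\<i> * pi * (2 * z) / 6) = e\<^sup>2" "exp (\<i> * pi * (4 * z) / 6) = e ^ 4"
    unfolding e_def by (simp_all add: exp_of_nat_mult[symmetric] mult_ac)
  have em: "exp (\<i> * pi * (z + 1 / 2) / 6) = exp (\<i> * pi / 12) * e"
    unfolding e_def by (simp add: exp_add[symmetric] distrib_left add_divide_distrib add.commute)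
  have e0: "e \<noteq> 0" unfolding e_def by simp
  have n: "euler_prod q \<noteq> 0" "euler_prod (q ^ 4) \<noteq> 0"
    using q by (auto intro!: euler_prod_nonzero simp: norm_power power_less_one_iff)
  have P: "euler_prod (- q) = euler_prod (q\<^sup>2) ^ 3 / (euler_prod q * euler_prod (q ^ 4))"
    using euler_prod_neg[OF q] n by (simp add: field_simps)
  define a b c w where "a = euler_prod q" and "b = euler_prod (q\<^sup>2)" and "c = euler_prod (q ^ 4)" and "w = exp (\<i> * complex_of_real pi / 12)"
  have "w * e * (b ^ 3 / (a * c))\<^sup>2 = w * (e\<^sup>2 * b\<^sup>2) ^ 3 / ((e * a\<^sup>2) * (e ^ 4 * c\<^sup>2))"
    using e0 n unfolding a_def[symmetric] c_def[symmetric]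
    by (simp add: field_simps power2_eq_square power3_eq_cube power4_eq_xxxx)
  then show ?thesis
    unfolding eta2_def q2 qm e em P q_def[symmetric] e_def[symmetric] a_def b_def c_def w_def .
qed

section \<open>A hyperbolic reflection group\<close>

type_synonym form = "real \<times> real \<times> real"

text \<open>The polarised discriminant: \<open>form_prod Q Q = B^2 - 4AC\<close>.\<close>

definition form_prod :: "form \<Rightarrow> form \<Rightarrow> real" where
  "form_prod = (\<lambda>(A, B, C) (A', B', C'). B * B' - 2 * A * C' - 2 * A' * C)"

text \<open>It vanishes on the geodesic of the form, and its sign tells the side. It is -1/2 times
  \<open>form_prod\<close> of \<open>Q\<close> with \<open>(1, -2 Re z, |z|^2) / Im z\<close>, the
  definite form attached to the point \<open>z\<close>, whence its invariance under
  reflections.\<close>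

definition form_at :: "form \<Rightarrow> complex \<Rightarrow> real" where
  "form_at = (\<lambda>(A, B, C) z. (A * ((Re z)\<^sup>2 + (Im z)\<^sup>2) + B * Re z + C) / Im z)"

definition form_poly :: "form \<Rightarrow> complex \<Rightarrow> complex" where
  "form_poly = (\<lambda>(A, B, C) z. of_real A * z\<^sup>2 + of_real B * z + of_real C)"

text \<open>Reflections in the four sides of the quadrilateral, in the order of the overview and in
  real coordinates.\<close>

definition "refl0 z = Complex (- Re z) (Im z)"
definition "refl1 z = Complex (Re z / (6 * ((Re z)\<^sup>2 + (Im z)\<^sup>2))) (Im z / (6 * ((Re z)\<^sup>2 + (Im z)\<^sup>2)))"
definition "refl2 z = Complex (1 / 2 + (Re z - 1 / 2) / (12 * ((Re z - 1 / 2)\<^sup>2 + (Im z)\<^sup>2)))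
  (Im z / (12 * ((Re z - 1 / 2)\<^sup>2 + (Im z)\<^sup>2)))"
definition "refl3 z = Complex (1 - Re z) (Im z)"

text \<open>The induced reflections of forms; each one changes a form by a multiple of the form of
  its mirror.\<close>

definition "form0 = (\<lambda>(A, B, C). (A, - B, C) :: form)"
definition "form1 = (\<lambda>(A, B, C). (6 * C, B, A / 6) :: form)"
definition "form2 = (\<lambda>(A, B, C). (3 * A + 6 * B + 12 * C, - 2 * A - 5 * B - 12 * C, A / 3 + B + 3 * C) :: form)"
definition "form3 = (\<lambda>(A, B, C). (A, - 2 * A - B, A + B + C) :: form)"

lemmas form_defs = form0_def form1_def form2_def form3_def
lemmas refl_defs = refl0_def refl1_def refl2_def refl3_def

lemma form_prod_refl:
  "form_prod (form0 P) (form0 Q) = form_prod P Q" "form_prod (form1 P) (form1 Q) = form_prod P Q"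
  "form_prod (form2 P) (form2 Q) = form_prod P Q" "form_prod (form3 P) (form3 Q) = form_prod P Q"
  by (cases P; cases Q; simp add: form_defs form_prod_def algebra_simps)+

lemma form_involution: "form0 (form0 Q) = Q" "form1 (form1 Q) = Q" "form2 (form2 Q) = Q" "form3 (form3 Q) = Q"
  by (cases Q; simp add: form_defs algebra_simps)+

lemma sum_squares_Im_pos: "Im z > 0 \<Longrightarrow> 0 < u\<^sup>2 + (Im z)\<^sup>2"
  by (simp add: add_nonneg_pos)

lemma Im_refl:
  assumes "Im z > 0"
  shows "Im (refl0 z) > 0" "Im (refl1 z) > 0" "Im (refl2 z) > 0" "Im (refl3 z) > 0"
proof -
  note p = sum_squares_Im_pos[OF assms]
  show "Im (refl0 z) > 0" "Im (refl3 z) > 0" using assms by (simp_all add: refl_defs)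
  show "Im (refl1 z) > 0" unfolding refl1_def complex.sel by (intro divide_pos_pos mult_pos_pos assms p) simp
  show "Im (refl2 z) > 0" unfolding refl2_def complex.sel by (intro divide_pos_pos mult_pos_pos assms p) simp
qed

lemma form_at_refl:
  assumes z: "Im z > 0"
  shows "form_at (form0 Q) (refl0 z) = form_at Q z" "form_at (form1 Q) (refl1 z) = form_at Q z"
    "form_at (form2 Q) (refl2 z) = form_at Q z" "form_at (form3 Q) (refl3 z) = form_at Q z"
proof -
  obtain A B C where Q: "Q = (A, B, C)" by (cases Q)
  define x y where "x = Re z" and "y = Im z"
  have y: "y > 0" using z by (simp add: y_def)
  show "form_at (form0 Q) (refl0 z) = form_at Q z" unfolding Q by (simp add: form_at_def form0_def refl0_def)
  show "form_at (form3 Q) (refl3 z) = form_at Q z" unfolding Q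
    by (simp add: form_at_def form3_def refl3_def power2_eq_square algebra_simps)
  define n where "n = x\<^sup>2 + y\<^sup>2"
  have n: "n > 0" unfolding n_def y_def by (rule sum_squares_Im_pos[OF z])
  have e: "(x / (6 * n))\<^sup>2 + (y / (6 * n))\<^sup>2 = 1 / (36 * n)"
  proof -
    have "(x / (6 * n))\<^sup>2 + (y / (6 * n))\<^sup>2 = n / (6 * n)\<^sup>2" unfolding n_def by (simp add: power_divide add_divide_distrib)
    also have "\<dots> = 1 / (36 * n)" using n by (simp add: power2_eq_square)
    finally show ?thesis .
  qed
  have "form_at (form1 Q) (refl1 z) = (6 * C * (1 / (36 * n)) + B * (x / (6 * n)) + A / 6) / (y / (6 * n))"
    unfolding Q form_at_def form1_def refl1_def by (simp add: x_def[symmetric] y_def[symmetric] n_def[symmetric] e)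
  also have "\<dots> = (A * n + B * x + C) / y" using n y by (simp add: field_simps)
  finally show "form_at (form1 Q) (refl1 z) = form_at Q z" unfolding Q form_at_def n_def x_def y_def by simp
  define u where "u = x - 1 / 2"
  define k where "k = u\<^sup>2 + y\<^sup>2"
  have k: "k > 0" unfolding k_def y_def by (rule sum_squares_Im_pos[OF z])
  have e2: "(1 / 2 + u / (12 * k))\<^sup>2 + (y / (12 * k))\<^sup>2 = 1 / 4 + u / (12 * k) + 1 / (144 * k)"
  proof -
    have "(1 / 2 + u / (12 * k))\<^sup>2 + (y / (12 * k))\<^sup>2 = 1 / 4 + u / (12 * k) + (u\<^sup>2 + y\<^sup>2) / (12 * k)\<^sup>2"
      by (simp add: power2_sum power_divide add_divide_distrib)
    also have "(u\<^sup>2 + y\<^sup>2) / (12 * k)\<^sup>2 = 1 / (144 * k)" unfolding k_def[symmetric] using k by (simp add: power2_eq_square)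
    finally show ?thesis .
  qed
  have "form_at (form2 Q) (refl2 z) = ((3 * A + 6 * B + 12 * C) * (1 / 4 + u / (12 * k) + 1 / (144 * k)) +
     (- 2 * A - 5 * B - 12 * C) * (1 / 2 + u / (12 * k)) + (A / 3 + B + 3 * C)) / (y / (12 * k))"
    unfolding Q form_at_def form2_def refl2_def
    by (simp add: x_def[symmetric] y_def[symmetric] u_def[symmetric] k_def[symmetric] e2)
  also have "\<dots> = (A * (k + u + 1 / 4) + B * (u + 1 / 2) + C) / y" using k y by (simp add: field_simps)
  also have "k + u + 1 / 4 = x\<^sup>2 + y\<^sup>2" unfolding k_def u_def by (simp add: power2_eq_square algebra_simps)
  also have "u + 1 / 2 = x" unfolding u_def by simp
  finally show "form_at (form2 Q) (refl2 z) = form_at Q z" unfolding Q form_at_def x_def y_def by simp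
qed

text \<open>A conjugated reflection is a Moebius map, hence holomorphic; this lets derivatives be
  used for the reflection laws.\<close>

lemma cnj_refl:
  assumes z: "Im z > 0"
  shows "cnj (refl0 z) = - z" "cnj (refl1 z) = 1 / (6 * z)" "cnj (refl2 z) = 1 / 2 + 1 / (12 * (z - 1 / 2))" "cnj (refl3 z) = 1 - z"
proof -
  have n: "(Re z)\<^sup>2 + (Im z)\<^sup>2 \<noteq> 0" "(Re z - 1 / 2)\<^sup>2 + (Im z)\<^sup>2 \<noteq> 0"
    using sum_squares_Im_pos[OF z] by (metis less_irrefl)+
  show "cnj (refl0 z) = - z" "cnj (refl3 z) = 1 - z" by (simp_all add: refl_defs complex_eq_iff)
  have inv: "1 / (of_real c * w) = Complex (Re w / (c * ((Re w)\<^sup>2 + (Im w)\<^sup>2))) (- Im w / (c * ((Re w)\<^sup>2 + (Im w)\<^sup>2)))"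
    if "(Re w)\<^sup>2 + (Im w)\<^sup>2 \<noteq> 0" "c > 0" for c :: real and w
  proof -
    define n where "n = (Re w)\<^sup>2 + (Im w)\<^sup>2"
    have n0: "n \<noteq> 0" using that(1) by (simp add: n_def)
    have ww: "cnj w * w = of_real n" unfolding n_def by (simp add: complex_mult_cnj mult.commute)
    then have w0: "w \<noteq> 0" using n0 by auto
    have "Complex (Re w / (c * n)) (- Im w / (c * n)) = cnj w / of_real (c * n)"
      by (simp add: complex_eq_iff)
    also have "\<dots> = cnj w / (of_real c * (cnj w * w))" unfolding ww by simp
    also have "\<dots> = 1 / (of_real c * w)" using w0 by simp
    finally show ?thesis unfolding n_def ..
  qed
  show "cnj (refl1 z) = 1 / (6 * z)"
    using inv[of z 6] n by (simp add: refl1_def complex_eq_iff)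
  show "cnj (refl2 z) = 1 / 2 + 1 / (12 * (z - 1 / 2))"
    using inv[of "z - 1 / 2" 12] n by (simp add: refl2_def complex_eq_iff)
qed

text \<open>Weight 4 invariance under the reflection group, with the sign \<open>eps\<close> only at
  the mirror \<open>Re z = 1/2\<close>: at the circle around 1/2 the signs of \<open>f_T\<close> and
  \<open>f_half\<close> cancel. Three iterated primitives suffice to integrate \<open>f\<close>
  against a quadratic polynomial by parts. \<open>f_neg\<close> concerns \<open>eps = 1\<close>; for
  the other sign a symmetry takes its place.\<close>

locale reflection_form =
  fixes f F1 F2 F3 :: "complex \<Rightarrow> complex" and eps K :: real
  assumes eps: "eps = 1 \<or> eps = -1"
    and F1: "Im z > 0 \<Longrightarrow> (F1 has_field_derivative f z) (at z)"
    and F2: "Im z > 0 \<Longrightarrow> (F2 has_field_derivative F1 z) (at z)"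
    and F3: "Im z > 0 \<Longrightarrow> (F3 has_field_derivative F2 z) (at z)"
    and F_bound: "Im z \<ge> 1 \<Longrightarrow> norm (F1 z) \<le> K * exp (- pi * Im z)"
      "Im z \<ge> 1 \<Longrightarrow> norm (F2 z) \<le> K * exp (- pi * Im z)"
      "Im z \<ge> 1 \<Longrightarrow> norm (F3 z) \<le> K * exp (- pi * Im z)"
    and f_cnj: "Im z > 0 \<Longrightarrow> f (- cnj z) = cnj (f z)"
    and f_T: "Im z > 0 \<Longrightarrow> f (z + 1) = of_real eps * f z"
    and f_S: "Im z > 0 \<Longrightarrow> f (- 1 / (6 * z)) = 36 * z ^ 4 * f z"
    and f_half: "Im z > 0 \<Longrightarrow> f (1 / 2 - 1 / (12 * z)) = of_real eps * (144 * z ^ 4 * f (1 / 2 + z))"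
    and f_pos: "t > 0 \<Longrightarrow> Re (f (\<i> * of_real t)) > 0"
    and f_neg: "eps = 1 \<Longrightarrow> t > 0 \<Longrightarrow> Re (f (1 / 2 + \<i> * of_real t)) \<le> 0"
begin

lemma cnj_f_refl:
  assumes z: "Im z > 0"
  shows "cnj (f (refl0 z)) = f z" "cnj (f (refl1 z)) = 36 * z ^ 4 * f z"
    "cnj (f (refl2 z)) = 144 * (z - 1 / 2) ^ 4 * f z" "cnj (f (refl3 z)) = of_real eps * f z"
proof -
  have *: "cnj (f w) = f (- cnj w)" if "Im w > 0" for w using f_cnj[OF that] by simp
  note I = Im_refl[OF z] and cr = cnj_refl[OF z]
  have ee: "complex_of_real eps * (complex_of_real eps * w) = w" for w using eps by auto
  have f_Tm: "f (w - 1) = of_real eps * f w" if "Im w > 0" for w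
    using f_T[of "w - 1"] that ee[of "f (w - 1)"] by simp
  show "cnj (f (refl0 z)) = f z" unfolding *[OF I(1)] cr by simp
  show "cnj (f (refl1 z)) = 36 * z ^ 4 * f z" unfolding *[OF I(2)] cr using f_S[OF z] by simp
  show "cnj (f (refl3 z)) = of_real eps * f z" unfolding *[OF I(4)] cr using f_Tm[OF z] by simp
  have y: "Im (z - 1 / 2) > 0" using z by simp
  have pos: "Im (1 / 2 - 1 / (12 * (z - 1 / 2))) > 0"
  proof -
    have "1 / 2 - 1 / (12 * (z - 1 / 2)) = 1 - cnj (refl2 z)" unfolding cr by simp
    then show ?thesis using I(3) by simp
  qed
  have "cnj (f (refl2 z)) = f (- (1 / 2 + 1 / (12 * (z - 1 / 2))))" unfolding *[OF I(3)] cr ..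
  also have "- (1 / 2 + 1 / (12 * (z - 1 / 2))) = (1 / 2 - 1 / (12 * (z - 1 / 2))) - 1" by simp
  also have "f \<dots> = of_real eps * f (1 / 2 - 1 / (12 * (z - 1 / 2)))" by (rule f_Tm[OF pos])
  also have "f (1 / 2 - 1 / (12 * (z - 1 / 2))) = of_real eps * (144 * (z - 1 / 2) ^ 4 * f (1 / 2 + (z - 1 / 2)))" by (rule f_half[OF y])
  also have "of_real eps * \<dots> = 144 * (z - 1 / 2) ^ 4 * f (1 / 2 + (z - 1 / 2))" by (rule ee)
  finally show "cnj (f (refl2 z)) = 144 * (z - 1 / 2) ^ 4 * f z" by simp
qed

text \<open>The primitive of \<open>2 f\<close> times the quadratic polynomial, found by parts and
  normalised to vanish at infinity.\<close>

definition period :: "form \<Rightarrow> complex \<Rightarrow> complex" where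
  "period = (\<lambda>(A, B, C) z. of_real B * (2 * z * F1 z - 2 * F2 z) + 2 * of_real C * F1 z
      + 2 * of_real A * (z\<^sup>2 * F1 z - 2 * z * F2 z + 2 * F3 z))"

definition "im_period Q z = Im (period Q z)"

lemma period_deriv:
  assumes z: "Im z > 0"
  shows "(period Q has_field_derivative 2 * f z * form_poly Q z) (at z)"
proof -
  obtain A B C where Q: "Q = (A, B, C)" by (cases Q)
  show ?thesis unfolding Q period_def form_poly_def prod.case
    by (rule derivative_eq_intros F1[OF z] F2[OF z] F3[OF z] refl | simp)+ (simp add: algebra_simps power2_eq_square)
qed

lemma im_period_linear:
  "im_period (A, B, C) z = A * im_period (1, 0, 0) z + B * im_period (0, 1, 0) z + C * im_period (0, 0, 1) z"
  unfolding im_period_def period_def prod.case by (simp add: algebra_simps)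

lemma im_period_bound:
  assumes z: "Im z \<ge> 1"
  shows "\<bar>im_period (A, B, C) z\<bar> \<le> K * exp (- pi * Im z) * (2 * \<bar>B\<bar> * (norm z + 1) + 2 * \<bar>C\<bar> + 2 * \<bar>A\<bar> * ((norm z)\<^sup>2 + 2 * norm z + 2))"
proof -
  let ?E = "K * exp (- pi * Im z)"
  note b = F_bound[OF z]
  have a: "norm (2 * z * F1 z - 2 * F2 z) \<le> 2 * norm z * ?E + 2 * ?E"
  proof -
    have "norm (2 * z * F1 z - 2 * F2 z) \<le> norm (2 * z * F1 z) + norm (2 * F2 z)" by (rule norm_triangle_ineq4)
    also have "\<dots> \<le> 2 * norm z * ?E + 2 * ?E" unfolding norm_mult by (intro add_mono mult_mono b) auto
    finally show ?thesis .
  qed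
  have c: "norm (2 * F1 z) \<le> 2 * ?E" using b(1) by (simp add: norm_mult)
  have d: "norm (z\<^sup>2 * F1 z - 2 * z * F2 z + 2 * F3 z) \<le> (norm z)\<^sup>2 * ?E + 2 * norm z * ?E + 2 * ?E"
  proof -
    have "norm (z\<^sup>2 * F1 z - 2 * z * F2 z + 2 * F3 z) \<le> norm (z\<^sup>2 * F1 z) + norm (2 * z * F2 z) + norm (2 * F3 z)"
      by (rule order.trans[OF norm_triangle_ineq add_right_mono[OF norm_triangle_ineq4]])
    also have "\<dots> \<le> (norm z)\<^sup>2 * ?E + 2 * norm z * ?E + 2 * ?E"
      unfolding norm_mult norm_power by (intro add_mono mult_mono b) auto
    finally show ?thesis .
  qed
  have "\<bar>im_period (A, B, C) z\<bar> \<le> norm (period (A, B, C) z)" unfolding im_period_def by (rule abs_Im_le_cmod)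
  also have "\<dots> \<le> norm (of_real B * (2 * z * F1 z - 2 * F2 z)) + norm (2 * of_real C * F1 z) + norm (2 * of_real A * (z\<^sup>2 * F1 z - 2 * z * F2 z + 2 * F3 z))"
    unfolding period_def prod.case by (rule order.trans[OF norm_triangle_ineq add_right_mono[OF norm_triangle_ineq]])
  also have "\<dots> = \<bar>B\<bar> * norm (2 * z * F1 z - 2 * F2 z) + \<bar>C\<bar> * norm (2 * F1 z) + 2 * \<bar>A\<bar> * norm (z\<^sup>2 * F1 z - 2 * z * F2 z + 2 * F3 z)"
    by (simp add: norm_mult)
  also have "\<dots> \<le> \<bar>B\<bar> * (2 * norm z * ?E + 2 * ?E) + \<bar>C\<bar> * (2 * ?E) + 2 * \<bar>A\<bar> * ((norm z)\<^sup>2 * ?E + 2 * norm z * ?E + 2 * ?E)"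
    by (intro add_mono mult_left_mono a c d) auto
  also have "\<dots> = ?E * (2 * \<bar>B\<bar> * (norm z + 1) + 2 * \<bar>C\<bar> + 2 * \<bar>A\<bar> * ((norm z)\<^sup>2 + 2 * norm z + 2))" by (simp add: algebra_simps)
  finally show ?thesis .
qed

lemma im_period_LIM: "((\<lambda>y. im_period Q (Complex x y)) \<longlongrightarrow> 0) at_top"
proof -
  obtain A B C where Q: "Q = (A, B, C)" by (cases Q)
  let ?g = "\<lambda>y. K * exp (- pi * y) * (2 * \<bar>B\<bar> * ((\<bar>x\<bar> + y) + 1) + 2 * \<bar>C\<bar> + 2 * \<bar>A\<bar> * ((\<bar>x\<bar> + y)\<^sup>2 + 2 * (\<bar>x\<bar> + y) + 2))"
  have K0: "0 \<le> K"
  proof -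
    have "0 \<le> K * exp (- pi * Im \<i>)" by (rule order.trans[OF norm_ge_zero F_bound(1)]) simp
    then show ?thesis by (simp add: zero_le_mult_iff)
  qed
  show ?thesis
  proof (rule Lim_null_comparison)
    show "(?g \<longlongrightarrow> 0) at_top" by real_asymp
    show "\<forall>\<^sub>F y in at_top. norm (im_period Q (Complex x y)) \<le> ?g y"
    proof (rule eventually_mono[OF eventually_ge_at_top[of 1]])
      fix y :: real assume y: "1 \<le> y"
      have n: "norm (Complex x y) \<le> \<bar>x\<bar> + y" using cmod_le[of "Complex x y"] y by simp
      then have n2: "(norm (Complex x y))\<^sup>2 \<le> (\<bar>x\<bar> + y)\<^sup>2" by (simp add: power_mono)
      have "norm (im_period Q (Complex x y)) \<le> K * exp (- pi * y) * (2 * \<bar>B\<bar> * (norm (Complex x y) + 1) + 2 * \<bar>C\<bar> + 2 * \<bar>A\<bar> * ((norm (Complex x y))\<^sup>2 + 2 * norm (Complex x y) + 2))"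
        using im_period_bound[of "Complex x y" A B C] y unfolding Q by simp
      also have "\<dots> \<le> ?g y"
        by (intro mult_left_mono add_mono n n2 order.refl) (use K0 in auto)
      finally show "norm (im_period Q (Complex x y)) \<le> ?g y" .
    qed
  qed
qed

text \<open>\<open>cnj (period Q' (R z)) + s * period Q z\<close> is holomorphic, and
  \<open>eq\<close> says that its derivative is zero. On imaginary parts the conjugation is a sign,
  which turns the constant sum into equivariance up to a constant.\<close>

lemma im_period_refl_aux:
  assumes R: "\<And>z. Im z > 0 \<Longrightarrow> Im (R z) > 0" and m: "\<And>z. Im z > 0 \<Longrightarrow> cnj (R z) = m z"
    and dm: "\<And>z. Im z > 0 \<Longrightarrow> (m has_field_derivative m' z) (at z)"
    and eq: "\<And>z. Im z > 0 \<Longrightarrow> cnj (f (R z)) * m' z * form_poly Q' (m z) = - (of_real s * f z * form_poly Q z)"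
  obtains c where "\<And>z. Im z > 0 \<Longrightarrow> im_period Q' (R z) = s * im_period Q z + c"
proof -
  let ?H = "{z. Im z > 0}"
  let ?g = "\<lambda>z. cnj (period Q' (cnj (m z))) + of_real s * period Q z"
  have cf: "cnj (form_poly Q' w) = form_poly Q' (cnj w)" for w by (cases Q') (simp add: form_poly_def)
  have "(?g has_field_derivative 0) (at z within ?H)" if z: "z \<in> ?H" for z
  proof -
    have z0: "Im z > 0" using z by simp
    have mz: "cnj (m z) = R z" using m[OF z0] by (metis complex_cnj_cnj)
    have "(period Q' has_field_derivative 2 * f (R z) * form_poly Q' (R z)) (at (cnj (m z)))"
      unfolding mz by (rule period_deriv[OF R[OF z0]])
    then have "((cnj \<circ> period Q' \<circ> cnj) has_field_derivative cnj (2 * f (R z) * form_poly Q' (R z))) (at (m z))"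
      by (rule has_field_derivative_cnj_cnj)
    then have "((\<lambda>w. (cnj \<circ> period Q' \<circ> cnj) (m w)) has_field_derivative cnj (2 * f (R z) * form_poly Q' (R z)) * m' z) (at z)"
      by (rule DERIV_chain2[OF _ dm[OF z0]])
    then have "(?g has_field_derivative cnj (2 * f (R z) * form_poly Q' (R z)) * m' z + of_real s * (2 * f z * form_poly Q z)) (at z)"
      unfolding o_def by (intro DERIV_add DERIV_cmult period_deriv[OF z0])
    also have "cnj (2 * f (R z) * form_poly Q' (R z)) * m' z = 2 * (cnj (f (R z)) * m' z * form_poly Q' (m z))"
      using m[OF z0] by (simp add: cf)
    also have "2 * (cnj (f (R z)) * m' z * form_poly Q' (m z)) + of_real s * (2 * f z * form_poly Q z) = 0"
      unfolding eq[OF z0] by simp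
    finally show ?thesis by (rule has_field_derivative_at_within)
  qed
  then obtain c where c: "\<And>z. z \<in> ?H \<Longrightarrow> ?g z = c"
    using has_field_derivative_zero_constant[OF convex_halfspace_Im_gt[of 0], of ?g] by auto
  have "im_period Q' (R z) = s * im_period Q z + (- Im c)" if z: "Im z > 0" for z
  proof -
    have "cnj (m z) = R z" using m[OF z] by (metis complex_cnj_cnj)
    then have "Im c = - im_period Q' (R z) + s * im_period Q z"
      using c[of z] z unfolding im_period_def by auto
    then show ?thesis by simp
  qed
  then show ?thesis using that by blast
qed

text \<open>Both mirrors are vertical, and \<open>im_period\<close> tends to 0 along vertical lines,
  so the constant vanishes.\<close>

lemma im_period_refl0: "Im z > 0 \<Longrightarrow> im_period (form0 Q) (refl0 z) = im_period Q z"
  and im_period_refl3: "Im z > 0 \<Longrightarrow> im_period (form3 Q) (refl3 z) = eps * im_period Q z"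
proof -
  obtain A B C where Q: "Q = (A, B, C)" by (cases Q)
  have zero: "c = 0" if c: "\<And>z. Im z > 0 \<Longrightarrow> im_period Q' (Complex (a - Re z) (Im z)) = s * im_period Q z + c" for Q' a s c
  proof -
    have "((\<lambda>y. im_period Q' (Complex a y) - s * im_period Q (Complex 0 y)) \<longlongrightarrow> 0 - s * 0) at_top"
      by (intro tendsto_intros im_period_LIM)
    moreover have "\<forall>\<^sub>F y in at_top. im_period Q' (Complex a y) - s * im_period Q (Complex 0 y) = c"
      using eventually_gt_at_top[of 0] by eventually_elim (use c[of "Complex 0 y" for y] in auto)
    ultimately have "((\<lambda>y::real. c) \<longlongrightarrow> 0) at_top" by (simp add: tendsto_cong)
    then show ?thesis by (simp add: tendsto_const_iff)
  qed
  obtain c where c: "\<And>z. Im z > 0 \<Longrightarrow> im_period (form0 Q) (refl0 z) = 1 * im_period Q z + c"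
  proof (rule im_period_refl_aux[of refl0 uminus "\<lambda>_. -1" "form0 Q" 1 Q])
    fix z assume z: "Im z > 0"
    show "cnj (f (refl0 z)) * -1 * form_poly (form0 Q) (- z) = - (of_real 1 * f z * form_poly Q z)"
      unfolding cnj_f_refl[OF z] Q by (simp add: form_poly_def form0_def)
  qed (auto simp: Im_refl cnj_refl intro!: derivative_eq_intros)
  have "c = 0" using zero[of "form0 Q" 0 1 c] c by (simp add: refl0_def)
  then show "Im z > 0 \<Longrightarrow> im_period (form0 Q) (refl0 z) = im_period Q z" using c by simp
  obtain c where c: "\<And>z. Im z > 0 \<Longrightarrow> im_period (form3 Q) (refl3 z) = eps * im_period Q z + c"
  proof (rule im_period_refl_aux[of refl3 "\<lambda>z. 1 - z" "\<lambda>_. -1" "form3 Q" eps Q])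
    fix z assume z: "Im z > 0"
    have "form_poly (form3 Q) (1 - z) = form_poly Q z"
      unfolding Q by (simp add: form_poly_def form3_def power2_eq_square algebra_simps)
    then show "cnj (f (refl3 z)) * -1 * form_poly (form3 Q) (1 - z) = - (of_real eps * f z * form_poly Q z)"
      unfolding cnj_f_refl[OF z] by simp
  qed (auto simp: Im_refl cnj_refl intro!: derivative_eq_intros)
  have "c = 0" using zero[of "form3 Q" 1 eps c] c by (simp add: refl3_def)
  then show "Im z > 0 \<Longrightarrow> im_period (form3 Q) (refl3 z) = eps * im_period Q z" using c by simp
qed

lemma im_period_refl12:
  obtains k1 k2 where
    "\<And>z. Im z > 0 \<Longrightarrow> im_period (form1 (A, B, C)) (refl1 z) = im_period (A, B, C) z + k1"
    "\<And>z. Im z > 0 \<Longrightarrow> im_period (form2 (A, B, C)) (refl2 z) = im_period (A, B, C) z + k2"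
proof -
  let ?Q = "(A, B, C)"
  obtain c where c: "\<And>z. Im z > 0 \<Longrightarrow> im_period (form1 ?Q) (refl1 z) = 1 * im_period ?Q z + c"
  proof (rule im_period_refl_aux[of refl1 "\<lambda>z. 1 / (6 * z)" "\<lambda>z. - (1 / (6 * z\<^sup>2))" "form1 ?Q" 1 ?Q])
    fix z assume z: "Im z > 0"
    then have z0: "z \<noteq> 0" by auto
    show "((\<lambda>z. 1 / (6 * z)) has_field_derivative - (1 / (6 * z\<^sup>2))) (at z)"
      using z0 by (auto intro!: derivative_eq_intros simp: power2_eq_square)
    have "form_poly (form1 ?Q) (1 / (6 * z)) = form_poly ?Q z / (6 * z\<^sup>2)"
      using z0 by (simp add: form_poly_def form1_def field_simps power2_eq_square)
    then show "cnj (f (refl1 z)) * - (1 / (6 * z\<^sup>2)) * form_poly (form1 ?Q) (1 / (6 * z)) = - (of_real 1 * f z * form_poly ?Q z)"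
      unfolding cnj_f_refl[OF z] using z0 by (simp add: power2_eq_square power4_eq_xxxx)
  qed (auto simp: Im_refl cnj_refl)
  obtain d where d: "\<And>z. Im z > 0 \<Longrightarrow> im_period (form2 ?Q) (refl2 z) = 1 * im_period ?Q z + d"
  proof (rule im_period_refl_aux[of refl2 "\<lambda>z. 1 / 2 + 1 / (12 * (z - 1 / 2))" "\<lambda>z. - (1 / (12 * (z - 1 / 2)\<^sup>2))" "form2 ?Q" 1 ?Q])
    fix z assume z: "Im z > 0"
    define w where "w = z - 1 / 2"
    have w0: "w \<noteq> 0" using z by (auto simp: w_def complex_eq_iff)
    show "((\<lambda>z. 1 / 2 + 1 / (12 * (z - 1 / 2))) has_field_derivative - (1 / (12 * (z - 1 / 2)\<^sup>2))) (at z)"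
    proof -
      have "((\<lambda>w. 1 / 2 + 1 / (12 * w)) has_field_derivative - (1 / (12 * w\<^sup>2))) (at w)"
        using w0 by (auto intro!: derivative_eq_intros simp: power2_eq_square)
      then have "((\<lambda>z. 1 / 2 + 1 / (12 * (z - 1 / 2))) has_field_derivative - (1 / (12 * w\<^sup>2)) * 1) (at z)"
        unfolding w_def by (rule DERIV_chain2) (auto intro!: derivative_eq_intros)
      then show ?thesis by (simp add: w_def)
    qed
    have zw: "z = w + 1 / 2" by (simp add: w_def)
    have "form_poly (form2 ?Q) (1 / 2 + 1 / (12 * w)) = form_poly ?Q z / (12 * w\<^sup>2)"
      unfolding zw using w0 by (simp add: form_poly_def form2_def field_simps power2_eq_square)
    then show "cnj (f (refl2 z)) * - (1 / (12 * (z - 1 / 2)\<^sup>2)) * form_poly (form2 ?Q) (1 / 2 + 1 / (12 * (z - 1 / 2))) = - (of_real 1 * f z * form_poly ?Q z)"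
      unfolding cnj_f_refl[OF z] w_def[symmetric] using w0 by (simp add: power2_eq_square power4_eq_xxxx)
  qed (auto simp: Im_refl cnj_refl)
  show ?thesis by (rule that[of c d]) (use c d in auto)
qed

end

section \<open>Walls of the reflection group\<close>

lemma nonincreasing_limit_nonneg:
  fixes g :: "real \<Rightarrow> real"
  assumes d: "\<And>y. a \<le> y \<Longrightarrow> (g has_real_derivative g' y) (at y) \<and> g' y \<le> 0" and l: "(g \<longlongrightarrow> 0) at_top"
  shows "0 \<le> g a"
proof (rule tendsto_upperbound[OF l])
  show "\<forall>\<^sub>F y in at_top. g y \<le> g a"
    using eventually_ge_at_top[of a]
  proof eventually_elim
    case (elim y)
    show ?case by (rule DERIV_nonpos_imp_nonincreasing[OF elim]) (use d in blast)
  qed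
qed simp

type_synonym wall = "int \<times> int \<times> int"

text \<open>\<open>(a, b, c)\<close> stands for \<open>6a|z|^2 + 12b Re z + c\<close>. For
  \<open>ac = 6b^2 - 1\<close> this is a semicircle with centre \<open>-b/a\<close> and radius
  \<open>1 / (a sqrt 6)\<close>; the triple \<open>(1, 0, -1)\<close> is the side
  \<open>|z|^2 = 1/6\<close>.\<close>

definition wall_form :: "wall \<Rightarrow> form" where
  "wall_form = (\<lambda>(a, b, c). (6 * of_int a, 12 * of_int b, of_int c))"

text \<open>The equation says that the form has discriminant 24. With this description, instead of
  an orbit, membership of a reflected wall is plain algebra.\<close>

definition walls :: "wall set" where
  "walls = {(a, b, c). 0 < a \<and> a * c = 6 * b\<^sup>2 - 1}"

text \<open>A nonpositive value means that \<open>z\<close> lies on or inside the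
  semicircle.\<close>

definition walls_above :: "complex \<Rightarrow> wall set" where
  "walls_above z = {w \<in> walls. form_at (wall_form w) z \<le> 0}"

lemma wall_form_at:
  assumes w: "(a, b, c) \<in> walls" and z: "Im z > 0"
  shows "form_at (wall_form (a, b, c)) z = (6 * (of_int a * Re z + of_int b)\<^sup>2 + 6 * (of_int a * Im z)\<^sup>2 - 1) / (of_int a * Im z)"
proof -
  have a: "0 < real_of_int a" and ac0: "a * c = 6 * b\<^sup>2 - 1" using w by (auto simp: walls_def)
  have "real_of_int (a * c) = real_of_int (6 * b\<^sup>2 - 1)" unfolding ac0 ..
  then have ac: "real_of_int a * real_of_int c = 6 * (real_of_int b)\<^sup>2 - 1" by simp
  have "of_int a * (6 * of_int a * ((Re z)\<^sup>2 + (Im z)\<^sup>2) + 12 * of_int b * Re z + of_int c) =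
     6 * (of_int a * Re z + of_int b)\<^sup>2 + 6 * (of_int a * Im z)\<^sup>2 - 1"
    using ac by (simp add: power2_eq_square algebra_simps)
  moreover have "form_at (wall_form (a, b, c)) z =
     of_int a * (6 * of_int a * ((Re z)\<^sup>2 + (Im z)\<^sup>2) + 12 * of_int b * Re z + of_int c) / (of_int a * Im z)"
    using a by (simp add: form_at_def wall_form_def)
  ultimately show ?thesis by simp
qed

lemma wall_le_0_iff:
  assumes w: "(a, b, c) \<in> walls" and z: "Im z > 0"
  shows "form_at (wall_form (a, b, c)) z \<le> 0 \<longleftrightarrow> 6 * (of_int a * Re z + of_int b)\<^sup>2 + 6 * (of_int a * Im z)\<^sup>2 \<le> 1"
proof -
  have "0 < of_int a * Im z" using w z by (auto simp: walls_def)
  then show ?thesis unfolding wall_form_at[OF assms] by (simp add: divide_le_0_iff)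
qed

lemma finite_walls_strip:
  assumes y: "y > 0"
  shows "finite {(a, b, c) \<in> walls. 6 * (of_int a * x + of_int b)\<^sup>2 + 6 * (of_int a * y)\<^sup>2 \<le> (1::real)}" (is "finite ?S")
proof -
  let ?N = "\<lceil>1 / y\<rceil>"
  let ?M = "\<lceil>1 + 1 / y * \<bar>x\<bar>\<rceil>"
  have "?S \<subseteq> (\<lambda>(a, b). (a, b, (6 * b\<^sup>2 - 1) div a)) ` ({0..?N} \<times> {-?M..?M})"
  proof
    fix w assume "w \<in> ?S"
    then obtain a b c where w: "w = (a, b, c)" and a: "0 < a" and ac: "a * c = 6 * b\<^sup>2 - 1"
      and h: "6 * (of_int a * x + of_int b)\<^sup>2 + 6 * (of_int a * y)\<^sup>2 \<le> (1::real)" by (auto simp: walls_def)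
    have "0 \<le> (of_int a * x + of_int b)\<^sup>2" "0 \<le> (of_int a * y)\<^sup>2" by simp_all
    then have "(of_int a * y)\<^sup>2 \<le> 1" "(of_int a * x + of_int b)\<^sup>2 \<le> 1" using h by linarith+
    then have l: "\<bar>of_int a * y\<bar> \<le> 1" "\<bar>of_int a * x + of_int b\<bar> \<le> 1" by (simp_all add: abs_square_le_1)
    then have ay: "of_int a \<le> 1 / y" using y by (simp add: field_simps)
    then have "a \<le> ?N" by linarith
    moreover have "\<bar>of_int b\<bar> \<le> 1 + \<bar>of_int a * x\<bar>" using l(2) by linarith
    moreover have "\<bar>of_int a * x\<bar> \<le> 1 / y * \<bar>x\<bar>" unfolding abs_mult by (rule mult_right_mono) (use ay a in auto)
    ultimately have "a \<le> ?N" "\<bar>real_of_int b\<bar> \<le> 1 + 1 / y * \<bar>x\<bar>" by linarith+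
    then have "a \<le> ?N" "\<bar>b\<bar> \<le> ?M" by linarith+
    moreover have "c = (6 * b\<^sup>2 - 1) div a" using ac a by (metis less_irrefl nonzero_mult_div_cancel_left)
    ultimately show "w \<in> (\<lambda>(a, b). (a, b, (6 * b\<^sup>2 - 1) div a)) ` ({0..?N} \<times> {-?M..?M})"
      unfolding w using a by (intro image_eqI[of _ _ "(a, b)"]) auto
  qed
  then show ?thesis by (rule finite_subset) auto
qed

lemma finite_walls_above: "Im z > 0 \<Longrightarrow> finite (walls_above z)"
proof -
  assume z: "Im z > 0"
  have "walls_above z \<subseteq> {(a, b, c) \<in> walls. 6 * (of_int a * Re z + of_int b)\<^sup>2 + 6 * (of_int a * Im z)\<^sup>2 \<le> (1::real)}"
    unfolding walls_above_def using wall_le_0_iff[OF _ z] by auto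
  then show ?thesis by (rule finite_subset) (rule finite_walls_strip[OF z])
qed

text \<open>The radii are at most \<open>1 / sqrt 6\<close>.\<close>

lemma walls_above_empty:
  assumes z: "Im z > 1"
  shows "walls_above z = {}"
proof -
  have False if w: "(a, b, c) \<in> walls" and h: "6 * (of_int a * Re z + of_int b)\<^sup>2 + 6 * (of_int a * Im z)\<^sup>2 \<le> (1::real)" for a b c
  proof -
    have "1 \<le> a" using w by (auto simp: walls_def)
    then have "1 * 1 \<le> of_int a * Im z" using z by (intro mult_mono) auto
    then have "1 \<le> (of_int a * Im z)\<^sup>2" by simp
    moreover have "0 \<le> (of_int a * Re z + of_int b)\<^sup>2" by simp
    ultimately show False using h by linarith
  qed
  then show ?thesis using z wall_le_0_iff[of _ _ _ z] unfolding walls_above_def by auto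
qed

definition "wall0 = (\<lambda>(a, b, c). (a, - b, c) :: wall)"
definition "wall1 = (\<lambda>(a, b, c). (c, b, a) :: wall)"
definition "wall2 = (\<lambda>(a, b, c). (3 * a + 12 * b + 2 * c, - a - 5 * b - c, 2 * a + 12 * b + 3 * c) :: wall)"
definition "wall3 = (\<lambda>(a, b, c). (a, - a - b, 6 * a + 12 * b + c) :: wall)"
lemmas wall_defs = wall0_def wall1_def wall2_def wall3_def

lemma wall_form_refl:
  "wall_form (wall0 w) = form0 (wall_form w)" "wall_form (wall1 w) = form1 (wall_form w)"
  "wall_form (wall2 w) = form2 (wall_form w)" "wall_form (wall3 w) = form3 (wall_form w)"
  by (cases w; simp add: wall_form_def wall_defs form_defs)+

lemma wall_involution: "wall0 (wall0 w) = w" "wall1 (wall1 w) = w" "wall2 (wall2 w) = w" "wall3 (wall3 w) = w"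
  by (cases w; simp add: wall_defs)+

text \<open>Oddness of \<open>a\<close> and \<open>c\<close> decides how the reflections treat the
  parity of \<open>b\<close>: \<open>wall2\<close> keeps it, since \<open>a + c\<close> is even, and
  \<open>wall3\<close> switches it.\<close>

lemma walls_odd:
  assumes "(a, b, c) \<in> walls"
  shows "odd a" "odd c"
proof -
  have "odd (6 * b\<^sup>2 - 1)" by simp
  then have "odd (a * c)" using assms by (simp add: walls_def)
  then show "odd a" "odd c" by auto
qed

lemma wall0_mem: "w \<in> walls \<Longrightarrow> wall0 w \<in> walls"
  by (auto simp: walls_def wall0_def)

lemma wall3_mem: "w \<in> walls \<Longrightarrow> wall3 w \<in> walls"
  by (auto simp: walls_def wall3_def power2_eq_square algebra_simps)

text \<open>The excluded wall is the mirror of this reflection, which is sent to its own negative.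
  On all others \<open>c > 0\<close>: as \<open>ac >= -1\<close>, a negative \<open>c\<close> forces
  \<open>a = 1\<close>, \<open>c = -1\<close> and \<open>b = 0\<close>.\<close>

lemma wall1_mem:
  assumes "w \<in> walls" "w \<noteq> (1, 0, -1)"
  shows "wall1 w \<in> walls" "wall1 w \<noteq> (1, 0, -1)"
proof -
  obtain a b c where w: "w = (a, b, c)" by (cases w)
  have a: "0 < a" and ac: "a * c = 6 * b\<^sup>2 - 1" using assms(1) w by (auto simp: walls_def)
  have "0 < c"
  proof (rule ccontr)
    assume "\<not> 0 < c"
    moreover have "c \<noteq> 0" using walls_odd(2)[of a b c] assms(1) w by auto
    ultimately have c: "c \<le> -1" by simp
    have "0 \<le> b\<^sup>2" by simp
    then have ge: "-1 \<le> a * c" unfolding ac by linarith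
    have "a * c \<le> a * (-1)" using c a by (intro mult_left_mono) auto
    then have a1: "a = 1" using ge a by simp
    then have "c = -1" using ge c by simp
    then have "b = 0" using ac a1 by simp
    then show False using assms(2) w a1 \<open>c = -1\<close> by simp
  qed
  then show "wall1 w \<in> walls" "wall1 w \<noteq> (1, 0, -1)" using w a ac by (auto simp: walls_def wall1_def mult.commute)
qed

text \<open>The new first entry is positive because
  \<open>a * (3a + 12b + 2c) = 3 (a + 2b)^2 - 2\<close> and \<open>a + 2b\<close> is odd.\<close>

lemma wall2_mem: "w \<in> walls \<Longrightarrow> wall2 w \<in> walls"
proof -
  assume ww: "w \<in> walls"
  obtain a b c where w: "w = (a, b, c)" by (cases w)
  have a: "0 < a" and ac: "a * c = 6 * b\<^sup>2 - 1" using ww w by (auto simp: walls_def)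
  have "odd (a + 2 * b)" using walls_odd(1)[of a b c] ww w by simp
  then have "a + 2 * b \<noteq> 0" by (metis even_zero)
  then have "0 < (a + 2 * b)\<^sup>2" by simp
  moreover have "a * (3 * a + 12 * b + 2 * c) = 3 * (a + 2 * b)\<^sup>2 - 2"
  proof -
    have "a * (3 * a + 12 * b + 2 * c) = 3 * a * a + 12 * a * b + 2 * (a * c)" by (simp add: algebra_simps)
    then show ?thesis unfolding ac by (simp add: power2_eq_square algebra_simps)
  qed
  ultimately have "0 < a * (3 * a + 12 * b + 2 * c)" by linarith
  then have p: "0 < 3 * a + 12 * b + 2 * c" using a by (simp add: zero_less_mult_iff)
  have "(3 * a + 12 * b + 2 * c) * (2 * a + 12 * b + 3 * c) - (6 * (- a - 5 * b - c)\<^sup>2 - 1) = a * c - (6 * b\<^sup>2 - 1)"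
    by (simp add: power2_eq_square algebra_simps)
  then have "(3 * a + 12 * b + 2 * c) * (2 * a + 12 * b + 3 * c) = 6 * (- a - 5 * b - c)\<^sup>2 - 1" using ac by simp
  then show "wall2 w \<in> walls" unfolding w walls_def wall2_def using p by simp
qed

section \<open>The constant kappa and the wall cocycle\<close>

context reflection_form
begin

lemma im_period_vertical_deriv:
  assumes y: "y > 0"
  shows "((\<lambda>y. im_period Q (Complex x y)) has_real_derivative Im (\<i> * (2 * f (Complex x y) * form_poly Q (Complex x y)))) (at y)"
proof -
  have "((\<lambda>y. Complex x y) has_vector_derivative \<i>) (at y)"
    unfolding Complex_eq by (auto intro!: derivative_eq_intros)
  then have "((period Q \<circ> (\<lambda>y. Complex x y)) has_vector_derivative \<i> * (2 * f (Complex x y) * form_poly Q (Complex x y))) (at y)"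
    by (rule field_vector_diff_chain_at) (use y in \<open>auto intro!: period_deriv\<close>)
  from bounded_linear.has_vector_derivative[OF bounded_linear_Im this]
  show ?thesis unfolding has_real_derivative_iff_has_vector_derivative im_period_def o_def .
qed

text \<open>Periods of the two circular mirrors, taken at points that their own reflections fix:
  \<open>(6, 0, -1)\<close> is the form of \<open>|z|^2 = 1/6\<close> and \<open>(6, -6, 1)\<close>
  that of \<open>|z - 1/2|^2 = 1/12\<close>.\<close>

definition "kappa1 = im_period (6, 0, -1) (Complex 0 (1 / sqrt 6))"
definition "kappa2 = im_period (6, -6, 1) (Complex (1 / 2) (1 / sqrt 12))"
definition "kappa = kappa1 - kappa2"

lemma Im_i_times_real: "Im (\<i> * (2 * w * (- of_real c))) = - (2 * c * Re w)"
  by simp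

text \<open>Along the imaginary axis the imaginary part of the period of \<open>(6, 0, -1)\<close>
  decreases strictly, by positivity of \<open>f\<close>, and tends to 0.\<close>

lemma kappa1_pos: "kappa1 > 0"
proof -
  let ?g = "\<lambda>y. im_period (6, 0, -1) (Complex 0 y)"
  let ?g' = "\<lambda>y. - (2 * (6 * y\<^sup>2 + 1) * Re (f (\<i> * of_real y)))"
  have d: "(?g has_real_derivative ?g' y) (at y) \<and> ?g' y < 0" if y: "y > 0" for y
  proof -
    have "Complex 0 y = \<i> * of_real y" by (simp add: complex_eq_iff)
    moreover have "form_poly (6, 0, -1) (\<i> * of_real y) = - of_real (6 * y\<^sup>2 + 1)"
      by (simp add: form_poly_def power_mult_distrib)
    ultimately have "Im (\<i> * (2 * f (Complex 0 y) * form_poly (6, 0, -1) (Complex 0 y))) = ?g' y"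
      by (simp only: Im_i_times_real)
    moreover have "0 < 6 * y\<^sup>2 + 1" by (simp add: add_nonneg_pos)
    ultimately show ?thesis using im_period_vertical_deriv[OF y, of "(6, 0, -1)" 0] f_pos[OF y]
      by (simp add: mult_pos_pos)
  qed
  let ?y = "1 / sqrt 6 :: real"
  have y0: "?y > 0" by simp
  \<comment> \<open>The limit only yields a weak inequality; applying it one unit higher and
    descending strictly makes it strict.\<close>
  have "0 \<le> ?g (?y + 1)"
  proof (rule nonincreasing_limit_nonneg[of "?y + 1" ?g ?g', OF _ im_period_LIM])
    fix y :: real assume "?y + 1 \<le> y"
    then have "0 < y" using y0 by linarith
    from d[OF this] show "(?g has_real_derivative ?g' y) (at y) \<and> ?g' y \<le> 0" by (metis less_imp_le)
  qed
  moreover have "?g (?y + 1) < ?g ?y"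
  proof (rule DERIV_neg_imp_decreasing[of ?y "?y + 1" ?g])
    fix x assume "?y \<le> x"
    then have "x > 0" using y0 by linarith
    then show "\<exists>y. (?g has_real_derivative y) (at x) \<and> y < 0" using d by blast
  qed simp
  ultimately show ?thesis unfolding kappa1_def by linarith
qed

lemma half_mirror:
  "refl2 (Complex (1 / 2) (1 / sqrt 12)) = Complex (1 / 2) (1 / sqrt 12)"
  "refl3 (Complex (1 / 2) y) = Complex (1 / 2) y"
  "refl1 (Complex 0 (1 / sqrt 6)) = Complex 0 (1 / sqrt 6)"
  by (simp_all add: refl_defs power_divide complex_eq_iff field_simps)

text \<open>The point lies on \<open>Re z = 1/2\<close> and \<open>form3\<close> fixes
  \<open>(6, -6, 1)\<close>, so the reflection law reads \<open>kappa2 = - kappa2\<close>.\<close>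

lemma kappa2_eps: "eps = -1 \<Longrightarrow> kappa2 = 0"
  using im_period_refl3[of "Complex (1 / 2) (1 / sqrt 12)" "(6, -6, 1)"]
  unfolding half_mirror kappa2_def by (simp add: form3_def)

lemma kappa2_nonpos: "kappa2 \<le> 0"
proof (cases "eps = 1")
  case True
  let ?g = "\<lambda>y. - im_period (6, -6, 1) (Complex (1 / 2) y)"
  let ?g' = "\<lambda>y. 2 * (6 * y\<^sup>2 + 1 / 2) * Re (f (1 / 2 + \<i> * of_real y))"
  have d: "(?g has_real_derivative ?g' y) (at y) \<and> ?g' y \<le> 0" if y: "y > 0" for y
  proof -
    have c: "Complex (1 / 2) y = 1 / 2 + \<i> * of_real y" by (simp add: complex_eq_iff)
    have "form_poly (6, -6, 1) (1 / 2 + \<i> * of_real y) = - of_real (6 * y\<^sup>2 + 1 / 2)"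
      by (simp add: form_poly_def complex_eq_iff power2_eq_square algebra_simps)
    then have "Im (\<i> * (2 * f (Complex (1 / 2) y) * form_poly (6, -6, 1) (Complex (1 / 2) y))) = - ?g' y"
      unfolding c by (simp only: Im_i_times_real)
    moreover have "0 \<le> 6 * y\<^sup>2 + 1 / 2" by simp
    ultimately show ?thesis using DERIV_minus[OF im_period_vertical_deriv[OF y, of "(6, -6, 1)" "1 / 2"]] f_neg[OF True y]
      by (simp add: mult_nonneg_nonpos)
  qed
  have "0 \<le> ?g (1 / sqrt 12)"
  proof (rule nonincreasing_limit_nonneg[of "1 / sqrt 12" ?g ?g'])
    show "(?g \<longlongrightarrow> 0) at_top" using tendsto_minus[OF im_period_LIM] by simp
    fix y :: real assume "1 / sqrt 12 \<le> y"
    moreover have "0 < 1 / sqrt (12::real)" by simp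
    ultimately have "0 < y" by linarith
    then show "(?g has_real_derivative ?g' y) (at y) \<and> ?g' y \<le> 0" by (rule d)
  qed
  then show ?thesis unfolding kappa2_def by simp
next
  case False
  then show ?thesis using kappa2_eps eps by simp
qed

lemma kappa_pos: "kappa > 0"
  using kappa1_pos kappa2_nonpos by (simp add: kappa_def)

text \<open>\<open>form1 Q - Q = (C - A/6) (6, 0, -1)\<close> and
  \<open>form2 Q - Q = (A/3 + B + 2C) (6, -6, 1)\<close>. Evaluating the unknown constant at a fixed
  point of the reflection therefore gives these multiples of \<open>kappa1\<close> and
  \<open>kappa2\<close>.\<close>

lemma im_period_refl1:
  assumes z: "Im z > 0"
  shows "im_period (form1 (A, B, C)) (refl1 z) = im_period (A, B, C) z + (C - A / 6) * kappa1"
    "im_period (form2 (A, B, C)) (refl2 z) = im_period (A, B, C) z + (A / 3 + B + 2 * C) * kappa2"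
proof -
  obtain k1 k2 where
    k1: "\<And>z. Im z > 0 \<Longrightarrow> im_period (form1 (A, B, C)) (refl1 z) = im_period (A, B, C) z + k1" and
    k2: "\<And>z. Im z > 0 \<Longrightarrow> im_period (form2 (A, B, C)) (refl2 z) = im_period (A, B, C) z + k2"
    using im_period_refl12[of A B C] by blast
  let ?p = "\<lambda>Q. im_period Q (Complex 0 (1 / sqrt 6))"
  have "k1 = ?p (6 * C, B, A / 6) - ?p (A, B, C)"
    using k1[of "Complex 0 (1 / sqrt 6)"] unfolding half_mirror by (simp add: form1_def)
  also have "\<dots> = (C - A / 6) * kappa1"
    unfolding kappa1_def by (subst (1 2 3) im_period_linear) (simp add: algebra_simps)
  finally show "im_period (form1 (A, B, C)) (refl1 z) = im_period (A, B, C) z + (C - A / 6) * kappa1" using k1[OF z] by simp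
  let ?q = "\<lambda>Q. im_period Q (Complex (1 / 2) (1 / sqrt 12))"
  have "k2 = ?q (3 * A + 6 * B + 12 * C, - 2 * A - 5 * B - 12 * C, A / 3 + B + 3 * C) - ?q (A, B, C)"
    using k2[of "Complex (1 / 2) (1 / sqrt 12)"] unfolding half_mirror by (simp add: form2_def)
  also have "\<dots> = (A / 3 + B + 2 * C) * kappa2"
    unfolding kappa2_def by (subst (1 2 3) im_period_linear) (simp add: algebra_simps)
  finally show "im_period (form2 (A, B, C)) (refl2 z) = im_period (A, B, C) z + (A / 3 + B + 2 * C) * kappa2" using k2[OF z] by simp
qed

text \<open>Weight one half for a point on the wall makes the reflection laws hold on the mirrors too.\<close>
definition wall_weight :: "form \<Rightarrow> complex \<Rightarrow> wall \<Rightarrow> real" where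
  "wall_weight Q z w = (if form_at (wall_form w) z = 0 then 1 / 2 else 1) *
     (if even (fst (snd w)) then 1 else eps) * form_prod (wall_form w) Q"

definition wall_function :: "form \<Rightarrow> complex \<Rightarrow> real" where
  "wall_function Q z = (\<Sum>w\<in>walls_above z. wall_weight Q z w)"

lemma wall_sum_reindex:
  assumes L: "\<And>P Q. form_prod (L P) (L Q) = form_prod P Q"
    and at: "\<And>Q. form_at (L Q) (R z) = form_at Q z"
    and g: "\<And>w. wall_form (g w) = L (wall_form w)" "\<And>w. g (g w) = w" "\<And>w. w \<in> S \<Longrightarrow> g w \<in> S"
    and par: "\<And>w. w \<in> S \<Longrightarrow> (if even (fst (snd (g w))) then 1 else eps) = s * (if even (fst (snd w)) then 1 else eps)"
  shows "(\<Sum>w | w \<in> S \<and> form_at (wall_form w) (R z) \<le> 0. wall_weight (L Q) (R z) w) =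
    s * (\<Sum>w | w \<in> S \<and> form_at (wall_form w) z \<le> 0. wall_weight Q z w)"
  unfolding sum_distrib_left
proof (rule sum.reindex_bij_witness[of _ g g])
  have a: "form_at (wall_form (g w)) (R z) = form_at (wall_form w) z" for w by (simp add: g(1) at)
  have b: "form_at (wall_form (g w)) z = form_at (wall_form w) (R z)" for w using a[of "g w"] by (simp add: g(2))
  show "g (g w) = w" for w by (rule g(2))
  show "g (g w) = w" for w by (rule g(2))
  fix w assume "w \<in> {w. w \<in> S \<and> form_at (wall_form w) (R z) \<le> 0}"
  then have w: "w \<in> S" "form_at (wall_form w) (R z) \<le> 0" by auto
  then show "g w \<in> {w. w \<in> S \<and> form_at (wall_form w) z \<le> 0}" using g(3) b by simp
  have f: "form_prod (wall_form w) (L Q) = form_prod (wall_form (g w)) Q"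
    using L[of "wall_form (g w)" Q] by (simp flip: g(1) add: g(2))
  show "s * wall_weight Q z (g w) = wall_weight (L Q) (R z) w"
    unfolding wall_weight_def f b using par[OF g(3)[OF w(1)]] by (simp add: g(2) mult_ac)
next
  fix w assume "w \<in> {w. w \<in> S \<and> form_at (wall_form w) z \<le> 0}"
  then show "g w \<in> {w. w \<in> S \<and> form_at (wall_form w) (R z) \<le> 0}" using g(3) by (simp add: g(1) at)
qed

text \<open>The reflections permute the walls, with one exception. \<open>wall3\<close> switches the
  parity of \<open>b\<close>, which produces \<open>eps\<close>. Under \<open>refl1\<close> the
  mirror \<open>(1, 0, -1)\<close> leaves the set, and its contribution jumps by
  \<open>- form_prod (6, 0, -1) Q = 12 (C - A/6)\<close>.\<close>

lemma wall_function_refl: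
  assumes z: "Im z > 0"
  shows "wall_function (form0 Q) (refl0 z) = wall_function Q z"
    "wall_function (form1 (A, B, C)) (refl1 z) = wall_function (A, B, C) z + 12 * (C - A / 6)"
    "wall_function (form2 Q) (refl2 z) = wall_function Q z"
    "wall_function (form3 Q) (refl3 z) = eps * wall_function Q z"
proof -
  have par0: "even (fst (snd (wall0 w))) \<longleftrightarrow> even (fst (snd w))" for w by (cases w) (simp add: wall0_def)
  have par1: "even (fst (snd (wall1 w))) \<longleftrightarrow> even (fst (snd w))" for w by (cases w) (simp add: wall1_def)
  have par2: "even (fst (snd (wall2 w))) \<longleftrightarrow> even (fst (snd w))" if "w \<in> walls" for w
    using that walls_odd by (cases w) (auto simp: wall2_def)
  have par3: "even (fst (snd (wall3 w))) \<longleftrightarrow> odd (fst (snd w))" if "w \<in> walls" for w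
    using that walls_odd by (cases w) (auto simp: wall3_def)
  have "wall_function (form0 Q) (refl0 z) = 1 * wall_function Q z"
    unfolding wall_function_def walls_above_def
    by (rule wall_sum_reindex[where L = form0 and R = refl0 and g = wall0 and S = "walls" and z = z, OF form_prod_refl(1) form_at_refl(1)[OF z] wall_form_refl(1) wall_involution(1) wall0_mem])
       (simp_all add: par0)
  then show "wall_function (form0 Q) (refl0 z) = wall_function Q z" by simp
  have "wall_function (form2 Q) (refl2 z) = 1 * wall_function Q z"
    unfolding wall_function_def walls_above_def
    by (rule wall_sum_reindex[where L = form2 and R = refl2 and g = wall2 and S = "walls" and z = z, OF form_prod_refl(3) form_at_refl(3)[OF z] wall_form_refl(3) wall_involution(3) wall2_mem])
       (simp_all add: par2)
  then show "wall_function (form2 Q) (refl2 z) = wall_function Q z" by simp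
  show "wall_function (form3 Q) (refl3 z) = eps * wall_function Q z"
    unfolding wall_function_def walls_above_def
    by (rule wall_sum_reindex[where L = form3 and R = refl3 and g = wall3 and S = "walls" and z = z, OF form_prod_refl(4) form_at_refl(4)[OF z] wall_form_refl(4) wall_involution(4) wall3_mem])
       (use eps in \<open>auto simp: par3\<close>)
  let ?Q = "(A, B, C)" and ?v = "(1, 0, -1) :: wall"
  define T where "T = (\<lambda>z. walls_above z - {?v})"
  have vw: "?v \<in> walls" by (simp add: walls_def)
  \<comment> \<open>The weight of the mirror as a function of its value at the point. The reflection
    negates both this value and the product with the form, so the jump is governed by
    \<open>h x + h (-x) = 1\<close>; at \<open>x = 0\<close> this is the reason for the weight one
    half.\<close>
  define h where "h = (\<lambda>x::real. if x < 0 then 1 else if x = 0 then 1 / 2 else (0::real))"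
  have split: "wall_function P y = sum (wall_weight P y) (T y) + h (form_at (wall_form ?v) y) * form_prod (wall_form ?v) P" if y: "Im y > 0" for P y
  proof (cases "?v \<in> walls_above y")
    case True
    then have "wall_function P y = wall_weight P y ?v + sum (wall_weight P y) (T y)"
      unfolding wall_function_def T_def by (rule sum.remove[OF finite_walls_above[OF y]])
    then show ?thesis using True by (auto simp: wall_weight_def h_def walls_above_def)
  next
    case False
    then have "T y = walls_above y" by (auto simp: T_def)
    then show ?thesis using False vw by (auto simp: wall_function_def h_def walls_above_def)
  qed
  have Teq: "T y = {w. w \<in> walls - {?v} \<and> form_at (wall_form w) y \<le> 0}" for y
    by (auto simp: T_def walls_above_def)
  have "sum (wall_weight (form1 ?Q) (refl1 z)) (T (refl1 z)) = 1 * sum (wall_weight ?Q z) (T z)"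
    unfolding Teq
    by (rule wall_sum_reindex[where L = form1 and R = refl1 and g = wall1 and S = "walls - {?v}" and z = z, OF form_prod_refl(2) form_at_refl(2)[OF z] wall_form_refl(2) wall_involution(2)])
       (use wall1_mem in \<open>auto simp: par1\<close>)
  moreover have "form1 (wall_form ?v) = (- 6, 0, 1)" "wall_form ?v = (6, 0, -1)" by (simp_all add: form1_def wall_form_def)
  moreover have "form_at (wall_form ?v) (refl1 z) = - form_at (wall_form ?v) z"
  proof -
    have "form_at (form1 (form1 (wall_form ?v))) (refl1 z) = form_at (form1 (wall_form ?v)) z"
      by (rule form_at_refl(2)[OF z])
    then show ?thesis unfolding form_involution
      by (simp add: form1_def form_at_def wall_form_def diff_divide_distrib add_divide_distrib)
  qed
  ultimately show "wall_function (form1 ?Q) (refl1 z) = wall_function ?Q z + 12 * (C - A / 6)"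
    unfolding split[OF Im_refl(2)[OF z]] split[OF z]
    by (simp add: h_def form1_def form_prod_def field_simps)
qed

text \<open>The term with \<open>fst Q\<close> is a coboundary that absorbs the jump at the second
  circle, since \<open>form2\<close> changes \<open>A\<close> by \<open>6 (A/3 + B + 2C)\<close>. At
  the first circle \<open>A\<close> changes by \<open>6 (C - A/6)\<close>, which leaves
  \<open>kappa1 - kappa2\<close> there for the walls to cancel.\<close>

definition residual :: "form \<Rightarrow> complex \<Rightarrow> real" where
  "residual Q z = im_period Q z - kappa2 / 6 * fst Q - kappa / 12 * wall_function Q z"

lemma residual_refl:
  assumes z: "Im z > 0"
  shows "residual (form0 Q) (refl0 z) = residual Q z" "residual (form1 Q) (refl1 z) = residual Q z"
    "residual (form2 Q) (refl2 z) = residual Q z" "residual (form3 Q) (refl3 z) = eps * residual Q z"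
proof -
  obtain A B C where Q: "Q = (A, B, C)" by (cases Q)
  show "residual (form0 Q) (refl0 z) = residual Q z"
    unfolding residual_def im_period_refl0[OF z] wall_function_refl[OF z] by (simp add: Q form0_def)
  show "residual (form1 Q) (refl1 z) = residual Q z"
    unfolding residual_def Q im_period_refl1[OF z] wall_function_refl[OF z]
    by (simp add: form1_def kappa_def field_simps)
  show "residual (form2 Q) (refl2 z) = residual Q z"
    unfolding residual_def wall_function_refl[OF z] unfolding Q im_period_refl1[OF z]
    by (simp add: form2_def algebra_simps)
  show "residual (form3 Q) (refl3 z) = eps * residual Q z"
    unfolding residual_def im_period_refl3[OF z] wall_function_refl[OF z]
    using eps kappa2_eps by (auto simp: Q form3_def algebra_simps)
qed

end

section \<open>Periods at the cusps\<close>

definition walls_over :: "real \<Rightarrow> wall set" where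
  "walls_over r = {(a, b, c) \<in> walls. 6 * (of_int a * r + of_int b)\<^sup>2 < 1}"

context reflection_form
begin

text \<open>An isotropic \<open>e\<close> stands for a cusp: \<open>form_at e z < \<delta>\<close>
  is a horoball there, and \<open>form_prod Q e = 0\<close> says that the geodesic of
  \<open>Q\<close> ends at that cusp. Phrased with forms, the property is carried along by the
  reflections.\<close>

definition vanishes_at :: "form \<Rightarrow> bool" where
  "vanishes_at e \<longleftrightarrow> (\<forall>Q. form_prod Q e = 0 \<longrightarrow>
     (\<forall>\<eta>>0. \<exists>\<delta>>0. \<forall>z. Im z > 0 \<and> form_at Q z = 0 \<and> form_at e z < \<delta> \<longrightarrow> \<bar>residual Q z\<bar> < \<eta>))"

lemma vanishes_at_step:
  assumes v: "vanishes_at (L e)"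
    and L: "\<And>P Q. form_prod (L P) (L Q) = form_prod P Q"
    and at: "\<And>Q z. Im z > 0 \<Longrightarrow> form_at (L Q) (R z) = form_at Q z"
    and R: "\<And>z. Im z > 0 \<Longrightarrow> Im (R z) > 0"
    and res: "\<And>Q z. Im z > 0 \<Longrightarrow> \<bar>residual (L Q) (R z)\<bar> = \<bar>residual Q z\<bar>"
  shows "vanishes_at e"
  unfolding vanishes_at_def
proof (intro allI impI)
  fix Q and \<eta> :: real assume Q: "form_prod Q e = 0" and \<eta>: "\<eta> > 0"
  have "form_prod (L Q) (L e) = 0" using Q L by simp
  then obtain \<delta> where \<delta>: "\<delta> > 0" "\<And>z. Im z > 0 \<Longrightarrow> form_at (L Q) z = 0 \<Longrightarrow> form_at (L e) z < \<delta> \<Longrightarrow> \<bar>residual (L Q) z\<bar> < \<eta>"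
    using v \<eta> unfolding vanishes_at_def by blast
  have "\<bar>residual Q z\<bar> < \<eta>" if "Im z > 0" "form_at Q z = 0" "form_at e z < \<delta>" for z
    using \<delta>(2)[of "R z"] that R at res by metis
  then show "\<exists>\<delta>>0. \<forall>z. Im z > 0 \<and> form_at Q z = 0 \<and> form_at e z < \<delta> \<longrightarrow> \<bar>residual Q z\<bar> < \<eta>" using \<delta>(1) by blast
qed

lemma vanishes_at_refl:
  "vanishes_at (form0 e) \<Longrightarrow> vanishes_at e" "vanishes_at (form1 e) \<Longrightarrow> vanishes_at e"
  "vanishes_at (form2 e) \<Longrightarrow> vanishes_at e" "vanishes_at (form3 e) \<Longrightarrow> vanishes_at e"
proof -
  show "vanishes_at (form0 e) \<Longrightarrow> vanishes_at e"
    by (rule vanishes_at_step[where L = form0 and R = refl0]) (simp_all add: form_prod_refl form_at_refl Im_refl residual_refl)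
  show "vanishes_at (form1 e) \<Longrightarrow> vanishes_at e"
    by (rule vanishes_at_step[where L = form1 and R = refl1]) (simp_all add: form_prod_refl form_at_refl Im_refl residual_refl)
  show "vanishes_at (form2 e) \<Longrightarrow> vanishes_at e"
    by (rule vanishes_at_step[where L = form2 and R = refl2]) (simp_all add: form_prod_refl form_at_refl Im_refl residual_refl)
  have "\<bar>eps\<bar> = 1" using eps by auto
  then show "vanishes_at (form3 e) \<Longrightarrow> vanishes_at e"
    by (intro vanishes_at_step[where L = form3 and R = refl3 and e = e]) (simp_all add: form_prod_refl form_at_refl Im_refl residual_refl abs_mult)
qed

text \<open>Orthogonality forces \<open>A = 0\<close>, so \<open>Q\<close> is a vertical line and
  the term with \<open>fst Q\<close> drops out. Above height 1 there are no walls, and the period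
  tends to 0.\<close>

lemma vanishes_at_infinity:
  assumes C: "C > 0"
  shows "vanishes_at (0, 0, C)"
  unfolding vanishes_at_def
proof (intro allI impI)
  fix Q and \<eta> :: real assume Q: "form_prod Q (0, 0, C) = 0" and \<eta>: "\<eta> > 0"
  obtain A B C' where Qe: "Q = (A, B, C')" by (cases Q)
  have A: "A = 0" using Q C by (simp add: Qe form_prod_def)
  have "((\<lambda>y. im_period Q (Complex (- C' / B) y)) \<longlongrightarrow> 0) at_top" by (rule im_period_LIM)
  then have "\<forall>\<^sub>F y in at_top. \<bar>im_period Q (Complex (- C' / B) y)\<bar> < \<eta>"
    using \<eta> by (auto simp: tendsto_iff dist_real_def)
  then obtain Y where Y: "\<And>y. y \<ge> Y \<Longrightarrow> \<bar>im_period Q (Complex (- C' / B) y)\<bar> < \<eta>"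
    by (auto simp: eventually_at_top_linorder)
  let ?d = "C / max Y 1"
  have d: "?d > 0" using C by simp
  have "\<bar>residual Q z\<bar> < \<eta>" if z: "Im z > 0" "form_at Q z = 0" "form_at (0, 0, C) z < ?d" for z
  proof -
    have "C / Im z < C / max Y 1" using z(3) by (simp add: form_at_def)
    have y: "max Y 1 < Im z"
    proof (rule ccontr)
      assume "\<not> max Y 1 < Im z"
      then have "C / max Y 1 \<le> C / Im z" using C z(1) by (intro divide_left_mono mult_pos_pos) auto
      then show False using \<open>C / Im z < C / max Y 1\<close> by simp
    qed
    then have e: "walls_above z = {}" by (intro walls_above_empty) simp
    have eq: "B * Re z + C' = 0" using z(1,2) by (simp add: Qe A form_at_def)
    show ?thesis
    proof (cases "B = 0")
      case True
      then have "Q = (0, 0, 0)" using eq by (simp add: Qe A)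
      then show ?thesis using \<eta> e by (simp add: residual_def im_period_def period_def wall_function_def)
    next
      case False
      then have "Re z = - C' / B" using eq by (simp add: field_simps)
      then have "z = Complex (- C' / B) (Im z)" by (simp add: complex_eq_iff)
      then have "\<bar>im_period Q z\<bar> < \<eta>" using Y[of "Im z"] y by simp
      then show ?thesis using e by (simp add: residual_def wall_function_def Qe A)
    qed
  qed
  then show "\<exists>\<delta>>0. \<forall>z. Im z > 0 \<and> form_at Q z = 0 \<and> form_at (0, 0, C) z < \<delta> \<longrightarrow> \<bar>residual Q z\<bar> < \<eta>"
    using d by blast
qed

text \<open>A descent to \<open>a = 0\<close>, the cusp at infinity. The translations
  \<open>z + 1\<close> and \<open>z - 1\<close> change \<open>b\<close> by \<open>12a\<close> and
  lead to \<open>|b| <= 6a\<close>; then \<open>form1\<close> exchanges \<open>a\<close> and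
  \<open>c\<close> if \<open>c < a\<close>, and otherwise \<open>form2\<close> lowers
  \<open>a\<close>. The outer induction is on \<open>a\<close>, the inner one on
  \<open>|b|\<close>.\<close>

lemma vanishes_at_isotropic:
  fixes a b c :: int
  assumes "0 \<le> a" "0 \<le> c" "0 < a + c" "b\<^sup>2 = 24 * a * c"
  shows "vanishes_at (6 * of_int a, of_int b, of_int c)"
  using assms
proof (induction "nat a" arbitrary: a b c rule: less_induct)
  case less
  note outer = less.hyps
  show ?case
    using less.prems outer
  proof (induction "nat \<bar>b\<bar>" arbitrary: b c rule: less_induct)
    case less
    note prems = less.prems(1-4) and outer = less.prems(5) and inner = less.hyps
    show ?case
    proof (cases "a = 0")
      case True
      then have "b = 0" using prems by simp
      then show ?thesis using True prems vanishes_at_infinity[of "of_int c"] by simp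
    next
      case False
      then have a: "a > 0" using prems by simp
      consider "b > 6 * a" | "b < - 6 * a" | "\<bar>b\<bar> \<le> 6 * a" by linarith
      then show ?thesis
      proof cases
        case 1
        have sq: "(b - 12 * a)\<^sup>2 = 24 * a * (6 * a - b + c)" using prems(4) by (simp add: power2_eq_square algebra_simps)
        have "0 \<le> a * (6 * a - b + c)" using sq by (metis zero_le_power2 mult.assoc zero_le_mult_iff zero_less_numeral not_less_iff_gr_or_eq order_less_imp_le mult_nonneg_nonneg zero_le_numeral linorder_not_le mult_pos_neg)
        then have c': "0 \<le> 6 * a - b + c" using a by (simp add: zero_le_mult_iff)
        have "vanishes_at (6 * of_int a, of_int (b - 12 * a), of_int (6 * a - b + c))"
          by (rule inner[OF _ _ _ _ _ outer]) (use 1 a c' sq in auto)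
        also have "(6 * real_of_int a, real_of_int (b - 12 * a), real_of_int (6 * a - b + c)) = form3 (form0 (6 * of_int a, of_int b, of_int c))"
          by (simp add: form_defs)
        finally show ?thesis using vanishes_at_refl by blast
      next
        case 2
        have sq: "(b + 12 * a)\<^sup>2 = 24 * a * (6 * a + b + c)" using prems(4) by (simp add: power2_eq_square algebra_simps)
        have c': "0 \<le> 6 * a + b + c"
        proof (rule ccontr)
          assume "\<not> 0 \<le> 6 * a + b + c"
          then have "24 * a * (6 * a + b + c) < 0" using a by (simp add: mult_pos_neg)
          then show False unfolding sq[symmetric] by (simp add: not_less[symmetric])
        qed
        have "vanishes_at (6 * of_int a, of_int (b + 12 * a), of_int (6 * a + b + c))"
          by (rule inner[OF _ _ _ _ _ outer]) (use 2 a c' sq in auto)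
        also have "(6 * real_of_int a, real_of_int (b + 12 * a), real_of_int (6 * a + b + c)) = form0 (form3 (6 * of_int a, of_int b, of_int c))"
          by (simp add: form_defs)
        finally show ?thesis using vanishes_at_refl by blast
      next
        case 3
        show ?thesis
        proof (cases "c < a")
          case True
          have "vanishes_at (6 * of_int c, of_int b, of_int a)"
            by (rule outer) (use True a prems in \<open>auto simp: mult_ac\<close>)
          also have "(6 * real_of_int c, real_of_int b, real_of_int a) = form1 (6 * of_int a, of_int b, of_int c)"
            by (simp add: form_defs)
          finally show ?thesis using vanishes_at_refl by blast
        next
          case False
          \<comment> \<open>Now \<open>a <= c\<close> and \<open>|b| <= 6a\<close>. As
            \<open>d^2 = 24ac >= 24a^2\<close>, one has \<open>4a <= d <= 6a\<close>, and for the
            new first entry \<open>a'\<close> the identity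
            \<open>24 a a' = 2 (6a - d)^2 <= 8a^2\<close> shows the decrease. \<open>form2\<close>
            is applied with \<open>b = -d\<close>; \<open>form0\<close> covers the other
            sign.\<close>
          define d where "d = \<bar>b\<bar>"
          have d: "0 \<le> d" "d \<le> 6 * a" "d\<^sup>2 = 24 * a * c" using 3 prems by (simp_all add: d_def)
          have "24 * a * a \<le> d\<^sup>2" unfolding d(3) using False a by simp
          moreover have "\<not> d < 4 * a"
          proof
            assume "d < 4 * a"
            then have "d\<^sup>2 \<le> (4 * a)\<^sup>2" using d by (intro power_mono) auto
            moreover have "(4 * a)\<^sup>2 = 16 * (a * a)" "0 < a * a" using a by (simp_all add: power2_eq_square)
            ultimately show False using \<open>24 * a * a \<le> d\<^sup>2\<close> by simp
          qed
          ultimately have d4: "4 * a \<le> d" by simp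
          have "(6 * a - d)\<^sup>2 \<le> (2 * a)\<^sup>2" using d d4 by (intro power_mono) auto
          then have dd: "(6 * a - d)\<^sup>2 \<le> 4 * (a * a)" by (simp add: power2_eq_square)
          have aa: "0 < a * a" using a by simp
          have e1: "24 * a * (3 * a - d + 2 * c) = 2 * (6 * a - d)\<^sup>2" using d(3) by (simp add: power2_eq_square algebra_simps)
          have e2: "24 * a * (2 * a - d + 3 * c) = 3 * (4 * a - d)\<^sup>2" using d(3) by (simp add: power2_eq_square algebra_simps)
          have pos: "0 \<le> x" if "0 \<le> 24 * a * x" for x :: int
            using that a by (simp add: zero_le_mult_iff)
          have p1: "0 \<le> 3 * a - d + 2 * c" by (rule pos) (simp add: e1)
          have p2: "0 \<le> 2 * a - d + 3 * c" by (rule pos) (simp add: e2)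
          have "24 * a * (3 * a - d + 2 * c) < 24 * a * a" unfolding e1 using dd aa by simp
          then have lt: "3 * a - d + 2 * c < a" using a by (simp only: mult_less_cancel_left)
          have sum: "0 < (3 * a - d + 2 * c) + (2 * a - d + 3 * c)"
          proof (rule ccontr)
            assume "\<not> ?thesis"
            then have z: "3 * a - d + 2 * c = 0" "2 * a - d + 3 * c = 0" using p1 p2 by simp_all
            then have "6 * a = d" "4 * a = d" using e1 e2 by simp_all
            then show False using a by simp
          qed
          have sq: "(- 12 * a + 5 * d - 12 * c)\<^sup>2 = 24 * (3 * a - d + 2 * c) * (2 * a - d + 3 * c)"
            using d(3) by (simp add: power2_eq_square algebra_simps)
          have "vanishes_at (6 * of_int (3 * a - d + 2 * c), of_int (- 12 * a + 5 * d - 12 * c), of_int (2 * a - d + 3 * c))"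
            by (rule outer) (use lt p1 p2 sum sq a in auto)
          also have "(6 * real_of_int (3 * a - d + 2 * c), real_of_int (- 12 * a + 5 * d - 12 * c), real_of_int (2 * a - d + 3 * c)) =
             form2 (6 * of_int a, of_int (- d), of_int c)"
            by (simp add: form_defs)
          finally have v: "vanishes_at (6 * of_int a, of_int (- d), of_int c)" using vanishes_at_refl by blast
          show ?thesis
          proof (cases "b \<le> 0")
            case True
            then show ?thesis using v by (simp add: d_def)
          next
            case False
            then have "(6 * real_of_int a, real_of_int (- d), real_of_int c) = form0 (6 * of_int a, of_int b, of_int c)"
              by (simp add: form_defs d_def)
            then show ?thesis using v vanishes_at_refl by metis
          qed
        qed
      qed
    qed
  qed
qed

text \<open>The cusp \<open>h/q\<close> is the isotropic form \<open>6 (q z - h)^2\<close>, with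
  value \<open>6 q^2 y\<close> at \<open>h/q + iy\<close>, and \<open>(0, 1, - r)\<close> is the
  vertical line through it.\<close>

lemma residual_at_cusp:
  fixes h q :: int
  assumes q: "0 < q"
  defines "r \<equiv> real_of_int h / real_of_int q"
  shows "((\<lambda>y. residual (0, 1, - r) (Complex r y)) \<longlongrightarrow> 0) (at_right 0)"
proof -
  let ?e = "(6 * real_of_int (q\<^sup>2), real_of_int (- 12 * h * q), real_of_int (6 * h\<^sup>2))"
  have hq: "real_of_int h = r * real_of_int q" unfolding r_def using q by simp
  have q2: "0 < q\<^sup>2" using q by simp
  have v: "vanishes_at ?e"
  proof (rule vanishes_at_isotropic)
    show "0 \<le> q\<^sup>2" "0 \<le> 6 * h\<^sup>2" by simp_all
    show "0 < q\<^sup>2 + 6 * h\<^sup>2" using q2 by (intro add_pos_nonneg) auto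
    show "(- 12 * h * q)\<^sup>2 = 24 * q\<^sup>2 * (6 * h\<^sup>2)" by (simp add: power2_eq_square)
  qed
  have "form_prod (0, 1, - r) ?e = 0" by (simp add: form_prod_def hq power2_eq_square)
  moreover have "form_at (0, 1, - r) (Complex r y) = 0" for y by (simp add: form_at_def)
  moreover have "form_at ?e (Complex r y) = 6 * real_of_int (q\<^sup>2) * y" if "y > 0" for y
    using that by (simp add: form_at_def hq power2_eq_square algebra_simps)
  ultimately have *: "\<exists>\<delta>>0. \<forall>y>0. 6 * real_of_int (q\<^sup>2) * y < \<delta> \<longrightarrow> \<bar>residual (0, 1, - r) (Complex r y)\<bar> < \<eta>" if "\<eta> > 0" for \<eta>
    using v that unfolding vanishes_at_def by (metis complex.sel(2))
  show ?thesis
  proof (rule tendstoI)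
    fix \<eta> :: real assume "\<eta> > 0"
    then obtain \<delta> where \<delta>: "\<delta> > 0" "\<And>y. y > 0 \<Longrightarrow> 6 * real_of_int (q\<^sup>2) * y < \<delta> \<Longrightarrow> \<bar>residual (0, 1, - r) (Complex r y)\<bar> < \<eta>"
      using * by blast
    let ?b = "\<delta> / (6 * real_of_int (q\<^sup>2))"
    have b: "?b > 0" using \<delta>(1) q by simp
    show "\<forall>\<^sub>F y in at_right 0. dist (residual (0, 1, - r) (Complex r y)) 0 < \<eta>"
      unfolding eventually_at_right_field
    proof (intro exI[of _ ?b] conjI allI impI b)
      fix y :: real assume "0 < y" "y < ?b"
      then have "6 * real_of_int (q\<^sup>2) * y < \<delta>" using q by (simp add: field_simps)
      then show "dist (residual (0, 1, - r) (Complex r y)) 0 < \<eta>" using \<delta>(2) \<open>0 < y\<close> by (simp add: dist_real_def)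
    qed
  qed
qed

text \<open>The walls over a rational point are the ones that cross the vertical geodesic ending there.\<close>
theorem period_limit:
  fixes h q :: int
  assumes q: "0 < q" and fin: "finite (walls_over (real_of_int h / real_of_int q))"
  defines "r \<equiv> real_of_int h / real_of_int q"
  shows "((\<lambda>y. Im (2 * (\<i> * of_real y) * F1 (Complex r y) - 2 * F2 (Complex r y))) \<longlongrightarrow>
     kappa * (\<Sum>(a, b, c)\<in>walls_over r. (if even b then 1 else eps) * (of_int a * r + of_int b))) (at_right 0)"
proof -
  let ?Q = "(0, 1, - r)"
  define s where "s = (\<lambda>(a::int, b::int, c::int). (if even b then 1 else eps) * (of_int a * r + of_int b))"
  \<comment> \<open>Close to the real axis the point lies strictly inside all of the finitely many
    semicircles over \<open>r\<close>, so the set of walls stabilises and no weight one half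
    occurs.\<close>
  have ev: "\<forall>\<^sub>F y in at_right 0. \<forall>w\<in>walls_over r. form_at (wall_form w) (Complex r y) < 0"
  proof (rule eventually_ball_finite[OF fin[folded r_def]], intro ballI)
    fix w assume w: "w \<in> walls_over r"
    obtain a b c where abc: "w = (a, b, c)" by (cases w)
    have ww: "(a, b, c) \<in> walls" and lt: "6 * (of_int a * r + of_int b)\<^sup>2 < (1::real)" using w abc by (auto simp: walls_over_def)
    have "((\<lambda>y. 6 * (of_int a * r + of_int b)\<^sup>2 + 6 * (of_int a * y)\<^sup>2 - 1) \<longlongrightarrow> 6 * (of_int a * r + of_int b)\<^sup>2 + 6 * (of_int a * 0)\<^sup>2 - 1) (at_right (0::real))"
      by (intro tendsto_intros)
    then have "\<forall>\<^sub>F y in at_right 0. 6 * (of_int a * r + of_int b)\<^sup>2 + 6 * (of_int a * y)\<^sup>2 - 1 < (0::real)"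
      by (rule order_tendstoD) (use lt in simp)
    then show "\<forall>\<^sub>F y in at_right 0. form_at (wall_form w) (Complex r y) < 0"
      using eventually_at_right_less[of 0]
    proof eventually_elim
      case (elim y)
      have "0 < of_int a * y" using ww elim by (auto simp: walls_def)
      then show ?case unfolding abc using wall_form_at[OF ww, of "Complex r y"] elim by (simp add: divide_neg_pos)
    qed
  qed
  have sub: "walls_above (Complex r y) \<subseteq> walls_over r" if "y > 0" for y
  proof
    fix w assume w: "w \<in> walls_above (Complex r y)"
    obtain a b c where abc: "w = (a, b, c)" by (cases w)
    have ww: "(a, b, c) \<in> walls" using w abc by (auto simp: walls_above_def)
    then have "6 * (of_int a * r + of_int b)\<^sup>2 + 6 * (of_int a * y)\<^sup>2 \<le> 1"
      using wall_le_0_iff[OF ww, of "Complex r y"] w abc that by (auto simp: walls_above_def)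
    moreover have "0 < (of_int a * y)\<^sup>2" using ww that by (auto simp: walls_def)
    ultimately have "6 * (of_int a * r + of_int b)\<^sup>2 < 1" by linarith
    then show "w \<in> walls_over r" using ww abc by (simp add: walls_over_def)
  qed
  have wf: "\<forall>\<^sub>F y in at_right 0. wall_function ?Q (Complex r y) = 12 * sum s (walls_over r)"
    using ev eventually_at_right_less[of 0]
  proof eventually_elim
    case (elim y)
    have "walls_above (Complex r y) = walls_over r"
      using sub[OF elim(2)] elim(1) by (auto simp: walls_above_def walls_over_def less_imp_le)
    \<comment> \<open>\<open>form_prod (6a, 12b, c) (0, 1, - r) = 12 (a r + b)\<close>; the 12
      cancels against \<open>kappa / 12\<close> in \<open>residual\<close>.\<close>
    moreover have "wall_weight ?Q (Complex r y) w = 12 * s w" if "w \<in> walls_over r" for w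
    proof -
      have ne: "form_at (wall_form w) (Complex r y) \<noteq> 0" using elim(1) that by force
      show ?thesis unfolding wall_weight_def using ne
        by (cases w) (simp add: form_prod_def wall_form_def s_def algebra_simps)
    qed
    ultimately show ?case unfolding wall_function_def by (simp add: sum_distrib_left)
  qed
  have "((\<lambda>y. residual ?Q (Complex r y) + kappa * sum s (walls_over r)) \<longlongrightarrow> 0 + kappa * sum s (walls_over r)) (at_right 0)"
    unfolding r_def by (intro tendsto_intros residual_at_cusp q)
  moreover have "\<forall>\<^sub>F y in at_right 0. residual ?Q (Complex r y) + kappa * sum s (walls_over r) =
     Im (2 * (\<i> * of_real y) * F1 (Complex r y) - 2 * F2 (Complex r y))"
    using wf
  proof eventually_elim
    case (elim y)
    have c: "Complex r y = of_real r + \<i> * of_real y" by (simp add: complex_eq_iff)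
    have "im_period ?Q (Complex r y) = Im (2 * (\<i> * of_real y) * F1 (Complex r y) - 2 * F2 (Complex r y))"
      unfolding im_period_def period_def prod.case by (rule arg_cong[of _ _ Im]) (simp add: c algebra_simps)
    then show ?case unfolding residual_def elim by simp
  qed
  ultimately have "((\<lambda>y. Im (2 * (\<i> * of_real y) * F1 (Complex r y) - 2 * F2 (Complex r y))) \<longlongrightarrow> 0 + kappa * sum s (walls_over r)) (at_right 0)"
    by (rule Lim_transform_eventually)
  then show ?thesis by (simp add: s_def case_prod_unfold)
qed

end

text \<open>Modulo \<open>a\<close> one has \<open>6b^2 = 1\<close>, hence
  \<open>6 (ah + bq)^2 = q^2\<close>.\<close>

lemma walls_over_dvd:
  assumes w: "(a, b, c) \<in> walls" and q: "0 < q"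
  shows "a dvd q\<^sup>2 - 6 * (a * h + b * q)\<^sup>2"
    "6 * (of_int a * (real_of_int h / real_of_int q) + of_int b)\<^sup>2 < 1 \<longleftrightarrow> 6 * (a * h + b * q)\<^sup>2 < q\<^sup>2"
proof -
  have ac: "6 * b\<^sup>2 = a * c + 1" using w by (simp add: walls_def)
  have "q\<^sup>2 - 6 * (a * h + b * q)\<^sup>2 = q\<^sup>2 * (1 - 6 * b\<^sup>2) - 6 * a * h * (a * h + 2 * b * q)"
    by (simp add: power2_eq_square algebra_simps)
  also have "\<dots> = a * (- q\<^sup>2 * c - 6 * h * (a * h + 2 * b * q))" unfolding ac by (simp add: algebra_simps)
  finally show "a dvd q\<^sup>2 - 6 * (a * h + b * q)\<^sup>2" by simp
  have "of_int a * (real_of_int h / real_of_int q) + of_int b = of_int (a * h + b * q) / of_int q"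
    using q by (simp add: field_simps)
  then have "6 * (of_int a * (real_of_int h / real_of_int q) + of_int b)\<^sup>2 = of_int (6 * (a * h + b * q)\<^sup>2) / of_int (q\<^sup>2)"
    by (simp add: power_divide)
  also have "\<dots> < 1 \<longleftrightarrow> real_of_int (6 * (a * h + b * q)\<^sup>2) < of_int (q\<^sup>2)"
    using q by (simp add: divide_less_eq_1)
  also have "\<dots> \<longleftrightarrow> 6 * (a * h + b * q)\<^sup>2 < q\<^sup>2" by (rule of_int_less_iff)
  finally show "6 * (of_int a * (real_of_int h / real_of_int q) + of_int b)\<^sup>2 < 1 \<longleftrightarrow> 6 * (a * h + b * q)\<^sup>2 < q\<^sup>2" .
qed

lemma finite_walls_over:
  assumes q: "0 < q"
  shows "finite (walls_over (real_of_int h / real_of_int q))"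
proof -
  let ?Y = "SIGMA m:{-q..q}. {d. 0 < d \<and> d dvd q\<^sup>2 - 6 * m\<^sup>2 \<and> 6 * m\<^sup>2 < q\<^sup>2}"
  have "finite {d. 0 < d \<and> d dvd q\<^sup>2 - 6 * m\<^sup>2 \<and> 6 * m\<^sup>2 < q\<^sup>2}" for m
    by (rule finite_subset[of _ "{0..q\<^sup>2 - 6 * m\<^sup>2}"]) (auto simp: zdvd_imp_le)
  then have fin: "finite ?Y" by auto
  have "walls_over (real_of_int h / real_of_int q) \<subseteq> (\<lambda>(m, a). (a, (m - a * h) div q, (6 * ((m - a * h) div q)\<^sup>2 - 1) div a)) ` ?Y"
  proof
    fix w assume "w \<in> walls_over (real_of_int h / real_of_int q)"
    then obtain a b c where w: "w = (a, b, c)" and ww: "(a, b, c) \<in> walls"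
      and lt: "6 * (of_int a * (real_of_int h / real_of_int q) + of_int b)\<^sup>2 < 1" by (auto simp: walls_over_def)
    define m where "m = a * h + b * q"
    have m: "a dvd q\<^sup>2 - 6 * m\<^sup>2" "6 * m\<^sup>2 < q\<^sup>2" using walls_over_dvd[OF ww q, of h] lt unfolding m_def by auto
    have "0 \<le> m\<^sup>2" by simp
    then have "m\<^sup>2 \<le> q\<^sup>2" using m(2) by linarith
    then have "\<bar>m\<bar> \<le> q" using abs_le_square_iff[of m q] q by simp
    then have mem: "(m, a) \<in> ?Y" using m ww by (auto simp: walls_def)
    have b: "(m - a * h) div q = b" unfolding m_def using q by simp
    have c: "(6 * b\<^sup>2 - 1) div a = c" 
    proof -
      have "6 * b\<^sup>2 - 1 = a * c" "a \<noteq> 0" using ww unfolding walls_def by auto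
      then show ?thesis by simp
    qed
    show "w \<in> (\<lambda>(m, a). (a, (m - a * h) div q, (6 * ((m - a * h) div q)\<^sup>2 - 1) div a)) ` ?Y"
      by (rule image_eqI[OF _ mem]) (simp add: w b c)
  qed
  then show ?thesis using fin finite_subset by blast
qed

section \<open>The wall sum twisted by the character\<close>

context odd_quadratic_character
begin

text \<open>A cusp \<open>2j/p\<close> with a wall over it corresponds to
  \<open>(m, d) = (2aj + bp, a)\<close>. If \<open>p\<close> does not divide \<open>m\<close>, this
  gives \<open>chi (2j) = chi m * chi a\<close>, and \<open>m\<close> has the parity of
  \<open>b\<close> since \<open>p\<close> is odd. Conversely \<open>j\<close> solves
  \<open>2dj = m\<close> modulo \<open>p\<close>, which determines \<open>b\<close>, and
  \<open>c\<close> exists since \<open>d\<close> divides \<open>6b^2 - 1\<close>.\<close>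

lemma twisted_wall_sum:
  fixes e :: int
  assumes e: "e = 1 \<or> e = -1"
  shows "(\<Sum>j\<in>{0..<p}. of_int (chi (2 * j)) * (\<Sum>(a, b, c)\<in>walls_over (of_int (2 * j) / of_int p).
     (if even b then 1 else of_int e) * (of_int a * (of_int (2 * j) / of_int p) + of_int b))) = real_of_int (wall_sum e) / of_int p"
proof -
  let ?W = "\<lambda>j. walls_over (of_int (2 * j) / of_int p)"
  let ?m = "\<lambda>(j, (a, b, c)). a * (2 * j) + b * p"
  let ?X = "SIGMA j:{0..<p}. ?W j"
  let ?X' = "{x \<in> ?X. \<not> p dvd ?m x}"
  let ?Y = "SIGMA m:{m. 6 * m\<^sup>2 < p\<^sup>2}. {d. 0 < d \<and> d dvd p\<^sup>2 - 6 * m\<^sup>2}"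
  let ?Y' = "{(m, d) \<in> ?Y. \<not> p dvd m \<and> \<not> p dvd d}"
  let ?g = "\<lambda>(j, (a, b, c)). chi (2 * j) * (if even b then 1 else e) * (a * (2 * j) + b * p)"
  let ?k = "\<lambda>(m, d). e ^ nat \<bar>m\<bar> * m * chi m * chi d"
  have finW: "finite (?W j)" for j by (rule finite_walls_over[OF p_pos])
  have finX: "finite ?X" by (rule finite_SigmaI[OF _ finW]) simp
  have finD: "finite {d. 0 < d \<and> d dvd p\<^sup>2 - 6 * m\<^sup>2}" if "6 * m\<^sup>2 < p\<^sup>2" for m
    by (rule finite_subset[of _ "{0..p\<^sup>2 - 6 * m\<^sup>2}"]) (use that in \<open>auto simp: zdvd_imp_le\<close>)
  have finY: "finite ?Y" using finite_wall_range finD by auto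
  have small: "m = 0" if "6 * m\<^sup>2 < p\<^sup>2" "p dvd m" for m
  proof (rule ccontr)
    assume "m \<noteq> 0"
    then have "p \<le> \<bar>m\<bar>" using dvd_imp_le_int[of m p] that(2) p_pos by simp
    then have "p\<^sup>2 \<le> m\<^sup>2" using p_pos by (metis abs_ge_zero power2_abs power_mono less_imp_le)
    moreover have "0 \<le> m\<^sup>2" by simp
    ultimately show False using that(1) by linarith
  qed
  have memX: "(a, b, c) \<in> walls \<and> a dvd p\<^sup>2 - 6 * (?m (j, a, b, c))\<^sup>2 \<and> 6 * (?m (j, a, b, c))\<^sup>2 < p\<^sup>2" if "(j, (a, b, c)) \<in> ?X" for j a b c
    using that walls_over_dvd[of a b c p "2 * j"] p_pos by (auto simp: walls_over_def)
  have "(\<Sum>j\<in>{0..<p}. of_int (chi (2 * j)) * (\<Sum>(a, b, c)\<in>?W j.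
     (if even b then 1 else of_int e) * (of_int a * (of_int (2 * j) / of_int p) + of_int b))) = (\<Sum>j\<in>{0..<p}. \<Sum>w\<in>?W j. real_of_int (?g (j, w)) / of_int p)"
    unfolding sum_distrib_left
    by (intro sum.cong refl) (use p_pos in \<open>auto simp: field_simps\<close>)
  also have "\<dots> = (\<Sum>x\<in>?X. real_of_int (?g x) / of_int p)"
    by (subst sum.Sigma) (use finW in \<open>simp_all add: case_prod_unfold del: of_int_mult\<close>)
  also have "\<dots> = real_of_int (\<Sum>x\<in>?X. ?g x) / of_int p" by (simp add: sum_divide_distrib)
  \<comment> \<open>If \<open>p\<close> divides \<open>m\<close>, the bound
    \<open>6m^2 < p^2\<close> forces \<open>m = 0\<close>, and the term vanishes through its factor
    \<open>m\<close>.\<close>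
  also have "(\<Sum>x\<in>?X. ?g x) = (\<Sum>x\<in>?X'. ?g x)"
  proof (rule sum.mono_neutral_right[OF finX])
    show "\<forall>x\<in>?X - ?X'. ?g x = 0"
    proof
      fix x assume x: "x \<in> ?X - ?X'"
      obtain j a b c where xe: "x = (j, (a, b, c))" by (cases x) auto
      have "?m x = 0" using small[of "?m x"] memX[of j a b c] x xe by auto
      then show "?g x = 0" using xe by simp
    qed
  qed auto
  also have "\<dots> = (\<Sum>y\<in>?Y'. ?k y)"
  proof (rule sum.reindex_cong[of "\<lambda>(j, (a, b, c)). (a * (2 * j) + b * p, a)", symmetric])
    let ?\<phi> = "\<lambda>(j, (a, b, c)). (a * (2 * j) + b * p, a)"
    have X'D: "0 \<le> j \<and> j < p \<and> (a, b, c) \<in> walls \<and> 0 < a \<and> a * c = 6 * b\<^sup>2 - 1 \<and> a dvd p\<^sup>2 - 6 * (a * (2 * j) + b * p)\<^sup>2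
        \<and> 6 * (a * (2 * j) + b * p)\<^sup>2 < p\<^sup>2 \<and> \<not> p dvd a * (2 * j) + b * p \<and> \<not> p dvd a"
      if "(j, (a, b, c)) \<in> ?X'" for j a b c
    proof -
      have x: "(j, (a, b, c)) \<in> ?X" and nd: "\<not> p dvd a * (2 * j) + b * p" using that by simp_all
      have "\<not> p dvd a" using nd by (auto simp: dvd_add dvd_mult2)
      moreover have "(a, b, c) \<in> walls" "a dvd p\<^sup>2 - 6 * (a * (2 * j) + b * p)\<^sup>2" "6 * (a * (2 * j) + b * p)\<^sup>2 < p\<^sup>2"
        using memX[OF x] by simp_all
      moreover from this have "0 < a" "a * c = 6 * b\<^sup>2 - 1" by (simp_all add: walls_def)
      ultimately show ?thesis using x nd by simp
    qed
    show "inj_on ?\<phi> ?X'"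
    proof (rule inj_onI)
      fix x y assume x: "x \<in> ?X'" and y: "y \<in> ?X'" and eq: "?\<phi> x = ?\<phi> y"
      obtain j a b c where xe: "x = (j, (a, b, c))" by (cases x) auto
      obtain j' a' b' c' where ye: "y = (j', (a', b', c'))" by (cases y) auto
      note X = X'D[OF x[unfolded xe]] and Y = X'D[OF y[unfolded ye]]
      have a: "a' = a" and m: "a * (2 * j) + b * p = a * (2 * j') + b' * p" using eq unfolding xe ye by auto
      have "2 * (a * (j - j')) = p * (b' - b)" using m by (simp add: algebra_simps)
      then have "p dvd 2 * (a * (j - j'))" by simp
      moreover have "\<not> p dvd 2" using p_odd p_prime by (metis prime_ge_2_int zdvd_imp_le zero_less_numeral order_antisym dvd_refl)
      ultimately have "p dvd j - j'" using p_prime X by (simp add: prime_dvd_mult_iff)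
      then have j: "j = j'" using X Y dvd_imp_le_int[of "j - j'" p] by (cases "j = j'") auto
      have b: "b = b'" using m j p_pos by simp
      have "a * c = a * c'" using X Y a b by metis
      moreover have "a \<noteq> 0" using X by blast
      ultimately have "c = c'" by simp
      then show "x = y" unfolding xe ye by (simp add: a j b)
    qed
    show "?Y' = ?\<phi> ` ?X'"
    proof (intro equalityI subsetI)
      fix y assume "y \<in> ?Y'"
      then obtain m d where y: "y = (m, d)" and m: "6 * m\<^sup>2 < p\<^sup>2" "\<not> p dvd m" and d: "0 < d" "d dvd p\<^sup>2 - 6 * m\<^sup>2" "\<not> p dvd d" by auto
      have cop: "coprime d p" using d(3) p_prime prime_imp_coprime coprime_commute by metis
      have "coprime 2 p" using p_odd by simp
      then have "coprime (2 * d) p" using cop by simp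
      then obtain x where x: "[2 * d * x = 1] (mod p)" using cong_solve_coprime_int by blast
      define j where "j = (x * m) mod p"
      have j: "0 \<le> j" "j < p" using p_pos unfolding j_def by auto
      have "[2 * d * j = 2 * d * (x * m)] (mod p)" unfolding j_def by (intro cong_mult cong_refl) (simp add: cong_def)
      also have "2 * d * (x * m) = (2 * d * x) * m" by (simp add: mult_ac)
      also have "[(2 * d * x) * m = 1 * m] (mod p)" using x by (rule cong_mult) simp
      finally have "p dvd m - 2 * d * j" by (simp add: cong_iff_dvd_diff dvd_diff_commute)
      then obtain b where "m - 2 * d * j = p * b" by (rule dvdE)
      then have mb: "m = d * (2 * j) + b * p" by (simp add: algebra_simps)
      \<comment> \<open>\<open>d\<close> divides the norm, hence \<open>p^2 (6b^2 - 1)\<close>;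
        coprimality with \<open>p\<close> removes the factor \<open>p^2\<close>.\<close>
      have "p\<^sup>2 - 6 * m\<^sup>2 = d * (- 6 * (2 * j) * (d * (2 * j) + 2 * b * p)) - p\<^sup>2 * (6 * b\<^sup>2 - 1)"
        unfolding mb by (simp add: power2_eq_square algebra_simps)
      then have "p\<^sup>2 * (6 * b\<^sup>2 - 1) = d * (- 6 * (2 * j) * (d * (2 * j) + 2 * b * p)) - (p\<^sup>2 - 6 * m\<^sup>2)" by linarith
      then have "d dvd p\<^sup>2 * (6 * b\<^sup>2 - 1)" using d(2) by simp
      then have "d dvd 6 * b\<^sup>2 - 1" using cop by (simp add: coprime_dvd_mult_right_iff)
      then obtain c where c: "6 * b\<^sup>2 - 1 = d * c" by (rule dvdE)
      have w: "(d, b, c) \<in> walls" using d c by (simp add: walls_def)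
      have "(d, b, c) \<in> ?W j"
        unfolding walls_over_def using w walls_over_dvd(2)[OF w p_pos, of "2 * j"] m(1) mb by simp
      then have "(j, (d, b, c)) \<in> ?X'" using j m(2) mb by simp
      moreover have "y = ?\<phi> (j, (d, b, c))" using y mb by simp
      ultimately show "y \<in> ?\<phi> ` ?X'" by (rule rev_image_eqI)
    next
      fix y assume "y \<in> ?\<phi> ` ?X'"
      then obtain x where x: "x \<in> ?X'" and y: "y = ?\<phi> x" by (rule imageE)
      obtain j a b c where xe: "x = (j, (a, b, c))" by (cases x) auto
      show "y \<in> ?Y'" using X'D[OF x[unfolded xe]] unfolding y xe by simp
    qed
    fix x assume x: "x \<in> ?X'"
    obtain j a b c where xe: "x = (j, (a, b, c))" by (cases x) auto
    note X = X'D[OF x[unfolded xe]]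
    define m where "m = a * (2 * j) + b * p"
    have "chi m = chi (a * (2 * j))" by (rule chi_cong) (simp add: m_def cong_iff_dvd_diff)
    then have "chi m * chi a = chi (a\<^sup>2) * chi (2 * j)" by (simp add: chi_mult power2_eq_square)
    then have 1: "chi m * chi a = chi (2 * j)" using X chi_square by simp
    have "even m \<longleftrightarrow> even b" using p_odd by (simp add: m_def)
    then have "even (nat \<bar>m\<bar>) \<longleftrightarrow> even b" by (simp add: even_nat_iff)
    then have 2: "e ^ nat \<bar>m\<bar> = (if even b then 1 else e)" using e by (elim disjE) simp_all
    have "?k (m, a) = e ^ nat \<bar>m\<bar> * m * (chi m * chi a)" by simp
    also have "\<dots> = ?g x" unfolding 1 2 xe by (simp add: m_def)
    finally show "?k (?\<phi> x) = ?g x" unfolding xe m_def by simp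
  qed
  also have "\<dots> = (\<Sum>y\<in>?Y. ?k y)"
    by (rule sum.mono_neutral_left[OF finY]) (auto simp: chi_zero)
  also have "\<dots> = wall_sum e"
    unfolding wall_sum_def divisor_sum_def sum_distrib_left
    by (subst sum.Sigma) (use finite_wall_range finD in \<open>auto simp: case_prod_unfold\<close>)
  finally show ?thesis .
qed

end

section \<open>The eta products\<close>

lemma norm_exp_i_pi: "norm (exp (\<i> * pi * z)) = exp (- pi * Im z)"
  by (simp add: norm_exp_eq_Re)

text \<open>The variable is \<open>exp (i pi z)\<close>, of period 2, since \<open>eta_form8\<close>
  is an odd function of it. The zero at the origin allows division by the variable, so the primitive
  is again a function on the disc, without a logarithm.\<close>

lemma disc_primitive:
  assumes hol: "\<phi> holomorphic_on ball 0 1" and 0: "\<phi> 0 = 0"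
  obtains \<psi> where "\<psi> holomorphic_on ball 0 1" "\<psi> 0 = 0"
    "\<And>z. Im z > 0 \<Longrightarrow> ((\<lambda>z. \<psi> (exp (\<i> * pi * z))) has_field_derivative \<phi> (exp (\<i> * pi * z))) (at z)"
proof -
  define g where "g = (\<lambda>z. if z = 0 then deriv \<phi> 0 else (\<phi> z - \<phi> 0) / (z - 0))"
  have "g holomorphic_on ball 0 1" unfolding g_def by (rule pole_lemma_open[OF hol]) simp
  then have "(\<lambda>z. g z / (\<i> * pi)) holomorphic_on ball 0 1" by (intro holomorphic_intros) auto
  then obtain p where p: "\<And>x. x \<in> ball 0 1 \<Longrightarrow> (p has_field_derivative g x / (\<i> * pi)) (at x within ball 0 1)"
    using holomorphic_convex_primitive'[of "ball 0 1" "\<lambda>z. g z / (\<i> * pi)"] by auto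
  have p': "(p has_field_derivative g x / (\<i> * pi)) (at x)" if "x \<in> ball 0 1" for x
    using p[OF that] that by (simp add: at_within_open[of _ "ball 0 1"])
  let ?\<psi> = "\<lambda>z. p z - p 0"
  have "?\<psi> holomorphic_on ball 0 1"
  proof (intro holomorphic_on_diff holomorphic_on_const)
    show "p holomorphic_on ball 0 1" unfolding holomorphic_on_def field_differentiable_def using p by blast
  qed
  moreover have "((\<lambda>z. ?\<psi> (exp (\<i> * pi * z))) has_field_derivative \<phi> (exp (\<i> * pi * z))) (at z)" if z: "Im z > 0" for z
  proof -
    let ?Z = "exp (\<i> * pi * z)"
    have Z: "?Z \<in> ball 0 1" using z by (simp add: norm_exp_i_pi)
    have e: "((\<lambda>z. exp (\<i> * pi * z)) has_field_derivative ?Z * (\<i> * pi)) (at z)"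
      by (auto intro!: derivative_eq_intros)
    have "((\<lambda>z. p (exp (\<i> * pi * z))) has_field_derivative g ?Z / (\<i> * pi) * (?Z * (\<i> * pi))) (at z)"
      by (rule DERIV_chain2[OF p'[OF Z] e])
    then have "((\<lambda>z. ?\<psi> (exp (\<i> * pi * z))) has_field_derivative g ?Z / (\<i> * pi) * (?Z * (\<i> * pi)) - 0) (at z)"
      by (intro DERIV_diff DERIV_const)
    moreover have "g ?Z / (\<i> * pi) * (?Z * (\<i> * pi)) - 0 = \<phi> ?Z" by (simp add: g_def 0)
    ultimately show ?thesis by simp
  qed
  ultimately show ?thesis using that[of ?\<psi>] by simp
qed

lemma disc_decay:
  assumes hol: "\<phi> holomorphic_on ball 0 1" and 0: "\<phi> 0 = 0"
  obtains K where "\<And>z. Im z \<ge> 1 \<Longrightarrow> norm (\<phi> (exp (\<i> * pi * z))) \<le> K * exp (- pi * Im z)"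
proof -
  define g where "g = (\<lambda>z. if z = 0 then deriv \<phi> 0 else (\<phi> z - \<phi> 0) / (z - 0))"
  have g: "g holomorphic_on ball 0 1" unfolding g_def by (rule pole_lemma_open[OF hol]) simp
  let ?C = "cball (0::complex) (exp (- pi))"
  have sub: "?C \<subseteq> ball 0 1" by auto (meson le_less_trans less_le_trans exp_less_one_iff neg_less_0_iff_less pi_gt_zero)
  have "continuous_on ?C g" using holomorphic_on_imp_continuous_on[OF g] sub continuous_on_subset by blast
  then have "compact (g ` ?C)" by (intro compact_continuous_image) auto
  then obtain K where K: "\<And>z. z \<in> ?C \<Longrightarrow> norm (g z) \<le> K"
    using compact_imp_bounded[of "g ` ?C"] unfolding bounded_iff by blast
  have "norm (\<phi> (exp (\<i> * pi * z))) \<le> K * exp (- pi * Im z)" if z: "Im z \<ge> 1" for z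
  proof -
    let ?Z = "exp (\<i> * pi * z)"
    have n: "norm ?Z = exp (- pi * Im z)" by (rule norm_exp_i_pi)
    have "exp (- pi * Im z) \<le> exp (- pi)" using z by simp
    then have "?Z \<in> ?C" using n by simp
    moreover have "\<phi> ?Z = g ?Z * ?Z" by (simp add: g_def 0)
    ultimately show ?thesis unfolding n[symmetric] by (simp add: norm_mult mult_right_mono K)
  qed
  then show ?thesis using that by blast
qed

lemma disc_primitives3:
  assumes hol: "\<phi> holomorphic_on ball 0 1" and 0: "\<phi> 0 = 0" and f: "\<And>z. f z = \<phi> (exp (\<i> * pi * z))"
  obtains F1 F2 F3 K where
    "\<And>z. Im z > 0 \<Longrightarrow> (F1 has_field_derivative f z) (at z)"
    "\<And>z. Im z > 0 \<Longrightarrow> (F2 has_field_derivative F1 z) (at z)"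
    "\<And>z. Im z > 0 \<Longrightarrow> (F3 has_field_derivative F2 z) (at z)"
    "\<And>z. Im z \<ge> 1 \<Longrightarrow> norm (F1 z) \<le> K * exp (- pi * Im z)"
    "\<And>z. Im z \<ge> 1 \<Longrightarrow> norm (F2 z) \<le> K * exp (- pi * Im z)"
    "\<And>z. Im z \<ge> 1 \<Longrightarrow> norm (F3 z) \<le> K * exp (- pi * Im z)"
    "\<And>z. F1 (z + 2) = F1 z" "\<And>z. F2 (z + 2) = F2 z"
proof -
  obtain a where a: "a holomorphic_on ball 0 1" "a 0 = 0"
    "\<And>z. Im z > 0 \<Longrightarrow> ((\<lambda>z. a (exp (\<i> * pi * z))) has_field_derivative \<phi> (exp (\<i> * pi * z))) (at z)"
    using disc_primitive[OF hol 0] by blast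
  obtain b where b: "b holomorphic_on ball 0 1" "b 0 = 0"
    "\<And>z. Im z > 0 \<Longrightarrow> ((\<lambda>z. b (exp (\<i> * pi * z))) has_field_derivative a (exp (\<i> * pi * z))) (at z)"
    using disc_primitive[OF a(1,2)] by blast
  obtain c where c: "c holomorphic_on ball 0 1" "c 0 = 0"
    "\<And>z. Im z > 0 \<Longrightarrow> ((\<lambda>z. c (exp (\<i> * pi * z))) has_field_derivative b (exp (\<i> * pi * z))) (at z)"
    using disc_primitive[OF b(1,2)] by blast
  obtain Ka where Ka: "\<And>z. Im z \<ge> 1 \<Longrightarrow> norm (a (exp (\<i> * pi * z))) \<le> Ka * exp (- pi * Im z)" using disc_decay[OF a(1,2)] by blast
  obtain Kb where Kb: "\<And>z. Im z \<ge> 1 \<Longrightarrow> norm (b (exp (\<i> * pi * z))) \<le> Kb * exp (- pi * Im z)" using disc_decay[OF b(1,2)] by blast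
  obtain Kc where Kc: "\<And>z. Im z \<ge> 1 \<Longrightarrow> norm (c (exp (\<i> * pi * z))) \<le> Kc * exp (- pi * Im z)" using disc_decay[OF c(1,2)] by blast
  have per: "exp (\<i> * pi * (z + 2)) = exp (\<i> * pi * z)" for z
  proof -
    have "\<i> * pi * (z + 2) = \<i> * pi * z + 2 * of_real pi * \<i>" by (simp add: algebra_simps)
    then show ?thesis by (simp only: exp_add exp_two_pi_i mult_1_right)
  qed
  let ?K = "max Ka (max Kb Kc)"
  have m: "x * exp (- pi * y) \<le> ?K * exp (- pi * y)" if "x \<le> ?K" for x y by (rule mult_right_mono[OF that]) simp
  show ?thesis
  proof (rule that[of "\<lambda>z. a (exp (\<i> * pi * z))" "\<lambda>z. b (exp (\<i> * pi * z))" "\<lambda>z. c (exp (\<i> * pi * z))" ?K])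
    show "norm (a (exp (\<i> * pi * z))) \<le> ?K * exp (- pi * Im z)" if "Im z \<ge> 1" for z using order.trans[OF Ka[OF that] m] by simp
    show "norm (b (exp (\<i> * pi * z))) \<le> ?K * exp (- pi * Im z)" if "Im z \<ge> 1" for z using order.trans[OF Kb[OF that] m] by simp
    show "norm (c (exp (\<i> * pi * z))) \<le> ?K * exp (- pi * Im z)" if "Im z \<ge> 1" for z using order.trans[OF Kc[OF that] m] by simp
  qed (use a(3) b(3) c(3) f per in auto)
qed

lemma i_mult_i_mult: "\<i> * (\<i> * x) = - x" by (simp flip: mult.assoc)

lemma Im_inverse_pos:
  assumes "Im z > 0"
  shows "Im (- 1 / z) > 0"
proof -
  have "0 < (Re z)\<^sup>2 + (Im z)\<^sup>2" using sum_squares_Im_pos[OF assms] by simp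
  then show ?thesis using assms by (simp add: Im_divide)
qed

text \<open>The multiplier of \<open>eta2\<close> under \<open>z + 1\<close>, a twelfth root of
  unity.\<close>

definition "omega = exp (\<i> * pi / 6)"

lemma omega_powers: "omega ^ 3 = \<i>" "omega ^ 6 = -1" "omega ^ 12 = 1"
proof -
  have "omega ^ 3 = exp (of_nat 3 * (\<i> * pi / 6))" unfolding omega_def by (rule exp_of_nat_mult[symmetric])
  also have "of_nat 3 * (\<i> * pi / 6) = \<i> * of_real (pi / 2)" by simp
  also have "exp \<dots> = \<i>" using cis_conv_exp[of "pi / 2"] by simp
  finally show 3: "omega ^ 3 = \<i>" .
  have "omega ^ 6 = omega ^ 3 * omega ^ 3" by (simp flip: power_add)
  then show 6: "omega ^ 6 = -1" unfolding 3 by simp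
  have "omega ^ 12 = omega ^ 6 * omega ^ 6" by (simp flip: power_add)
  then show "omega ^ 12 = 1" unfolding 6 by simp
qed

lemma eta2_add_nat: "eta2 (z + of_nat n) = omega ^ n * eta2 z"
proof (induction n)
  case (Suc n)
  have "eta2 (z + of_nat (Suc n)) = eta2 ((z + of_nat n) + 1)" by (simp add: add_ac)
  also have "\<dots> = omega * (omega ^ n * eta2 z)" unfolding eta2_T Suc.IH omega_def ..
  finally show ?case by simp
qed simp

lemma eta2_S_scaled:
  assumes "Im z > 0" "k > 0"
  shows "eta2 (- 1 / (of_real k * z)) = - \<i> * (of_real k * z) * eta2 (of_real k * z)"
  by (rule eta2_S) (use assms in simp)

lemma euler_prod_cnj:
  assumes "norm q < 1"
  shows "euler_prod (cnj q) = cnj (euler_prod q)"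
proof (rule LIMSEQ_unique)
  show "(\<lambda>n. \<Prod>k<n. 1 - cnj q ^ Suc k) \<longlonglongrightarrow> euler_prod (cnj q)" by (rule euler_prod_LIMSEQ) (use assms in simp)
  have "(\<lambda>n. cnj (\<Prod>k<n. 1 - q ^ Suc k)) \<longlonglongrightarrow> cnj (euler_prod q)" by (intro tendsto_cnj euler_prod_LIMSEQ assms)
  then show "(\<lambda>n. \<Prod>k<n. 1 - cnj q ^ Suc k) \<longlonglongrightarrow> cnj (euler_prod q)" by simp
qed

lemma eta2_cnj:
  assumes z: "Im z > 0"
  shows "eta2 (- cnj z) = cnj (eta2 z)"
proof -
  have "exp (2 * \<i> * pi * (- cnj z)) = cnj (exp (2 * \<i> * pi * z))" by (simp add: exp_cnj)
  moreover have "exp (\<i> * pi * (- cnj z) / 6) = cnj (exp (\<i> * pi * z / 6))" by (simp add: exp_cnj)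
  ultimately show ?thesis unfolding eta2_def using euler_prod_cnj[OF norm_q_less_1[OF z]] by simp
qed

definition eta_form :: "complex \<Rightarrow> complex" where
  "eta_form z = eta2 z * eta2 (2 * z) * eta2 (3 * z) * eta2 (6 * z)"

text \<open>With \<open>2z\<close> in place of \<open>z\<close> this is the newform of weight 4 and
  level 8; in the present variable it has period 2 and changes sign under
  \<open>z + 1\<close>.\<close>

definition eta_form8 :: "complex \<Rightarrow> complex" where
  "eta_form8 z = (eta2 z * eta2 (2 * z))\<^sup>2"

text \<open>The coefficient 9 makes the two summands exchange places when \<open>z\<close> becomes
  \<open>-1/(6z)\<close>: \<open>eta_form8\<close> then takes the value
  \<open>36 * 9 z^4 eta_form8 (3z)\<close>.\<close>

definition eta_form24 :: "complex \<Rightarrow> complex" where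
  "eta_form24 z = eta_form8 z + 9 * eta_form8 (3 * z)"

lemma eta_form_T: "eta_form (z + 1) = eta_form z"
proof -
  have "eta_form (z + 1) = omega ^ 12 * eta_form z"
    using eta2_add_nat[of z 1] eta2_add_nat[of "2 * z" 2] eta2_add_nat[of "3 * z" 3] eta2_add_nat[of "6 * z" 6]
    unfolding eta_form_def by (simp add: distrib_left) (simp add: power_numeral_reduce)
  then show ?thesis by (simp add: omega_powers)
qed

lemma eta_form8_T: "eta_form8 (z + 1) = - eta_form8 z"
proof -
  have "eta_form8 (z + 1) = omega ^ 6 * eta_form8 z"
    using eta2_add_nat[of z 1] eta2_add_nat[of "2 * z" 2]
    unfolding eta_form8_def by (simp add: distrib_left) (simp add: power_numeral_reduce)
  then show ?thesis by (simp add: omega_powers)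
qed

lemma eta_form_S:
  assumes z: "Im z > 0"
  shows "eta_form (- 1 / (6 * z)) = 36 * z ^ 4 * eta_form z"
proof -
  have z0: "z \<noteq> 0" using z by auto
  have a: "2 * (- 1 / (6 * z)) = - 1 / (3 * z)" "3 * (- 1 / (6 * z)) = - 1 / (2 * z)" "6 * (- 1 / (6 * z)) = - 1 / z"
    using z0 by (simp_all add: field_simps)
  note s = eta2_S_scaled[OF z, of 6] eta2_S_scaled[OF z, of 3] eta2_S_scaled[OF z, of 2] eta2_S[OF z]
  have "eta_form (- 1 / (6 * z)) = (- \<i> * (6 * z) * eta2 (6 * z)) * (- \<i> * (3 * z) * eta2 (3 * z)) * (- \<i> * (2 * z) * eta2 (2 * z)) * (- \<i> * z * eta2 z)"
    unfolding eta_form_def a using s by simp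
  also have "\<dots> = 36 * z ^ 4 * eta_form z" unfolding eta_form_def
    by (simp add: power4_eq_xxxx mult_ac i_mult_i_mult)
  finally show ?thesis .
qed

lemma eta_form8_S:
  assumes z: "Im z > 0"
  shows "eta_form8 (- 1 / (2 * z)) = 4 * z ^ 4 * eta_form8 z"
proof -
  have z0: "z \<noteq> 0" using z by auto
  have a: "2 * (- 1 / (2 * z)) = - 1 / z" using z0 by (simp add: field_simps)
  have "eta_form8 (- 1 / (2 * z)) = ((- \<i> * (2 * z) * eta2 (2 * z)) * (- \<i> * z * eta2 z))\<^sup>2"
    unfolding eta_form8_def a using eta2_S_scaled[OF z, of 2] eta2_S[OF z] by simp
  also have "\<dots> = 4 * z ^ 4 * eta_form8 z" unfolding eta_form8_def
    by (simp add: power4_eq_xxxx power2_eq_square mult_ac i_mult_i_mult)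
  finally show ?thesis .
qed

text \<open>The roots of unity from \<open>eta2_half\<close> and the translations multiply to -1.
  The remaining eta quotient is positive on the imaginary axis, and its arguments are permuted when
  \<open>z\<close> becomes \<open>-1/(12z)\<close>; both the sign on \<open>Re z = 1/2\<close> and
  the law at 1/2 follow.\<close>

lemma eta_form_half:
  assumes z: "Im z > 0"
  shows "eta_form (1 / 2 + z) = - ((eta2 (2 * z) * eta2 (6 * z)) ^ 4 / (eta2 z * eta2 (4 * z) * (eta2 (3 * z) * eta2 (12 * z))))"
proof -
  define v where "v = exp (\<i> * pi / 12)"
  have v2: "v * v = omega" unfolding v_def omega_def by (simp flip: exp_add)
  have z3: "Im (3 * z) > 0" using z by simp
  have 1: "eta2 (1 / 2 + z) = v * eta2 (2 * z) ^ 3 / (eta2 z * eta2 (4 * z))"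
    using eta2_half[OF z] unfolding v_def by (simp add: add.commute)
  have 2: "eta2 (2 * (1 / 2 + z)) = omega * eta2 (2 * z)"
    using eta2_add_nat[of "2 * z" 1] by (simp add: distrib_left add.commute)
  have "eta2 (3 * (1 / 2 + z)) = eta2 ((3 * z + 1 / 2) + of_nat 1)" by (rule arg_cong[of _ _ eta2]) (simp add: field_simps)
  also have "\<dots> = omega * (v * eta2 (6 * z) ^ 3 / (eta2 (3 * z) * eta2 (12 * z)))"
    unfolding eta2_add_nat using eta2_half[OF z3] unfolding v_def by simp
  finally have 3: "eta2 (3 * (1 / 2 + z)) = omega * (v * eta2 (6 * z) ^ 3 / (eta2 (3 * z) * eta2 (12 * z)))" .
  have 6: "eta2 (6 * (1 / 2 + z)) = omega ^ 3 * eta2 (6 * z)"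
    using eta2_add_nat[of "6 * z" 3] by (simp add: distrib_left add.commute)
  have c: "(v * v) * omega * omega * omega ^ 3 = -1"
    unfolding v2 using omega_powers(2) by (simp add: power_numeral_reduce mult.assoc)
  have "eta_form (1 / 2 + z) = ((v * v) * omega * omega * omega ^ 3) * ((eta2 (2 * z) * eta2 (6 * z)) ^ 4 / (eta2 z * eta2 (4 * z) * (eta2 (3 * z) * eta2 (12 * z))))"
    unfolding eta_form_def 1 2 3 6 by (simp add: power_numeral_reduce mult_ac)
  then show ?thesis unfolding c by simp
qed

lemma eta_form_half_S:
  assumes z: "Im z > 0"
  shows "eta_form (1 / 2 - 1 / (12 * z)) = 144 * z ^ 4 * eta_form (1 / 2 + z)"
proof -
  have z0: "z \<noteq> 0" using z by auto
  define w where "w = - 1 / (12 * z)"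
  have "w = - 1 / (of_real 12 * z)" by (simp add: w_def)
  have "Im (12 * z) > 0" using z by simp
  then have w: "Im w > 0" unfolding w_def using Im_inverse_pos[of "12 * z"] by simp
  have a: "2 * w = - 1 / (6 * z)" "6 * w = - 1 / (2 * z)" "4 * w = - 1 / (3 * z)" "3 * w = - 1 / (4 * z)" "12 * w = - 1 / z"
    using z0 by (simp_all add: w_def field_simps)
  have s: "eta2 (2 * w) = - \<i> * (6 * z) * eta2 (6 * z)" "eta2 (6 * w) = - \<i> * (2 * z) * eta2 (2 * z)"
    "eta2 w = - \<i> * (12 * z) * eta2 (12 * z)" "eta2 (4 * w) = - \<i> * (3 * z) * eta2 (3 * z)"
    "eta2 (3 * w) = - \<i> * (4 * z) * eta2 (4 * z)" "eta2 (12 * w) = - \<i> * z * eta2 z"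
    unfolding a unfolding w_def
    using eta2_S_scaled[OF z, of 6] eta2_S_scaled[OF z, of 2] eta2_S_scaled[OF z, of 12] eta2_S_scaled[OF z, of 3] eta2_S_scaled[OF z, of 4] eta2_S[OF z]
    by simp_all
  let ?n = "(eta2 (2 * z) * eta2 (6 * z)) ^ 4" and ?d = "eta2 z * eta2 (4 * z) * (eta2 (3 * z) * eta2 (12 * z))"
  have n: "(eta2 (2 * w) * eta2 (6 * w)) ^ 4 = 12 ^ 4 * z ^ 8 * ?n"
    unfolding s by (simp add: power_numeral_reduce mult_ac i_mult_i_mult)
  have d: "eta2 w * eta2 (4 * w) * (eta2 (3 * w) * eta2 (12 * w)) = 144 * z ^ 4 * ?d"
    unfolding s by (simp add: power_numeral_reduce mult_ac i_mult_i_mult)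
  have "eta_form (1 / 2 - 1 / (12 * z)) = eta_form (1 / 2 + w)" by (simp add: w_def)
  also have "\<dots> = - (12 ^ 4 * z ^ 8 * ?n / (144 * z ^ 4 * ?d))" unfolding eta_form_half[OF w] n d ..
  also have "12 ^ 4 * z ^ 8 * ?n / (144 * z ^ 4 * ?d) = 144 * z ^ 4 * (?n / ?d)"
  proof -
    have "(144 * z ^ 4) * (144 * z ^ 4 * ?n) / ((144 * z ^ 4) * ?d) = 144 * z ^ 4 * ?n / ?d" by (rule mult_divide_mult_cancel_left) (use z0 in simp)
    moreover have "(144 * z ^ 4) * (144 * z ^ 4 * ?n) = 12 ^ 4 * z ^ 8 * ?n" by (simp add: power_numeral_reduce mult_ac)
    ultimately show ?thesis by simp
  qed
  finally show ?thesis unfolding eta_form_half[OF z] by simp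
qed

lemma eta_form8_half:
  assumes z: "Im z > 0"
  shows "eta_form8 (1 / 2 + z) = \<i> * (eta2 (2 * z) ^ 8 / (eta2 z * eta2 (4 * z))\<^sup>2)"
proof -
  define v where "v = exp (\<i> * pi / 12)"
  have v2: "v * v = omega" unfolding v_def omega_def by (simp flip: exp_add)
  have 1: "eta2 (1 / 2 + z) = v * eta2 (2 * z) ^ 3 / (eta2 z * eta2 (4 * z))"
    using eta2_half[OF z] unfolding v_def by (simp add: add.commute)
  have 2: "eta2 (2 * (1 / 2 + z)) = omega * eta2 (2 * z)"
    using eta2_add_nat[of "2 * z" 1] by (simp add: distrib_left add.commute)
  have c: "(v * v) * (omega * omega) = \<i>" unfolding v2 using omega_powers(1) by (simp add: power3_eq_cube mult.assoc)
  have "eta_form8 (1 / 2 + z) = ((v * v) * (omega * omega)) * (eta2 (2 * z) ^ 8 / (eta2 z * eta2 (4 * z))\<^sup>2)"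
    unfolding eta_form8_def 1 2 by (simp add: power2_eq_square power_numeral_reduce mult_ac)
  then show ?thesis unfolding c .
qed

lemma eta_form8_half_S:
  assumes z: "Im z > 0"
  shows "eta_form8 (1 / 2 - 1 / (4 * z)) = 16 * z ^ 4 * eta_form8 (1 / 2 + z)"
proof -
  have z0: "z \<noteq> 0" using z by auto
  define w where "w = - 1 / (4 * z)"
  have "Im (4 * z) > 0" using z by simp
  then have w: "Im w > 0" unfolding w_def using Im_inverse_pos[of "4 * z"] by simp
  have a: "2 * w = - 1 / (2 * z)" "4 * w = - 1 / z" using z0 by (simp_all add: w_def field_simps)
  have s: "eta2 (2 * w) = - \<i> * (2 * z) * eta2 (2 * z)" "eta2 w = - \<i> * (4 * z) * eta2 (4 * z)" "eta2 (4 * w) = - \<i> * z * eta2 z"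
    unfolding a unfolding w_def using eta2_S_scaled[OF z, of 2] eta2_S_scaled[OF z, of 4] eta2_S[OF z] by simp_all
  let ?n = "eta2 (2 * z) ^ 8" and ?d = "(eta2 z * eta2 (4 * z))\<^sup>2"
  have n: "eta2 (2 * w) ^ 8 = 256 * z ^ 8 * ?n" unfolding s by (simp add: power_numeral_reduce mult_ac i_mult_i_mult)
  have d: "(eta2 w * eta2 (4 * w))\<^sup>2 = 16 * z ^ 4 * ?d"
    unfolding s by (simp add: power_numeral_reduce mult_ac i_mult_i_mult)
  have "eta_form8 (1 / 2 - 1 / (4 * z)) = eta_form8 (1 / 2 + w)" by (simp add: w_def)
  also have "\<dots> = \<i> * (256 * z ^ 8 * ?n / (16 * z ^ 4 * ?d))" unfolding eta_form8_half[OF w] n d ..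
  also have "256 * z ^ 8 * ?n / (16 * z ^ 4 * ?d) = 16 * z ^ 4 * (?n / ?d)"
  proof -
    have "(16 * z ^ 4) * (16 * z ^ 4 * ?n) / ((16 * z ^ 4) * ?d) = 16 * z ^ 4 * ?n / ?d" by (rule mult_divide_mult_cancel_left) (use z0 in simp)
    moreover have "(16 * z ^ 4) * (16 * z ^ 4 * ?n) = 256 * z ^ 8 * ?n" by (simp add: power_numeral_reduce mult_ac)
    ultimately show ?thesis by simp
  qed
  finally show ?thesis unfolding eta_form8_half[OF z] by simp
qed

lemma eta_form24_T: "eta_form24 (z + 1) = - eta_form24 z"
proof -
  have "eta_form8 (3 * (z + 1)) = eta_form8 (((3 * z + 1) + 1) + 1)" by (rule arg_cong[of _ _ eta_form8]) simp
  also have "\<dots> = - eta_form8 (3 * z)" unfolding eta_form8_T by simp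
  finally show ?thesis unfolding eta_form24_def eta_form8_T by simp
qed

lemma eta_form24_S:
  assumes z: "Im z > 0"
  shows "eta_form24 (- 1 / (6 * z)) = 36 * z ^ 4 * eta_form24 z"
proof -
  have z0: "z \<noteq> 0" using z by auto
  have z3: "Im (3 * z) > 0" using z by simp
  have a: "- 1 / (6 * z) = - 1 / (2 * (3 * z))" "3 * (- 1 / (2 * (3 * z))) = - 1 / (2 * z)" using z0 by (simp_all add: field_simps)
  show ?thesis unfolding eta_form24_def a eta_form8_S[OF z] eta_form8_S[OF z3]
    by (simp add: power_mult_distrib algebra_simps)
qed

lemma eta_form8_half3: "eta_form8 (3 * (1 / 2 + z)) = - eta_form8 (1 / 2 + 3 * z)"
proof -
  have "3 * (1 / 2 + z) = (1 / 2 + 3 * z) + 1" by simp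
  then show ?thesis by (simp only: eta_form8_T)
qed

text \<open>The two summands exchange places, and each picks up a minus sign from
  \<open>3 (1/2 + z) = (1/2 + 3z) + 1\<close>, because \<open>eta_form8\<close> changes sign under
  translation by 1.\<close>

lemma eta_form24_half_S:
  assumes z: "Im z > 0"
  shows "eta_form24 (1 / 2 - 1 / (12 * z)) = - (144 * z ^ 4 * eta_form24 (1 / 2 + z))"
proof -
  have z0: "z \<noteq> 0" using z by auto
  have z3: "Im (3 * z) > 0" using z by simp
  have a: "- 1 / (12 * z) = - 1 / (4 * (3 * z))" "3 * (- 1 / (4 * (3 * z))) = - 1 / (4 * z)" using z0 by (simp_all add: field_simps)
  have b: "1 / 2 - 1 / (12 * z) = 1 / 2 + (- 1 / (12 * z))" by simp
  have 1: "eta_form8 (1 / 2 + - 1 / (4 * (3 * z))) = 16 * (3 * z) ^ 4 * eta_form8 (1 / 2 + 3 * z)" using eta_form8_half_S[OF z3] by simp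
  have 2: "eta_form8 (1 / 2 + - 1 / (4 * z)) = 16 * z ^ 4 * eta_form8 (1 / 2 + z)" using eta_form8_half_S[OF z] by simp
  show ?thesis unfolding b eta_form24_def eta_form8_half3 a 1 2
    by (simp add: power_mult_distrib algebra_simps)
qed

lemma eta2_scaled_cnj:
  assumes "Im z > 0" "k > 0"
  shows "eta2 (of_real k * (- cnj z)) = cnj (eta2 (of_real k * z))"
  using eta2_cnj[of "of_real k * z"] assms by simp

lemma eta_form_cnj:
  assumes z: "Im z > 0"
  shows "eta_form (- cnj z) = cnj (eta_form z)"
  using eta2_cnj[OF z] eta2_scaled_cnj[OF z, of 2] eta2_scaled_cnj[OF z, of 3] eta2_scaled_cnj[OF z, of 6]
  unfolding eta_form_def by simp

lemma eta_form8_cnj: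
  assumes z: "Im z > 0"
  shows "eta_form8 (- cnj z) = cnj (eta_form8 z)"
  using eta2_cnj[OF z] eta2_scaled_cnj[OF z, of 2]
  unfolding eta_form8_def by simp

lemma eta_form24_cnj:
  assumes z: "Im z > 0"
  shows "eta_form24 (- cnj z) = cnj (eta_form24 z)"
proof -
  have z3: "Im (3 * z) > 0" using z by simp
  have "3 * (- cnj z) = - cnj (3 * z)" by simp
  then show ?thesis unfolding eta_form24_def by (simp only: eta_form8_cnj[OF z] eta_form8_cnj[OF z3]) simp
qed

lemma eta2_imag_axis_pos:
  assumes "t > 0" "k > 0"
  obtains x where "x > 0" "eta2 (of_real k * (\<i> * of_real t)) = of_real x"
proof
  show "exp (- pi * (k * t) / 6 - 2 * lambert (k * t)) > 0" by simp
  have "of_real k * (\<i> * of_real t) = \<i> * complex_of_real (k * t)" by simp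
  then show "eta2 (of_real k * (\<i> * of_real t)) = of_real (exp (- pi * (k * t) / 6 - 2 * lambert (k * t)))"
    using eta2_imag_axis[of "k * t"] assms by (simp only: ) simp
qed

lemma eta_form_pos:
  assumes t: "t > 0"
  shows "Re (eta_form (\<i> * of_real t)) > 0"
proof -
  obtain a where a: "a > 0" "eta2 (of_real 1 * (\<i> * of_real t)) = of_real a" using eta2_imag_axis_pos[OF t, of 1] by auto
  obtain b where b: "b > 0" "eta2 (of_real 2 * (\<i> * of_real t)) = of_real b" using eta2_imag_axis_pos[OF t, of 2] by auto
  obtain c where c: "c > 0" "eta2 (of_real 3 * (\<i> * of_real t)) = of_real c" using eta2_imag_axis_pos[OF t, of 3] by auto
  obtain d where d: "d > 0" "eta2 (of_real 6 * (\<i> * of_real t)) = of_real d" using eta2_imag_axis_pos[OF t, of 6] by auto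
  have "eta_form (\<i> * of_real t) = of_real (a * b * c * d)" unfolding eta_form_def using a b c d by simp
  then show ?thesis using a b c d by (simp del: of_real_mult)
qed

lemma eta_form8_pos:
  assumes t: "t > 0"
  shows "Re (eta_form8 (\<i> * of_real t)) > 0"
proof -
  obtain a where a: "a > 0" "eta2 (of_real 1 * (\<i> * of_real t)) = of_real a" using eta2_imag_axis_pos[OF t, of 1] by auto
  obtain b where b: "b > 0" "eta2 (of_real 2 * (\<i> * of_real t)) = of_real b" using eta2_imag_axis_pos[OF t, of 2] by auto
  have "eta_form8 (\<i> * of_real t) = of_real ((a * b)\<^sup>2)" unfolding eta_form8_def using a b by simp
  then show ?thesis using a b by (simp del: of_real_mult of_real_power)
qed

lemma eta_form24_pos:
  assumes t: "t > 0"
  shows "Re (eta_form24 (\<i> * of_real t)) > 0"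
proof -
  have "3 * (\<i> * of_real t) = \<i> * complex_of_real (3 * t)" by simp
  then show ?thesis using eta_form8_pos[OF t] eta_form8_pos[of "3 * t"] t unfolding eta_form24_def by (simp only:) simp
qed

lemma eta_form_half_neg:
  assumes t: "t > 0"
  shows "Re (eta_form (1 / 2 + \<i> * of_real t)) \<le> 0"
proof -
  obtain a where a: "a > 0" "eta2 (of_real 1 * (\<i> * of_real t)) = of_real a" using eta2_imag_axis_pos[OF t, of 1] by auto
  obtain b where b: "b > 0" "eta2 (of_real 2 * (\<i> * of_real t)) = of_real b" using eta2_imag_axis_pos[OF t, of 2] by auto
  obtain c where c: "c > 0" "eta2 (of_real 3 * (\<i> * of_real t)) = of_real c" using eta2_imag_axis_pos[OF t, of 3] by auto
  obtain d where d: "d > 0" "eta2 (of_real 6 * (\<i> * of_real t)) = of_real d" using eta2_imag_axis_pos[OF t, of 6] by auto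
  obtain x where x: "x > 0" "eta2 (of_real 4 * (\<i> * of_real t)) = of_real x" using eta2_imag_axis_pos[OF t, of 4] by auto
  obtain y where y: "y > 0" "eta2 (of_real 12 * (\<i> * of_real t)) = of_real y" using eta2_imag_axis_pos[OF t, of 12] by auto
  have "Im (\<i> * of_real t) > 0" using t by simp
  from eta_form_half[OF this] have "eta_form (1 / 2 + \<i> * of_real t) = of_real (- ((b * d) ^ 4 / (a * x * (c * y))))"
    using a b c d x y by simp
  then have "Re (eta_form (1 / 2 + \<i> * of_real t)) = - ((b * d) ^ 4 / (a * x * (c * y)))" by (simp only: Re_complex_of_real)
  moreover have "(b * d) ^ 4 / (a * x * (c * y)) > 0" using a b c d x y by simp
  ultimately show ?thesis by simp
qed

lemma euler_prod_power_holomorphic: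
  assumes "k > 0"
  shows "(\<lambda>Z. euler_prod (Z ^ k)) holomorphic_on ball 0 1"
proof -
  have "norm (Z ^ k) < 1" if "norm Z < 1" for Z :: complex
    using power_less_one_iff[of "norm Z" k] that assms by (simp add: norm_power)
  then have "euler_prod \<circ> (\<lambda>Z. Z ^ k) holomorphic_on ball 0 1"
    by (intro holomorphic_on_compose_gen[OF _ euler_prod_holomorphic]) (auto intro!: holomorphic_intros)
  then show ?thesis by (simp add: comp_def)
qed

lemma eta2_disc: "eta2 (of_nat k * z) = exp (\<i> * pi * z / 6) ^ k * (euler_prod (exp (\<i> * pi * z) ^ (2 * k)))\<^sup>2"
proof -
  have "exp (\<i> * pi * (of_nat k * z) / 6) = exp (of_nat k * (\<i> * pi * z / 6))" by (simp add: mult_ac)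
  also have "\<dots> = exp (\<i> * pi * z / 6) ^ k" by (rule exp_of_nat_mult)
  finally have 1: "exp (\<i> * pi * (of_nat k * z) / 6) = exp (\<i> * pi * z / 6) ^ k" .
  have "exp (2 * \<i> * pi * (of_nat k * z)) = exp (of_nat (2 * k) * (\<i> * pi * z))" by (simp add: mult_ac)
  also have "\<dots> = exp (\<i> * pi * z) ^ (2 * k)" by (rule exp_of_nat_mult)
  finally show ?thesis unfolding eta2_def 1 by simp
qed

lemma exp_sixth_power: "exp (\<i> * pi * z / 6) ^ 6 = exp (\<i> * pi * z)"
  using exp_of_nat_mult[of 6 "\<i> * pi * z / 6"] by simp

lemma eta_form_disc:
  "\<exists>\<phi>. \<phi> holomorphic_on ball 0 1 \<and> \<phi> 0 = 0 \<and> (\<forall>z. eta_form z = \<phi> (exp (\<i> * pi * z)))"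
proof (intro exI conjI allI)
  let ?\<phi> = "\<lambda>Z. Z\<^sup>2 * (euler_prod (Z ^ 2) * euler_prod (Z ^ 4) * euler_prod (Z ^ 6) * euler_prod (Z ^ 12))\<^sup>2"
  show "?\<phi> holomorphic_on ball 0 1" by (intro holomorphic_intros euler_prod_power_holomorphic) auto
  show "?\<phi> 0 = 0" by simp
  fix z
  let ?u = "exp (\<i> * pi * z / 6)"
  have "eta_form z = ?u ^ 12 * (euler_prod (exp (\<i> * pi * z) ^ 2) * euler_prod (exp (\<i> * pi * z) ^ 4) * euler_prod (exp (\<i> * pi * z) ^ 6) * euler_prod (exp (\<i> * pi * z) ^ 12))\<^sup>2"
    unfolding eta_form_def using eta2_disc[of 1 z] eta2_disc[of 2 z] eta2_disc[of 3 z] eta2_disc[of 6 z]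
    by (simp add: power_mult_distrib) (simp add: power_numeral_reduce mult_ac)
  also have "?u ^ 12 = exp (\<i> * pi * z) ^ 2" using power_mult[of ?u 6 2] by (simp add: exp_sixth_power)
  finally show "eta_form z = ?\<phi> (exp (\<i> * pi * z))" .
qed

lemma eta_form8_disc:
  "\<exists>\<phi>. \<phi> holomorphic_on ball 0 1 \<and> \<phi> 0 = 0 \<and> (\<forall>z. eta_form8 z = \<phi> (exp (\<i> * pi * z)))"
proof (intro exI conjI allI)
  let ?\<phi> = "\<lambda>Z. Z * (euler_prod (Z ^ 2) * euler_prod (Z ^ 4)) ^ 4"
  show "?\<phi> holomorphic_on ball 0 1" by (intro holomorphic_intros euler_prod_power_holomorphic) auto
  show "?\<phi> 0 = 0" by simp
  fix z
  let ?u = "exp (\<i> * pi * z / 6)"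
  have "eta_form8 z = ?u ^ 6 * (euler_prod (exp (\<i> * pi * z) ^ 2) * euler_prod (exp (\<i> * pi * z) ^ 4)) ^ 4"
    unfolding eta_form8_def using eta2_disc[of 1 z] eta2_disc[of 2 z]
    by (simp add: power_mult_distrib power_numeral_reduce mult_ac)
  then show "eta_form8 z = ?\<phi> (exp (\<i> * pi * z))" by (simp add: exp_sixth_power)
qed

lemma eta_form_reflection:
  obtains F1 F2 F3 K where "reflection_form eta_form F1 F2 F3 1 K"
proof -
  obtain \<phi> where "\<phi> holomorphic_on ball 0 1 \<and> \<phi> 0 = 0 \<and> (\<forall>z. eta_form z = \<phi> (exp (\<i> * pi * z)))"
    using eta_form_disc ..
  then have \<phi>: "\<phi> holomorphic_on ball 0 1" "\<phi> 0 = 0" "\<And>z. eta_form z = \<phi> (exp (\<i> * pi * z))" by auto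
  show ?thesis
  proof (rule disc_primitives3[OF \<phi>])
  fix F1 F2 F3 K assume F:
    "\<And>z. Im z > 0 \<Longrightarrow> (F1 has_field_derivative eta_form z) (at z)"
    "\<And>z. Im z > 0 \<Longrightarrow> (F2 has_field_derivative F1 z) (at z)"
    "\<And>z. Im z > 0 \<Longrightarrow> (F3 has_field_derivative F2 z) (at z)"
    "\<And>z. Im z \<ge> 1 \<Longrightarrow> norm (F1 z) \<le> K * exp (- pi * Im z)"
    "\<And>z. Im z \<ge> 1 \<Longrightarrow> norm (F2 z) \<le> K * exp (- pi * Im z)"
    "\<And>z. Im z \<ge> 1 \<Longrightarrow> norm (F3 z) \<le> K * exp (- pi * Im z)"
    "\<And>z. F1 (z + 2) = F1 z" "\<And>z. F2 (z + 2) = F2 z"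
  have "reflection_form eta_form F1 F2 F3 1 K"
    by unfold_locales
      (use F eta_form_cnj eta_form_T eta_form_S eta_form_half_S eta_form_pos eta_form_half_neg in simp_all)
  then show ?thesis by (rule that)
  qed
qed

text \<open>The primitives of \<open>eta_form8\<close> and their period 2 are exported as well,
  since the vanishing argument compares the periods of the two summands. Each integration of the
  summand in \<open>3z\<close> divides its coefficient by 3: 9, 3, 1, 1/3.\<close>

lemma eta_form24_reflection:
  obtains H1 H2 H3 K where
    "\<And>z. Im z > 0 \<Longrightarrow> (H1 has_field_derivative eta_form8 z) (at z)"
    "\<And>z. Im z > 0 \<Longrightarrow> (H2 has_field_derivative H1 z) (at z)"
    "\<And>z. H1 (z + 2) = H1 z" "\<And>z. H2 (z + 2) = H2 z"
    "reflection_form eta_form24 (\<lambda>z. H1 z + 3 * H1 (3 * z)) (\<lambda>z. H2 z + H2 (3 * z)) H3 (-1) K"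
proof -
  obtain \<phi> where "\<phi> holomorphic_on ball 0 1 \<and> \<phi> 0 = 0 \<and> (\<forall>z. eta_form8 z = \<phi> (exp (\<i> * pi * z)))"
    using eta_form8_disc ..
  then have \<phi>: "\<phi> holomorphic_on ball 0 1" "\<phi> 0 = 0" "\<And>z. eta_form8 z = \<phi> (exp (\<i> * pi * z))" by auto
  show ?thesis
  proof (rule disc_primitives3[OF \<phi>])
  fix F1 F2 F3 K assume F:
    "\<And>z. Im z > 0 \<Longrightarrow> (F1 has_field_derivative eta_form8 z) (at z)"
    "\<And>z. Im z > 0 \<Longrightarrow> (F2 has_field_derivative F1 z) (at z)"
    "\<And>z. Im z > 0 \<Longrightarrow> (F3 has_field_derivative F2 z) (at z)"
    "\<And>z. Im z \<ge> 1 \<Longrightarrow> norm (F1 z) \<le> K * exp (- pi * Im z)"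
    "\<And>z. Im z \<ge> 1 \<Longrightarrow> norm (F2 z) \<le> K * exp (- pi * Im z)"
    "\<And>z. Im z \<ge> 1 \<Longrightarrow> norm (F3 z) \<le> K * exp (- pi * Im z)"
    "\<And>z. F1 (z + 2) = F1 z" "\<And>z. F2 (z + 2) = F2 z"
  have "norm (F1 \<i>) \<le> K * exp (- pi)" using F(4)[of \<i>] by simp
  then have "0 \<le> K * exp (- pi)" using norm_ge_zero order_trans by blast
  then have K: "0 \<le> K" by (simp add: zero_le_mult_iff)
  have Fb3: "norm (F (3 * z)) \<le> K * exp (- pi * Im z)"
    if F: "\<And>z. Im z \<ge> 1 \<Longrightarrow> norm (F z) \<le> K * exp (- pi * Im z)" and z: "Im z \<ge> 1" for F :: "complex \<Rightarrow> complex" and z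
  proof -
    have "norm (F (3 * z)) \<le> K * exp (- pi * Im (3 * z))" by (rule F) (use z in simp)
    also have "\<dots> \<le> K * exp (- pi * Im z)" by (rule mult_left_mono[OF _ K]) (use z in simp)
    finally show ?thesis .
  qed
  have tri: "norm (x + of_real c * y) \<le> 4 * K * E" if "norm x \<le> K * E" "norm y \<le> K * E" "0 \<le> c" "c \<le> 3" for x y :: complex and c E
  proof -
    have "norm (x + of_real c * y) \<le> norm x + c * norm y" using norm_triangle_ineq[of x "of_real c * y"] that by (simp add: norm_mult)
    also have "\<dots> \<le> norm x + 3 * norm y" using mult_right_mono[OF that(4), of "norm y"] by simp
    also have "\<dots> \<le> 4 * K * E" using that by simp
    finally show ?thesis .
  qed
  have D3: "((\<lambda>z. F (3 * z)) has_field_derivative 3 * D (3 * z)) (at z)"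
    if "\<And>z. Im z > 0 \<Longrightarrow> (F has_field_derivative D z) (at z)" "Im z > 0" for F D :: "complex \<Rightarrow> complex" and z
  proof -
    have "((\<lambda>z. 3 * z) has_field_derivative 3) (at z)" by (auto intro!: derivative_eq_intros)
    from DERIV_chain2[OF that(1)[of "3 * z"] this] show ?thesis using that(2) by (simp add: mult.commute)
  qed
  have "reflection_form eta_form24 (\<lambda>z. F1 z + 3 * F1 (3 * z)) (\<lambda>z. F2 z + F2 (3 * z)) (\<lambda>z. F3 z + (1 / 3) * F3 (3 * z)) (-1) (4 * K)"
  proof
    show "((\<lambda>z. F1 z + 3 * F1 (3 * z)) has_field_derivative eta_form24 z) (at z)" if z: "Im z > 0" for z
      using DERIV_add[OF F(1)[OF z] DERIV_cmult[OF D3[OF F(1) z], of 3]] by (simp add: eta_form24_def)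
    show "((\<lambda>z. F2 z + F2 (3 * z)) has_field_derivative F1 z + 3 * F1 (3 * z)) (at z)" if z: "Im z > 0" for z
      using DERIV_add[OF F(2)[OF z] D3[OF F(2) z]] by simp
    show "((\<lambda>z. F3 z + (1 / 3) * F3 (3 * z)) has_field_derivative F2 z + F2 (3 * z)) (at z)" if z: "Im z > 0" for z
      using DERIV_add[OF F(3)[OF z] DERIV_cmult[OF D3[OF F(3) z], of "1 / 3"]] by simp
    show "norm (F1 z + 3 * F1 (3 * z)) \<le> 4 * K * exp (- pi * Im z)" if z: "Im z \<ge> 1" for z
      using tri[OF F(4)[OF z] Fb3[OF F(4) z], of 3] by simp
    show "norm (F2 z + F2 (3 * z)) \<le> 4 * K * exp (- pi * Im z)" if z: "Im z \<ge> 1" for z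
      using tri[OF F(5)[OF z] Fb3[OF F(5) z], of 1] by simp
    show "norm (F3 z + (1 / 3) * F3 (3 * z)) \<le> 4 * K * exp (- pi * Im z)" if z: "Im z \<ge> 1" for z
      using tri[OF F(6)[OF z] Fb3[OF F(6) z], of "1 / 3"] by simp
  qed (use eta_form24_cnj eta_form24_T eta_form24_S eta_form24_half_S eta_form24_pos in simp_all)
  with F(1,2,7,8) show ?thesis by (rule that)
  qed
qed

section \<open>Decay at the cusps\<close>

text \<open>Invariant under \<open>z + 1\<close> and \<open>-1/z\<close>, hence under the modular
  group, so that one estimate high in the half-plane controls every cusp.\<close>

definition eta_height :: "complex \<Rightarrow> real" where
  "eta_height z = (norm (eta2 z))\<^sup>2 * Im z"

lemma eta_height_T: "eta_height (z + 1) = eta_height z"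
  by (simp add: eta_height_def eta2_T norm_mult norm_exp_eq_Re)

lemma eta_height_add_nat: "eta_height (z + of_nat n) = eta_height z"
proof (induction n)
  case (Suc n)
  have "eta_height (z + of_nat (Suc n)) = eta_height ((z + of_nat n) + 1)" by (simp add: add_ac)
  then show ?case unfolding eta_height_T Suc.IH .
qed simp

lemma eta_height_add_int: "eta_height (z + of_int k) = eta_height z"
proof (cases "k \<ge> 0")
  case True
  then show ?thesis using eta_height_add_nat[of z "nat k"] by simp
next
  case False
  then show ?thesis using eta_height_add_nat[of "z + of_int k" "nat (- k)"] by simp
qed

lemma Im_minus_inverse: "Im (- 1 / z) = Im z / (norm z)\<^sup>2"
  by (simp add: Im_divide cmod_power2)

lemma eta_height_S:
  assumes z: "Im z > 0"
  shows "eta_height (- 1 / z) = eta_height z"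
proof -
  have "norm z \<noteq> 0" using z by auto
  then show ?thesis unfolding eta_height_def eta2_S[OF z] Im_minus_inverse
    by (simp add: norm_mult power_mult_distrib)
qed

text \<open>Euclid's algorithm on \<open>(c, d)\<close>: the point \<open>w\<close> is the image of
  \<open>z\<close> under a modular matrix with lower row \<open>(c, d)\<close>, up to sign, composed
  of translations by \<open>d div c\<close> and inversions.\<close>

lemma eta_height_cusp:
  fixes c d :: int
  assumes "coprime c d" "Im z > 0"
  shows "\<exists>w. Im w = Im z / (norm (of_int c * z + of_int d))\<^sup>2 \<and> eta_height w = eta_height z"
  using assms
proof (induction "nat \<bar>c\<bar>" arbitrary: c d z rule: less_induct)
  case less
  show ?case
  proof (cases "c = 0")
    case True
    then have "\<bar>d\<bar> = 1" using less.prems by simp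
    then have "norm (of_int c * z + of_int d) = 1" using True by (simp flip: of_int_abs)
    then show ?thesis by auto
  next
    case False
    define k where "k = d div c"
    define r where "r = d mod c"
    have d: "d = c * k + r" by (simp add: k_def r_def)
    define w where "w = z + of_int k"
    define u where "u = - 1 / w"
    have w: "Im w > 0" "eta_height w = eta_height z" "Im w = Im z"
      using less.prems by (simp_all add: w_def eta_height_add_int)
    then have w0: "w \<noteq> 0" by auto
    have u: "Im u > 0" "Im u = Im z / (norm w)\<^sup>2" "eta_height u = eta_height z"
      using w w0 unfolding u_def Im_minus_inverse eta_height_S[OF w(1)] by simp_all
    have "nat \<bar>- r\<bar> < nat \<bar>c\<bar>" using False abs_mod_less[of c d] by (simp add: r_def)
    moreover have "coprime (- r) c" unfolding r_def using less.prems(1) False by (simp add: coprime_commute)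
    ultimately obtain v where v: "Im v = Im u / (norm (of_int (- r) * u + of_int c))\<^sup>2" "eta_height v = eta_height u"
      using less.hyps u(1) by blast
    have "of_int c * z + of_int d = of_int c * w + of_int r" unfolding d w_def by (simp add: algebra_simps)
    also have "\<dots> = w * (of_int (- r) * u + of_int c)" using w0 by (simp add: u_def field_simps)
    finally have "norm (of_int c * z + of_int d) = norm w * norm (of_int (- r) * u + of_int c)" by (simp only: norm_mult)
    then show ?thesis using v u by (intro exI[of _ v]) (simp add: power_mult_distrib)
  qed
qed

text \<open>After a translation to \<open>|Re w| <= 1/2\<close>, a point of height below 1/2 has
  \<open>|w|^2 <= 1/2\<close>, so the inversion at least doubles its height; \<open>n\<close> bounds
  the number of steps.\<close>

lemma eta_height_reduce:
  assumes "Im z > 0" "2 ^ n * Im z \<ge> 1 / 2"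
  shows "\<exists>w. Im w \<ge> 1 / 2 \<and> eta_height w = eta_height z"
  using assms
proof (induction n arbitrary: z)
  case 0
  then show ?case by auto
next
  case (Suc n)
  show ?case
  proof (cases "Im z \<ge> 1 / 2")
    case True
    then show ?thesis by blast
  next
    case False
    define w where "w = z + of_int (- round (Re z))"
    have w: "Im w = Im z" "eta_height w = eta_height z" unfolding w_def eta_height_add_int by simp_all
    have "\<bar>Re w\<bar> \<le> 1 / 2" using of_int_round_abs_le[of "Re z"] by (simp add: w_def abs_minus_commute)
    then have "(Re w)\<^sup>2 \<le> (1 / 2)\<^sup>2" by (metis abs_ge_zero power2_abs power_mono)
    moreover have "(Im w)\<^sup>2 \<le> (1 / 2)\<^sup>2" using False Suc.prems by (intro power_mono) (simp_all add: w)
    ultimately have n: "(norm w)\<^sup>2 \<le> 1 / 2" unfolding cmod_power2 by (simp add: power_divide)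
    have w0: "Im w > 0" "w \<noteq> 0" using Suc.prems(1) w by auto
    then have "0 < (norm w)\<^sup>2" by simp
    then have "2 * Im w \<le> Im (- 1 / w)" unfolding Im_minus_inverse using n w0(1) by (simp add: field_simps)
    moreover have "Im (- 1 / w) > 0" using Im_inverse_pos[OF w0(1)] .
    moreover have "2 ^ Suc n * Im z = 2 ^ n * (2 * Im w)" by (simp add: w)
    ultimately have "2 ^ n * Im (- 1 / w) \<ge> 1 / 2" using Suc.prems(2) by (metis mult_left_mono order_trans zero_le_numeral zero_le_power)
    from Suc.IH[OF \<open>Im (- 1 / w) > 0\<close> this] show ?thesis using eta_height_S[OF w0(1)] w(2) by metis
  qed
qed

lemma mult_exp_half_le:
  fixes x :: real
  shows "x * exp (- x) \<le> 2 * exp (- x / 2)"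
proof -
  have "x / 2 \<le> exp (x / 2)" using exp_ge_add_one_self[of "x / 2"] by linarith
  then have "x \<le> 2 * exp (x / 2)" by simp
  then have "x * exp (- x) \<le> 2 * exp (x / 2) * exp (- x)" by (rule mult_right_mono) simp
  also have "\<dots> = 2 * exp (- x / 2)" by (simp add: mult.assoc flip: exp_add)
  finally show ?thesis .
qed

text \<open>The Euler product is bounded there, and the squared norm of \<open>eta2\<close> decays
  at least like \<open>exp (- pi y / 3)\<close>, hence like \<open>exp (- y)\<close>. Half of this
  exponent absorbs the factor \<open>Im z\<close>.\<close>

lemma eta_height_bound_high:
  obtains B where "B \<ge> 0" "\<And>z. Im z \<ge> 1 / 2 \<Longrightarrow> eta_height z \<le> B * exp (- Im z / 2)"
proof -
  let ?C = "cball (0::complex) (exp (- pi))"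
  have e1: "exp (- pi) < 1" by simp
  have sub: "?C \<subseteq> ball 0 1" by (auto intro: le_less_trans[OF _ e1])
  have "continuous_on ?C euler_prod" using holomorphic_on_imp_continuous_on[OF euler_prod_holomorphic] sub continuous_on_subset by blast
  then have "compact (euler_prod ` ?C)" by (intro compact_continuous_image) auto
  then obtain M where M: "\<And>q. q \<in> ?C \<Longrightarrow> norm (euler_prod q) \<le> M"
    using compact_imp_bounded[of "euler_prod ` ?C"] unfolding bounded_iff by blast
  have "eta_height z \<le> (2 * M ^ 4) * exp (- Im z / 2)" if z: "Im z \<ge> 1 / 2" for z
  proof -
    let ?y = "Im z"
    have "exp (2 * \<i> * pi * z) \<in> ?C" using z by (simp add: norm_exp_2pi)
    then have "(norm (euler_prod (exp (2 * \<i> * pi * z)))) ^ 4 \<le> M ^ 4" by (intro power_mono M) auto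
    moreover have "norm (exp (\<i> * pi * z / 6)) = exp (- pi * ?y / 6)" by (simp add: norm_exp_eq_Re)
    ultimately have "(norm (eta2 z))\<^sup>2 \<le> exp (- pi * ?y / 6) ^ 2 * M ^ 4"
      unfolding eta2_def by (simp add: norm_mult norm_power power_mult_distrib mult_left_mono flip: power_mult)
    also have "exp (- pi * ?y / 6) ^ 2 = exp (- pi * ?y / 3)" by (simp add: power2_eq_square flip: exp_add)
    also have "exp (- pi * ?y / 3) * M ^ 4 \<le> exp (- ?y) * M ^ 4"
      using z pi_gt3 by (intro mult_right_mono) (simp_all add: )
    finally have "eta_height z \<le> exp (- ?y) * M ^ 4 * ?y" unfolding eta_height_def by (rule mult_right_mono) (use z in simp)
    also have "\<dots> = M ^ 4 * (?y * exp (- ?y))" by simp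
    also have "\<dots> \<le> M ^ 4 * (2 * exp (- ?y / 2))" by (rule mult_left_mono[OF mult_exp_half_le]) simp
    finally show ?thesis by simp
  qed
  moreover have "2 * M ^ 4 \<ge> 0" by simp
  ultimately show ?thesis using that by blast
qed

text \<open>A point below height 1/2 is first moved up. For it \<open>exp (- Im z / 2)\<close> is at
  least \<open>exp (-1/4)\<close>, which the constant \<open>exp (1/4)\<close> compensates.\<close>

lemma eta_height_bound:
  obtains B where "B \<ge> 0" "\<And>z. Im z > 0 \<Longrightarrow> eta_height z \<le> B * exp (- Im z / 2)"
proof -
  obtain B where B: "B \<ge> 0" "\<And>z. Im z \<ge> 1 / 2 \<Longrightarrow> eta_height z \<le> B * exp (- Im z / 2)" by (rule eta_height_bound_high) blast
  have "eta_height z \<le> (B * exp (1 / 4)) * exp (- Im z / 2)" if z: "Im z > 0" for z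
  proof (cases "Im z \<ge> 1 / 2")
    case True
    have "B * exp (- Im z / 2) \<le> (B * exp (1 / 4)) * exp (- Im z / 2)"
      using B(1) by (intro mult_right_mono) (simp_all add: mult_le_cancel_left1)
    then show ?thesis using B(2)[OF True] by linarith
  next
    case False
    obtain n where "(1 / 2) / Im z < 2 ^ n" using real_arch_pow[of 2 "(1 / 2) / Im z"] by auto
    then have "2 ^ n * Im z \<ge> 1 / 2" using z by (simp add: field_simps)
    then obtain w where w: "Im w \<ge> 1 / 2" "eta_height w = eta_height z" using eta_height_reduce[OF z] by blast
    have "eta_height z \<le> B * exp (- Im w / 2)" using B(2)[OF w(1)] w(2) by simp
    also have "\<dots> \<le> B * (exp (1 / 4) * exp (- Im z / 2))"
      using B(1) w(1) False by (intro mult_left_mono) (simp_all flip: exp_add)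
    finally show ?thesis by simp
  qed
  moreover have "B * exp (1 / 4) \<ge> 0" using B(1) by simp
  ultimately show ?thesis using that by blast
qed

text \<open>A modular map sends \<open>h/q\<close> to infinity and \<open>h/q + iy\<close> to height
  \<open>1 / (q^2 y)\<close>, where the invariant height function is exponentially small.\<close>

lemma eta2_cusp_decay:
  assumes r: "r \<in> \<rat>"
  obtains C \<delta> where "C \<ge> 0" "\<delta> > 0" "\<And>y. y > 0 \<Longrightarrow> norm (eta2 (Complex r y)) \<le> C * exp (- \<delta> / y)"
proof -
  obtain B where B: "B \<ge> 0" "\<And>z. Im z > 0 \<Longrightarrow> eta_height z \<le> B * exp (- Im z / 2)" by (rule eta_height_bound) blast
  obtain h q :: int where hq: "r = of_int h / of_int q" "q > 0" "coprime h q" using r by (rule Rats_cases')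
  define s where "s = 1 / (2 * (real_of_int q)\<^sup>2)"
  have s: "s > 0" using hq by (simp add: s_def)
  have "norm (eta2 (Complex r y)) \<le> sqrt (2 * B / s) * exp (- (s / 4) / y)" if y: "y > 0" for y
  proof -
    have e: "of_int q * Complex r y + of_int (- h) = Complex 0 (of_int q * y)" using hq by (simp add: complex_eq_iff)
    have "coprime q (- h)" using hq(3) by (simp add: coprime_commute)
    from eta_height_cusp[OF this, of "Complex r y"] obtain w where
      w: "Im w = y / (norm (Complex 0 (of_int q * y)))\<^sup>2" "eta_height w = eta_height (Complex r y)" unfolding e using y by auto
    have "Im w = 2 * (s / y)" unfolding w(1) cmod_power2 using y hq(2) by (simp add: s_def power2_eq_square field_simps)
    then have "eta_height (Complex r y) \<le> B * exp (- (s / y))" using B(2)[of w] w(2) s y by simp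
    then have "(norm (eta2 (Complex r y)))\<^sup>2 \<le> (B / s) * ((s / y) * exp (- (s / y)))"
      using y s by (simp add: eta_height_def field_simps)
    also have "\<dots> \<le> (B / s) * (2 * exp (- (s / y) / 2))" using B(1) s by (intro mult_left_mono mult_exp_half_le) simp
    also have "\<dots> = (2 * B / s) * (exp (- (s / 4) / y))\<^sup>2" by (simp add: power2_eq_square flip: exp_add)
    also have "\<dots> = (sqrt (2 * B / s) * exp (- (s / 4) / y))\<^sup>2" using B(1) s by (simp add: power_mult_distrib)
    finally show ?thesis by (rule power2_le_imp_le) (use B(1) s in simp)
  qed
  then show ?thesis using that[of "sqrt (2 * B / s)" "s / 4"] B(1) s by simp
qed

lemma eta2_scaled_decay:
  assumes "r \<in> \<rat>" and k: "k \<in> \<rat>" "k > 0"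
  obtains C \<delta> where "C \<ge> 0" "\<delta> > 0" "\<And>y. y > 0 \<Longrightarrow> norm (eta2 (of_real k * Complex r y)) \<le> C * exp (- \<delta> / y)"
proof -
  obtain C \<delta> where C: "C \<ge> 0" "\<delta> > 0" "\<And>y. y > 0 \<Longrightarrow> norm (eta2 (Complex (k * r) y)) \<le> C * exp (- \<delta> / y)"
    using eta2_cusp_decay[OF Rats_mult[OF k(1) assms(1)]] by blast
  have e: "of_real k * Complex r y = Complex (k * r) (k * y)" for y by (simp add: complex_eq_iff)
  have "norm (eta2 (of_real k * Complex r y)) \<le> C * exp (- (\<delta> / k) / y)" if "y > 0" for y
    unfolding e using C(3)[of "k * y"] that k by simp
  then show ?thesis using that[of C "\<delta> / k"] C k by simp
qed

text \<open>Decay of one factor is enough; the others are bounded on the vertical line.\<close>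

lemma eta_form_cusp_decay:
  assumes r: "r \<in> \<rat>"
  obtains C \<delta> where "C \<ge> 0" "\<delta> > 0" "\<And>y. y > 0 \<Longrightarrow> norm (eta_form (Complex r y)) \<le> C * exp (- \<delta> / y)"
    "\<And>y. y > 0 \<Longrightarrow> norm (eta_form8 (Complex r y)) \<le> C * exp (- \<delta> / y)"
proof -
  obtain C1 \<delta>1 where 1: "C1 \<ge> 0" "\<delta>1 > 0" "\<And>y. y > 0 \<Longrightarrow> norm (eta2 (Complex r y)) \<le> C1 * exp (- \<delta>1 / y)"
    using eta2_cusp_decay[OF r] by blast
  obtain C2 \<delta>2 where 2: "C2 \<ge> 0" "\<delta>2 > 0" "\<And>y. y > 0 \<Longrightarrow> norm (eta2 (2 * Complex r y)) \<le> C2 * exp (- \<delta>2 / y)"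
    using eta2_scaled_decay[OF r, of 2] by auto
  obtain C3 \<delta>3 where 3: "C3 \<ge> 0" "\<delta>3 > 0" "\<And>y. y > 0 \<Longrightarrow> norm (eta2 (3 * Complex r y)) \<le> C3 * exp (- \<delta>3 / y)"
    using eta2_scaled_decay[OF r, of 3] by auto
  obtain C6 \<delta>6 where 6: "C6 \<ge> 0" "\<delta>6 > 0" "\<And>y. y > 0 \<Longrightarrow> norm (eta2 (6 * Complex r y)) \<le> C6 * exp (- \<delta>6 / y)"
    using eta2_scaled_decay[OF r, of 6] by auto
  have b: "norm (eta2 (2 * Complex r y)) \<le> C2" "norm (eta2 (3 * Complex r y)) \<le> C3" "norm (eta2 (6 * Complex r y)) \<le> C6"
    "norm (eta2 (Complex r y)) \<le> C1" if y: "y > 0" for y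
  proof -
    have "C * exp (- \<delta> / y) \<le> C" if "C \<ge> 0" "\<delta> > 0" for C \<delta> :: real using that y by (simp add: mult_le_cancel_left2)
    then show "norm (eta2 (2 * Complex r y)) \<le> C2" "norm (eta2 (3 * Complex r y)) \<le> C3" "norm (eta2 (6 * Complex r y)) \<le> C6"
      "norm (eta2 (Complex r y)) \<le> C1" using 1 2 3 6 y order_trans by metis+
  qed
  define D where "D = C1 * C2 * C3 * C6 + C1 * C2 * C1 * C2"
  have D: "C1 * C2 * C3 * C6 \<le> D" "C1 * C2 * C1 * C2 \<le> D" "D \<ge> 0" unfolding D_def using 1 2 3 6 by simp_all
  have "norm (eta_form (Complex r y)) \<le> D * exp (- \<delta>1 / y)" "norm (eta_form8 (Complex r y)) \<le> D * exp (- \<delta>1 / y)" if y: "y > 0" for y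
  proof -
    have "norm (eta_form (Complex r y)) \<le> (C1 * exp (- \<delta>1 / y)) * C2 * C3 * C6"
      unfolding eta_form_def norm_mult by (intro mult_mono 1(3) b y) (use 1 2 3 6 in auto)
    also have "\<dots> = (C1 * C2 * C3 * C6) * exp (- \<delta>1 / y)" by simp
    also have "\<dots> \<le> D * exp (- \<delta>1 / y)" by (intro mult_right_mono D) simp
    finally show "norm (eta_form (Complex r y)) \<le> D * exp (- \<delta>1 / y)" .
    have "norm (eta_form8 (Complex r y)) \<le> (C1 * exp (- \<delta>1 / y)) * C2 * (C1 * C2)"
      unfolding eta_form8_def norm_power norm_mult power2_eq_square by (intro mult_mono 1(3) b y) (use 1 2 3 6 in auto)
    also have "\<dots> = (C1 * C2 * C1 * C2) * exp (- \<delta>1 / y)" by simp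
    also have "\<dots> \<le> D * exp (- \<delta>1 / y)" by (intro mult_right_mono D) simp
    finally show "norm (eta_form8 (Complex r y)) \<le> D * exp (- \<delta>1 / y)" .
  qed
  then show ?thesis using that[of D \<delta>1] D 1 by blast
qed

text \<open>The bound on \<open>eta_height\<close> at \<open>k z\<close> with \<open>k >= 1\<close>
  gives \<open>B exp (-y/2) / y\<close> for the squared norm of each of the four factors.\<close>

lemma eta_form_bound:
  obtains C where "C \<ge> 0" "\<And>z. Im z > 0 \<Longrightarrow> norm (eta_form z) \<le> C * exp (- Im z) / (Im z)\<^sup>2"
proof -
  obtain B where B: "B \<ge> 0" "\<And>z. Im z > 0 \<Longrightarrow> eta_height z \<le> B * exp (- Im z / 2)" by (rule eta_height_bound) blast
  have e: "(norm (eta2 (of_real k * z)))\<^sup>2 \<le> B * exp (- Im z / 2) / Im z" if z: "Im z > 0" and k: "k \<ge> 1" for k z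
  proof -
    have "eta_height (of_real k * z) \<le> B * exp (- (k * Im z) / 2)" using B(2)[of "of_real k * z"] z k by simp
    also have "\<dots> \<le> B * exp (- Im z / 2)" using B(1) z k by (intro mult_left_mono) simp_all
    finally have "(norm (eta2 (of_real k * z)))\<^sup>2 * (k * Im z) \<le> B * exp (- Im z / 2)" by (simp add: eta_height_def)
    moreover have "(norm (eta2 (of_real k * z)))\<^sup>2 * (1 * Im z) \<le> (norm (eta2 (of_real k * z)))\<^sup>2 * (k * Im z)"
      using z k by (intro mult_left_mono mult_right_mono) simp_all
    ultimately have "(norm (eta2 (of_real k * z)))\<^sup>2 * Im z \<le> B * exp (- Im z / 2)" by simp
    then show ?thesis using z by (simp add: field_simps)
  qed
  have "norm (eta_form z) \<le> B\<^sup>2 * exp (- Im z) / (Im z)\<^sup>2" if z: "Im z > 0" for z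
  proof -
    define b where "b = B * exp (- Im z / 2) / Im z"
    have b0: "b \<ge> 0" using B z by (simp add: b_def)
    note e = e[OF z, folded b_def]
    have "(norm (eta_form z))\<^sup>2 = (norm (eta2 (of_real 1 * z)))\<^sup>2 * (norm (eta2 (of_real 2 * z)))\<^sup>2 * (norm (eta2 (of_real 3 * z)))\<^sup>2 * (norm (eta2 (of_real 6 * z)))\<^sup>2"
      unfolding eta_form_def by (simp add: norm_mult power_mult_distrib)
    also have "\<dots> \<le> b * b * b * b" using b0 by (intro mult_mono e) auto
    also have "\<dots> = (b * b)\<^sup>2" by (simp add: power2_eq_square)
    finally have "norm (eta_form z) \<le> b * b" by (rule power2_le_imp_le) (use b0 in simp)
    also have "\<dots> = B\<^sup>2 * (exp (- Im z / 2) * exp (- Im z / 2)) / (Im z)\<^sup>2" by (simp add: power2_eq_square b_def)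
    also have "exp (- Im z / 2) * exp (- Im z / 2) = exp (- Im z)" by (simp flip: exp_add)
    finally show ?thesis .
  qed
  then show ?thesis using that[of "B\<^sup>2"] by simp
qed

section \<open>Fourier coefficients\<close>

lemma dvd_mult_minus_one:
  fixes x a b :: "'a::comm_ring_1"
  assumes "x dvd a - 1" "x dvd b - 1"
  shows "x dvd a * b - 1"
proof -
  have e: "a * b - 1 = (a - 1) * b + (b - 1)" by (simp add: algebra_simps)
  show ?thesis unfolding e by (intro dvd_add dvd_mult2 assms)
qed

lemma eta_prod_trunc_Suc:
  "eta_prod_trunc (Suc N) = eta_prod_trunc N * ((1 - Polynomial.monom 1 (Suc N))\<^sup>2 * (1 - Polynomial.monom 1 (2 * Suc N))\<^sup>2 *
     (1 - Polynomial.monom 1 (3 * Suc N))\<^sup>2 * (1 - Polynomial.monom 1 (6 * Suc N))\<^sup>2)"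
  unfolding eta_prod_trunc_def by (simp only: prod.nat_ivl_Suc' le_add1 One_nat_def) (simp add: mult.commute)

text \<open>All four new factors are 1 modulo \<open>X^(N+1)\<close>.\<close>

lemma coeff_eta_prod_trunc_Suc:
  assumes "n \<le> N"
  shows "Polynomial.coeff (eta_prod_trunc (Suc N)) n = Polynomial.coeff (eta_prod_trunc N) n"
proof -
  let ?x = "Polynomial.monom 1 (Suc N) :: int poly"
  have x: "?x dvd (1 - Polynomial.monom 1 (k * Suc N)) - 1" if "k > 0" for k
  proof -
    have "Polynomial.monom (1::int) (k * Suc N) = ?x ^ k" by (simp add: monom_power mult.commute)
    then show ?thesis using that by (simp add: dvd_power)
  qed
  have x2: "?x dvd (1 - Polynomial.monom 1 (k * Suc N))\<^sup>2 - 1" if "k > 0" for k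
    unfolding power2_eq_square by (intro dvd_mult_minus_one x that)
  have "?x dvd ((1 - Polynomial.monom 1 (1 * Suc N))\<^sup>2 * (1 - Polynomial.monom 1 (2 * Suc N))\<^sup>2 *
     (1 - Polynomial.monom 1 (3 * Suc N))\<^sup>2 * (1 - Polynomial.monom 1 (6 * Suc N))\<^sup>2) - 1" (is "?x dvd ?F - 1")
    by (intro dvd_mult_minus_one x2) simp_all
  then obtain S where S: "?F - 1 = ?x * S" by (rule dvdE)
  have "eta_prod_trunc (Suc N) = eta_prod_trunc N * ?F" by (simp only: eta_prod_trunc_Suc mult_1)
  also have "?F = 1 + ?x * S" using S by (simp only: algebra_simps)
  finally have "eta_prod_trunc (Suc N) = eta_prod_trunc N + ?x * (eta_prod_trunc N * S)" by (simp add: algebra_simps)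
  then show ?thesis using assms by (simp add: coeff_monom_mult)
qed

lemma coeff_eta_prod_trunc:
  assumes "n < N"
  shows "Polynomial.coeff (eta_prod_trunc N) n = eta_coeff (Suc n)"
  using assms
proof (induction N)
  case (Suc N)
  then show ?case
    by (cases "n < N") (auto simp: coeff_eta_prod_trunc_Suc eta_coeff_def less_Suc_eq)
qed simp

lemma higher_deriv_poly_0: "(deriv ^^ n) (poly p) 0 = fact n * Polynomial.coeff (p :: complex poly) n"
proof -
  have "(deriv ^^ n) (poly p) = poly ((pderiv ^^ n) p)"
  proof (induction n)
    case (Suc n)
    have "deriv (poly q) = poly (pderiv q)" for q :: "complex poly" by (intro ext DERIV_imp_deriv poly_DERIV)
    then show ?case using Suc by simp
  qed simp
  then show ?thesis by (simp add: poly_0_coeff_0 coeff_higher_pderiv pochhammer_fact)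
qed

text \<open>The newform divided by \<open>q\<close>, as a function of \<open>q\<close>; hence its
  \<open>n\<close>-th coefficient is \<open>eta_coeff (Suc n)\<close>.\<close>

definition eta_disc :: "complex \<Rightarrow> complex" where
  "eta_disc q = (euler_prod q * euler_prod (q ^ 2) * euler_prod (q ^ 3) * euler_prod (q ^ 6))\<^sup>2"

lemma eta_disc_holomorphic: "eta_disc holomorphic_on ball 0 1"
  unfolding eta_disc_def using euler_prod_power_holomorphic[of 1]
  by (intro holomorphic_intros euler_prod_power_holomorphic) auto

lemma eta_form_eq_disc: "eta_form z = exp (2 * \<i> * pi * z) * eta_disc (exp (2 * \<i> * pi * z))"
proof -
  let ?u = "exp (\<i> * pi * z / 6)" and ?q = "exp (2 * \<i> * pi * z)"
  have q: "exp (\<i> * pi * z) ^ (2 * k) = ?q ^ k" for k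
  proof -
    have "exp (\<i> * pi * z) ^ 2 = ?q" by (simp add: mult_ac flip: exp_of_nat_mult)
    then show ?thesis by (simp add: power_mult)
  qed
  have "eta_form z = ?u ^ 12 * eta_disc ?q"
    unfolding eta_form_def eta_disc_def using eta2_disc[of 1 z] eta2_disc[of 2 z] eta2_disc[of 3 z] eta2_disc[of 6 z]
    unfolding q by (simp add: power_mult_distrib power_numeral_reduce mult_ac)
  also have "?u ^ 12 = ?q" using power_mult[of ?u 6 2] q[of 1] by (simp add: exp_sixth_power)
  finally show ?thesis .
qed

lemma euler_prod_power_limit:
  assumes k: "k > 0"
  shows "uniform_limit (cball 0 (1 / 2)) (\<lambda>n q. \<Prod>m<n. 1 - (q ^ k) ^ Suc m) (\<lambda>q. euler_prod (q ^ k)) sequentially"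
proof (rule uniform_limit_compose'[OF euler_prod_uniform_limit[of "1 / 2"]])
  show "(\<lambda>q. q ^ k) \<in> cball 0 (1 / 2) \<rightarrow> cball (0::complex) (1 / 2)"
  proof
    fix q :: complex assume q: "q \<in> cball 0 (1 / 2)"
    have "norm q ^ k \<le> norm q ^ 1" by (rule power_decreasing) (use q k in auto)
    then show "q ^ k \<in> cball 0 (1 / 2)" using q by (simp add: norm_power)
  qed
qed simp

lemma bounded_euler_prod_power:
  assumes k: "k > 0"
  shows "bounded ((\<lambda>q. euler_prod (q ^ k)) ` cball 0 (1 / 2))"
proof (intro compact_imp_bounded compact_continuous_image)
  have "cball (0::complex) (1 / 2) \<subseteq> ball 0 1" by auto
  then show "continuous_on (cball 0 (1 / 2)) (\<lambda>q. euler_prod (q ^ k))"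
    using holomorphic_on_imp_continuous_on[OF euler_prod_power_holomorphic[OF k]] continuous_on_subset by blast
qed simp

lemma bounded_mult_image:
  fixes f g :: "'a \<Rightarrow> 'b::real_normed_algebra"
  assumes "bounded (f ` A)" "bounded (g ` A)"
  shows "bounded ((\<lambda>x. f x * g x) ` A)"
proof -
  obtain a b where "\<And>x. x \<in> A \<Longrightarrow> norm (f x) \<le> a" "\<And>x. x \<in> A \<Longrightarrow> norm (g x) \<le> b"
    using assms unfolding bounded_iff by auto
  then have "norm (f x * g x) \<le> a * b" if "x \<in> A" for x
    using that by (meson mult_mono' norm_ge_zero norm_mult_ineq order_trans)
  then show ?thesis unfolding bounded_iff by blast
qed

lemma map_poly_of_int_mult:
  "map_poly of_int (p * r) = map_poly of_int p * (map_poly of_int r :: 'a::comm_ring_1 poly)"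
  by (rule poly_eqI) (simp add: coeff_map_poly coeff_mult)

lemma poly_of_int_factor:
  "poly (map_poly of_int ((1 - Polynomial.monom 1 k)\<^sup>2)) x = (1 - x ^ k :: 'a::comm_ring_1)\<^sup>2"
proof -
  have "map_poly of_int (1 - Polynomial.monom 1 k) = (1 - Polynomial.monom 1 k :: 'a poly)"
    by (rule poly_eqI) (simp add: coeff_map_poly)
  then show ?thesis unfolding power2_eq_square map_poly_of_int_mult by (simp add: poly_monom)
qed

lemma poly_eta_prod_trunc:
  "poly (map_poly of_int (eta_prod_trunc N)) q = ((\<Prod>m<N. 1 - (q ^ 1) ^ Suc m) * (\<Prod>m<N. 1 - (q ^ 2) ^ Suc m) *
     (\<Prod>m<N. 1 - (q ^ 3) ^ Suc m) * (\<Prod>m<N. 1 - (q ^ 6) ^ Suc m) :: 'a::comm_ring_1)\<^sup>2"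
proof (induction N)
  case 0
  then show ?case by (simp add: eta_prod_trunc_def)
next
  case (Suc N)
  have sq: "(a * b * c * d)\<^sup>2 * (x\<^sup>2 * y\<^sup>2 * z\<^sup>2 * w\<^sup>2) = ((a * x) * (b * y) * (c * z) * (d * w))\<^sup>2" for a b c d x y z w :: 'a
    by (simp add: power2_eq_square mult_ac)
  show ?case
    unfolding eta_prod_trunc_Suc map_poly_of_int_mult poly_mult poly_of_int_factor Suc.IH sq prod.lessThan_Suc power_mult[symmetric] mult_1 ..
qed

text \<open>The truncated products converge uniformly near 0, so their derivatives at 0 converge,
  and these are constant in \<open>N\<close> as soon as \<open>n < N\<close>. This ties the
  combinatorial coefficients to the analytic form.\<close>

lemma eta_disc_higher_deriv: "(deriv ^^ n) eta_disc 0 = fact n * of_int (eta_coeff (Suc n))"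
proof (rule LIMSEQ_unique)
  let ?T = "\<lambda>N. poly (map_poly of_int (eta_prod_trunc N) :: complex poly)"
  let ?f = "\<lambda>k N q. \<Prod>m<N. 1 - (q ^ k) ^ Suc m" and ?g = "\<lambda>k q. euler_prod (q ^ k)"
  have "uniform_limit (cball 0 (1 / 2)) (\<lambda>N q. (?f 1 N q * ?f 2 N q * ?f 3 N q * ?f 6 N q) * (?f 1 N q * ?f 2 N q * ?f 3 N q * ?f 6 N q))
     (\<lambda>q. (?g 1 q * ?g 2 q * ?g 3 q * ?g 6 q) * (?g 1 q * ?g 2 q * ?g 3 q * ?g 6 q)) sequentially"
    by (intro uniform_lim_mult bounded_mult_image euler_prod_power_limit bounded_euler_prod_power) simp_all
  then have "uniform_limit (cball 0 (1 / 2)) ?T eta_disc sequentially"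
    unfolding poly_eta_prod_trunc eta_disc_def power2_eq_square by (simp add: power2_eq_square)
  then have "uniform_limit (ball 0 (1 / 2)) ?T eta_disc sequentially" by (rule uniform_limit_on_subset) auto
  then show "(\<lambda>N. (deriv ^^ n) (?T N) 0) \<longlonglongrightarrow> (deriv ^^ n) eta_disc 0"
    by (rule higher_deriv_complex_uniform_limit) (auto intro!: always_eventually holomorphic_intros)
  have "\<forall>\<^sub>F N in sequentially. (deriv ^^ n) (?T N) 0 = fact n * of_int (eta_coeff (Suc n))"
    using eventually_gt_at_top[of n]
    by eventually_elim (simp add: higher_deriv_poly_0 coeff_map_poly coeff_eta_prod_trunc)
  then show "(\<lambda>N. (deriv ^^ n) (?T N) 0) \<longlonglongrightarrow> fact n * of_int (eta_coeff (Suc n))"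
    by (rule tendsto_eventually)
qed

lemma eta_form_sums:
  assumes z: "Im z > 0"
  shows "(\<lambda>n. of_int (eta_coeff n) * exp (2 * \<i> * pi * z) ^ n) sums eta_form z"
proof -
  let ?q = "exp (2 * \<i> * pi * z)"
  have "?q \<in> ball 0 1" using norm_q_less_1[OF z] by simp
  from holomorphic_power_series[OF eta_disc_holomorphic this]
  have "(\<lambda>n. of_int (eta_coeff (Suc n)) * ?q ^ n) sums eta_disc ?q" by (simp add: eta_disc_higher_deriv)
  from sums_mult[OF this, of ?q] have "(\<lambda>n. of_int (eta_coeff (Suc n)) * ?q ^ Suc n) sums eta_form z"
    unfolding eta_form_eq_disc by (simp add: mult_ac)
  from sums_Suc[where f = "\<lambda>n. of_int (eta_coeff n) * ?q ^ n", OF this]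
  show ?thesis by (simp add: eta_coeff_def)
qed

text \<open>Hecke's bound: Cauchy's inequality on the circle of radius \<open>exp (-2 pi y)\<close>
  with \<open>y = 1 / (n + 1)\<close>, where the form is at most \<open>B / y^2\<close>.\<close>

lemma eta_coeff_bound:
  obtains C where "C \<ge> 0" "\<And>n. \<bar>real_of_int (eta_coeff n)\<bar> \<le> C * (real n)\<^sup>2"
proof -
  obtain B where B: "B \<ge> 0" "\<And>z. Im z > 0 \<Longrightarrow> norm (eta_form z) \<le> B * exp (- Im z) / (Im z)\<^sup>2" by (rule eta_form_bound) blast
  have "\<bar>real_of_int (eta_coeff (Suc n))\<bar> \<le> B * exp (2 * pi) * (real (Suc n))\<^sup>2" for n
  proof -
    define y where "y = 1 / real (Suc n)"
    define \<rho> where "\<rho> = exp (- 2 * pi * y)"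
    have y: "y > 0" "real (Suc n) * y = 1" by (simp_all add: y_def)
    have \<rho>: "0 < \<rho>" "\<rho> < 1" using y by (simp_all add: \<rho>_def)
    have "norm ((deriv ^^ n) eta_disc 0) \<le> fact n * (B / y\<^sup>2 / \<rho>) / \<rho> ^ n"
    proof (rule Cauchy_inequality)
      have sub: "cball (0::complex) \<rho> \<subseteq> ball 0 1" using \<rho> by auto
      show "continuous_on (cball 0 \<rho>) eta_disc"
        by (rule continuous_on_subset[OF holomorphic_on_imp_continuous_on[OF eta_disc_holomorphic] sub])
      show "eta_disc holomorphic_on ball 0 \<rho>"
        by (rule holomorphic_on_subset[OF eta_disc_holomorphic]) (use \<rho> in auto)
      fix q :: complex assume "norm (0 - q) = \<rho>"
      then have q: "norm q = \<rho>" "q \<noteq> 0" using \<rho> by auto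
      \<comment> \<open>A logarithm of \<open>q\<close>; its imaginary part is \<open>y\<close> for
        every choice of branch.\<close>
      define z where "z = Ln q / (2 * \<i> * pi)"
      have e: "exp (2 * \<i> * pi * z) = q" using q by (simp add: z_def)
      have "exp (- 2 * pi * Im z) = \<rho>" using norm_exp_2pi[of z] unfolding e q(1) by simp
      then have Imz: "Im z = y" by (simp add: \<rho>_def)
      have "norm (q * eta_disc q) \<le> B * exp (- y) / y\<^sup>2" using B(2)[of z] y unfolding eta_form_eq_disc e Imz by simp
      also have "\<dots> \<le> B * 1 / y\<^sup>2" using B(1) y by (intro divide_right_mono mult_left_mono) simp_all
      finally have "\<rho> * norm (eta_disc q) \<le> B / y\<^sup>2" by (simp add: norm_mult q(1))
      from divide_right_mono[OF this, of \<rho>] have "\<rho> * norm (eta_disc q) / \<rho> \<le> B / y\<^sup>2 / \<rho>" using \<rho> by (simp only: less_imp_le)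
      then show "norm (eta_disc q) \<le> B / y\<^sup>2 / \<rho>" using \<rho> by simp
    qed (use \<rho> in auto)
    then have "fact n * \<bar>real_of_int (eta_coeff (Suc n))\<bar> \<le> fact n * (B / y\<^sup>2 / \<rho> / \<rho> ^ n)"
      by (simp add: eta_disc_higher_deriv norm_mult)
    then have "\<bar>real_of_int (eta_coeff (Suc n))\<bar> \<le> B / y\<^sup>2 / \<rho> / \<rho> ^ n" by (rule mult_left_le_imp_le) simp
    also have "\<dots> = B * (real (Suc n))\<^sup>2 * (1 / \<rho> ^ Suc n)" by (simp add: y_def power_divide)
    also have "\<rho> ^ Suc n = exp (- 2 * pi * (real (Suc n) * y))" unfolding \<rho>_def exp_of_nat_mult[symmetric] by (simp only: mult_ac)
    also have "1 / \<dots> = exp (2 * pi)" unfolding y(2) by (simp add: exp_minus inverse_eq_divide)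
    finally show ?thesis by (simp add: mult_ac)
  qed
  then have "\<bar>real_of_int (eta_coeff n)\<bar> \<le> B * exp (2 * pi) * (real n)\<^sup>2" for n
    by (cases n) (simp_all add: eta_coeff_def del: of_nat_Suc)
  then show ?thesis using that[of "B * exp (2 * pi)"] B(1) by simp
qed

section \<open>Mellin transforms\<close>

lemma has_integral_stretch_UNIV:
  fixes f :: "real \<Rightarrow> complex"
  assumes f: "(f has_integral I) UNIV" and m: "m > 0"
  shows "((\<lambda>x. f (m * x)) has_integral I / of_real m) UNIV"
proof -
  have nb: "\<not> (\<exists>a b. (UNIV :: real set) = cbox a b)" using bounded_cbox not_bounded_UNIV by metis
  have U: "(h has_integral J) UNIV \<longleftrightarrow> (\<forall>e>0. \<exists>B>0. \<forall>a b. ball 0 B \<subseteq> cbox a b \<longrightarrow>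
     (\<exists>z. (h has_integral z) (cbox a b) \<and> norm (z - J) < e))" for h :: "real \<Rightarrow> complex" and J
    using nb by (subst has_integral_alt) simp
  show ?thesis unfolding U
  proof (intro allI impI)
    fix e :: real assume e: "e > 0"
    then have "e * m > 0" using m by simp
    then obtain B where B: "B > 0" "\<And>a b. ball 0 B \<subseteq> cbox a b \<Longrightarrow> \<exists>z. (f has_integral z) (cbox a b) \<and> norm (z - I) < e * m"
      using f unfolding U by blast
    show "\<exists>B>0. \<forall>a b. ball 0 B \<subseteq> cbox a b \<longrightarrow> (\<exists>z. ((\<lambda>x. f (m * x)) has_integral z) (cbox a b) \<and> norm (z - I / of_real m) < e)"
    proof (intro exI[of _ "B / m"] conjI allI impI)
      fix a b :: real assume sub: "ball 0 (B / m) \<subseteq> cbox a b"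
      have "ball 0 B \<subseteq> cbox (m * a) (m * b)"
      proof
        fix x :: real assume "x \<in> ball 0 B"
        then have "x / m \<in> ball 0 (B / m)" using m by (simp add: divide_strict_right_mono)
        then have "x / m \<in> cbox a b" using sub by blast
        then show "x \<in> cbox (m * a) (m * b)" using m by (simp add: field_simps)
      qed
      then obtain z where z: "(f has_integral z) (cbox (m * a) (m * b))" "norm (z - I) < e * m" using B(2) by blast
      have "norm ((z - I) / of_real m) < e" using z(2) m by (simp add: norm_divide field_simps)
      moreover have "((\<lambda>x. f (m * x)) has_integral z / of_real m) (cbox a b)"
        using has_integral_affinity'[OF z(1) m, of 0] m by (simp add: scaleR_conv_of_real field_simps)
      ultimately show "\<exists>z. ((\<lambda>x. f (m * x)) has_integral z) (cbox a b) \<and> norm (z - I / of_real m) < e"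
        by (intro exI[of _ "z / of_real m"]) (simp add: diff_divide_distrib)
    qed (use B m in simp)
  qed
qed

text \<open>For \<open>y > 0\<close> the power \<open>y^(s-1)\<close>, written through
  \<open>exp\<close> so that it is visibly entire in \<open>s\<close>.\<close>

definition mellin_kernel :: "complex \<Rightarrow> real \<Rightarrow> complex" where
  "mellin_kernel s y = exp ((s - 1) * of_real (ln y))"

lemma mellin_kernel_powr: "y > 0 \<Longrightarrow> mellin_kernel s y = of_real y powr (s - 1)"
  by (simp add: mellin_kernel_def powr_def Ln_of_real)

lemma norm_mellin_kernel: "y > 0 \<Longrightarrow> norm (mellin_kernel s y) = y powr (Re s - 1)"
  by (simp add: mellin_kernel_def norm_exp_eq_Re powr_def)

lemma mellin_kernel_mult: "m > 0 \<Longrightarrow> y > 0 \<Longrightarrow> mellin_kernel s (m * y) = mellin_kernel s m * mellin_kernel s y"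
  by (simp add: mellin_kernel_def ln_mult algebra_simps flip: exp_add)

lemma mellin_exp:
  assumes s: "Re s > 0" and m: "m > 0"
  shows "((\<lambda>y. of_real (exp (- m * y)) * mellin_kernel s y) has_integral Gamma s / of_real m powr s) {0<..}"
proof -
  let ?f = "\<lambda>t. of_real t powr (s - 1) / complex_of_real (exp t)"
  have "((\<lambda>t. if t \<in> {0<..} then ?f t else 0) has_integral Gamma s) UNIV"
    using Gamma_integral_complex'[OF s] by (simp only: has_integral_restrict_UNIV)
  from has_integral_stretch_UNIV[OF this m]
  have "((\<lambda>t. if t \<in> {0<..} then ?f (m * t) else 0) has_integral Gamma s / of_real m) UNIV"
    using m by (simp add: zero_less_mult_iff)
  then have "((\<lambda>t. ?f (m * t)) has_integral Gamma s / of_real m) {0<..}" by (simp only: has_integral_restrict_UNIV)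
  from has_integral_mult_right[OF this, of "1 / mellin_kernel s m"]
  have 1: "((\<lambda>t. 1 / mellin_kernel s m * ?f (m * t)) has_integral 1 / mellin_kernel s m * (Gamma s / of_real m)) {0<..}" .
  have 2: "1 / mellin_kernel s m * (Gamma s / of_real m) = Gamma s / of_real m powr s"
    using m by (simp add: mellin_kernel_powr powr_diff)
  have "1 / mellin_kernel s m * ?f (m * t) = of_real (exp (- m * t)) * mellin_kernel s t" if "t \<in> {0<..}" for t
  proof -
    have "of_real (m * t) powr (s - 1) = mellin_kernel s (m * t)" using m that mellin_kernel_powr[of "m * t" s] by simp
    moreover have "mellin_kernel s m \<noteq> 0" by (simp add: mellin_kernel_def)
    ultimately show ?thesis using mellin_kernel_mult[of m t s] m that by (simp add: exp_minus field_simps)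
  qed
  from has_integral_eq[OF this 1[unfolded 2]] show ?thesis .
qed

lemma power_exp_bounded:
  fixes \<delta> :: real
  assumes "\<delta> > 0"
  obtains D where "D \<ge> 0" "\<And>x. x > 0 \<Longrightarrow> x ^ m * exp (- \<delta> * x) \<le> D"
proof -
  define k where "k = Suc m"
  have "x ^ m * exp (- \<delta> * x) \<le> 1 + (real k / \<delta>) ^ k" if x: "x > 0" for x
  proof (cases "x \<le> 1")
    case True
    have "x ^ m * exp (- \<delta> * x) \<le> 1 * 1" using True x assms by (intro mult_mono power_le_one) auto
    moreover have "0 \<le> (real k / \<delta>) ^ k" using assms by simp
    ultimately show ?thesis by linarith
  next
    case False
    have k: "real k > 0" by (simp add: k_def)
    have "\<delta> * x / k \<le> exp (\<delta> * x / k)" using exp_ge_add_one_self[of "\<delta> * x / k"] by linarith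
    then have "(\<delta> * x / k) ^ k \<le> exp (\<delta> * x / k) ^ k" using x assms by (intro power_mono) simp_all
    also have "\<dots> = exp (\<delta> * x)" using k by (simp flip: exp_of_nat_mult)
    finally have "x ^ k \<le> (real k / \<delta>) ^ k * exp (\<delta> * x)" using assms k by (simp add: power_divide power_mult_distrib field_simps)
    moreover have "x ^ m \<le> x ^ k" using False by (intro power_increasing) (simp_all add: k_def)
    ultimately have "x ^ m * exp (- \<delta> * x) \<le> (real k / \<delta>) ^ k * exp (\<delta> * x) * exp (- \<delta> * x)"
      by (intro mult_right_mono) simp_all
    also have "\<dots> = (real k / \<delta>) ^ k" by (simp add: mult.assoc flip: exp_add)
    finally show ?thesis by linarith
  qed
  moreover have "0 \<le> 1 + (real k / \<delta>) ^ k" using assms by (simp add: add_nonneg_nonneg)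
  ultimately show ?thesis using that by blast
qed

text \<open>A majorant uniform in \<open>K\<close>: \<open>n^2 <= (2 / y^2) exp (n y)\<close>, and
  since \<open>2 pi > 6\<close> there remains a factor \<open>exp (-y)\<close> and a geometric
  series with ratio \<open>exp (-4y)\<close>.\<close>

lemma sum_square_exp:
  fixes y :: real
  assumes y: "y > 0"
  shows "(\<Sum>n<K. (real n)\<^sup>2 * exp (- 2 * pi * real n * y)) \<le> exp (- y) / y ^ 3"
proof -
  define x where "x = exp (- 4 * y)"
  have x: "0 < x" "x < 1" using y by (simp_all add: x_def)
  have t: "(real n)\<^sup>2 * exp (- 2 * pi * real n * y) \<le> exp (- y) * (2 / y\<^sup>2) * (if n = 0 then 0 else x ^ n)" for n
  proof (cases "n = 0")
    case False
    then have n: "real n \<ge> 1" by simp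
    have "(real n * y)\<^sup>2 / 2 \<le> exp (real n * y)"
      using exp_lower_Taylor_quadratic[of "real n * y"] mult_nonneg_nonneg[of "real n" y] y by linarith
    then have a: "(real n)\<^sup>2 \<le> 2 / y\<^sup>2 * exp (real n * y)" using y by (simp add: field_simps power_mult_distrib)
    have "6 * (real n * y) \<le> 2 * pi * (real n * y)" using n y pi_gt3 by (intro mult_right_mono) auto
    moreover have "y \<le> real n * y" using n y by simp
    ultimately have "exp (- 2 * pi * real n * y) \<le> exp (- y - 5 * (real n * y))" by (simp add: algebra_simps)
    then have "(real n)\<^sup>2 * exp (- 2 * pi * real n * y) \<le> (2 / y\<^sup>2 * exp (real n * y)) * exp (- y - 5 * (real n * y))"
      by (intro mult_mono a) simp_all
    also have "\<dots> = exp (- y) * (2 / y\<^sup>2) * exp (real n * (- 4 * y))" by (simp add: mult.assoc mult.left_commute flip: exp_add)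
    also have "exp (real n * (- 4 * y)) = x ^ n" unfolding x_def by (rule exp_of_nat_mult)
    finally show ?thesis using False by simp
  qed simp
  have "(\<Sum>n<K. if n = 0 then 0 else x ^ n) \<le> 1 / (4 * y)"
  proof -
    have "(\<Sum>n<K. if n = 0 then 0 else x ^ n) \<le> x / (1 - x)"
    proof (cases K)
      case (Suc k)
      have "(\<Sum>n<K. if n = 0 then 0 else x ^ n) = (\<Sum>n<k. x * x ^ n)" unfolding Suc sum.lessThan_Suc_shift by simp
      also have "\<dots> = x * (\<Sum>n<k. x ^ n)" by (simp add: sum_distrib_left)
      also have "(\<Sum>n<k. x ^ n) \<le> 1 / (1 - x)" using x by (simp add: sum_gp_strict divide_right_mono)
      finally show ?thesis using x by simp
    qed (use x in simp)
    also have "x / (1 - x) \<le> 1 / (4 * y)"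
    proof -
      have "1 + 4 * y \<le> exp (4 * y)" by (rule exp_ge_add_one_self)
      also have "exp (4 * y) = 1 / x" by (simp add: x_def exp_minus field_simps)
      finally show ?thesis using x y by (simp add: field_simps)
    qed
    finally show ?thesis .
  qed
  then have "exp (- y) * (2 / y\<^sup>2) * (\<Sum>n<K. if n = 0 then 0 else x ^ n) \<le> exp (- y) * (2 / y\<^sup>2) * (1 / (4 * y))"
    by (intro mult_left_mono) simp_all
  also have "\<dots> \<le> exp (- y) / y ^ 3" using y by (simp add: field_simps power3_eq_cube power2_eq_square)
  finally have "(\<Sum>n<K. exp (- y) * (2 / y\<^sup>2) * (if n = 0 then 0 else x ^ n)) \<le> exp (- y) / y ^ 3" unfolding sum_distrib_left .
  moreover have "(\<Sum>n<K. (real n)\<^sup>2 * exp (- 2 * pi * real n * y)) \<le> (\<Sum>n<K. exp (- y) * (2 / y\<^sup>2) * (if n = 0 then 0 else x ^ n))"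
    by (intro sum_mono t)
  ultimately show ?thesis by linarith
qed

text \<open>Exponential decay of \<open>g\<close> at 0 takes the place of a functional equation: the
  Mellin integral converges for every \<open>s\<close> and continues the Dirichlet series to an
  entire function.\<close>

locale twisted_series =
  fixes b :: "nat \<Rightarrow> complex" and g :: "real \<Rightarrow> complex" and C \<delta> :: real
  assumes b_0: "b 0 = 0" and b_bound: "norm (b n) \<le> C * (real n)\<^sup>2"
    and g_sums: "y > 0 \<Longrightarrow> (\<lambda>n. b n * of_real (exp (- 2 * pi * real n * y))) sums g y"
    and g_cont: "continuous_on {0<..} g"
    and C_nonneg: "C \<ge> 0" and \<delta>_pos: "\<delta> > 0"
    and g_decay: "y > 0 \<Longrightarrow> norm (g y) \<le> C * exp (- \<delta> / y)"
begin

lemma norm_partial_sum: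
  assumes y: "y > 0"
  shows "norm (\<Sum>n<K. b n * of_real (exp (- 2 * pi * real n * y))) \<le> C * (exp (- y) / y ^ 3)"
proof -
  have "norm (\<Sum>n<K. b n * of_real (exp (- 2 * pi * real n * y))) \<le> (\<Sum>n<K. C * ((real n)\<^sup>2 * exp (- 2 * pi * real n * y)))"
  proof (rule sum_norm_le)
    fix n
    have "norm (b n * of_real (exp (- 2 * pi * real n * y))) = norm (b n) * exp (- 2 * pi * real n * y)" by (simp add: norm_mult)
    also have "\<dots> \<le> C * (real n)\<^sup>2 * exp (- 2 * pi * real n * y)" by (intro mult_right_mono b_bound) simp
    finally show "norm (b n * of_real (exp (- 2 * pi * real n * y))) \<le> C * ((real n)\<^sup>2 * exp (- 2 * pi * real n * y))" by (simp add: mult.assoc)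
  qed
  also have "\<dots> = C * (\<Sum>n<K. (real n)\<^sup>2 * exp (- 2 * pi * real n * y))" by (simp add: sum_distrib_left)
  also have "\<dots> \<le> C * (exp (- y) / y ^ 3)" by (intro mult_left_mono sum_square_exp y C_nonneg)
  finally show ?thesis .
qed

lemma norm_g:
  assumes y: "y > 0"
  shows "norm (g y) \<le> C * (exp (- y) / y ^ 3)"
proof (rule LIMSEQ_le_const2)
  show "(\<lambda>K. norm (\<Sum>n<K. b n * of_real (exp (- 2 * pi * real n * y)))) \<longlonglongrightarrow> norm (g y)"
    using g_sums[OF y] unfolding sums_def by (rule tendsto_norm)
qed (use norm_partial_sum[OF y] in blast)

definition truncated_mellin :: "nat \<Rightarrow> complex \<Rightarrow> complex" where
  "truncated_mellin N s = integral {1 / real (Suc N)..real (Suc N)} (\<lambda>y. g y * mellin_kernel s y)"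

text \<open>A telescoping series whose sum is the limit of the truncated integrals; in this form the
  Weierstrass test yields locally uniform convergence in \<open>s\<close>.\<close>

definition mellin :: "complex \<Rightarrow> complex" where
  "mellin s = (\<Sum>n. truncated_mellin (Suc n) s - truncated_mellin n s)"

lemma integrand_cont:
  assumes "S \<subseteq> {0<..}"
  shows "continuous_on S (\<lambda>y. g y * mellin_kernel s y)"
  unfolding mellin_kernel_def
  by (rule continuous_on_subset[OF _ assms]) (intro continuous_intros g_cont, auto)

lemma truncated_mellin_holomorphic: "truncated_mellin N holomorphic_on UNIV"
proof -
  let ?I = "{1 / real (Suc N)..real (Suc N)}"
  have I: "?I \<subseteq> {0<..}" using order.strict_trans2[of 0 "1 / real (Suc N)"] by auto
  have "(\<lambda>s. integral (cbox (1 / real (Suc N)) (real (Suc N))) (\<lambda>y. g y * mellin_kernel s y)) holomorphic_on UNIV"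
  proof (rule leibniz_rule_holomorphic[where fx = "\<lambda>s y. g y * (exp ((s - 1) * of_real (ln y)) * of_real (ln y))"])
    show "((\<lambda>s. g y * mellin_kernel s y) has_field_derivative g y * (exp ((s - 1) * of_real (ln y)) * of_real (ln y))) (at s within UNIV)" for s y
      unfolding mellin_kernel_def by (auto intro!: derivative_eq_intros)
    show "(\<lambda>y. g y * mellin_kernel s y) integrable_on cbox (1 / real (Suc N)) (real (Suc N))" for s
      by (rule integrable_continuous) (use integrand_cont[OF I] in simp)
    have "continuous_on (UNIV \<times> ?I) (\<lambda>p. g (snd p))"
      by (rule continuous_on_compose2[OF continuous_on_subset[OF g_cont I] continuous_on_snd[OF continuous_on_id]]) auto
    moreover have "0 < snd p" if "p \<in> UNIV \<times> ?I" for p :: "complex \<times> real" using that I by auto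
    ultimately show "continuous_on (UNIV \<times> cbox (1 / real (Suc N)) (real (Suc N))) (\<lambda>(s, y). g y * (exp ((s - 1) * of_real (ln y)) * of_real (ln y)))"
      unfolding case_prod_unfold cbox_interval by (intro continuous_intros) (auto simp: less_le)
  qed simp
  then show ?thesis unfolding truncated_mellin_def by simp
qed

lemma integrand_bound:
  obtains D where "D \<ge> 0"
    "\<And>s y. \<bar>Re s\<bar> \<le> A \<Longrightarrow> 0 < y \<Longrightarrow> y \<le> 1 \<Longrightarrow> norm (g y * mellin_kernel s y) \<le> D"
    "\<And>s y. \<bar>Re s\<bar> \<le> A \<Longrightarrow> 1 \<le> y \<Longrightarrow> norm (g y * mellin_kernel s y) \<le> D / y\<^sup>2"
proof -
  obtain m :: nat where m: "A + 1 \<le> real m" using real_arch_simple by blast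
  obtain D1 where D1: "D1 \<ge> 0" "\<And>x. x > 0 \<Longrightarrow> x ^ m * exp (- \<delta> * x) \<le> D1" using power_exp_bounded[OF \<delta>_pos] by blast
  obtain D2 where D2: "D2 \<ge> 0" "\<And>x :: real. x > 0 \<Longrightarrow> x ^ m * exp (- 1 * x) \<le> D2" by (rule power_exp_bounded[of 1 m]) simp_all
  have 1: "norm (g y * mellin_kernel s y) \<le> C * D1" if "\<bar>Re s\<bar> \<le> A" "0 < y" "y \<le> 1" for s y
  proof -
    have "y powr (Re s - 1) \<le> y powr (- real m)" by (rule powr_mono') (use that m in auto)
    also have "\<dots> = (1 / y) ^ m" using that by (simp add: powr_minus powr_realpow power_divide inverse_eq_divide)
    finally have "norm (g y * mellin_kernel s y) \<le> (C * exp (- \<delta> / y)) * (1 / y) ^ m"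
      unfolding norm_mult norm_mellin_kernel[OF that(2)] using that C_nonneg by (intro mult_mono g_decay) auto
    also have "\<dots> = C * ((1 / y) ^ m * exp (- \<delta> * (1 / y)))" by simp
    also have "\<dots> \<le> C * D1" using that by (intro mult_left_mono D1 C_nonneg) simp
    finally show ?thesis .
  qed
  have 2: "norm (g y * mellin_kernel s y) \<le> C * D2 / y\<^sup>2" if "\<bar>Re s\<bar> \<le> A" "1 \<le> y" for s y
  proof -
    have y: "0 < y" using that by simp
    have "y powr (Re s - 1) \<le> y powr real m" by (rule powr_mono) (use that m in auto)
    also have "\<dots> = y ^ m" using y by (simp add: powr_realpow)
    finally have "norm (g y * mellin_kernel s y) \<le> (C * (exp (- y) / y ^ 3)) * y ^ m"
      unfolding norm_mult norm_mellin_kernel[OF y] using y C_nonneg by (intro mult_mono norm_g) auto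
    also have "\<dots> = C * (y ^ m * exp (- 1 * y)) / y ^ 3" by simp
    also have "\<dots> \<le> C * D2 / y ^ 3" using y by (intro divide_right_mono mult_left_mono D2 C_nonneg) auto
    also have "\<dots> \<le> C * D2 / y\<^sup>2" using that C_nonneg D2(1) by (intro divide_left_mono power_increasing) auto
    finally show ?thesis .
  qed
  have "C * D1 / 1 \<le> C * (D1 + D2)" "C * D2 \<le> C * (D1 + D2)" "0 \<le> C * (D1 + D2)"
    using C_nonneg D1(1) D2(1) by (simp_all add: distrib_left)
  then show ?thesis
    using that[of "C * (D1 + D2)"] order_trans[OF 1] order_trans[OF 2] by (simp add: divide_right_mono)
qed

text \<open>One added interval, \<open>[1/(n+2), 1/(n+1)]\<close>, has length at most
  \<open>1/(n+1)^2\<close>; on the other, \<open>[n+1, n+2]\<close>, the integrand is at most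
  \<open>D/(n+1)^2\<close>.\<close>

lemma truncated_mellin_step:
  assumes D: "D \<ge> 0" "\<And>y. 0 < y \<Longrightarrow> y \<le> 1 \<Longrightarrow> norm (g y * mellin_kernel s y) \<le> D"
    "\<And>y. 1 \<le> y \<Longrightarrow> norm (g y * mellin_kernel s y) \<le> D / y\<^sup>2"
  shows "norm (truncated_mellin (Suc n) s - truncated_mellin n s) \<le> 2 * D * (1 / (real (Suc n))\<^sup>2)"
proof -
  let ?f = "\<lambda>y. g y * mellin_kernel s y"
  define a where "a = real (Suc n)"
  have a: "a \<ge> 1" and Sa: "real (Suc (Suc n)) = a + 1" by (simp_all add: a_def)
  have o: "1 / (a + 1) \<le> 1 / a" "1 / a \<le> a" "a \<le> a + 1" "0 < 1 / (a + 1)" "1 / a \<le> 1" "0 < 1 / a" using a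
    by (auto simp: field_simps intro: order_trans[OF _ mult_left_mono[of 1 a a]])
  have o': "1 / (a + 1) \<le> a" using o by linarith
  have int: "?f integrable_on {u..v}" if "0 < u" for u v
    by (rule integrable_continuous_interval, rule integrand_cont) (use that in auto)
  have "integral {1 / (a + 1)..a + 1} ?f = integral {1 / (a + 1)..a} ?f + integral {a..a + 1} ?f"
    by (rule Henstock_Kurzweil_Integration.integral_combine[OF o' o(3) int[OF o(4)], symmetric])
  also have "integral {1 / (a + 1)..a} ?f = integral {1 / (a + 1)..1 / a} ?f + integral {1 / a..a} ?f"
    by (rule Henstock_Kurzweil_Integration.integral_combine[OF o(1) o(2) int[OF o(4)], symmetric])
  finally have eq: "truncated_mellin (Suc n) s - truncated_mellin n s = integral {1 / (a + 1)..1 / a} ?f + integral {a..a + 1} ?f"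
    unfolding truncated_mellin_def Sa a_def[symmetric] by simp
  have "norm (integral {1 / (a + 1)..1 / a} ?f) \<le> D * (1 / a - 1 / (a + 1))"
  proof (rule integral_bound)
    have t: "0 < t" "t \<le> 1" if "t \<in> {1 / (a + 1)..1 / a}" for t
      using that less_le_trans[OF o(4)] order_trans[OF _ o(5)] by auto
    show "continuous_on {1 / (a + 1)..1 / a} ?f" by (rule integrand_cont) (use t in auto)
    show "norm (?f x) \<le> D" if "x \<in> {1 / (a + 1)..1 / a}" for x using D(2) t[OF that] by blast
  qed (rule o(1))
  moreover have "norm (integral {a..a + 1} ?f) \<le> (D / a\<^sup>2) * (a + 1 - a)"
  proof (rule integral_bound)
    fix t assume t: "t \<in> {a..a + 1}"
    have "norm (?f t) \<le> D / t\<^sup>2" by (rule D) (use a t in auto)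
    also have "\<dots> \<le> D / a\<^sup>2" using D(1) a t by (intro divide_left_mono power_mono) auto
    finally show "norm (?f t) \<le> D / a\<^sup>2" .
  qed (use a in \<open>auto intro!: integrand_cont\<close>)
  moreover have "D * (1 / a - 1 / (a + 1)) \<le> D * (1 / a\<^sup>2)"
  proof (rule mult_left_mono[OF _ D(1)])
    have "1 / a - 1 / (a + 1) = 1 / (a * (a + 1))" using a by (simp add: field_simps)
    also have "\<dots> \<le> 1 / (a * a)" using a by (intro divide_left_mono mult_left_mono mult_pos_pos) auto
    finally show "1 / a - 1 / (a + 1) \<le> 1 / a\<^sup>2" by (simp only: power2_eq_square)
  qed
  moreover have "D / a\<^sup>2 * (a + 1 - a) = D * (1 / a\<^sup>2)" by simp
  ultimately show ?thesis unfolding eq a_def[symmetric] mult.assoc[of 2 D]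
    using norm_triangle_ineq[of "integral {1 / (a + 1)..1 / a} ?f" "integral {a..a + 1} ?f"]
    by linarith
qed

lemma truncated_mellin_uniform:
  "uniform_limit {s. \<bar>Re s\<bar> \<le> A} truncated_mellin mellin sequentially"
proof -
  obtain D where D: "D \<ge> 0"
    "\<And>s y. \<bar>Re s\<bar> \<le> A \<Longrightarrow> 0 < y \<Longrightarrow> y \<le> 1 \<Longrightarrow> norm (g y * mellin_kernel s y) \<le> D"
    "\<And>s y. \<bar>Re s\<bar> \<le> A \<Longrightarrow> 1 \<le> y \<Longrightarrow> norm (g y * mellin_kernel s y) \<le> D / y\<^sup>2"
    using integrand_bound by blast
  have "summable (\<lambda>n. 1 / (real (Suc n))\<^sup>2)" using inverse_squares_sums sums_summable by (simp add: add.commute)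
  then have "summable (\<lambda>n. 2 * D * (1 / (real (Suc n))\<^sup>2))" by (rule summable_mult)
  then have "uniform_limit {s. \<bar>Re s\<bar> \<le> A} (\<lambda>N s. \<Sum>n<N. truncated_mellin (Suc n) s - truncated_mellin n s) mellin sequentially"
    unfolding mellin_def[abs_def] 
  proof (rule Weierstrass_m_test[rotated])
    fix n s assume s: "s \<in> {s. \<bar>Re s\<bar> \<le> A}"
    show "norm (truncated_mellin (Suc n) s - truncated_mellin n s) \<le> 2 * D * (1 / (real (Suc n))\<^sup>2)"
      by (rule truncated_mellin_step) (use D s in auto)
  qed
  moreover have "(\<Sum>n<N. truncated_mellin (Suc n) s - truncated_mellin n s) = truncated_mellin N s" for N s
    by (subst sum_lessThan_telescope) (simp add: truncated_mellin_def)
  ultimately show ?thesis by simp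
qed

lemma truncated_mellin_LIMSEQ: "(\<lambda>N. truncated_mellin N s) \<longlonglongrightarrow> mellin s"
  by (rule tendsto_uniform_limitI[OF truncated_mellin_uniform[of "\<bar>Re s\<bar>"]]) simp

lemma mellin_holomorphic: "mellin holomorphic_on UNIV"
proof (rule holomorphic_uniform_sequence[OF _ truncated_mellin_holomorphic])
  fix x :: complex
  have "\<bar>Re s\<bar> \<le> \<bar>Re x\<bar> + 1" if "s \<in> cball x 1" for s
    using that abs_Re_le_cmod[of "x - s"] by (auto simp: dist_norm)
  then have "uniform_limit (cball x 1) truncated_mellin mellin sequentially"
    by (intro uniform_limit_on_subset[OF truncated_mellin_uniform[of "\<bar>Re x\<bar> + 1"]]) auto
  then show "\<exists>d>0. cball x d \<subseteq> UNIV \<and> uniform_limit (cball x d) truncated_mellin mellin sequentially"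
    by (intro exI[of _ 1]) simp
qed simp

text \<open>Dominated convergence is used twice with the same majorant \<open>h\<close>: for the
  partial sums of \<open>g\<close> and for the truncated integrals. The factor \<open>y^(-3)\<close>
  in the bound is integrable near 0 against the kernel since \<open>Re s > 3\<close>.\<close>

lemma mellin_sums:
  assumes s: "Re s > 3"
  shows "(\<lambda>n. b n * (Gamma s / of_real (2 * pi * real n) powr s)) sums mellin s"
proof -
  define h where "h = (\<lambda>y. C * (y powr (Re s - 3 - 1) / exp y))"
  have "((\<lambda>t. t powr (Re s - 3 - 1) / exp t) has_integral Gamma (Re s - 3)) {0..}"
    by (rule Gamma_integral_real) (use s in simp)
  then have G3: "((\<lambda>t. t powr (Re s - 3 - 1) / exp t) has_integral Gamma (Re s - 3)) {0<..}"
    by (subst (asm) has_integral_spike_set_eq[where T = "{0<..}"]) (auto intro: negligible_subset[of "{0}"])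
  have "h integrable_on {0<..}"
    unfolding h_def by (rule has_integral_integrable[OF has_integral_mult_right[OF G3]])
  note h = this
  have hb: "norm (x * mellin_kernel s y) \<le> h y" if y: "y > 0" and x: "norm x \<le> C * (exp (- y) / y ^ 3)" for x y
  proof -
    have "Re s - 3 - 1 = (Re s - 1) - 3" by simp
    then have "y powr (Re s - 3 - 1) = y powr (Re s - 1) / y powr 3" by (simp only: powr_diff[of y "Re s - 1" 3])
    also have "y powr 3 = y ^ 3" using powr_realpow[OF y, of 3] by simp
    finally have "h y = C * (exp (- y) / y ^ 3) * y powr (Re s - 1)" by (simp add: h_def exp_minus field_simps)
    then show ?thesis unfolding norm_mult norm_mellin_kernel[OF y] using mult_right_mono[OF x, of "y powr (Re s - 1)"] by simp
  qed
  define I where "I = integral {0<..} (\<lambda>y. g y * mellin_kernel s y)"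
  let ?F = "\<lambda>K y. (\<Sum>n<K. b n * of_real (exp (- 2 * pi * real n * y))) * mellin_kernel s y"
  let ?c = "\<lambda>n. b n * (Gamma s / of_real (2 * pi * real n) powr s)"
  have t: "((\<lambda>y. b n * of_real (exp (- 2 * pi * real n * y)) * mellin_kernel s y) has_integral ?c n) {0<..}" for n
  proof (cases "n = 0")
    case False
    then have "2 * pi * real n > 0" by simp
    from has_integral_mult_right[OF mellin_exp[OF _ this, of s], of "b n"] s show ?thesis by (simp add: mult.assoc)
  qed (simp add: b_0)
  have F: "(?F K has_integral (\<Sum>n<K. ?c n)) {0<..}" for K
    unfolding sum_distrib_right by (intro has_integral_sum t) simp
  have "(\<lambda>K. integral {0<..} (?F K)) \<longlonglongrightarrow> I"
    unfolding I_def
  proof (rule dominated_convergence(2)[OF _ h])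
    show "?F K integrable_on {0<..}" for K using F by (rule has_integral_integrable)
    show "norm (?F K y) \<le> h y" if "y \<in> {0<..}" for K y using that norm_partial_sum[of y K] by (intro hb) auto
    show "(\<lambda>K. ?F K y) \<longlonglongrightarrow> g y * mellin_kernel s y" if "y \<in> {0<..}" for y
      using that g_sums[of y] unfolding sums_def by (intro tendsto_mult_right) auto
  qed
  then have sums: "?c sums I" unfolding sums_def integral_unique[OF F] .
  let ?J = "\<lambda>N. {1 / real (Suc N)..real (Suc N)}"
  let ?G = "\<lambda>N y. if y \<in> ?J N then g y * mellin_kernel s y else 0"
  have J: "?J N \<subseteq> {0<..}" for N using order.strict_trans2[of 0 "1 / real (Suc N)"] by auto
  have G: "(?G N has_integral truncated_mellin N s) {0<..}" for N
    unfolding truncated_mellin_def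
    by (rule iffD2[OF has_integral_restrict[OF J]], rule integrable_integral, rule integrable_continuous_interval, rule integrand_cont[OF J])
  have "(\<lambda>N. integral {0<..} (?G N)) \<longlonglongrightarrow> I"
    unfolding I_def
  proof (rule dominated_convergence(2)[OF _ h])
    show "?G N integrable_on {0<..}" for N using G by (rule has_integral_integrable)
    show "norm (?G N y) \<le> h y" if "y \<in> {0<..}" for N y
      using that hb[of y "g y"] norm_g[of y] C_nonneg by (auto simp: h_def)
    show "(\<lambda>N. ?G N y) \<longlonglongrightarrow> g y * mellin_kernel s y" if "y \<in> {0<..}" for y
    proof (rule tendsto_eventually)
      have y: "y > 0" using that by simp
      obtain N0 :: nat where N0: "max y (1 / y) \<le> real N0" using real_arch_simple by blast
      have "y \<in> ?J N" if "N \<ge> N0" for N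
      proof -
        have "max y (1 / y) \<le> real (Suc N)" using N0 that by simp
        then have "y \<le> real (Suc N)" "1 / y \<le> real (Suc N)" by simp_all
        then show ?thesis using y by (simp add: field_simps del: of_nat_Suc)
      qed
      then show "\<forall>\<^sub>F N in sequentially. ?G N y = g y * mellin_kernel s y"
        unfolding eventually_sequentially by (intro exI[of _ N0]) simp
    qed
  qed
  then have "(\<lambda>N. truncated_mellin N s) \<longlonglongrightarrow> I" unfolding integral_unique[OF G] .
  then have "mellin s = I" using truncated_mellin_LIMSEQ LIMSEQ_unique by blast
  then show ?thesis using sums by simp
qed

text \<open>The continuation is \<open>(2 pi)^s mellin s / Gamma s\<close>, entire because
  \<open>1 / Gamma\<close> is. At \<open>s = 2\<close> the kernel is \<open>y\<close> and
  \<open>Gamma 2 = 1\<close>.\<close>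

theorem entire_continuation:
  obtains L where "L holomorphic_on UNIV" "\<And>s. Re s > 3 \<Longrightarrow> (\<lambda>n. b n / of_nat n powr s) sums L s"
    "(\<lambda>N. (2 * pi)\<^sup>2 * integral {1 / real (Suc N)..real (Suc N)} (\<lambda>y. g y * of_real y)) \<longlonglongrightarrow> L 2"
proof
  let ?L = "\<lambda>s. of_real (2 * pi) powr s * rGamma s * mellin s"
  show "?L holomorphic_on UNIV" by (intro holomorphic_intros mellin_holomorphic)
  show "(\<lambda>n. b n / of_nat n powr s) sums ?L s" if s: "Re s > 3" for s
  proof -
    have "s \<notin> \<int>\<^sub>\<le>\<^sub>0" using s by (auto elim!: nonpos_Ints_cases)
    then have G: "rGamma s * Gamma s = 1" by (simp add: rGamma_inverse_Gamma Gamma_eq_zero_iff)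
    have "of_real (2 * pi) powr s * rGamma s * (b n * (Gamma s / of_real (2 * pi * real n) powr s)) = b n / of_nat n powr s" for n
    proof (cases "n = 0")
      case False
      have "complex_of_real (2 * pi * real n) powr s = of_real (2 * pi) powr s * of_real (real n) powr s"
        by (subst powr_times_real[symmetric]) (simp_all)
      moreover have "complex_of_real (2 * pi) powr s \<noteq> 0" by simp
      ultimately have "of_real (2 * pi) powr s * rGamma s * (b n * (Gamma s / of_real (2 * pi * real n) powr s)) = (rGamma s * Gamma s) * (b n / of_nat n powr s)"
        by (simp add: field_simps)
      then show ?thesis unfolding G by simp
    qed (simp add: b_0)
    then show ?thesis using sums_mult[OF mellin_sums[OF s], of "of_real (2 * pi) powr s * rGamma s"] by simp
  qed
  have k: "integral {1 / real (Suc N)..real (Suc N)} (\<lambda>y. g y * of_real y) = truncated_mellin N 2" for N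
    unfolding truncated_mellin_def
  proof (rule integral_cong)
    fix y assume "y \<in> {1 / real (Suc N)..real (Suc N)}"
    then have "y > 0" using order.strict_trans2[of 0 "1 / real (Suc N)" y] by simp
    then show "g y * of_real y = g y * mellin_kernel 2 y" by (simp add: mellin_kernel_def exp_of_real)
  qed
  have "complex_of_real (2 * pi) powr 2 = of_real (2 * pi) ^ 2" by (rule powr_complexnumeral)
  moreover have "rGamma (2 :: complex) = 1" by (simp add: rGamma_inverse_Gamma Gamma_numeral)
  ultimately have "(2 * pi)\<^sup>2 * mellin 2 = ?L 2" by (simp only: of_real_power mult_1_right)
  moreover have "(\<lambda>N. (2 * pi)\<^sup>2 * truncated_mellin N 2) \<longlonglongrightarrow> (2 * pi)\<^sup>2 * mellin 2"
    by (rule tendsto_mult_left[OF truncated_mellin_LIMSEQ])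
  ultimately show "(\<lambda>N. (2 * pi)\<^sup>2 * integral {1 / real (Suc N)..real (Suc N)} (\<lambda>y. g y * of_real y)) \<longlonglongrightarrow> ?L 2"
    unfolding k by (simp only:)
qed

end

section \<open>Twists by a quadratic character\<close>

text \<open>The expression of \<open>period_limit\<close> before taking the imaginary part. It is a
  primitive in \<open>y\<close> of \<open>-2 y f(r + iy)\<close> when \<open>F1\<close> and
  \<open>F2\<close> are successive primitives of \<open>f\<close>.\<close>

definition cusp_period :: "(complex \<Rightarrow> complex) \<Rightarrow> (complex \<Rightarrow> complex) \<Rightarrow> real \<Rightarrow> real \<Rightarrow> complex" where
  "cusp_period F1 F2 r y = 2 * (\<i> * of_real y) * F1 (Complex r y) - 2 * F2 (Complex r y)"

lemma cusp_period_deriv: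
  assumes F: "\<And>z. Im z > 0 \<Longrightarrow> (F1 has_field_derivative f z) (at z)"
    "\<And>z. Im z > 0 \<Longrightarrow> (F2 has_field_derivative F1 z) (at z)" and y: "y > 0"
  shows "(cusp_period F1 F2 r has_vector_derivative - 2 * of_real y * f (Complex r y)) (at y)"
proof -
  have c: "(Complex r has_vector_derivative \<i>) (at y)"
  proof -
    have "Complex r = (\<lambda>y. of_real r + of_real y * \<i>)" by (auto simp: complex_eq_iff)
    then show ?thesis by (auto intro!: derivative_eq_intros has_vector_derivative_real_field)
  qed
  have z: "Im (Complex r y) > 0" using y by simp
  have 1: "((\<lambda>y. F1 (Complex r y)) has_vector_derivative \<i> * f (Complex r y)) (at y)"
    using field_vector_diff_chain_at[OF c F(1)[OF z]] by (simp add: comp_def)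
  have 2: "((\<lambda>y. F2 (Complex r y)) has_vector_derivative \<i> * F1 (Complex r y)) (at y)"
    using field_vector_diff_chain_at[OF c F(2)[OF z]] by (simp add: comp_def)
  have 3: "((\<lambda>y. 2 * (\<i> * complex_of_real y)) has_vector_derivative 2 * \<i>) (at y)"
    by (auto intro!: derivative_eq_intros simp: has_vector_derivative_def scaleR_conv_of_real)
  have "((\<lambda>y. 2 * (\<i> * of_real y) * F1 (Complex r y) - 2 * F2 (Complex r y)) has_vector_derivative
      (2 * (\<i> * of_real y) * (\<i> * f (Complex r y)) + 2 * \<i> * F1 (Complex r y)) - 2 * (\<i> * F1 (Complex r y))) (at y)"
    by (intro has_vector_derivative_diff has_vector_derivative_mult 1 3 has_vector_derivative_mult_right 2)
  moreover have "(2 * (\<i> * of_real y) * (\<i> * f (Complex r y)) + 2 * \<i> * F1 (Complex r y)) - 2 * (\<i> * F1 (Complex r y)) = - 2 * of_real y * f (Complex r y)"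
    by (simp add: algebra_simps i_mult_i_mult)
  ultimately show ?thesis unfolding cusp_period_def[abs_def] by (simp only:)
qed

context odd_quadratic_character
begin

lemma sum_residues:
  assumes F: "\<And>x y. [x = y] (mod p) \<Longrightarrow> F x = F y" and k: "\<not> p dvd k"
  shows "(\<Sum>j\<in>{0..<p}. F (k * j)) = (\<Sum>j\<in>{0..<p}. F j)"
proof -
  let ?h = "\<lambda>j. (k * j) mod p"
  have inj: "inj_on ?h {0..<p}"
  proof (rule inj_onI)
    fix i j assume i: "i \<in> {0..<p}" and j: "j \<in> {0..<p}" and eq: "?h i = ?h j"
    have "p dvd k * (i - j)" using eq by (simp add: mod_eq_dvd_iff right_diff_distrib)
    then have "p dvd i - j" using k p_prime by (simp add: prime_dvd_mult_iff)
    then show "i = j" using i j dvd_imp_le_int[of "i - j" p] by (cases "i = j") auto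
  qed
  have "?h ` {0..<p} = {0..<p}" by (rule endo_inj_surj[OF _ _ inj]) (use p_pos in auto)
  then have "(\<Sum>j\<in>{0..<p}. F j) = (\<Sum>j\<in>{0..<p}. F (?h j))" using sum.reindex[OF inj, of F] by (simp add: comp_def)
  also have "\<dots> = (\<Sum>j\<in>{0..<p}. F (k * j))" by (intro sum.cong refl F) (simp add: cong_def)
  finally show ?thesis ..
qed

lemma sum_character: "(\<Sum>j\<in>{0..<p}. chi j) = 0"
proof -
  have "\<not> p dvd -1" using p_prime not_prime_unit by (metis dvd_minus_iff)
  from sum_residues[OF chi_cong this, of "\<lambda>x. x"] have "(\<Sum>j\<in>{0..<p}. chi (- j)) = (\<Sum>j\<in>{0..<p}. chi j)" by simp
  then show ?thesis by (simp add: chi_minus sum_negf)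
qed

definition additive_char :: "int \<Rightarrow> complex" where
  "additive_char x = exp (2 * \<i> * pi * (of_int x / of_int p))"

lemma additive_char_cong:
  assumes "[x = y] (mod p)"
  shows "additive_char x = additive_char y"
proof -
  obtain k where "x - y = p * k" using assms unfolding cong_iff_dvd_diff by (rule dvdE)
  then have x: "x = y + p * k" by simp
  have e: "2 * \<i> * pi * (of_int x / of_int p) = 2 * \<i> * pi * (of_int y / of_int p) + of_int k * (2 * of_real pi * \<i>)"
    using p_pos unfolding x by (simp add: field_simps)
  have "exp (of_int k * (2 * complex_of_real pi * \<i>)) = 1" using exp_integer_2pi[of "of_int k"] by (simp add: mult_ac)
  then show ?thesis unfolding additive_char_def e exp_add by simp
qed

definition gauss_sum :: complex where
  "gauss_sum = (\<Sum>j\<in>{0..<p}. of_int (chi j) * additive_char j)"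

text \<open>Substitute \<open>n j\<close> for \<open>j\<close>; if \<open>p\<close> divides
  \<open>n\<close>, both sides vanish because the character sums to 0.\<close>

lemma gauss_sum_twist: "(\<Sum>j\<in>{0..<p}. of_int (chi j) * additive_char (n * j)) = of_int (chi n) * gauss_sum"
proof (cases "p dvd n")
  case True
  then have "additive_char (n * j) = additive_char 0" for j by (intro additive_char_cong) (simp add: cong_0_iff)
  then have "additive_char (n * j) = 1" for j by (simp add: additive_char_def)
  moreover have "(\<Sum>j\<in>{0..<p}. complex_of_int (chi j)) = 0" using sum_character by (simp flip: of_int_sum)
  ultimately show ?thesis using True chi_zero[of n] by simp
next
  case False
  have n1: "chi n * chi n = 1" using chi_square[OF False] by (simp add: power2_eq_square chi_mult)
  have "of_int (chi n) * gauss_sum = of_int (chi n) * (\<Sum>j\<in>{0..<p}. of_int (chi (n * j)) * additive_char (n * j))"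
    unfolding gauss_sum_def
    by (subst sum_residues[of "\<lambda>j. of_int (chi j) * additive_char j" n]) (use False chi_cong additive_char_cong in auto)
  also have "\<dots> = (\<Sum>j\<in>{0..<p}. of_int (chi n * chi n) * (of_int (chi j) * additive_char (n * j)))"
    unfolding sum_distrib_left by (intro sum.cong refl) (simp add: chi_mult)
  finally show ?thesis by (simp add: n1)
qed

text \<open>Even numerators, so that functions of period 2 can also be summed over residues modulo
  \<open>p\<close>.\<close>

definition twisted_value :: "(complex \<Rightarrow> complex) \<Rightarrow> real \<Rightarrow> complex" where
  "twisted_value f y = (\<Sum>j\<in>{0..<p}. of_int (chi (2 * j)) * f (Complex (of_int (2 * j) / of_int p) y))"

definition twisted_period :: "(complex \<Rightarrow> complex) \<Rightarrow> (complex \<Rightarrow> complex) \<Rightarrow> real \<Rightarrow> complex" where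
  "twisted_period F1 F2 y = (\<Sum>j\<in>{0..<p}. of_int (chi (2 * j)) * cusp_period F1 F2 (of_int (2 * j) / of_int p) y)"

lemma two_coprime: "\<not> p dvd 2"
  using p_odd p_prime by (metis prime_ge_2_int zdvd_imp_le zero_less_numeral order_antisym dvd_refl)

lemma additive_char_form:
  "additive_char x ^ n * of_real (exp (- 2 * pi * real n * y)) = exp (2 * \<i> * pi * Complex (of_int x / of_int p) y) ^ n"
proof -
  have "2 * \<i> * pi * Complex (of_int x / of_int p) y = 2 * \<i> * pi * (of_int x / of_int p) + of_real (- 2 * pi * y)"
    by (simp add: complex_eq_iff)
  then have e: "exp (2 * \<i> * pi * Complex (of_int x / of_int p) y) = additive_char x * of_real (exp (- 2 * pi * y))"
    by (simp only: exp_add additive_char_def exp_of_real)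
  have "exp (- 2 * pi * real n * y) = exp (- 2 * pi * y) ^ n" by (simp add: mult_ac flip: exp_of_nat_mult)
  then show ?thesis unfolding e by (simp add: power_mult_distrib)
qed

text \<open>Summing over \<open>j\<close> inside the Fourier expansion produces \<open>chi n\<close>
  times the Gauss sum; doubling \<open>j\<close> only permutes the residues.\<close>

lemma twisted_value_sums:
  assumes y: "y > 0"
  shows "(\<lambda>n. gauss_sum * (of_int (eta_coeff n * chi (int n)) * of_real (exp (- 2 * pi * real n * y)))) sums twisted_value eta_form y"
proof -
  have "(\<lambda>n. \<Sum>j\<in>{0..<p}. of_int (chi (2 * j)) * (of_int (eta_coeff n) * exp (2 * \<i> * pi * Complex (of_int (2 * j) / of_int p) y) ^ n))
     sums twisted_value eta_form y"
    unfolding twisted_value_def by (intro sums_sum sums_mult eta_form_sums) (use y in simp)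
  moreover have "(\<Sum>j\<in>{0..<p}. of_int (chi (2 * j)) * (of_int (eta_coeff n) * exp (2 * \<i> * pi * Complex (of_int (2 * j) / of_int p) y) ^ n))
     = gauss_sum * (of_int (eta_coeff n * chi (int n)) * of_real (exp (- 2 * pi * real n * y)))" for n
  proof -
    have p: "additive_char x ^ n = additive_char (int n * x)" for x
      unfolding additive_char_def by (subst exp_of_nat_mult[symmetric]) (simp add: mult_ac)
    have "(\<Sum>j\<in>{0..<p}. of_int (chi (2 * j)) * (of_int (eta_coeff n) * exp (2 * \<i> * pi * Complex (of_int (2 * j) / of_int p) y) ^ n))
      = (\<Sum>j\<in>{0..<p}. of_int (eta_coeff n) * of_real (exp (- 2 * pi * real n * y)) * (of_int (chi (2 * j)) * additive_char (int n * (2 * j))))"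
      unfolding additive_char_form[symmetric] p by (intro sum.cong refl) (simp only: mult_ac)
    also have "\<dots> = of_int (eta_coeff n) * of_real (exp (- 2 * pi * real n * y)) * (\<Sum>j\<in>{0..<p}. of_int (chi (2 * j)) * additive_char (int n * (2 * j)))"
      by (rule sum_distrib_left[symmetric])
    also have "(\<Sum>j\<in>{0..<p}. of_int (chi (2 * j)) * additive_char (int n * (2 * j))) = (\<Sum>j\<in>{0..<p}. of_int (chi j) * additive_char (int n * j))"
      by (rule sum_residues[of "\<lambda>j. of_int (chi j) * additive_char (int n * j)" 2, OF _ two_coprime])
        (metis chi_cong additive_char_cong cong_mult cong_refl)
    finally show ?thesis unfolding gauss_sum_twist by (simp add: mult_ac)
  qed
  ultimately show ?thesis by simp
qed

lemma continuous_twisted_value: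
  assumes f: "f holomorphic_on {z. Im z > 0}"
  shows "continuous_on {0<..} (twisted_value f)"
  unfolding twisted_value_def[abs_def]
proof (intro continuous_intros)
  fix j
  have "Complex r = (\<lambda>y. of_real r + of_real y * \<i>)" for r by (auto simp: complex_eq_iff)
  then have c: "continuous_on {0<..} (Complex r)" for r by (simp add: continuous_intros)
  show "continuous_on {0<..} (\<lambda>y. f (Complex (of_int (2 * j) / of_int p) y))"
    by (rule continuous_on_compose2[OF holomorphic_on_imp_continuous_on[OF f] c]) auto
qed

lemma eta_form_holomorphic: "eta_form holomorphic_on {z. Im z > 0}"
proof -
  have "(\<lambda>z. eta2 (of_real k * z)) holomorphic_on {z. Im z > 0}" if "k > 0" for k
    using holomorphic_on_compose_gen[OF _ eta2_holomorphic, of "\<lambda>z. of_real k * z" "{z. Im z > 0}"] that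
    by (auto simp: comp_def image_subset_iff intro!: holomorphic_intros)
  from this[of 2] this[of 3] this[of 6] show ?thesis
    unfolding eta_form_def[abs_def] by (intro holomorphic_intros eta2_holomorphic) simp_all
qed

lemma twisted_period_deriv:
  assumes F: "\<And>z. Im z > 0 \<Longrightarrow> (F1 has_field_derivative f z) (at z)"
    "\<And>z. Im z > 0 \<Longrightarrow> (F2 has_field_derivative F1 z) (at z)" and y: "y > 0"
  shows "(twisted_period F1 F2 has_vector_derivative - 2 * of_real y * twisted_value f y) (at y)"
proof -
  have "(twisted_period F1 F2 has_vector_derivative (\<Sum>j\<in>{0..<p}. of_int (chi (2 * j)) * (- 2 * of_real y * f (Complex (of_int (2 * j) / of_int p) y)))) (at y)"
    unfolding twisted_period_def[abs_def]
    by (intro has_vector_derivative_sum has_vector_derivative_mult_right cusp_period_deriv F y)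
  then show ?thesis unfolding twisted_value_def sum_distrib_left by (simp add: mult_ac)
qed

lemma twisted_period_integral:
  assumes F: "\<And>z. Im z > 0 \<Longrightarrow> (F1 has_field_derivative f z) (at z)"
    "\<And>z. Im z > 0 \<Longrightarrow> (F2 has_field_derivative F1 z) (at z)" and ab: "0 < a" "a \<le> b"
  shows "((\<lambda>y. twisted_value f y * of_real y) has_integral (twisted_period F1 F2 a - twisted_period F1 F2 b) / 2) {a..b}"
proof -
  have "((\<lambda>y. - 2 * of_real y * twisted_value f y) has_integral twisted_period F1 F2 b - twisted_period F1 F2 a) {a..b}"
    using ab by (intro fundamental_theorem_of_calculus has_vector_derivative_at_within[OF twisted_period_deriv] F) auto
  from has_integral_mult_right[OF this, of "- 1 / 2"]
  have "((\<lambda>y. - 1 / 2 * (- 2 * of_real y * twisted_value f y)) has_integral - 1 / 2 * (twisted_period F1 F2 b - twisted_period F1 F2 a)) {a..b}" .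
  moreover have "- 1 / 2 * (- 2 * of_real y * x) = x * of_real y" for x :: complex and y by simp
  moreover have "- 1 / 2 * (u - v) = (v - u) / 2" for u v :: complex by (simp add: field_simps)
  ultimately show ?thesis by (simp only:)
qed

lemma cusp_period_at_top:
  assumes "\<And>z. Im z \<ge> 1 \<Longrightarrow> norm (F1 z) \<le> K * exp (- pi * Im z)" "\<And>z. Im z \<ge> 1 \<Longrightarrow> norm (F2 z) \<le> K * exp (- pi * Im z)"
  shows "(cusp_period F1 F2 r \<longlongrightarrow> 0) at_top"
proof (rule Lim_null_comparison)
  show "\<forall>\<^sub>F y in at_top. norm (cusp_period F1 F2 r y) \<le> K * ((2 * y + 2) * exp (- pi * y))"
    using eventually_ge_at_top[of 1]
  proof eventually_elim
    case (elim y)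
    have "norm (cusp_period F1 F2 r y) \<le> 2 * y * norm (F1 (Complex r y)) + 2 * norm (F2 (Complex r y))"
      unfolding cusp_period_def using norm_triangle_ineq4[of "2 * (\<i> * of_real y) * F1 (Complex r y)" "2 * F2 (Complex r y)"] elim
      by (simp add: norm_mult)
    also have "\<dots> \<le> 2 * y * (K * exp (- pi * y)) + 2 * (K * exp (- pi * y))"
      using assms[of "Complex r y"] elim by (intro add_mono mult_left_mono) auto
    finally show ?case by (simp add: algebra_simps)
  qed
  have "((\<lambda>y. (2 * y + 2) * exp (- pi * y)) \<longlongrightarrow> 0) at_top" by real_asymp
  from tendsto_mult_right_zero[OF this, of K] show "((\<lambda>y. K * ((2 * y + 2) * exp (- pi * y))) \<longlongrightarrow> 0) at_top" .
qed

lemma twisted_period_at_top: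
  assumes "\<And>z. Im z \<ge> 1 \<Longrightarrow> norm (F1 z) \<le> K * exp (- pi * Im z)" "\<And>z. Im z \<ge> 1 \<Longrightarrow> norm (F2 z) \<le> K * exp (- pi * Im z)"
  shows "(twisted_period F1 F2 \<longlongrightarrow> 0) at_top"
  unfolding twisted_period_def[abs_def]
  by (intro tendsto_null_sum tendsto_mult_right_zero cusp_period_at_top[OF assms])

lemma twisted_period_limit:
  assumes "reflection_form f F1 F2 F3 (of_int e) K" and e: "e = 1 \<or> e = -1"
  shows "((\<lambda>y. Im (twisted_period F1 F2 y)) \<longlongrightarrow> reflection_form.kappa F1 F2 F3 * (of_int (wall_sum e) / of_int p)) (at_right 0)"
proof -
  interpret reflection_form f F1 F2 F3 "of_int e" K by fact
  let ?r = "\<lambda>j. real_of_int (2 * j) / real_of_int p"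
  have "((\<lambda>y. \<Sum>j\<in>{0..<p}. of_int (chi (2 * j)) * Im (cusp_period F1 F2 (?r j) y)) \<longlongrightarrow>
     (\<Sum>j\<in>{0..<p}. of_int (chi (2 * j)) * (kappa * (\<Sum>(a, b, c)\<in>walls_over (?r j). (if even b then 1 else of_int e) * (of_int a * ?r j + of_int b))))) (at_right 0)"
    unfolding cusp_period_def by (intro tendsto_intros period_limit[OF p_pos finite_walls_over[OF p_pos]])
  moreover have "(\<Sum>j\<in>{0..<p}. of_int (chi (2 * j)) * (kappa * (\<Sum>(a, b, c)\<in>walls_over (?r j). (if even b then 1 else of_int e) * (of_int a * ?r j + of_int b))))
     = kappa * (of_int (wall_sum e) / of_int p)"
    unfolding twisted_wall_sum[OF e, symmetric] sum_distrib_left[where r = kappa and A = "{0..<p}"] by (intro sum.cong refl mult.left_commute)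
  moreover have "Im (twisted_period F1 F2 y) = (\<Sum>j\<in>{0..<p}. of_int (chi (2 * j)) * Im (cusp_period F1 F2 (?r j) y))" for y
    unfolding twisted_period_def by (simp add: Im_sum)
  ultimately show ?thesis by simp
qed

end

section \<open>Non-vanishing\<close>

lemma exponential_decay_sum:
  assumes "finite A"
    and "\<And>j. j \<in> A \<Longrightarrow> \<exists>C \<delta>. 0 \<le> C \<and> 0 < \<delta> \<and> (\<forall>y>0. norm (f j y) \<le> C * exp (- \<delta> / y))"
  shows "\<exists>C \<delta>. 0 \<le> C \<and> 0 < \<delta> \<and> (\<forall>y>0::real. norm (\<Sum>j\<in>A. f j y :: complex) \<le> C * exp (- \<delta> / y))"
  using assms
proof (induction A rule: finite_induct)
  case empty
  show ?case by (intro exI[of _ 0] exI[of _ 1]) simp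
next
  case (insert i A)
  obtain C1 \<delta>1 where 1: "0 \<le> C1" "0 < \<delta>1" "\<And>y. y > 0 \<Longrightarrow> norm (f i y) \<le> C1 * exp (- \<delta>1 / y)" using insert.prems by blast
  obtain C2 \<delta>2 where 2: "0 \<le> C2" "0 < \<delta>2" "\<And>y. y > 0 \<Longrightarrow> norm (\<Sum>j\<in>A. f j y) \<le> C2 * exp (- \<delta>2 / y)"
    using insert.IH insert.prems by blast
  define \<delta> where "\<delta> = min \<delta>1 \<delta>2"
  have "norm (\<Sum>j\<in>insert i A. f j y) \<le> (C1 + C2) * exp (- \<delta> / y)" if y: "y > 0" for y
  proof -
    have e: "exp (- \<delta>1 / y) \<le> exp (- \<delta> / y)" "exp (- \<delta>2 / y) \<le> exp (- \<delta> / y)"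
      using y by (simp_all add: \<delta>_def divide_right_mono)
    have "norm (\<Sum>j\<in>insert i A. f j y) \<le> norm (f i y) + norm (\<Sum>j\<in>A. f j y)" using insert.hyps by (simp add: norm_triangle_ineq)
    also have "\<dots> \<le> C1 * exp (- \<delta>1 / y) + C2 * exp (- \<delta>2 / y)" by (intro add_mono 1 2 y)
    also have "\<dots> \<le> C1 * exp (- \<delta> / y) + C2 * exp (- \<delta> / y)" by (intro add_mono mult_left_mono e 1 2)
    finally show ?thesis by (simp add: distrib_right)
  qed
  moreover have "0 \<le> C1 + C2" "0 < \<delta>" using 1 2 by (simp_all add: \<delta>_def)
  ultimately show ?case by blast
qed

context odd_quadratic_character
begin

lemma twisted_value_decay:
  "\<exists>C \<delta>. 0 \<le> C \<and> 0 < \<delta> \<and> (\<forall>y>0. norm (twisted_value eta_form y) \<le> C * exp (- \<delta> / y))"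
  "\<exists>C \<delta>. 0 \<le> C \<and> 0 < \<delta> \<and> (\<forall>y>0. norm (twisted_value eta_form8 y) \<le> C * exp (- \<delta> / y))"
proof -
  have n: "norm (of_int (chi x) * w) \<le> norm w" for x and w :: complex
    using chi_range[of x] by (auto simp: norm_mult)
  have r: "real_of_int (2 * j) / real_of_int p \<in> \<rat>" for j by (intro Rats_divide Rats_of_int)
  show "\<exists>C \<delta>. 0 \<le> C \<and> 0 < \<delta> \<and> (\<forall>y>0. norm (twisted_value eta_form y) \<le> C * exp (- \<delta> / y))"
    unfolding twisted_value_def
  proof (rule exponential_decay_sum)
    fix j
    show "\<exists>C \<delta>. 0 \<le> C \<and> 0 < \<delta> \<and> (\<forall>y>0. norm (of_int (chi (2 * j)) * eta_form (Complex (of_int (2 * j) / of_int p) y)) \<le> C * exp (- \<delta> / y))"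
      by (rule eta_form_cusp_decay[OF r[of j]]) (use order_trans[OF n] in blast)
  qed simp
  show "\<exists>C \<delta>. 0 \<le> C \<and> 0 < \<delta> \<and> (\<forall>y>0. norm (twisted_value eta_form8 y) \<le> C * exp (- \<delta> / y))"
    unfolding twisted_value_def
  proof (rule exponential_decay_sum)
    fix j
    show "\<exists>C \<delta>. 0 \<le> C \<and> 0 < \<delta> \<and> (\<forall>y>0. norm (of_int (chi (2 * j)) * eta_form8 (Complex (of_int (2 * j) / of_int p) y)) \<le> C * exp (- \<delta> / y))"
      by (rule eta_form_cusp_decay[OF r[of j]]) (use order_trans[OF n] in blast)
  qed simp
qed

text \<open>\<open>J N\<close> is the truncated Mellin integral at \<open>s = 2\<close> before
  division by the Gauss sum, and half a difference of twisted periods. The upper end tends to 0, and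
  the lower end has imaginary part tending to \<open>kappa * wall_sum 1 / p\<close>, so
  \<open>J\<close> does not tend to 0.\<close>

theorem twisted_L_nonzero:
  assumes ws: "wall_sum 1 \<noteq> 0"
  shows "\<exists>L. L holomorphic_on UNIV \<and>
    (\<forall>s. Re s > 3 \<longrightarrow> (\<lambda>n. of_int (eta_coeff n * chi (int n)) / of_nat n powr s) sums L s) \<and> L 2 \<noteq> 0"
proof (rule eta_form_reflection)
  fix F1 F2 F3 K assume R: "reflection_form eta_form F1 F2 F3 1 K"
  interpret R: reflection_form eta_form F1 F2 F3 1 K by fact
  define \<nu> where "\<nu> = R.kappa * (of_int (wall_sum 1) / of_int p)"
  have "\<nu> \<noteq> 0" using R.kappa_pos ws p_pos by (simp add: \<nu>_def)
  let ?T = "twisted_period F1 F2"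
  define J where "J = (\<lambda>N. integral {1 / real (Suc N)..real (Suc N)} (\<lambda>y. twisted_value eta_form y * of_real y))"
  have J: "J N = (?T (1 / real (Suc N)) - ?T (real (Suc N))) / 2" for N
  proof -
    have "1 / real (Suc N) \<le> 1" "1 \<le> real (Suc N)" by simp_all
    then have "1 / real (Suc N) \<le> real (Suc N)" by (rule order_trans)
    then show ?thesis unfolding J_def by (intro integral_unique twisted_period_integral R.F1 R.F2) simp_all
  qed
  have "((\<lambda>y. Im (?T y)) \<longlongrightarrow> \<nu>) (at_right 0)"
    unfolding \<nu>_def using twisted_period_limit[of eta_form F1 F2 F3 1 K] R by simp
  moreover have "filterlim (\<lambda>N. 1 / real (Suc N)) (at_right 0) sequentially" by real_asymp
  ultimately have 1: "(\<lambda>N. Im (?T (1 / real (Suc N)))) \<longlonglongrightarrow> \<nu>" by (rule filterlim_compose)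
  have "filterlim (\<lambda>N. real (Suc N)) at_top sequentially" by real_asymp
  moreover have "(?T \<longlongrightarrow> 0) at_top" by (rule twisted_period_at_top) (fact R.F_bound)+
  ultimately have "(\<lambda>N. ?T (real (Suc N))) \<longlonglongrightarrow> 0" by (rule filterlim_compose[rotated])
  from tendsto_Im[OF this] have 2: "(\<lambda>N. Im (?T (real (Suc N)))) \<longlonglongrightarrow> 0" by simp
  have "(\<lambda>N. (Im (?T (1 / real (Suc N))) - Im (?T (real (Suc N)))) / 2) \<longlonglongrightarrow> (\<nu> - 0) / 2" by (intro tendsto_intros 1 2) simp
  then have Jlim: "(\<lambda>N. Im (J N)) \<longlonglongrightarrow> \<nu> / 2" unfolding J by simp
  have nz: "\<not> J \<longlonglongrightarrow> 0"
  proof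
    assume "J \<longlonglongrightarrow> 0"
    from tendsto_Im[OF this] have "(\<lambda>N. Im (J N)) \<longlonglongrightarrow> 0" by simp
    then show False using Jlim LIMSEQ_unique \<open>\<nu> \<noteq> 0\<close> by force
  qed
  \<comment> \<open>A vanishing Gauss sum would annihilate the whole Fourier expansion of the
    twisted value, and \<open>J\<close> with it.\<close>
  have gauss: "gauss_sum \<noteq> 0"
  proof
    assume g0: "gauss_sum = 0"
    have v: "twisted_value eta_form y = 0" if "y > 0" for y
    proof -
      have "(\<lambda>n. 0) sums twisted_value eta_form y" using twisted_value_sums[OF that] unfolding g0 by simp
      then show ?thesis using sums_unique2 sums_zero by blast
    qed
    have "J N = 0" for N
      unfolding J_def by (rule integral_unique, rule has_integral_is_0) (use v less_le_trans[of 0 "1 / real (Suc N)"] in auto)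
    then have "J = (\<lambda>_. 0)" by (rule ext)
    then show False using nz by simp
  qed
  define b where "b = (\<lambda>n. complex_of_int (eta_coeff n * chi (int n)))"
  define g where "g = (\<lambda>y. twisted_value eta_form y / gauss_sum)"
  obtain C1 where C1: "C1 \<ge> 0" "\<And>n. \<bar>real_of_int (eta_coeff n)\<bar> \<le> C1 * (real n)\<^sup>2" by (rule eta_coeff_bound) blast
  obtain C2 \<delta> where C2: "0 \<le> C2" "0 < \<delta>" "\<And>y. y > 0 \<Longrightarrow> norm (twisted_value eta_form y) \<le> C2 * exp (- \<delta> / y)"
    using twisted_value_decay(1) by blast
  define C where "C = C1 + C2 / norm gauss_sum"
  have C: "C1 \<le> C" "C2 / norm gauss_sum \<le> C" "0 \<le> C" using C1(1) C2(1) by (simp_all add: C_def)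
  interpret twisted_series b g C \<delta>
  proof
    show "b 0 = 0" by (simp add: b_def eta_coeff_def)
    show "norm (b n) \<le> C * (real n)\<^sup>2" for n
    proof -
      have "norm (b n) = \<bar>real_of_int (eta_coeff n)\<bar> * \<bar>real_of_int (chi (int n))\<bar>" unfolding b_def by (simp add: norm_mult)
      also have "\<dots> \<le> \<bar>real_of_int (eta_coeff n)\<bar> * 1" using chi_range[of "int n"] by (intro mult_left_mono) auto
      also have "\<dots> \<le> C1 * (real n)\<^sup>2" using C1(2) by simp
      also have "\<dots> \<le> C * (real n)\<^sup>2" by (intro mult_right_mono C) simp
      finally show ?thesis .
    qed
    show "(\<lambda>n. b n * of_real (exp (- 2 * pi * real n * y))) sums g y" if "y > 0" for y
      using sums_divide[OF twisted_value_sums[OF that], of gauss_sum] gauss unfolding b_def g_def by simp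
    show "continuous_on {0<..} g"
      unfolding g_def by (intro continuous_intros continuous_twisted_value eta_form_holomorphic) (use gauss in auto)
    show "norm (g y) \<le> C * exp (- \<delta> / y)" if "y > 0" for y
    proof -
      have "norm (g y) \<le> C2 * exp (- \<delta> / y) / norm gauss_sum"
        unfolding g_def norm_divide by (intro divide_right_mono C2 that) simp
      also have "\<dots> = C2 / norm gauss_sum * exp (- \<delta> / y)" by simp
      also have "\<dots> \<le> C * exp (- \<delta> / y)" by (intro mult_right_mono C) simp
      finally show ?thesis .
    qed
  qed (use C C2 in simp_all)
  show ?thesis
  proof (rule entire_continuation)
    fix L assume L: "L holomorphic_on UNIV" "\<And>s. Re s > 3 \<Longrightarrow> (\<lambda>n. b n / of_nat n powr s) sums L s"
      and L2: "(\<lambda>N. (2 * pi)\<^sup>2 * integral {1 / real (Suc N)..real (Suc N)} (\<lambda>y. g y * of_real y)) \<longlonglongrightarrow> L 2"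
    have I: "integral {1 / real (Suc N)..real (Suc N)} (\<lambda>y. g y * of_real y) = J N / gauss_sum" for N
    proof -
      have "(\<lambda>y. g y * of_real y) = (\<lambda>y. twisted_value eta_form y * of_real y * (1 / gauss_sum))" by (simp add: g_def)
      then show ?thesis unfolding J_def by (simp only: integral_mult_left) simp
    qed
    have "L 2 \<noteq> 0"
    proof
      assume "L 2 = 0"
      then have "(\<lambda>N. (2 * pi)\<^sup>2 * (J N / gauss_sum)) \<longlonglongrightarrow> 0" using L2 unfolding I by simp
      from tendsto_mult_right_zero[OF this, of "gauss_sum / of_real ((2 * pi)\<^sup>2)"] have "J \<longlonglongrightarrow> 0" using gauss by simp
      then show False using nz by simp
    qed
    then show ?thesis using L(1) L(2)[unfolded b_def] by blast
  qed
qed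

lemma cusp_period_shift:
  assumes "\<And>z. F1 (z + 2) = F1 z" "\<And>z. F2 (z + 2) = F2 z"
  shows "cusp_period F1 F2 (r + of_int (2 * k)) y = cusp_period F1 F2 r y"
proof -
  have nat: "cusp_period F1 F2 (r + 2 * real n) y = cusp_period F1 F2 r y" for r n
  proof (induction n)
    case (Suc n)
    have "Complex (r + 2 * real (Suc n)) y = Complex (r + 2 * real n) y + 2" by (simp add: complex_eq_iff)
    then show ?case using Suc by (simp only: cusp_period_def assms)
  qed simp
  show ?thesis
  proof (cases "k \<ge> 0")
    case True
    then show ?thesis using nat[of r "nat k"] by simp
  next
    case False
    then show ?thesis using nat[of "r + of_int (2 * k)" "nat (- k)"] by simp
  qed
qed

text \<open>Multiplication by 3 permutes the residues and \<open>chi 3 = -1\<close>, so the twisted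
  period of \<open>eta_form24\<close> at \<open>y\<close> is \<open>X(y) - X(3y)\<close>, with
  \<open>X\<close> that of \<open>eta_form8\<close>: an integral over \<open>[y, 3y]\<close>, which
  tends to 0 with \<open>y\<close>. Its imaginary part also tends to
  \<open>kappa * wall_sum (-1) / p\<close>, and \<open>kappa > 0\<close>. In terms of Dirichlet
  series, the factor \<open>1 + 9 chi(3) 3^(-s)\<close> vanishes at \<open>s = 2\<close>.\<close>

lemma wall_sum_alternating_eq_0:
  assumes chi3: "chi 3 = -1"
  shows "wall_sum (-1) = 0"
proof (rule eta_form24_reflection)
  fix H1 H2 H3 K
  assume H: "\<And>z. Im z > 0 \<Longrightarrow> (H1 has_field_derivative eta_form8 z) (at z)"
    "\<And>z. Im z > 0 \<Longrightarrow> (H2 has_field_derivative H1 z) (at z)"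
    and per: "\<And>z. H1 (z + 2) = H1 z" "\<And>z. H2 (z + 2) = H2 z"
    and R: "reflection_form eta_form24 (\<lambda>z. H1 z + 3 * H1 (3 * z)) (\<lambda>z. H2 z + H2 (3 * z)) H3 (-1) K"
  interpret R: reflection_form eta_form24 "\<lambda>z. H1 z + 3 * H1 (3 * z)" "\<lambda>z. H2 z + H2 (3 * z)" H3 "-1" K by fact
  let ?T = "twisted_period (\<lambda>z. H1 z + 3 * H1 (3 * z)) (\<lambda>z. H2 z + H2 (3 * z))" and ?X = "twisted_period H1 H2"
  have lim: "((\<lambda>y. Im (?T y)) \<longlongrightarrow> R.kappa * (of_int (wall_sum (-1)) / of_int p)) (at_right 0)"
    using twisted_period_limit[of eta_form24 _ _ H3 "-1" K] R by simp
  have np3: "\<not> p dvd 3" using chi_zero[of 3] chi3 by simp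
  have split: "cusp_period (\<lambda>z. H1 z + 3 * H1 (3 * z)) (\<lambda>z. H2 z + H2 (3 * z)) r y = cusp_period H1 H2 r y + cusp_period H1 H2 (3 * r) (3 * y)" for r y
  proof -
    have "3 * Complex r y = Complex (3 * r) (3 * y)" by (simp add: complex_eq_iff)
    then show ?thesis unfolding cusp_period_def by (simp add: algebra_simps)
  qed
  have T: "?T y = ?X y - ?X (3 * y)" for y
  proof -
    let ?F = "\<lambda>x. of_int (chi (2 * x)) * cusp_period H1 H2 (of_int (2 * x) / of_int p) (3 * y)"
    \<comment> \<open>Shifting the residue by \<open>p k\<close> moves the cusp by
      \<open>2k\<close>, a period of \<open>H1\<close> and \<open>H2\<close>; this is where even
      numerators are used.\<close>
    have cong: "?F u = ?F v" if uv: "[u = v] (mod p)" for u v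
    proof -
      obtain k where "u - v = p * k" using uv unfolding cong_iff_dvd_diff by (rule dvdE)
      then have u: "u = v + p * k" by simp
      have "real_of_int (2 * u) / of_int p = of_int (2 * v) / of_int p + of_int (2 * k)" using p_pos unfolding u by (simp add: field_simps)
      then show ?thesis using chi_cong[of "2 * u" "2 * v"] uv cusp_period_shift[of H1 H2, OF per] by (simp only: cong_mult cong_refl)
    qed
    have "(\<Sum>j\<in>{0..<p}. of_int (chi (2 * j)) * cusp_period H1 H2 (3 * (of_int (2 * j) / of_int p)) (3 * y)) = (\<Sum>j\<in>{0..<p}. - ?F (3 * j))"
    proof (intro sum.cong refl)
      fix j
      have "chi (2 * (3 * j)) = - chi (2 * j)" unfolding mult.left_commute[of 2 3] chi_mult[of 3] chi3 by simp
      moreover have "3 * (real_of_int (2 * j) / of_int p) = of_int (2 * (3 * j)) / of_int p" by simp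
      ultimately show "of_int (chi (2 * j)) * cusp_period H1 H2 (3 * (of_int (2 * j) / of_int p)) (3 * y) = - ?F (3 * j)"
        by (simp only: of_int_minus minus_mult_left[symmetric] minus_minus)
    qed
    also have "\<dots> = - (\<Sum>j\<in>{0..<p}. ?F (3 * j))" by (rule sum_negf)
    also have "(\<Sum>j\<in>{0..<p}. ?F (3 * j)) = (\<Sum>j\<in>{0..<p}. ?F j)" by (rule sum_residues[where F = ?F, OF cong np3])
    also have "\<dots> = ?X (3 * y)" unfolding twisted_period_def ..
    finally show ?thesis unfolding twisted_period_def split distrib_left sum.distrib by simp
  qed
  obtain C \<delta> where C: "0 \<le> C" "0 < \<delta>" "\<And>y. y > 0 \<Longrightarrow> norm (twisted_value eta_form8 y) \<le> C * exp (- \<delta> / y)"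
    using twisted_value_decay(2) by blast
  \<comment> \<open>The integrand is at most \<open>3 C y\<close> on an interval of length
    \<open>2y\<close>, and the twisted period is twice the integral.\<close>
  have bound: "norm (?T y) \<le> 12 * C * y\<^sup>2" if y: "y > 0" for y
  proof -
    have int: "((\<lambda>t. twisted_value eta_form8 t * of_real t) has_integral (?X y - ?X (3 * y)) / 2) {y..3 * y}"
      by (rule twisted_period_integral) (use H y in auto)
    have "norm ((?X y - ?X (3 * y)) / 2) \<le> C * (3 * y) * measure lborel {y..3 * y}"
    proof (rule has_integral_bound_real[OF _ _ int, of "C * (3 * y)" "{}"])
      show "0 \<le> C * (3 * y)" using C(1) y by simp
      fix t assume t: "t \<in> {y..3 * y} - {}"
      then have t0: "t > 0" using y by simp
      have "C * exp (- \<delta> / t) \<le> C * 1" using C t0 by (intro mult_left_mono) simp_all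
      then have "norm (twisted_value eta_form8 t) \<le> C" using C(3)[OF t0] by simp
      then show "norm (twisted_value eta_form8 t * of_real t) \<le> C * (3 * y)"
        unfolding norm_mult using t t0 C(1) by (intro mult_mono) auto
    qed simp
    then show ?thesis unfolding T using y by (simp add: norm_divide power2_eq_square)
  qed
  have "((\<lambda>y. Im (?T y)) \<longlongrightarrow> 0) (at_right 0)"
  proof (rule Lim_null_comparison)
    show "\<forall>\<^sub>F y in at_right 0. norm (Im (?T y)) \<le> 12 * C * y\<^sup>2"
      using eventually_at_right_less[of 0]
      by eventually_elim (use bound abs_Im_le_cmod order_trans in \<open>simp, blast\<close>)
    have "((\<lambda>y. 12 * C * y\<^sup>2) \<longlongrightarrow> 12 * C * 0\<^sup>2) (at_right 0)" by (intro tendsto_intros)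
    then show "((\<lambda>y. 12 * C * y\<^sup>2) \<longlongrightarrow> 0) (at_right 0)" by simp
  qed
  then have "R.kappa * (of_int (wall_sum (-1)) / of_int p) = 0" using tendsto_unique[OF _ lim] by simp
  then show ?thesis using R.kappa_pos p_pos by simp
qed

end

lemma quadratic_residue_of_Legendre_1:
  "Legendre a p = 1 \<Longrightarrow> \<exists>s. [s\<^sup>2 = a] (mod p)"
  by (auto simp: Legendre_def QuadRes_def split: if_splits)

theorem theorem6p1:
  fixes D :: int
  assumes "D < 0"
    and "fundamental_discriminant D"
    and "prime (- D)"
    and "D mod 24 \<in> {13, 17, 21}"
  shows "\<exists>L :: complex \<Rightarrow> complex.
           L holomorphic_on UNIV \<and>
           (\<forall>s. Re s > 3 \<longrightarrow>
              ((\<lambda>n. of_int (eta_coeff n * kronecker D n) / (of_nat n powr s)) sums L s)) \<and>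
           L 2 \<noteq> 0"
proof -
  define p where "p = nat (- D)"
  have D: "D = - int p" and prime: "prime p" using assms(1,3) by (simp_all add: p_def)
  \<comment> \<open>The residues 13, 17, 21 of the discriminant become 11, 7, 3 for the prime
    \<open>p = -D\<close>.\<close>
  have "- D mod 24 \<in> {11, 7, 3}" using assms(4) by (auto simp: zmod_zminus1_eq_if)
  then have "int (p mod 24) \<in> {11, 7, 3}" unfolding D by (simp add: zmod_int)
  then have p24: "p mod 24 \<in> {11, 7, 3}" by auto
  have m: "int p mod 24 = int (p mod 24)" using zmod_int[of p 24] by simp
  have "p mod 4 = (p mod 24) mod 4" by (simp add: mod_mod_cancel)
  then have p4: "p mod 4 = 3" using p24 by auto
  interpret odd_quadratic_character "int p" "\<lambda>a. Legendre a (int p)" by (rule odd_quadratic_character_Legendre[OF prime p4])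
  have "wall_sum 1 \<noteq> 0"
  proof -
    consider "p mod 24 = 11" | "p mod 24 = 7" | "p mod 24 = 3" using p24 by blast
    then show ?thesis
    proof cases
      case 1
      then show ?thesis by (intro wall_sum_11 Legendre_6_values(1) prime) (simp_all add: m)
    next
      case 2
      then have L: "Legendre (-6) (int p) = 1" by (rule Legendre_6_values(2)[OF prime])
      then obtain s where "[s\<^sup>2 = -6] (mod int p)" using quadratic_residue_of_Legendre_1 by blast
      moreover have "int p mod 24 = 7" using 2 by (simp add: m)
      ultimately show ?thesis using wall_sum_7 L wall_sum_alternating_eq_0[OF Legendre_6_values(3)[OF prime 2]] by blast
    next
      case 3
      \<comment> \<open>In this class 3 divides \<open>p\<close>, so only \<open>p = 3\<close>
        occurs.\<close>
      have "p mod 3 = (p mod 24) mod 3" by (simp add: mod_mod_cancel)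
      then have "3 dvd p" using 3 by (simp add: dvd_eq_mod_eq_0)
      then have "p = 3" using prime unfolding prime_nat_iff by (metis num.distinct(3) numeral_eq_one_iff)
      then show ?thesis by (intro wall_sum_3) simp
    qed
  qed
  \<comment> \<open>As \<open>p mod 4 = 3\<close>, the Kronecker symbol of the discriminant agrees
    with the Legendre symbol modulo \<open>p\<close> at every \<open>n\<close>, including 0 and even
    \<open>n\<close>.\<close>
  from twisted_L_nonzero[OF this] show ?thesis unfolding D kronecker_eq_Legendre[OF prime p4] .
qed

end
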